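(* Let $\mathbb{H}^N$ be the Heisenberg group with homogeneous dimension $Q=2N+2$, let $\lambda\in\big(0,\big(\tfrac{Q-2}{2}\big)^2\big)$, $\alpha\in(-1,\infty)$, and let $0\le u_0,f\in L^\infty(\mathbb{H}^N)$. Then, for any $p>\frac{\mu(\lambda)+2}{\mu(\lambda)}$, the problem (the case $\gamma=0$) $$\partial_tu-\Delta_{H}u=\lambda \frac{\psi u}{\|\cdot\|_{H}^{2}}+|u|^{p}+t^\alpha f \ \text{ in } \mathbb{H}^N\times(0,T),\qquad u(\cdot,0)=u_0 \ \text{ in } \mathbb{H}^N,$$ does not admit a local-in-time weak solution (for any $T>0$).
   Context: **Heisenberg group.** $\mathbb{H}^N$ is $\mathbb{R}^{2N+1}$ with points $\xi=(x,y,w)$, $x,y\in\mathbb{R}^N$, $w\in\mathbb{R}$, and group law $(x,y,w)\circ(x',y',w')=(x+x',y+y',w+w'+2\langle y,x'\rangle-2\langle x,y'\rangle)$. $Q=2N+2$. $d\xi$ is Lebesgue measure on $\mathbb{R}^{2N+1}$. Let $X_i=\partial_{x_i}+2y_i\partial_w$, $Y_i=\partial_{y_i}-2x_i\partial_w$ ($1\le i\le N$); $\nabla_H u=(X_1u,\dots,X_Nu,Y_1u,\dots,Y_Nu)$; $\Delta_H=\sum_{i=1}^N(X_i^2+Y_i^2)$; $\nabla_H\cdot$ denotes the corresponding horizontal divergence. The Korányi norm is $\|\xi\|_H=\big[\big(\sum_{i=1}^N(x_i^2+y_i^2)\big)^2+w^2\big]^{1/4}$, and $\psi=\big|\nabla_H\|\cdot\|_H\big|^2$.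 **Constant $\mu(\lambda)$.** For $\lambda\in(0,(\frac{Q-2}{2})^2)$, $\mu(\lambda)=\frac{Q-2}{2}-\sqrt{\big(\frac{Q-2}{2}\big)^2-\lambda}$. **Weak solution.** Put $v(\xi,t)=\|\xi\|_H^{\mu(\lambda)}u(\xi,t)$, $v(0,\xi)=\|\xi\|_H^{\mu(\lambda)}u_0(\xi)$, and $L_H\phi=-\nabla_H\cdot\big(\|\cdot\|_H^{-2\mu(\lambda)}\nabla_H\phi\big)$. Let $v(0,\cdot)\in L^1_{\rm loc}(\mathbb{H}^N,\|\xi\|_H^{-2\mu(\lambda)}d\xi)$ and $f\in L^1_{\rm loc}(\mathbb{H}^N,\|\xi\|_H^{-\mu(\lambda)}d\xi)$. The function $v\in L^p_{\rm loc}((0,T),L^p_{\rm loc}(\mathbb{H}^N,\|\xi\|_H^{-(p+1)\mu(\lambda)}d\xi))\cap L^1_{\rm loc}((0,T),L^1_{\rm loc}(\mathbb{H}^N,\|\xi\|_H^{-2\mu(\lambda)}d\xi))$ (equivalently $u$) is a local-in-time weak solution of the problem on $(0,T)$ if $$-\int_0^T\!\!\int_{\mathbb{H}^N}v\big(\|\xi\|_H^{-2\mu(\lambda)}\partial_t\phi-L_H\phi\big)d\xi dt=\int_0^T\!\!\int_{\mathbb{H}^N}\|\xi\|_H^{-(p+1)\mu(\lambda)}|v|^p\phi\,d\xi dt+\int_{\mathbb{H}^N}\|\xi\|_H^{-2\mu(\lambda)}v(0,\xi)\phi(0,\xi)d\xi+\int_0^T\!\!\int_{\mathbb{H}^N}\|\xi\|_H^{-\mu(\lambda)}t^\alpha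 f\phi\,d\xi dt$$ for every non-negative test function $\phi\in C_c^1([0,T),C_c^2(\mathbb{H}^N))$.
   Formalization: For u_0 = f = 0 the zero function is a weak solution, so nonexistence is stated when u_0 and f are not both zero almost everywhere; in every case no weak solution other than u = 0 almost everywhere exists. *)

theory Defs
  imports "HOL-Analysis.Analysis"
begin

text \<open>Points \<open>(x, y, w)\<close> of the Heisenberg group, with \<open>N = CARD('n)\<close>. As a Euclidean space
  this is \<open>R^(2N+1)\<close>, and \<open>lebesgue\<close> is the Haar measure.\<close>

type_synonym 'n heis = "(real ^ 'n) \<times> (real ^ 'n) \<times> real"

definition hdim :: "'n::finite itself \<Rightarrow> real" where
  "hdim _ = 2 * real CARD('n) + 2"

definition koranyi :: "'n::finite heis \<Rightarrow> real" where
  "koranyi = (\<lambda>(x, y, w). ((\<Sum>i\<in>UNIV. (x $ i)\<^sup>2 + (y $ i)\<^sup>2)\<^sup>2 + w\<^sup>2) powr (1 / 4))"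

definition hardy_mu :: "real \<Rightarrow> real \<Rightarrow> real" where
  "hardy_mu Q lam = (Q - 2) / 2 - sqrt (((Q - 2) / 2)\<^sup>2 - lam)"

definition partial :: "'a::euclidean_space \<Rightarrow> ('a \<Rightarrow> real) \<Rightarrow> 'a \<Rightarrow> real" where
  "partial b g \<xi> = frechet_derivative g (at \<xi>) b"

definition vf_X :: "'n::finite \<Rightarrow> ('n heis \<Rightarrow> real) \<Rightarrow> 'n heis \<Rightarrow> real" where
  "vf_X i g = (\<lambda>(x, y, w). partial (axis i 1, 0, 0) g (x, y, w)
                          + 2 * y $ i * partial (0, 0, 1) g (x, y, w))"

definition vf_Y :: "'n::finite \<Rightarrow> ('n heis \<Rightarrow> real) \<Rightarrow> 'n heis \<Rightarrow> real" where
  "vf_Y i g = (\<lambda>(x, y, w). partial (0, axis i 1, 0) g (x, y, w)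
                          - 2 * x $ i * partial (0, 0, 1) g (x, y, w))"

definition hgrad :: "('n::finite heis \<Rightarrow> real) \<Rightarrow> 'n heis \<Rightarrow> (real ^ 'n) \<times> (real ^ 'n)" where
  "hgrad g \<xi> = ((\<chi> i. vf_X i g \<xi>), (\<chi> i. vf_Y i g \<xi>))"

definition hdiv :: "('n::finite heis \<Rightarrow> (real ^ 'n) \<times> (real ^ 'n)) \<Rightarrow> 'n heis \<Rightarrow> real" where
  "hdiv F \<xi> = (\<Sum>i\<in>UNIV. vf_X i (\<lambda>\<eta>. fst (F \<eta>) $ i) \<xi> + vf_Y i (\<lambda>\<eta>. snd (F \<eta>) $ i) \<xi>)"

definition L_H :: "real \<Rightarrow> ('n::finite heis \<Rightarrow> real) \<Rightarrow> 'n heis \<Rightarrow> real" where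
  "L_H \<mu> g \<xi> = - hdiv (\<lambda>\<eta>. koranyi \<eta> powr (- 2 * \<mu>) *\<^sub>R hgrad g \<eta>) \<xi>"

definition Linf :: "('a::euclidean_space \<Rightarrow> real) \<Rightarrow> bool" where
  "Linf g \<longleftrightarrow> g \<in> borel_measurable lebesgue \<and> (\<exists>C. AE \<xi> in lebesgue. \<bar>g \<xi>\<bar> \<le> C)"

definition L1_loc :: "('a::euclidean_space \<Rightarrow> real) \<Rightarrow> ('a \<Rightarrow> real) \<Rightarrow> bool" where
  "L1_loc \<omega> g \<longleftrightarrow> g \<in> borel_measurable lebesgue \<and>
     (\<forall>K. compact K \<longrightarrow> (\<lambda>\<xi>. \<bar>g \<xi>\<bar> * \<omega> \<xi>) absolutely_integrable_on K)"

text \<open>The space \<open>L^q_loc((0,T), L^q_loc(\<omega> d\<xi>))\<close>.\<close>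

definition Lq_loc_time ::
  "real \<Rightarrow> real \<Rightarrow> ('a::euclidean_space \<Rightarrow> real) \<Rightarrow> (real \<Rightarrow> 'a \<Rightarrow> real) \<Rightarrow> bool" where
  "Lq_loc_time T q \<omega> v \<longleftrightarrow>
     (\<lambda>(t, \<xi>). v t \<xi>) \<in> borel_measurable (lebesgue_on ({0<..<T} \<times> UNIV)) \<and>
     (\<forall>J K. compact J \<and> J \<subseteq> {0<..<T} \<and> compact K \<longrightarrow>
        (\<lambda>(t, \<xi>). \<bar>v t \<xi>\<bar> powr q * \<omega> \<xi>) absolutely_integrable_on (J \<times> K))"

text \<open>Continuity of \<open>t \<mapsto> \<phi>(t,\<cdot>)\<close> from \<open>[0,T)\<close> into \<open>C^2\<close>: all spatial derivatives
  of order at most two exist and are jointly continuous. For functions supported in a fixed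
  compact set of space this is continuity with respect to the \<open>C^2\<close> norm.\<close>

definition cont_into_C2 :: "real \<Rightarrow> (real \<Rightarrow> 'a::euclidean_space \<Rightarrow> real) \<Rightarrow> bool" where
  "cont_into_C2 T \<phi> \<longleftrightarrow>
     continuous_on ({0..<T} \<times> UNIV) (\<lambda>(t, \<xi>). \<phi> t \<xi>) \<and>
     (\<forall>t\<in>{0..<T}. \<forall>\<xi>. \<phi> t differentiable (at \<xi>)) \<and>
     (\<forall>b\<in>Basis.
        continuous_on ({0..<T} \<times> UNIV) (\<lambda>(t, \<xi>). partial b (\<phi> t) \<xi>) \<and>
        (\<forall>t\<in>{0..<T}. \<forall>\<xi>. partial b (\<phi> t) differentiable (at \<xi>)) \<and>
        (\<forall>c\<in>Basis. continuous_on ({0..<T} \<times> UNIV) (\<lambda>(t, \<xi>). partial c (partial b (\<phi> t)) \<xi>)))"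

text \<open>The non-negative elements of \<open>C_c^1([0,T), C_c^2)\<close>. Their support is a compact subset
  of \<open>[0,T) \<times> R^(2N+1)\<close>, so it may meet \<open>t = 0\<close>, where the time derivative is one-sided.
  Values of \<open>\<phi>\<close> at times outside \<open>[0,T)\<close> are irrelevant.\<close>

definition test_fun :: "real \<Rightarrow> (real \<Rightarrow> 'a::euclidean_space \<Rightarrow> real) \<Rightarrow> bool" where
  "test_fun T \<phi> \<longleftrightarrow>
     (\<forall>t\<in>{0..<T}. \<forall>\<xi>. 0 \<le> \<phi> t \<xi>) \<and>
     (\<exists>S<T. \<exists>K. compact K \<and> (\<forall>t\<in>{0..<T}. \<forall>\<xi>. \<phi> t \<xi> \<noteq> 0 \<longrightarrow> t \<le> S \<and> \<xi> \<in> K)) \<and>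
     cont_into_C2 T \<phi> \<and>
     (\<exists>\<phi>'. (\<forall>t\<in>{0..<T}. \<forall>\<xi>.
              ((\<lambda>s. \<phi> s \<xi>) has_real_derivative \<phi>' t \<xi>) (at t within {0..<T})) \<and>
           cont_into_C2 T \<phi>')"

text \<open>Local-in-time weak solutions on \<open>(0,T)\<close> of
  \<open>u_t - \<Delta>_H u = \<lambda> \<psi> u / \<rho>^2 + |u|^p + t^\<alpha> f\<close>, \<open>u(0) = u0\<close>, where \<open>\<rho>\<close> is the Koranyi norm
  and \<open>\<psi> = |\<nabla>_H \<rho>|^2\<close>.
  The Hardy term does not appear because \<open>\<rho>^(-\<mu>)\<close> is annihilated by \<open>\<Delta>_H + \<lambda> \<psi> / \<rho>^2\<close>, so
  the substitution \<open>v = \<rho>^\<mu> u\<close> turns \<open>-\<Delta>_H - \<lambda> \<psi> / \<rho>^2\<close> into the weighted operator \<open>L_H\<close>.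

  The two integrability conditions in front of the identity say that its integrals exist; this
  does not follow from local integrability on the open interval \<open>(0,T)\<close>, since \<open>\<phi>\<close> need not
  vanish near \<open>t = 0\<close>, and the Bochner integral of a non-integrable function is \<open>0\<close>.\<close>

definition weak_solution ::
  "real \<Rightarrow> real \<Rightarrow> real \<Rightarrow> ('n::finite heis \<Rightarrow> real) \<Rightarrow> ('n heis \<Rightarrow> real) \<Rightarrow> real
    \<Rightarrow> (real \<Rightarrow> 'n heis \<Rightarrow> real) \<Rightarrow> bool" where
  "weak_solution lam \<alpha> p u0 f T u \<longleftrightarrow>
     (let \<mu> = hardy_mu (hdim TYPE('n)) lam;
          v = (\<lambda>t \<xi>. koranyi \<xi> powr \<mu> * u t \<xi>);
          v0 = (\<lambda>\<xi>. koranyi \<xi> powr \<mu> * u0 \<xi>);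
          D = {0<..<T} \<times> (UNIV :: 'n heis set)
      in L1_loc (\<lambda>\<xi>. koranyi \<xi> powr (- 2 * \<mu>)) v0 \<and>
         L1_loc (\<lambda>\<xi>. koranyi \<xi> powr (- \<mu>)) f \<and>
         Lq_loc_time T p (\<lambda>\<xi>. koranyi \<xi> powr (- (p + 1) * \<mu>)) v \<and>
         Lq_loc_time T 1 (\<lambda>\<xi>. koranyi \<xi> powr (- 2 * \<mu>)) v \<and>
         (\<forall>\<phi>. test_fun T \<phi> \<longrightarrow>
            (\<lambda>(t, \<xi>). v t \<xi> * (koranyi \<xi> powr (- 2 * \<mu>) * deriv (\<lambda>s. \<phi> s \<xi>) t - L_H \<mu> (\<phi> t) \<xi>))
              absolutely_integrable_on D \<and>
            (\<lambda>(t, \<xi>). koranyi \<xi> powr (- (p + 1) * \<mu>) * \<bar>v t \<xi>\<bar> powr p * \<phi> t \<xi>)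
              absolutely_integrable_on D \<and>
            - (LINT (t, \<xi>):D|lebesgue.
                 v t \<xi> * (koranyi \<xi> powr (- 2 * \<mu>) * deriv (\<lambda>s. \<phi> s \<xi>) t - L_H \<mu> (\<phi> t) \<xi>))
            = (LINT (t, \<xi>):D|lebesgue.
                 koranyi \<xi> powr (- (p + 1) * \<mu>) * \<bar>v t \<xi>\<bar> powr p * \<phi> t \<xi>)
            + (LINT \<xi>|lebesgue. koranyi \<xi> powr (- 2 * \<mu>) * v0 \<xi> * \<phi> 0 \<xi>)
            + (LINT (t, \<xi>):D|lebesgue.
                 koranyi \<xi> powr (- \<mu>) * t powr \<alpha> * f \<xi> * \<phi> t \<xi>)))"

end

theory Submission
  imports Defs
begin

fun Ck :: "nat \<Rightarrow> 'a::euclidean_space set \<Rightarrow> ('a \<Rightarrow> real) \<Rightarrow> bool" where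
  "Ck 0 U f \<longleftrightarrow> continuous_on U f"
| "Ck (Suc n) U f \<longleftrightarrow> (\<forall>x\<in>U. f differentiable (at x)) \<and> (\<forall>b\<in>Basis. Ck n U (partial b f))"

text \<open>Write \<open>a = |x|^2 + |y|^2\<close>, \<open>n = a^2 + w^2\<close> (the fourth power of the Koranyi norm \<open>\<rho>\<close>),
\<open>q = 2 / (p - 1)\<close>, and let \<open>\<mu>\<close> be the smaller root of \<open>lam = \<mu> (2 N - \<mu>)\<close>. The Hardy potential is
\<open>lam a / n\<close>, and \<open>\<rho>^(-\<mu>)\<close> is annihilated by \<open>\<Delta> + lam a / n\<close>. Testing with \<open>\<rho>^\<mu> \<Phi>\<close> therefore turns
the weighted weak formulation into
\<open>- \<integral> u (\<Phi>_t + \<Delta> \<Phi> + lam (a / n) \<Phi>) = \<integral> |u|^p \<Phi> + \<integral> u0 \<Phi>(0) + \<integral> t^\<alpha> f \<Phi>\<close>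
for smooth \<open>\<Phi> \<ge> 0\<close> that vanish near the origin of the group (lemma \<open>weak_solution_borel\<close>).

The hypothesis on \<open>p\<close> says \<open>q < \<mu>\<close>. A nontrivial supersolution would be at least of size \<open>\<rho>^(-\<mu>)\<close> near
the origin, whereas the term \<open>\<integral> |u|^p \<Phi>\<close> in the weak identity forces averages of size at most \<open>\<rho>^(-q)\<close> there. These are incompatible, so \<open>u\<close> vanishes near the origin, and then everywhere, together with
the data. Every step applies the weak identity to an explicit test function.

\<^item> Sign. A solution may a priori change sign. Convolution on the group with a smooth kernel commutes
with the operator up to the potential, which is almost constant on small scales, and Jensen's
inequality makes the mollification a supersolution of an equation with a power nonlinearity. It is
compared with the negative of a large solution that blows up on two spheres; shrinking the inner
sphere and expanding the outer one shows that \<open>u\<close> is nonnegative as a distribution off the origin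
(\<open>mollified_lower_bound\<close>, \<open>mollified_lower_limit\<close>, \<open>nonneg_distributional\<close>). Consequently only the
negative part of \<open>\<Phi>_t + \<Delta> \<Phi> + lam (a / n) \<Phi>\<close> counts (\<open>negative_part_inequality\<close>).

\<^item> A priori bound. The classical rescaled test function gives \<open>\<integral> |u| = O(r^(2 N + 2 - q))\<close> over the shell
\<open>\<rho> ~ r\<close> (\<open>shell_bound\<close>).

\<^item> Vanishing near the origin. The test function \<open>\<rho>^(-\<mu>) j(\<theta>(t) M - 1)\<close>, where \<open>j\<close> is convex and \<open>M\<close> is
comparable to \<open>\<rho>^(-\<beta>)\<close> with \<open>\<beta>\<close> slightly larger than \<open>2 N - 2 \<mu>\<close>, is a subsolution of the adjoint
equation. Cutting it off at \<open>\<rho> ~ r\<close> costs \<open>O(r^(-2 - \<beta> - \<mu>))\<close> on a shell. Against the a priori bound this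
tends to zero because \<open>\<beta> < 2 N - \<mu> - q\<close>, so \<open>u = 0\<close> where the test function is positive
(\<open>zero_near_origin\<close>).

\<^item> Propagation. Away from the origin a function of the form \<open>e^(-A S) - e^(A (c t - \<Lambda>))\<close> is an adjoint
subsolution of the heat equation. It can be cut off near the origin at no cost, since \<open>u\<close> vanishes
there. Letting \<open>\<Lambda>\<close> grow exhausts space-time (\<open>propagation_test_function\<close>) and all three terms on the right
of the weak identity vanish.\<close>

section \<open>Finitely often differentiable functions\<close>

lemma Ck_imp_continuous_on: "Ck n U f \<Longrightarrow> continuous_on U f"
  by (cases n) (auto intro!: continuous_at_imp_continuous_on differentiable_imp_continuous_within)

lemma Ck_mono: "Ck n U f \<Longrightarrow> m \<le> n \<Longrightarrow> Ck m U f"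
proof (induction n arbitrary: m f)
  case (Suc n)
  show ?case
  proof (cases m)
    case 0
    then show ?thesis using Ck_imp_continuous_on[OF Suc.prems(1)] by simp
  next
    case (Suc k)
    then show ?thesis using Suc.prems Suc.IH by auto
  qed
qed auto

lemma Ck_subset: "Ck n U f \<Longrightarrow> V \<subseteq> U \<Longrightarrow> Ck n V f"
  by (induction n arbitrary: f) (auto intro: continuous_on_subset)

lemma Ck_Un:
  assumes "open U" "open V"
  shows "Ck n U f \<Longrightarrow> Ck n V f \<Longrightarrow> Ck n (U \<union> V) f"
  using assms by (induction n arbitrary: f) (auto intro: continuous_on_open_Un)

lemma partial_cong:
  assumes "open U" "x \<in> U" "\<And>y. y \<in> U \<Longrightarrow> f y = g y"
  shows "partial b f x = partial b g x"
proof -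
  have "(f has_derivative D) (at x) \<longleftrightarrow> (g has_derivative D) (at x)" for D
    using assms has_derivative_transform_within_open by metis
  then show ?thesis by (simp add: partial_def frechet_derivative_def)
qed

lemma differentiable_cong_open:
  assumes "open U" "x \<in> U" "\<And>y. y \<in> U \<Longrightarrow> f y = g y"
  shows "f differentiable (at x) \<longleftrightarrow> g differentiable (at x)"
proof -
  have "(f has_derivative D) (at x) \<longleftrightarrow> (g has_derivative D) (at x)" for D
    using assms has_derivative_transform_within_open by metis
  then show ?thesis by (simp add: differentiable_def)
qed

lemma Ck_cong:
  assumes "open U" "\<And>y. y \<in> U \<Longrightarrow> f y = g y"
  shows "Ck n U f \<longleftrightarrow> Ck n U g"
  using assms(2)
proof (induction n arbitrary: f g)
  case 0
  then show ?case by (auto cong: continuous_on_cong)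
next
  case (Suc n)
  have "\<And>b y. y \<in> U \<Longrightarrow> partial b f y = partial b g y"
    using partial_cong[OF assms(1)] Suc.prems by blast
  then have "\<And>b. Ck n U (partial b f) = Ck n U (partial b g)" using Suc.IH by blast
  moreover have "\<And>x. x \<in> U \<Longrightarrow> f differentiable (at x) \<longleftrightarrow> g differentiable (at x)"
    using differentiable_cong_open[OF assms(1)] Suc.prems by blast
  ultimately show ?case by auto
qed

lemma partial_eqI: "(f has_derivative D) (at x) \<Longrightarrow> partial b f x = D b"
  using frechet_derivative_at[of f D x] by (simp add: partial_def)

lemma partial_works: "f differentiable (at x) \<Longrightarrow> (f has_derivative (\<lambda>h. partial h f x)) (at x)"
  unfolding partial_def using frechet_derivative_works by blast

text \<open>Having a derivative that is itself of class \<open>C^n\<close> in each direction is what the product and chain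
rules below verify.\<close>

lemma Ck_SucI:
  assumes "open U" "\<And>x. x \<in> U \<Longrightarrow> (f has_derivative D x) (at x)"
    and "\<And>b. b \<in> Basis \<Longrightarrow> Ck n U (\<lambda>x. D x b)"
  shows "Ck (Suc n) U f"
proof -
  have "partial b f x = D x b" if "x \<in> U" for b x using partial_eqI assms(2) that by blast
  then have "Ck n U (partial b f)" if "b \<in> Basis" for b
    using Ck_cong[OF assms(1), of "partial b f" "\<lambda>x. D x b"] assms(3) that by blast
  then show ?thesis using assms(2) by (auto simp: differentiable_def)
qed

lemma Ck_const [intro, simp]: "Ck n U (\<lambda>x. c)"
proof -
  have "Ck n UNIV (\<lambda>x. c)"
  proof (induction n arbitrary: c)
    case (Suc n)
    show ?case by (rule Ck_SucI[where D="\<lambda>x h. 0"]) (auto intro!: derivative_eq_intros Suc)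
  qed auto
  then show ?thesis using Ck_subset by blast
qed

lemma Ck_bounded_linear:
  assumes "bounded_linear f"
  shows "Ck n U f"
proof -
  have "Ck n UNIV f"
  proof (cases n)
    case 0
    then show ?thesis using assms by (simp add: linear_continuous_on)
  next
    case (Suc m)
    show ?thesis unfolding Suc
      by (rule Ck_SucI[where D="\<lambda>x. f"]) (auto intro: assms bounded_linear_imp_has_derivative)
  qed
  then show ?thesis using Ck_subset by blast
qed

lemma Ck_add:
  assumes "open U" "Ck n U f" "Ck n U g"
  shows "Ck n U (\<lambda>x. f x + g x)"
  using assms(2,3)
proof (induction n arbitrary: f g)
  case 0
  then show ?case by (auto intro: continuous_intros)
next
  case (Suc n)
  show ?case
    by (rule Ck_SucI[where D="\<lambda>x h. partial h f x + partial h g x"])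
      (use Suc assms(1) in \<open>auto intro!: has_derivative_add partial_works\<close>)
qed

lemma Ck_mult:
  assumes "open U" "Ck n U f" "Ck n U g"
  shows "Ck n U (\<lambda>x. f x * g x)"
  using assms(2,3)
proof (induction n arbitrary: f g)
  case 0
  then show ?case by (auto intro: continuous_intros)
next
  case (Suc n)
  have m: "Ck n U f" "Ck n U g" using Suc.prems Ck_mono le_SucI order_refl by blast+
  show ?case
    by (rule Ck_SucI[where D="\<lambda>x h. f x * partial h g x + partial h f x * g x"])
      (use Suc assms(1) m in \<open>auto intro!: has_derivative_mult partial_works Ck_add\<close>)
qed

lemma Ck_cmult: "open U \<Longrightarrow> Ck n U f \<Longrightarrow> Ck n U (\<lambda>x. c * f x)"
  by (auto intro: Ck_mult)

lemma Ck_uminus: "open U \<Longrightarrow> Ck n U f \<Longrightarrow> Ck n U (\<lambda>x. - f x)"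
  using Ck_cmult[of U n f "-1"] by simp

lemma Ck_diff: "open U \<Longrightarrow> Ck n U f \<Longrightarrow> Ck n U g \<Longrightarrow> Ck n U (\<lambda>x. f x - g x)"
  using Ck_add[OF _ _ Ck_uminus, of U n f g] by simp

lemma Ck_sum:
  assumes "open U" "\<And>i. i \<in> A \<Longrightarrow> Ck n U (f i)"
  shows "Ck n U (\<lambda>x. \<Sum>i\<in>A. f i x)"
  using assms(2) by (induction A rule: infinite_finite_induct) (auto intro!: Ck_add assms(1))

lemma Ck_power: "open U \<Longrightarrow> Ck n U f \<Longrightarrow> Ck n U (\<lambda>x. f x ^ k)"
  by (induction k) (auto intro: Ck_mult)

lemma Ck_comp:
  fixes g :: "real \<Rightarrow> real"
  assumes "open U" "Ck n U f" "open V" "Ck n V g" "f ` U \<subseteq> V"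
  shows "Ck n U (\<lambda>x. g (f x))"
  using assms(2,4)
proof (induction n arbitrary: g)
  case 0
  then show ?case using continuous_on_compose2 assms(5) by (auto intro: continuous_on_compose2)
next
  case (Suc n)
  have m: "Ck n U f" using Suc.prems Ck_mono le_SucI order_refl by blast
  have g: "Ck n V (partial 1 g)" "\<And>y. y \<in> V \<Longrightarrow> g differentiable (at y)" using Suc.prems by auto
  have lin: "partial h g y = h * partial 1 g y" if "y \<in> V" for h y
    using linear_cmul[OF linear_frechet_derivative[OF g(2)[OF that]], of h 1] by (simp add: partial_def)
  show ?case
  proof (rule Ck_SucI[where D="\<lambda>x h. partial h f x * partial 1 g (f x)"])
    fix x assume x: "x \<in> U"
    then have "f differentiable (at x)" "f x \<in> V" using Suc.prems assms(5) by auto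
    then have "(g \<circ> f has_derivative (\<lambda>h. partial h g (f x)) \<circ> (\<lambda>h. partial h f x)) (at x)"
      by (intro diff_chain_at partial_works g(2)) auto
    then show "((\<lambda>x. g (f x)) has_derivative (\<lambda>h. partial h f x * partial 1 g (f x))) (at x)"
      unfolding o_def by (subst (asm) lin[OF \<open>f x \<in> V\<close>])
  next
    fix b :: 'a assume "b \<in> Basis"
    then show "Ck n U (\<lambda>x. partial b f x * partial 1 g (f x))"
      using Suc.prems Suc.IH[OF m g(1)] assms(1) by (intro Ck_mult) auto
  qed fact
qed

lemma Ck_real_SucI:
  fixes g :: "real \<Rightarrow> real"
  assumes "open V" "\<And>x. x \<in> V \<Longrightarrow> (g has_real_derivative g' x) (at x)" "Ck n V g'"
  shows "Ck (Suc n) V g"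
  by (rule Ck_SucI[where D="\<lambda>x h. g' x * h"])
    (use assms in \<open>auto simp: has_field_derivative_def\<close>)

lemma Ck_id: "Ck n U (\<lambda>x::real. x)"
  by (rule Ck_bounded_linear) (rule bounded_linear_ident)

lemma Ck_powr: "Ck n {0<..} (\<lambda>x::real. x powr c)"
proof (induction n arbitrary: c)
  case 0
  then show ?case by (auto intro!: continuous_intros)
next
  case (Suc n)
  show ?case
    by (rule Ck_real_SucI[where g'="\<lambda>x. c * x powr (c - 1)"])
      (auto intro!: derivative_eq_intros Ck_cmult Suc)
qed

lemma Ck_exp: "Ck n UNIV (exp :: real \<Rightarrow> real)"
proof (induction n)
  case (Suc n)
  show ?case by (rule Ck_real_SucI[where g'=exp]) (auto intro!: derivative_eq_intros Suc)
qed (auto intro: continuous_intros)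

text \<open>Powers of the positive part supply compactly supported test functions of finite smoothness; three
derivatives suffice, as the time derivative of a test function has to be of class \<open>C^2\<close> in space.\<close>

lemma has_real_derivative_pospart_power:
  assumes "1 \<le> k"
  shows "((\<lambda>x::real. max 0 x ^ Suc k) has_real_derivative real (Suc k) * max 0 x ^ k) (at x)"
proof -
  consider "x > 0" | "x < 0" | "x = 0" by linarith
  then show ?thesis
  proof cases
    case 1
    have "((\<lambda>x. x ^ Suc k) has_real_derivative real (Suc k) * x ^ k) (at x)"
      using DERIV_pow[of "Suc k" x] by simp
    then have "((\<lambda>x. max 0 x ^ Suc k) has_real_derivative real (Suc k) * x ^ k) (at x)"
      by (rule has_field_derivative_transform_within_open[where S="{0<..}"]) (use 1 in auto)
    then show ?thesis using 1 by simp
  next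
    case 2
    have "((\<lambda>x::real. 0) has_real_derivative 0) (at x)" by simp
    then have "((\<lambda>x. max 0 x ^ Suc k) has_real_derivative 0) (at x)"
      by (rule has_field_derivative_transform_within_open[where S="{..<0}"]) (use 2 in auto)
    then show ?thesis using 2 assms by (cases k) auto
  next
    case 3
    have b: "\<bar>max 0 h ^ Suc k / h\<bar> \<le> \<bar>h\<bar> ^ k" for h :: real
      by (cases "h > 0") (auto simp: max_def)
    have "((\<lambda>h::real. \<bar>h\<bar> ^ k) \<longlongrightarrow> \<bar>0\<bar> ^ k) (at 0)" by (intro tendsto_intros)
    moreover have "\<bar>0::real\<bar> ^ k = 0" using assms by (cases k) auto
    ultimately have "((\<lambda>h::real. \<bar>h\<bar> ^ k) \<longlongrightarrow> 0) (at 0)" by (simp only:)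
    then have "((\<lambda>h::real. max 0 h ^ Suc k / h) \<longlongrightarrow> 0) (at 0)"
      by (rule Lim_null_comparison[rotated]) (use b in auto)
    then show ?thesis using 3 assms by (cases k) (auto simp: DERIV_def)
  qed
qed

lemma Ck_pospart_power: "n < k \<Longrightarrow> Ck n UNIV (\<lambda>x::real. max 0 x ^ k)"
proof (induction n arbitrary: k)
  case 0
  then show ?case by (auto intro!: continuous_intros)
next
  case (Suc n)
  then obtain l where k: "k = Suc l" "n < l" by (metis Suc_lessE)
  show ?case unfolding k
    by (rule Ck_real_SucI[OF _ has_real_derivative_pospart_power])
      (use Suc.IH[OF k(2)] k in \<open>auto intro!: Ck_cmult\<close>)
qed

section \<open>Horizontal derivatives on space-time\<close>

type_synonym 'n st = "real \<times> 'n heis"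

text \<open>Points of \<open>st\<close> are pairs of a time and a point of the group. The functions \<open>a = |x|^2 + |y|^2\<close>, \<open>w\<close> and
\<open>n = a^2 + w^2\<close> are all that the explicit test functions depend on, besides time.\<close>

definition hz :: "'n::finite heis \<Rightarrow> real" where
  "hz = (\<lambda>(x, y, w). \<Sum>i\<in>UNIV. (x $ i)\<^sup>2 + (y $ i)\<^sup>2)"

definition hw :: "'n::finite heis \<Rightarrow> real" where
  "hw = (\<lambda>(x, y, w). w)"

definition hn :: "'n::finite heis \<Rightarrow> real" where
  "hn \<xi> = (hz \<xi>)\<^sup>2 + (hw \<xi>)\<^sup>2"

abbreviation aa :: "'n::finite st \<Rightarrow> real" where "aa \<equiv> \<lambda>p. hz (snd p)"
abbreviation ww :: "'n::finite st \<Rightarrow> real" where "ww \<equiv> \<lambda>p. hw (snd p)"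
abbreviation nn :: "'n::finite st \<Rightarrow> real" where "nn \<equiv> \<lambda>p. hn (snd p)"

text \<open>The value at \<open>p\<close> of the horizontal field \<open>X_i\<close> (\<open>Inl i\<close>) or \<open>Y_i\<close> (\<open>Inr i\<close>), with zero time component.\<close>

fun hv :: "'n::finite + 'n \<Rightarrow> 'n st \<Rightarrow> 'n st" where
  "hv (Inl i) p = (0, axis i 1, 0, 2 * fst (snd (snd p)) $ i)"
| "hv (Inr i) p = (0, 0, axis i 1, - 2 * fst (snd p) $ i)"

definition VF :: "'n::finite + 'n \<Rightarrow> ('n st \<Rightarrow> real) \<Rightarrow> 'n st \<Rightarrow> real" where
  "VF j F p = partial (hv j p) F p"

definition dt :: "('n::finite st \<Rightarrow> real) \<Rightarrow> 'n st \<Rightarrow> real" where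
  "dt F p = partial (1, 0) F p"

definition Lap :: "('n::finite st \<Rightarrow> real) \<Rightarrow> 'n st \<Rightarrow> real" where
  "Lap F p = (\<Sum>j\<in>UNIV. VF j (VF j F) p)"

lemma VF_eqI: "(F has_derivative D) (at p) \<Longrightarrow> VF j F p = D (hv j p)"
  by (simp add: VF_def partial_eqI)

lemma dt_eqI: "(F has_derivative D) (at p) \<Longrightarrow> dt F p = D (1, 0)"
  by (simp add: dt_def partial_eqI)

lemma VF_cong: "open U \<Longrightarrow> p \<in> U \<Longrightarrow> (\<And>q. q \<in> U \<Longrightarrow> F q = G q) \<Longrightarrow> VF j F p = VF j G p"
  unfolding VF_def by (rule partial_cong)

lemma dt_cong: "open U \<Longrightarrow> p \<in> U \<Longrightarrow> (\<And>q. q \<in> U \<Longrightarrow> F q = G q) \<Longrightarrow> dt F p = dt G p"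
  unfolding dt_def by (rule partial_cong)

lemma Lap_cong: "open U \<Longrightarrow> p \<in> U \<Longrightarrow> (\<And>q. q \<in> U \<Longrightarrow> F q = G q) \<Longrightarrow> Lap F p = Lap G p"
  unfolding Lap_def by (intro sum.cong refl VF_cong) (auto intro: VF_cong)

lemma Ck_differentiable: "Ck (Suc n) U F \<Longrightarrow> p \<in> U \<Longrightarrow> F differentiable (at p)"
  by simp

lemma VF_add:
  assumes "F differentiable (at p)" "G differentiable (at p)"
  shows "VF j (\<lambda>q. F q + G q) p = VF j F p + VF j G p"
  using VF_eqI[OF has_derivative_add[OF assms[THEN partial_works]]] by (simp add: VF_def)

lemma VF_mult:
  assumes "F differentiable (at p)" "G differentiable (at p)"
  shows "VF j (\<lambda>q. F q * G q) p = F p * VF j G p + VF j F p * G p"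
  using VF_eqI[OF has_derivative_mult[OF assms[THEN partial_works]]] by (simp add: VF_def)

lemma dt_add:
  assumes "F differentiable (at p)" "G differentiable (at p)"
  shows "dt (\<lambda>q. F q + G q) p = dt F p + dt G p"
  using dt_eqI[OF has_derivative_add[OF assms[THEN partial_works]]] by (simp add: dt_def)

lemma dt_mult:
  assumes "F differentiable (at p)" "G differentiable (at p)"
  shows "dt (\<lambda>q. F q * G q) p = F p * dt G p + dt F p * G p"
  using dt_eqI[OF has_derivative_mult[OF assms[THEN partial_works]]] by (simp add: dt_def)

lemma
  fixes g :: "real \<Rightarrow> real"
  assumes F: "F differentiable (at p)" and g: "(g has_real_derivative g') (at (F p))"
  shows VF_comp: "VF j (\<lambda>q. g (F q)) p = g' * VF j F p"
    and dt_comp: "dt (\<lambda>q. g (F q)) p = g' * dt F p"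
proof -
  have "(g \<circ> F has_derivative (\<lambda>h. g' * h) \<circ> (\<lambda>h. partial h F p)) (at p)"
    by (intro diff_chain_at partial_works F) (use g in \<open>simp add: has_field_derivative_def\<close>)
  then have d: "((\<lambda>q. g (F q)) has_derivative (\<lambda>h. g' * partial h F p)) (at p)" by (simp add: o_def)
  show "VF j (\<lambda>q. g (F q)) p = g' * VF j F p" using VF_eqI[OF d] by (simp add: VF_def)
  show "dt (\<lambda>q. g (F q)) p = g' * dt F p" using dt_eqI[OF d] by (simp add: dt_def)
qed

lemma partial_linear_comb:
  assumes "F differentiable (at p)"
  shows "partial (u + c *\<^sub>R v) F p = partial u F p + c * partial v F p"
  using linear_add[OF linear_frechet_derivative[OF assms], of u "c *\<^sub>R v"]
    linear_cmul[OF linear_frechet_derivative[OF assms], of c v]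
  by (simp add: partial_def)

text \<open>Horizontal derivatives expand in coordinate derivatives with polynomial coefficients, which is how
they inherit smoothness.\<close>

lemma VF_basis:
  assumes "F differentiable (at p)"
  shows "VF (Inl i) F p = partial (0, axis i 1, 0, 0) F p
            + 2 * fst (snd (snd p)) $ i * partial (0, 0, 0, 1) F p"
    and "VF (Inr i) F p = partial (0, 0, axis i 1, 0) F p
            - 2 * fst (snd p) $ i * partial (0, 0, 0, 1) F p"
  using partial_linear_comb[OF assms, of "(0, axis i 1, 0, 0)" "2 * fst (snd (snd p)) $ i" "(0, 0, 0, 1)"]
    partial_linear_comb[OF assms, of "(0, 0, axis i 1, 0)" "- 2 * fst (snd p) $ i" "(0, 0, 0, 1)"]
  by (simp_all add: VF_def)

lemma st_Basis:
  "(0, axis i 1, 0, 0) \<in> (Basis :: 'n::finite st set)"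
  "(0, 0, axis i 1, 0) \<in> (Basis :: 'n::finite st set)"
  "(0, 0, 0, 1) \<in> (Basis :: 'n::finite st set)"
  "(1, 0) \<in> (Basis :: 'n::finite st set)"
  by (auto simp: Basis_prod_def zero_prod_def axis_in_Basis_iff)

lemma Ck_coord_x: "Ck n U (\<lambda>p::'n::finite st. fst (snd p) $ i)"
  and Ck_coord_y: "Ck n U (\<lambda>p::'n::finite st. fst (snd (snd p)) $ i)"
  and Ck_coord_w: "Ck n U (\<lambda>p::'n::finite st. snd (snd (snd p)))"
  and Ck_coord_t: "Ck n U (\<lambda>p::'n::finite st. fst p)"
  by (rule Ck_bounded_linear, simp add: linear_conv_bounded_linear[symmetric],
      auto intro!: linearI)+

lemma Ck_VF:
  assumes "open U" "Ck (Suc n) U F"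
  shows "Ck n U (VF j F)"
proof (cases j)
  case (Inl i)
  have "Ck n U (\<lambda>p. partial (0, axis i 1, 0, 0) F p
            + (2 * fst (snd (snd p)) $ i) * partial (0, 0, 0, 1) F p)"
    using assms st_Basis by (intro Ck_add Ck_mult Ck_const Ck_coord_y) auto
  then show ?thesis unfolding Inl
    by (rule iffD1[OF Ck_cong[OF assms(1)], rotated]) (use assms in \<open>simp add: VF_basis\<close>)
next
  case (Inr i)
  have "Ck n U (\<lambda>p. partial (0, 0, axis i 1, 0) F p
            - (2 * fst (snd p) $ i) * partial (0, 0, 0, 1) F p)"
    using assms st_Basis by (intro Ck_diff Ck_mult Ck_const Ck_coord_x) auto
  then show ?thesis unfolding Inr
    by (rule iffD1[OF Ck_cong[OF assms(1)], rotated]) (use assms in \<open>simp add: VF_basis\<close>)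
qed

lemma Ck_dt: "Ck (Suc n) U F \<Longrightarrow> Ck n U (dt F)"
  using st_Basis(4) unfolding dt_def[abs_def] by auto

lemma Ck_Lap: "open U \<Longrightarrow> Ck (Suc (Suc n)) U F \<Longrightarrow> Ck n U (Lap F)"
  unfolding Lap_def[abs_def] by (intro Ck_sum Ck_VF)

lemma Ck2D: "open U \<Longrightarrow> Ck 2 U F \<Longrightarrow> p \<in> U \<Longrightarrow> F differentiable (at p)"
  "open U \<Longrightarrow> Ck 2 U F \<Longrightarrow> p \<in> U \<Longrightarrow> VF j F differentiable (at p)"
  using Ck_VF[of U 1 F j] by (auto simp: numeral_2_eq_2 simp del: Ck.simps dest: Ck_differentiable)

lemma Lap_mult:
  assumes "open U" "Ck 2 U F" "Ck 2 U G" "p \<in> U"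
  shows "Lap (\<lambda>q. F q * G q) p = F p * Lap G p + Lap F p * G p + 2 * (\<Sum>j\<in>UNIV. VF j F p * VF j G p)"
proof -
  note d = Ck2D[OF assms(1,2)] Ck2D[OF assms(1,3)]
  have "VF j (VF j (\<lambda>q. F q * G q)) p
      = F p * VF j (VF j G) p + VF j (VF j F) p * G p + 2 * (VF j F p * VF j G p)" for j
  proof -
    have "VF j (VF j (\<lambda>q. F q * G q)) p = VF j (\<lambda>q. F q * VF j G q + VF j F q * G q) p"
      by (rule VF_cong[OF assms(1,4)]) (simp add: VF_mult d)
    also have "\<dots> = F p * VF j (VF j G) p + VF j F p * VF j G p
        + (VF j F p * VF j G p + VF j (VF j F) p * G p)"
      using assms(4) by (simp add: VF_add VF_mult d)
    finally show ?thesis by simp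
  qed
  then show ?thesis
    unfolding Lap_def by (simp add: sum.distrib sum_distrib_left sum_distrib_right)
qed

lemma Lap_add:
  assumes "open U" "Ck 2 U F" "Ck 2 U G" "p \<in> U"
  shows "Lap (\<lambda>q. F q + G q) p = Lap F p + Lap G p"
proof -
  note d = Ck2D[OF assms(1,2)] Ck2D[OF assms(1,3)]
  have "VF j (VF j (\<lambda>q. F q + G q)) p = VF j (VF j F) p + VF j (VF j G) p" for j
  proof -
    have "VF j (VF j (\<lambda>q. F q + G q)) p = VF j (\<lambda>q. VF j F q + VF j G q) p"
      by (rule VF_cong[OF assms(1,4)]) (simp add: VF_add d)
    then show ?thesis using assms(4) by (simp add: VF_add d)
  qed
  then show ?thesis unfolding Lap_def by (simp add: sum.distrib)
qed

lemma Lap_comp: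
  fixes g :: "real \<Rightarrow> real"
  assumes "open U" "Ck 2 U F" "p \<in> U" and "F ` U \<subseteq> V" 
    and g: "\<And>x. x \<in> V \<Longrightarrow> (g has_real_derivative g' x) (at x)"
    and g': "\<And>x. x \<in> V \<Longrightarrow> (g' has_real_derivative g'' x) (at x)"
  shows "Lap (\<lambda>q. g (F q)) p = g' (F p) * Lap F p + g'' (F p) * (\<Sum>j\<in>UNIV. (VF j F p)\<^sup>2)"
proof -
  note d = Ck2D[OF assms(1,2)]
  have V: "F q \<in> V" if "q \<in> U" for q using that assms(4) by auto
  have "VF j (VF j (\<lambda>q. g (F q))) p = g' (F p) * VF j (VF j F) p + g'' (F p) * (VF j F p)\<^sup>2" for j
  proof -
    have "VF j (VF j (\<lambda>q. g (F q))) p = VF j (\<lambda>q. g' (F q) * VF j F q) p"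
      by (rule VF_cong[OF assms(1,3)]) (simp add: VF_comp d g V)
    also have "\<dots> = g' (F p) * VF j (VF j F) p + VF j (\<lambda>q. g' (F q)) p * VF j F p"
    proof (rule VF_mult)
      have "(g' \<circ> F) differentiable (at p)"
        using g'[OF V[OF assms(3)]] d(1)[OF assms(3)]
        by (intro differentiable_chain_at) (auto simp: differentiable_def has_field_derivative_def)
      then show "(\<lambda>q. g' (F q)) differentiable (at p)" by (simp add: o_def)
    qed (use d assms(3) in auto)
    also have "VF j (\<lambda>q. g' (F q)) p = g'' (F p) * VF j F p"
      by (rule VF_comp) (use d g' V assms(3) in auto)
    finally show ?thesis by (simp add: power2_eq_square)
  qed
  then show ?thesis unfolding Lap_def by (simp add: sum.distrib sum_distrib_left)
qed

lemma aa_alt: "aa = (\<lambda>p::'n::finite st. \<Sum>i\<in>UNIV. (fst (snd p) $ i)\<^sup>2 + (fst (snd (snd p)) $ i)\<^sup>2)"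
  by (auto simp: hz_def split_beta)

lemma ww_alt: "ww = (\<lambda>p::'n::finite st. snd (snd (snd p)))"
  by (auto simp: hw_def split_beta)

lemma Ck_aa: "Ck n UNIV (aa :: 'n::finite st \<Rightarrow> real)"
  unfolding aa_alt by (intro Ck_sum Ck_add Ck_power Ck_coord_x Ck_coord_y open_UNIV)

lemma Ck_ww: "Ck n U (ww :: 'n::finite st \<Rightarrow> real)"
  unfolding ww_alt by (rule Ck_coord_w)

lemma coord_deriv:
  "((\<lambda>p::'n::finite st. fst (snd p) $ i) has_derivative (\<lambda>h. fst (snd h) $ i)) F"
  "((\<lambda>p::'n::finite st. fst (snd (snd p)) $ i) has_derivative (\<lambda>h. fst (snd (snd h)) $ i)) F"
  by (rule bounded_linear_imp_has_derivative, simp add: linear_conv_bounded_linear[symmetric],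
      auto intro!: linearI)+

lemma aa_deriv: "(aa has_derivative (\<lambda>h. \<Sum>i\<in>UNIV. 2 * fst (snd p) $ i * fst (snd h) $ i
     + 2 * fst (snd (snd p)) $ i * fst (snd (snd h)) $ i)) (at (p::'n::finite st))"
  unfolding aa_alt
  by (rule has_derivative_sum) (auto intro!: derivative_eq_intros coord_deriv simp: algebra_simps)

lemma ww_deriv: "(ww has_derivative (\<lambda>h. snd (snd (snd h)))) (at (p::'n::finite st))"
  unfolding ww_alt by (auto intro!: derivative_eq_intros)

lemma sum_axis: "(\<Sum>k\<in>UNIV. f k * axis i (1::real) $ k) = f (i::'n::finite)"
proof -
  have "(\<Sum>k\<in>UNIV. f k * axis i (1::real) $ k) = (\<Sum>k\<in>UNIV. if k = i then f k else 0)"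
    by (intro sum.cong) (auto simp: axis_def)
  then show ?thesis by simp
qed

lemma VF_aa: "VF (Inl i) aa = (\<lambda>p::'n::finite st. 2 * fst (snd p) $ i)"
  "VF (Inr i) aa = (\<lambda>p::'n::finite st. 2 * fst (snd (snd p)) $ i)"
  by (auto simp: VF_eqI[OF aa_deriv] sum_axis)

lemma VF_ww: "VF (Inl i) ww = (\<lambda>p::'n::finite st. 2 * fst (snd (snd p)) $ i)"
  "VF (Inr i) ww = (\<lambda>p::'n::finite st. - 2 * fst (snd p) $ i)"
  by (auto simp: VF_eqI[OF ww_deriv])

lemma sum_UNIV_Plus: "(\<Sum>j\<in>(UNIV::('n::finite + 'n) set). f j) = (\<Sum>i\<in>UNIV. f (Inl i)) + (\<Sum>i\<in>UNIV. f (Inr i))"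
  unfolding UNIV_Plus_UNIV[symmetric] by (subst sum.Plus) auto

text \<open>These inner products of horizontal gradients are functions of \<open>a\<close> alone, which is why the functions of \<open>a\<close>
and \<open>w\<close> are closed under the sub-Laplacian.\<close>

lemma Gamma_base:
  "(\<Sum>j\<in>UNIV. (VF j aa p)\<^sup>2) = 4 * aa (p::'n::finite st)"
  "(\<Sum>j\<in>UNIV. (VF j ww p)\<^sup>2) = 4 * aa (p::'n::finite st)"
  "(\<Sum>j\<in>UNIV. VF j aa p * VF j ww p) = 0"
  unfolding sum_UNIV_Plus VF_aa VF_ww
  by (auto simp: hz_def split_beta sum_distrib_left sum.distrib power2_eq_square algebra_simps
      sum_negf)

lemma VF_coord:
  "VF (Inl i) (\<lambda>p::'n::finite st. c * fst (snd p) $ k) p = c * (if k = i then 1 else 0)"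
  "VF (Inr i) (\<lambda>p::'n::finite st. c * fst (snd p) $ k) p = 0"
  "VF (Inl i) (\<lambda>p::'n::finite st. c * fst (snd (snd p)) $ k) p = 0"
  "VF (Inr i) (\<lambda>p::'n::finite st. c * fst (snd (snd p)) $ k) p = c * (if k = i then 1 else 0)"
proof -
  have x: "((\<lambda>p::'n st. c * fst (snd p) $ k) has_derivative (\<lambda>h. c * fst (snd h) $ k)) (at p)"
    by (auto intro!: derivative_eq_intros coord_deriv)
  have y: "((\<lambda>p::'n st. c * fst (snd (snd p)) $ k) has_derivative (\<lambda>h. c * fst (snd (snd h)) $ k)) (at p)"
    by (auto intro!: derivative_eq_intros coord_deriv)
  show "VF (Inl i) (\<lambda>p::'n::finite st. c * fst (snd p) $ k) p = c * (if k = i then 1 else 0)"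
  "VF (Inr i) (\<lambda>p::'n::finite st. c * fst (snd p) $ k) p = 0"
  "VF (Inl i) (\<lambda>p::'n::finite st. c * fst (snd (snd p)) $ k) p = 0"
  "VF (Inr i) (\<lambda>p::'n::finite st. c * fst (snd (snd p)) $ k) p = c * (if k = i then 1 else 0)"
    unfolding VF_eqI[OF x] VF_eqI[OF y] by (auto simp: axis_def)
qed

lemma Lap_aa: "Lap aa (p::'n::finite st) = 4 * real CARD('n)"
  unfolding Lap_def sum_UNIV_Plus VF_aa VF_coord by simp

lemma Lap_ww: "Lap ww (p::'n::finite st) = 0"
  unfolding Lap_def sum_UNIV_Plus VF_ww VF_coord by simp

section \<open>Calculus of functions of t, a and w\<close>

text \<open>\<open>cyl\<close> records a function of \<open>t, a, w\<close> together with its partial derivatives in \<open>t\<close>, \<open>a\<close>, \<open>w\<close> and its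
sub-Laplacian. By \<open>Gamma_base\<close> the inner product of two horizontal gradients is \<open>4 a (F_a G_a + F_w G_w)\<close>,
so the four data propagate through products and compositions, and the sub-Laplacian of any explicit
test function is found without returning to coordinates.\<close>

definition cyl :: "'n::finite st set \<Rightarrow> ('n st \<Rightarrow> real) \<Rightarrow> ('n st \<Rightarrow> real) \<Rightarrow> ('n st \<Rightarrow> real)
    \<Rightarrow> ('n st \<Rightarrow> real) \<Rightarrow> ('n st \<Rightarrow> real) \<Rightarrow> bool" where
  "cyl U F Ft Fa Fw FL \<longleftrightarrow> open U \<and> Ck 3 U F \<and>
     (\<forall>p\<in>U. dt F p = Ft p \<and> (\<forall>j. VF j F p = Fa p * VF j aa p + Fw p * VF j ww p) \<and> Lap F p = FL p)"

lemma cyl_Gamma: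
  assumes "cyl U F Ft Fa Fw FL" "cyl U G Gt Ga Gw GL" "p \<in> U"
  shows "(\<Sum>j\<in>UNIV. VF j F p * VF j G p) = 4 * aa p * (Fa p * Ga p + Fw p * Gw p)"
proof -
  have "VF j F p * VF j G p = Fa p * Ga p * (VF j aa p)\<^sup>2 + Fw p * Gw p * (VF j ww p)\<^sup>2
      + (Fa p * Gw p + Fw p * Ga p) * (VF j aa p * VF j ww p)" for j
    using assms by (simp add: cyl_def algebra_simps power2_eq_square)
  then show ?thesis
    by (simp add: sum.distrib Gamma_base flip: sum_distrib_left) (simp add: algebra_simps)
qed

lemma Ck32: "Ck 3 U F \<Longrightarrow> Ck 2 U F"
  by (rule Ck_mono) auto

lemma cyl_const: "open U \<Longrightarrow> cyl U (\<lambda>p. c) (\<lambda>p. 0) (\<lambda>p. 0) (\<lambda>p. 0) (\<lambda>p. 0)"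
proof -
  have c: "VF j (\<lambda>p. c) = (\<lambda>p. 0)" "dt (\<lambda>p. c) = (\<lambda>p. 0)" for c and j :: "'a + 'a"
    using VF_eqI[OF has_derivative_const] dt_eqI[OF has_derivative_const] by fastforce+
  assume "open U"
  then show ?thesis by (auto simp: cyl_def c Lap_def)
qed

lemma cyl_t: "open U \<Longrightarrow> cyl U (\<lambda>p. fst p) (\<lambda>p. 1) (\<lambda>p. 0) (\<lambda>p. 0) (\<lambda>p. 0)"
proof -
  assume "open U"
  have d: "((\<lambda>p::'a st. fst p) has_derivative (\<lambda>h. fst h)) (at p)" for p :: "'a st"
    by (auto intro!: derivative_eq_intros)
  have v: "VF j (\<lambda>p::'a st. fst p) = (\<lambda>p. 0)" for j
    by (cases j) (auto simp: VF_eqI[OF d])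
  have c: "VF j (\<lambda>p. c) = (\<lambda>p. 0)" for c and j :: "'a + 'a"
    using VF_eqI[OF has_derivative_const] by fastforce
  show ?thesis using \<open>open U\<close> by (auto simp: cyl_def v c Lap_def Ck_coord_t dt_eqI[OF d])
qed

lemma cyl_a: "open U \<Longrightarrow> cyl U (aa::'n::finite st \<Rightarrow> real) (\<lambda>p. 0) (\<lambda>p. 1) (\<lambda>p. 0) (\<lambda>p. 4 * real CARD('n))"
  by (auto simp: cyl_def Lap_aa dt_eqI[OF aa_deriv] intro: Ck_subset[OF Ck_aa])

lemma cyl_w: "open U \<Longrightarrow> cyl U (ww::'n::finite st \<Rightarrow> real) (\<lambda>p. 0) (\<lambda>p. 0) (\<lambda>p. 1) (\<lambda>p. 0)"
  by (auto simp: cyl_def Lap_ww dt_eqI[OF ww_deriv] Ck_ww)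

lemma cyl_add:
  assumes "cyl U F Ft Fa Fw FL" "cyl U G Gt Ga Gw GL"
  shows "cyl U (\<lambda>p. F p + G p) (\<lambda>p. Ft p + Gt p) (\<lambda>p. Fa p + Ga p) (\<lambda>p. Fw p + Gw p) (\<lambda>p. FL p + GL p)"
proof -
  have U: "open U" and C: "Ck 3 U F" "Ck 3 U G" using assms by (auto simp: cyl_def)
  note d = Ck2D[OF U Ck32] 
  show ?thesis unfolding cyl_def
    using assms U C
    by (auto simp: cyl_def Ck_add dt_add VF_add d Lap_add[OF U Ck32 Ck32] algebra_simps)
qed

lemma cyl_mult:
  assumes "cyl U F Ft Fa Fw FL" "cyl U G Gt Ga Gw GL"
  shows "cyl U (\<lambda>p. F p * G p) (\<lambda>p. F p * Gt p + Ft p * G p) (\<lambda>p. F p * Ga p + Fa p * G p)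
     (\<lambda>p. F p * Gw p + Fw p * G p)
     (\<lambda>p. F p * GL p + FL p * G p + 8 * aa p * (Fa p * Ga p + Fw p * Gw p))"
proof -
  have U: "open U" and C: "Ck 3 U F" "Ck 3 U G" using assms by (auto simp: cyl_def)
  note d = Ck2D[OF U Ck32] 
  have L: "Lap (\<lambda>q. F q * G q) p = F p * Lap G p + Lap F p * G p
      + 8 * aa p * (Fa p * Ga p + Fw p * Gw p)" if "p \<in> U" for p
    using Lap_mult[OF U Ck32 Ck32 that, of F G] C cyl_Gamma[OF assms that] by simp
  show ?thesis unfolding cyl_def
    using assms U C L
    by (auto simp: cyl_def Ck_mult dt_mult VF_mult d algebra_simps)
qed

lemma cyl_comp:
  fixes g :: "real \<Rightarrow> real"
  assumes F: "cyl U F Ft Fa Fw FL" and V: "open V" "\<And>p. p \<in> U \<Longrightarrow> F p \<in> V" and C: "Ck 3 V g"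
    and g: "\<And>x. x \<in> V \<Longrightarrow> (g has_real_derivative g' x) (at x)"
    and g': "\<And>x. x \<in> V \<Longrightarrow> (g' has_real_derivative g'' x) (at x)"
  shows "cyl U (\<lambda>p. g (F p)) (\<lambda>p. g' (F p) * Ft p) (\<lambda>p. g' (F p) * Fa p) (\<lambda>p. g' (F p) * Fw p)
     (\<lambda>p. g' (F p) * FL p + g'' (F p) * (4 * aa p * ((Fa p)\<^sup>2 + (Fw p)\<^sup>2)))"
proof -
  have U: "open U" and CF: "Ck 3 U F" using F by (auto simp: cyl_def)
  note d = Ck2D[OF U Ck32]
  have L: "Lap (\<lambda>q. g (F q)) p = g' (F p) * Lap F p + g'' (F p) * (\<Sum>j\<in>UNIV. (VF j F p)\<^sup>2)" if "p \<in> U" for p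
    by (rule Lap_comp[OF U Ck32[OF CF] that _ g g', of V]) (use V in auto)
  have S: "(\<Sum>j\<in>UNIV. (VF j F p)\<^sup>2) = 4 * aa p * ((Fa p)\<^sup>2 + (Fw p)\<^sup>2)" if "p \<in> U" for p
    using cyl_Gamma[OF F F that] by (simp add: power2_eq_square)
  have LS: "Lap (\<lambda>q. g (F q)) p = g' (F p) * Lap F p + g'' (F p) * (4 * aa p * ((Fa p)\<^sup>2 + (Fw p)\<^sup>2))"
    if "p \<in> U" for p
    using L[OF that] S[OF that] by simp
  show ?thesis unfolding cyl_def
    using F U CF V
    by (auto simp: cyl_def Ck_comp[OF U CF V(1) C] image_subset_iff dt_comp[OF d(1) g] VF_comp[OF d(1) g] LS algebra_simps)
qed

lemma cyl_eq:
  assumes "cyl U F Ft Fa Fw FL" "\<And>p. p \<in> U \<Longrightarrow> G p = F p" "\<And>p. p \<in> U \<Longrightarrow> Gt p = Ft p"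
   "\<And>p. p \<in> U \<Longrightarrow> Ga p = Fa p" "\<And>p. p \<in> U \<Longrightarrow> Gw p = Fw p" "\<And>p. p \<in> U \<Longrightarrow> GL p = FL p"
  shows "cyl U G Gt Ga Gw GL"
proof -
  have U: "open U" using assms by (auto simp: cyl_def)
  show ?thesis using assms Ck_cong[OF U, of G F 3]
    by (auto simp: cyl_def VF_cong[OF U, of _ G F] dt_cong[OF U, of _ G F] Lap_cong[OF U, of _ G F])
qed

lemma cyl_subset: "cyl U F Ft Fa Fw FL \<Longrightarrow> open W \<Longrightarrow> W \<subseteq> U \<Longrightarrow> cyl W F Ft Fa Fw FL"
  by (auto simp: cyl_def intro: Ck_subset)

lemma Ck_numeralD:
  "Ck 3 U F \<Longrightarrow> p \<in> U \<Longrightarrow> F differentiable (at p)"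
  "Ck 2 U F \<Longrightarrow> p \<in> U \<Longrightarrow> F differentiable (at p)"
  "Ck 2 U F \<Longrightarrow> b \<in> Basis \<Longrightarrow> Ck 1 U (partial b F)"
  "Ck 1 U F \<Longrightarrow> p \<in> U \<Longrightarrow> F differentiable (at p)"
  "Ck 1 U F \<Longrightarrow> b \<in> Basis \<Longrightarrow> continuous_on U (partial b F)"
  unfolding numeral_3_eq_3 numeral_2_eq_2 One_nat_def Ck.simps by blast+

text \<open>From here on smoothness is handled by the rules above, and points of space-time are not split into
coordinates.\<close>

declare Ck.simps [simp del] split_paired_All [simp del] split_paired_Ex [simp del]

lemma Ck_3_Suc: "Ck 3 U F \<Longrightarrow> Ck (Suc 2) U F" "Ck 3 U F \<Longrightarrow> Ck (Suc (Suc 1)) U F" "Ck 2 U F \<Longrightarrow> Ck (Suc 1) U F"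
  by (simp_all add: eval_nat_numeral)

section \<open>Admissible test functions and the operator with Hardy potential\<close>

lemma hz_nonneg: "0 \<le> hz \<xi>"
  by (auto simp: hz_def split_beta intro!: sum_nonneg)

lemma hn_nonneg: "0 \<le> hn \<xi>"
  by (simp add: hn_def)

lemma norm_heis: "(norm (\<xi>::'n::finite heis))\<^sup>2 = hz \<xi> + (hw \<xi>)\<^sup>2"
  by (auto simp: hz_def hw_def split_beta norm_prod_def norm_vec_def L2_set_def sum.distrib sum_nonneg)

lemma hn_eq_0_iff: "hn \<xi> = 0 \<longleftrightarrow> \<xi> = (0::'n::finite heis)"
proof
  assume "hn \<xi> = 0"
  then have "hz \<xi> = 0" "hw \<xi> = 0" by (auto simp: hn_def add_nonneg_eq_0_iff)
  then have "(norm \<xi>)\<^sup>2 = 0" by (simp add: norm_heis)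
  then show "\<xi> = 0" by simp
qed (auto simp: hn_def hz_def hw_def zero_prod_def)

lemma hn_pos_iff: "0 < hn \<xi> \<longleftrightarrow> \<xi> \<noteq> (0::'n::finite heis)"
  using hn_eq_0_iff[of \<xi>] hn_nonneg[of \<xi>] by linarith

lemma koranyi_hn: "koranyi \<xi> = hn \<xi> powr (1 / 4)"
  by (auto simp: koranyi_def hn_def hz_def hw_def split_beta)

lemma koranyi_powr: "koranyi \<xi> powr c = hn \<xi> powr (c / 4)"
  by (simp add: koranyi_hn powr_powr)

lemma hz_le_hn: "(hz \<xi>)\<^sup>2 \<le> hn \<xi>"
  by (simp add: hn_def)

lemma continuous_hz: "continuous_on S (hz :: 'n::finite heis \<Rightarrow> real)"
  and continuous_hw: "continuous_on S (hw :: 'n::finite heis \<Rightarrow> real)"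
  unfolding hz_def hw_def split_beta by (intro continuous_intros)+

lemma continuous_hn: "continuous_on S (hn :: 'n::finite heis \<Rightarrow> real)"
  unfolding hn_def[abs_def] by (intro continuous_intros continuous_hz continuous_hw)

lemma compact_hn_le: "compact {\<xi>::'n::finite heis. hn \<xi> \<le> R}"
proof -
  have "(norm \<xi>)\<^sup>2 \<le> (1 + R) + R" if "hn \<xi> \<le> R" for \<xi> :: "'n heis"
  proof -
    have "hz \<xi> \<le> 1 + (hz \<xi>)\<^sup>2" using zero_le_power2[of "hz \<xi> - 1"] hz_nonneg[of \<xi>]
      by (simp add: power2_diff)
    then show ?thesis using that hz_nonneg[of \<xi>] unfolding norm_heis hn_def
      using zero_le_power2[of "hz \<xi>"] zero_le_power2[of "hw \<xi>"] by linarith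
  qed
  then have "norm \<xi> \<le> sqrt (1 + R + R)" if "hn \<xi> \<le> R" for \<xi> :: "'n heis"
    using that by (simp add: real_le_rsqrt)
  then have "bounded {\<xi>::'n heis. hn \<xi> \<le> R}" by (intro boundedI) auto
  moreover have "closed {\<xi>::'n heis. hn \<xi> \<le> R}"
    by (intro closed_Collect_le continuous_on_const continuous_hn)
  ultimately show ?thesis by (simp add: compact_eq_bounded_closed)
qed

lemma continuous_nn: "continuous_on S (nn :: 'n::finite st \<Rightarrow> real)"
  by (intro continuous_on_compose2[OF continuous_hn[of UNIV]] continuous_intros) auto

lemma continuous_aa: "continuous_on S (aa :: 'n::finite st \<Rightarrow> real)"
  by (intro continuous_on_compose2[OF continuous_hz[of UNIV]] continuous_intros) auto

lemma open_nn_pos: "open {p::'n::finite st. 0 < nn p}"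
  and open_nn_less: "open {p::'n::finite st. nn p < c}"
  and open_nn_greater: "open {p::'n::finite st. c < nn p}"
  by (intro open_Collect_less continuous_on_const continuous_nn)+

lemma cyl_n: "cyl UNIV (nn::'n::finite st \<Rightarrow> real) (\<lambda>p. 0) (\<lambda>p. 2 * aa p) (\<lambda>p. 2 * ww p)
    (\<lambda>p. 8 * (real CARD('n) + 2) * aa p)"
  by (rule cyl_eq[OF cyl_add[OF cyl_mult[OF cyl_a cyl_a] cyl_mult[OF cyl_w cyl_w]]])
    (auto simp: hn_def power2_eq_square algebra_simps)

lemma cyl_n_powr: "cyl {p. 0 < nn p} (\<lambda>p::'n::finite st. nn p powr c) (\<lambda>p. 0)
    (\<lambda>p. c * nn p powr (c - 1) * (2 * aa p)) (\<lambda>p. c * nn p powr (c - 1) * (2 * ww p))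
    (\<lambda>p. 8 * c * aa p * nn p powr (c - 1) * (real CARD('n) + 2 * c))"
proof -
  have "cyl {p. 0 < nn p} (\<lambda>p::'n st. nn p powr c) (\<lambda>p. c * nn p powr (c - 1) * 0)
    (\<lambda>p. c * nn p powr (c - 1) * (2 * aa p)) (\<lambda>p. c * nn p powr (c - 1) * (2 * ww p))
    (\<lambda>p. c * nn p powr (c - 1) * (8 * (real CARD('n) + 2) * aa p)
      + c * ((c - 1) * nn p powr (c - 1 - 1)) * (4 * aa p * ((2 * aa p)\<^sup>2 + (2 * ww p)\<^sup>2)))"
    by (rule cyl_comp[OF cyl_subset[OF cyl_n open_nn_pos], where V="{0<..}"])
      (auto intro!: Ck_powr derivative_eq_intros)
  then show ?thesis
  proof (rule cyl_eq)
    fix p :: "'n st" assume p: "p \<in> {p. 0 < nn p}"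
    then have "nn p powr (c - 1) = nn p powr (c - 1 - 1) * nn p"
      using powr_add[of "nn p" "c - 1 - 1" 1] by simp
    moreover have "(2 * aa p)\<^sup>2 + (2 * ww p)\<^sup>2 = 4 * nn p" by (simp add: hn_def)
    ultimately show "8 * c * aa p * nn p powr (c - 1) * (real CARD('n) + 2 * c)
      = c * nn p powr (c - 1) * (8 * (real CARD('n) + 2) * aa p)
      + c * ((c - 1) * nn p powr (c - 1 - 1)) * (4 * aa p * ((2 * aa p)\<^sup>2 + (2 * ww p)\<^sup>2))"
      by (simp add: algebra_simps)
  qed auto
qed

text \<open>The adjoint parabolic operator; \<open>a / n\<close> is \<open>\<psi> / \<rho>^2\<close>.\<close>

definition hardy_op :: "real \<Rightarrow> ('n::finite st \<Rightarrow> real) \<Rightarrow> 'n st \<Rightarrow> real" where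
  "hardy_op lam F p = dt F p + Lap F p + lam * (aa p / nn p) * F p"

text \<open>The weight \<open>\<rho>^\<mu>\<close> is not smooth at the origin, so the test functions vanish near it, for all times.
At times \<open>t \<ge> 0\<close> the support is compact and stays away from \<open>t = T\<close>; it may meet \<open>t = 0\<close>.\<close>

definition admissible :: "real \<Rightarrow> ('n::finite st \<Rightarrow> real) \<Rightarrow> bool" where
  "admissible T F \<longleftrightarrow> Ck 3 UNIV F \<and> (\<forall>p. 0 \<le> F p) \<and> (\<exists>n0>0. \<forall>p. nn p < n0 \<longrightarrow> F p = 0) \<and>
     (\<exists>S<T. \<exists>R. \<forall>p. 0 \<le> fst p \<longrightarrow> F p \<noteq> 0 \<longrightarrow> fst p \<le> S \<and> nn p \<le> R)"

lemma hardy_op_zero: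
  assumes "open U" "p \<in> U" "\<And>q. q \<in> U \<Longrightarrow> F q = 0"
  shows "dt F p = 0" "VF j F p = 0" "Lap F p = 0" "hardy_op lam F p = 0"
proof -
  have c: "cyl UNIV (\<lambda>p. 0) (\<lambda>p. 0) (\<lambda>p. 0) (\<lambda>p. 0) (\<lambda>p. 0)" by (rule cyl_const) simp
  have c': "cyl U F (\<lambda>p. 0) (\<lambda>p. 0) (\<lambda>p. 0) (\<lambda>p. 0)"
    by (rule cyl_eq[OF cyl_subset[OF c assms(1)]]) (use assms in auto)
  then show "dt F p = 0" "VF j F p = 0" "Lap F p = 0" using assms(2) by (auto simp: cyl_def)
  then show "hardy_op lam F p = 0" using assms by (simp add: hardy_op_def)
qed

lemma continuous_hardy_op:
  fixes F :: "'n::finite st \<Rightarrow> real"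
  assumes F: "Ck 3 UNIV F" and n0: "0 < n0" "\<And>p. nn p < n0 \<Longrightarrow> F p = 0"
  shows "continuous_on UNIV (hardy_op lam F)"
proof -
  have "continuous_on {p. 0 < nn p} (hardy_op lam F)"
  proof -
    have "Ck (Suc (Suc 1)) {p. 0 < nn p} F" by (intro Ck_3_Suc Ck_subset[OF F]) simp
    then have "continuous_on {p. 0 < nn p} (Lap F)" "continuous_on {p. 0 < nn p} (dt F)"
      using Ck_imp_continuous_on Ck_Lap[OF open_nn_pos] Ck_dt by blast+
    then show ?thesis
      unfolding hardy_op_def[abs_def]
      by (intro continuous_intros continuous_aa continuous_nn Ck_imp_continuous_on[OF Ck_subset[OF F]]) auto
  qed
  moreover have "continuous_on {p. nn p < n0} (hardy_op lam F)"
  proof -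
    have "hardy_op lam F p = 0" if "nn p < n0" for p
      by (rule hardy_op_zero(4)[OF open_nn_less[of n0]]) (use n0 that in auto)
    then show ?thesis by (intro continuous_on_eq[OF continuous_on_const[of _ 0]]) auto
  qed
  ultimately have "continuous_on ({p. 0 < nn p} \<union> {p. nn p < n0}) (hardy_op lam F)"
    by (intro continuous_on_open_Un open_nn_pos open_nn_less) auto
  moreover have "{p::'n st. 0 < nn p} \<union> {p. nn p < n0} = UNIV" using n0 by force
  ultimately show ?thesis by (simp only:)
qed

section \<open>The weak identity without weights\<close>

lemma slice_deriv:
  fixes F :: "'n::finite st \<Rightarrow> real"
  assumes "F differentiable (at (t, \<xi>))"
  shows "((\<lambda>\<eta>. F (t, \<eta>)) has_derivative (\<lambda>h. partial (0, h) F (t, \<xi>))) (at \<xi>)"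
proof -
  have "(F \<circ> (\<lambda>\<eta>. (t, \<eta>)) has_derivative (\<lambda>h. partial h F (t, \<xi>)) \<circ> (\<lambda>h. (0, h))) (at \<xi>)"
    by (intro diff_chain_at partial_works assms) (auto intro!: derivative_eq_intros)
  then show ?thesis by (simp add: o_def)
qed

lemma slice_partial:
  fixes F :: "'n::finite st \<Rightarrow> real"
  assumes "F differentiable (at (t, \<xi>))"
  shows "partial b (\<lambda>\<eta>. F (t, \<eta>)) \<xi> = partial (0, b) F (t, \<xi>)"
  by (rule partial_eqI[OF slice_deriv[OF assms]])

lemma slice_vf:
  fixes F :: "'n::finite st \<Rightarrow> real"
  assumes "F differentiable (at (t, \<xi>))"
  shows "vf_X i (\<lambda>\<eta>. F (t, \<eta>)) \<xi> = VF (Inl i) F (t, \<xi>)"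
    and "vf_Y i (\<lambda>\<eta>. F (t, \<eta>)) \<xi> = VF (Inr i) F (t, \<xi>)"
  using VF_basis[OF assms] slice_partial[OF assms]
  by (cases \<xi>; simp add: vf_X_def vf_Y_def)+

lemma time_deriv:
  fixes F :: "'n::finite st \<Rightarrow> real"
  assumes "F differentiable (at (t, \<xi>))"
  shows "((\<lambda>s. F (s, \<xi>)) has_real_derivative dt F (t, \<xi>)) (at t)"
proof -
  have "(F \<circ> (\<lambda>s. (s, \<xi>)) has_derivative (\<lambda>h. partial h F (t, \<xi>)) \<circ> (\<lambda>h. (h, 0))) (at t)"
    by (intro diff_chain_at partial_works assms) (auto intro!: derivative_eq_intros)
  moreover have "partial (h, 0) F (t, \<xi>) = dt F (t, \<xi>) * h" for h
    using linear_cmul[OF linear_frechet_derivative[OF assms], of h "(1, 0)"]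
    by (simp add: partial_def dt_def)
  ultimately show ?thesis by (simp add: o_def has_field_derivative_def)
qed

lemma Basis_slice: "b \<in> Basis \<Longrightarrow> (0, b) \<in> (Basis :: 'n::finite st set)"
  unfolding Basis_prod_def[where 'a=real and 'b="'n heis"] by blast

lemma cont_into_C2_slice:
  fixes F :: "'n::finite st \<Rightarrow> real"
  assumes "Ck 2 UNIV F"
  shows "cont_into_C2 T (\<lambda>t \<xi>. F (t, \<xi>))"
proof -
  have F: "F differentiable (at q)" "\<And>b. b \<in> Basis \<Longrightarrow> Ck 1 UNIV (partial b F)" for q
    using Ck_numeralD(2,3)[OF assms] by blast+
  then have F': "partial b F differentiable (at q)"
    "\<And>c. c \<in> Basis \<Longrightarrow> continuous_on UNIV (partial c (partial b F))" if "b \<in> Basis" for b q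
    using Ck_numeralD(4,5)[OF F(2)[OF that]] by blast+
  have p: "partial b (\<lambda>\<xi>. F (t, \<xi>)) = (\<lambda>\<xi>. partial (0, b) F (t, \<xi>))" for b t
    using slice_partial[OF F(1)] by blast
  have p2: "partial c (\<lambda>\<xi>. partial (0, b) F (t, \<xi>)) = (\<lambda>\<xi>. partial (0, c) (partial (0, b) F) (t, \<xi>))"
    if "b \<in> Basis" for b c t
    using slice_partial[OF F'(1)[OF Basis_slice[OF that]]] by blast
  have d: "(\<lambda>\<xi>. G (t, \<xi>)) differentiable (at \<xi>)" if "G differentiable (at (t, \<xi>))" for G :: "'n st \<Rightarrow> real" and t \<xi>
    using slice_deriv[OF that] by (auto simp: differentiable_def)
  have c: "continuous_on UNIV F" using Ck_imp_continuous_on[OF assms] .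
  have cc: "continuous_on ({0..<T} \<times> UNIV) (\<lambda>(t, \<xi>). G (t, \<xi>))" if "continuous_on UNIV G" for G :: "'n st \<Rightarrow> real"
    unfolding case_prod_eta using that by (rule continuous_on_subset) simp
  show ?thesis
    unfolding cont_into_C2_def
  proof (intro conjI ballI allI)
    show "continuous_on ({0..<T} \<times> UNIV) (\<lambda>(t, \<xi>). F (t, \<xi>))" by (rule cc[OF c])
    show "(\<lambda>\<xi>. F (t, \<xi>)) differentiable at \<xi>" for t \<xi> by (rule d[OF F(1)])
    fix b :: "'n heis" assume b: "b \<in> Basis"
    show "continuous_on ({0..<T} \<times> UNIV) (\<lambda>(t, \<xi>). partial b (\<lambda>\<xi>. F (t, \<xi>)) \<xi>)"
      unfolding p by (rule cc[OF Ck_imp_continuous_on[OF F(2)[OF Basis_slice[OF b]]]])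
    show "partial b (\<lambda>\<xi>. F (t, \<xi>)) differentiable at \<xi>" for t \<xi>
      unfolding p by (rule d[OF F'(1)[OF Basis_slice[OF b]]])
    fix c :: "'n heis" assume c: "c \<in> Basis"
    show "continuous_on ({0..<T} \<times> UNIV) (\<lambda>(t, \<xi>). partial c (partial b (\<lambda>\<xi>. F (t, \<xi>))) \<xi>)"
      unfolding p p2[OF b] by (rule cc[OF F'(2)[OF Basis_slice[OF b] Basis_slice[OF c]]])
  qed
qed

lemma test_fun_slice:
  fixes F :: "'n::finite st \<Rightarrow> real"
  assumes "Ck 3 UNIV F" "\<And>p. 0 \<le> F p" "S < T" "compact K"
    and "\<And>p. 0 \<le> fst p \<Longrightarrow> F p \<noteq> 0 \<Longrightarrow> fst p \<le> S \<and> snd p \<in> K"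
  shows "test_fun T (\<lambda>t \<xi>. F (t, \<xi>))"
  unfolding test_fun_def
proof (intro conjI)
  show "\<exists>S<T. \<exists>K. compact K \<and> (\<forall>t\<in>{0..<T}. \<forall>\<xi>. F (t, \<xi>) \<noteq> 0 \<longrightarrow> t \<le> S \<and> \<xi> \<in> K)"
    using assms by (intro exI[of _ S] conjI exI[of _ K]) auto
  show "cont_into_C2 T (\<lambda>t \<xi>. F (t, \<xi>))" by (rule cont_into_C2_slice[OF Ck32[OF assms(1)]])
  have "Ck 2 UNIV (dt F)" by (intro Ck_dt Ck_3_Suc assms(1))
  moreover have "F differentiable (at q)" for q
    using Ck_numeralD(1)[OF assms(1)] by blast
  ultimately have "(\<forall>t\<in>{0..<T}. \<forall>\<xi>. ((\<lambda>s. F (s, \<xi>)) has_real_derivative dt F (t, \<xi>)) (at t within {0..<T}))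
      \<and> cont_into_C2 T (\<lambda>t \<xi>. dt F (t, \<xi>))"
    using cont_into_C2_slice has_field_derivative_at_within[OF time_deriv] by blast
  then show "\<exists>\<phi>'. (\<forall>t\<in>{0..<T}. \<forall>\<xi>. ((\<lambda>s. F (s, \<xi>)) has_real_derivative \<phi>' t \<xi>) (at t within {0..<T}))
      \<and> cont_into_C2 T \<phi>'"
    by (rule exI[of _ "\<lambda>t \<xi>. dt F (t, \<xi>)"])
qed (use assms in auto)

lemma L_H_slice:
  fixes F :: "'n::finite st \<Rightarrow> real"
  assumes F: "Ck 3 UNIV F" and "\<xi> \<noteq> 0"
  shows "L_H \<mu> (\<lambda>\<eta>. F (t, \<eta>)) \<xi>
    = - (\<Sum>j\<in>UNIV. VF j (\<lambda>q. nn q powr (- \<mu> / 2) * VF j F q) (t, \<xi>))"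
proof -
  have d: "F differentiable (at q)" for q using Ck_numeralD(1)[OF F] by blast
  define W where "W j = (\<lambda>q. nn q powr (- \<mu> / 2) * VF j F q)" for j
  have "(\<lambda>\<eta>. fst (koranyi \<eta> powr (- 2 * \<mu>) *\<^sub>R hgrad (\<lambda>\<eta>. F (t, \<eta>)) \<eta>) $ i) = (\<lambda>\<eta>. W (Inl i) (t, \<eta>))"
    "(\<lambda>\<eta>. snd (koranyi \<eta> powr (- 2 * \<mu>) *\<^sub>R hgrad (\<lambda>\<eta>. F (t, \<eta>)) \<eta>) $ i) = (\<lambda>\<eta>. W (Inr i) (t, \<eta>))" for i
    by (auto simp: hgrad_def W_def koranyi_powr slice_vf[OF d])
  moreover have "W j differentiable (at (t, \<xi>))" for j
  proof -
    have "Ck 2 UNIV (VF j F)" by (intro Ck_VF Ck_3_Suc F open_UNIV)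
    then have "Ck 2 {p. 0 < nn p} (W j)"
      unfolding W_def using cyl_n_powr[of "-\<mu>/2", where 'n='n]
      by (intro Ck_mult open_nn_pos) (auto simp: cyl_def intro: Ck32 Ck_subset)
    then show ?thesis by (rule Ck_numeralD(2)) (use assms(2) in \<open>simp add: hn_pos_iff\<close>)
  qed
  ultimately show ?thesis
    unfolding L_H_def hdiv_def W_def[symmetric]
    by (simp add: slice_vf sum_UNIV_Plus sum.distrib)
qed

text \<open>The ground state transform: the weight \<open>\<rho>^(-2 \<mu>)\<close> in \<open>L_H\<close> is conjugated away by \<open>\<rho>^\<mu>\<close>, at the price of
the potential \<open>lam a / n\<close>.\<close>

lemma conjugate_operator:
  fixes F :: "'n::finite st \<Rightarrow> real"
  assumes F: "Ck 3 UNIV F" and n: "0 < nn p" and lam: "lam = \<mu> * (2 * real CARD('n) - \<mu>)"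
  shows "(\<Sum>j\<in>UNIV. VF j (\<lambda>q. nn q powr (- \<mu> / 2) * VF j (\<lambda>q. nn q powr (\<mu> / 4) * F q) q) p)
    = nn p powr (- \<mu> / 4) * (Lap F p + lam * (aa p / nn p) * F p)"
proof -
  let ?U = "{p::'n st. 0 < nn p}"
  let ?g = "\<lambda>q::'n st. nn q powr (- \<mu> / 4)"
  have U: "open ?U" by (rule open_nn_pos)
  have F2: "Ck 2 ?U F" using Ck32[OF F] Ck_subset by blast
  have g: "cyl ?U ?g (\<lambda>p. 0)
    (\<lambda>p. - \<mu> / 4 * nn p powr (- \<mu> / 4 - 1) * (2 * aa p)) (\<lambda>p. - \<mu> / 4 * nn p powr (- \<mu> / 4 - 1) * (2 * ww p))
    (\<lambda>p. 8 * (- \<mu> / 4) * aa p * nn p powr (- \<mu> / 4 - 1) * (real CARD('n) + 2 * (- \<mu> / 4)))"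
    by (rule cyl_n_powr)
  then have g2: "Ck 2 ?U ?g" by (auto simp: cyl_def intro: Ck32)
  note d = Ck2D[OF U F2] Ck2D[OF U g2]
  have n2: "Ck 2 UNIV (nn::'n st \<Rightarrow> real)" using cyl_n[where 'n='n] by (auto simp: cyl_def intro: Ck32)
  have dn: "nn differentiable (at q)" for q :: "'n st" using Ck2D(1)[OF _ n2] by auto
  have V: "VF j (\<lambda>q. nn q powr c) q = c * nn q powr (c - 1) * VF j nn q" if "q \<in> ?U" for q c j
    by (rule VF_comp[OF dn]) (use that in \<open>auto intro!: derivative_eq_intros\<close>)
  have dp: "(\<lambda>q. nn q powr c) differentiable (at q)" if "q \<in> ?U" for q :: "'n st" and c
    using that Ck2D(1)[OF U Ck32] cyl_n_powr[of c, where 'n='n] by (auto simp: cyl_def)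
  have e: "nn q powr (- \<mu> / 2) * VF j (\<lambda>q. nn q powr (\<mu> / 4) * F q) q
     = ?g q * VF j F q + (-1) * (F q * VF j ?g q)" if q: "q \<in> ?U" for q j
  proof -
    have "VF j (\<lambda>q. nn q powr (\<mu> / 4) * F q) q
      = nn q powr (\<mu> / 4) * VF j F q + \<mu> / 4 * nn q powr (\<mu> / 4 - 1) * VF j nn q * F q"
      using VF_mult[OF dp[OF q] d(1)[OF q]] V[OF q] by simp
    moreover have "nn q powr (- \<mu> / 2) * nn q powr (\<mu> / 4) = ?g q"
      "nn q powr (- \<mu> / 2) * nn q powr (\<mu> / 4 - 1) = nn q powr (- \<mu> / 4 - 1)"
      by (simp_all flip: powr_add)
    ultimately have "nn q powr (- \<mu> / 2) * VF j (\<lambda>q. nn q powr (\<mu> / 4) * F q) q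
      = ?g q * VF j F q + \<mu> / 4 * nn q powr (- \<mu> / 4 - 1) * VF j nn q * F q"
      by (simp add: algebra_simps)
    then show ?thesis using V[OF q, of j "-\<mu>/4"] by simp
  qed
  have p: "p \<in> ?U" using n by simp
  have "VF j (\<lambda>q. nn q powr (- \<mu> / 2) * VF j (\<lambda>q. nn q powr (\<mu> / 4) * F q) q) p
    = ?g p * VF j (VF j F) p - F p * VF j (VF j ?g) p" for j
  proof -
    have "VF j (\<lambda>q. nn q powr (- \<mu> / 2) * VF j (\<lambda>q. nn q powr (\<mu> / 4) * F q) q) p
      = VF j (\<lambda>q. ?g q * VF j F q + (-1) * (F q * VF j ?g q)) p"
      by (rule VF_cong[OF U p e])
    also have "\<dots> = VF j (\<lambda>q. ?g q * VF j F q) p + VF j (\<lambda>q. (-1) * (F q * VF j ?g q)) p"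
      by (rule VF_add) (use d p in \<open>auto intro!: differentiable_mult\<close>)
    also have "\<dots> = ?g p * VF j (VF j F) p + VF j ?g p * VF j F p
        + VF j (\<lambda>q. (-1) * (F q * VF j ?g q)) p"
      using VF_mult[OF d(3)[OF p] d(2)[OF p], of j] by (simp only:)
    also have "VF j (\<lambda>q. (-1) * (F q * VF j ?g q)) p = - VF j (\<lambda>q. F q * VF j ?g q) p"
      by (subst VF_comp[where g="\<lambda>x. (-1) * x", OF _ DERIV_cmult_Id])
        (use d p in \<open>auto intro!: differentiable_mult\<close>)
    also have "VF j (\<lambda>q. F q * VF j ?g q) p = F p * VF j (VF j ?g) p + VF j F p * VF j ?g p"
      using d p by (simp add: VF_mult)
    finally show ?thesis by simp
  qed
  then have "(\<Sum>j\<in>UNIV. VF j (\<lambda>q. nn q powr (- \<mu> / 2) * VF j (\<lambda>q. nn q powr (\<mu> / 4) * F q) q) p)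
    = ?g p * Lap F p - F p * Lap ?g p"
    unfolding Lap_def by (simp add: sum_subtractf sum_distrib_left)
  also have "Lap ?g p = 8 * (- \<mu> / 4) * aa p * nn p powr (- \<mu> / 4 - 1) * (real CARD('n) + 2 * (- \<mu> / 4))"
    using g p unfolding cyl_def by blast
  also have "\<dots> = - lam * (aa p / nn p) * ?g p"
  proof -
    have "?g p = nn p powr (- \<mu> / 4 - 1) * nn p"
      using n powr_add[of "nn p" "-\<mu>/4 - 1" 1] by simp
    then show ?thesis using n by (simp add: lam)
  qed
  finally show ?thesis by (simp add: algebra_simps)
qed


lemma AE_spatial_nonzero: "AE q :: 'n::finite st in lebesgue. snd q \<noteq> 0"
proof -
  have "negligible {q :: 'n st. q \<bullet> (0, 0, 0, 1) = 0}"
    by (rule negligible_standard_hyperplane) (rule st_Basis)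
  then have "{q :: 'n st. q \<bullet> (0, 0, 0, 1) = 0} \<in> null_sets lebesgue"
    by (simp add: negligible_iff_null_sets)
  then show ?thesis
    by (rule AE_I') (auto simp: zero_prod_def inner_prod_def)
qed

lemma hardy_mu_eq:
  assumes "0 < lam" "lam < ((hdim TYPE('n::finite) - 2) / 2)\<^sup>2"
  defines "\<mu> \<equiv> hardy_mu (hdim TYPE('n)) lam"
  shows "lam = \<mu> * (2 * real CARD('n) - \<mu>)" "0 < \<mu>" "\<mu> < real CARD('n)"
proof -
  let ?N = "real CARD('n)"
  have d: "(hdim TYPE('n) - 2) / 2 = ?N" by (simp add: hdim_def)
  have m: "\<mu> = ?N - sqrt (?N\<^sup>2 - lam)" unfolding \<mu>_def hardy_mu_def d ..
  have l: "lam < ?N\<^sup>2" using assms(2) d by simp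
  have "(sqrt (?N\<^sup>2 - lam))\<^sup>2 = ?N\<^sup>2 - lam" using l by simp
  then show "lam = \<mu> * (2 * ?N - \<mu>)" unfolding m by (simp add: algebra_simps power2_eq_square)
  have "sqrt (?N\<^sup>2 - lam) < sqrt (?N\<^sup>2)" using assms(1) by (intro real_sqrt_less_mono) auto
  then show "0 < \<mu>" unfolding m by simp
  show "\<mu> < ?N" unfolding m using l by simp
qed

lemma test_function_identity:
  fixes F :: "'n::finite st \<Rightarrow> real"
  assumes F: "Ck 3 UNIV F" and \<xi>: "\<xi> \<noteq> 0" and lam: "lam = \<mu> * (2 * real CARD('n) - \<mu>)"
    and G: "Ck 3 UNIV G" "G = (\<lambda>q. nn q powr (\<mu> / 4) * F q)" 
  shows "koranyi \<xi> powr \<mu> * v * (koranyi \<xi> powr (- 2 * \<mu>) * deriv (\<lambda>s. G (s, \<xi>)) t - L_H \<mu> (\<lambda>\<eta>. G (t, \<eta>)) \<xi>)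
    = v * hardy_op lam F (t, \<xi>)"
proof -
  have n: "0 < nn (t, \<xi>)" using \<xi> by (simp add: hn_pos_iff)
  have "deriv (\<lambda>s. G (s, \<xi>)) t = dt G (t, \<xi>)"
    by (intro DERIV_imp_deriv time_deriv Ck_numeralD(1)[OF G(1)]) simp
  also have "\<dots> = hn \<xi> powr (\<mu> / 4) * dt F (t, \<xi>)"
  proof -
    have "(\<lambda>q::'n st. nn q powr (\<mu> / 4)) differentiable (at (t, \<xi>))"
      using cyl_n_powr[of "\<mu>/4", where 'n='n] n unfolding cyl_def by (intro Ck_numeralD(1)) auto
    moreover have "dt (\<lambda>q::'n st. nn q powr (\<mu> / 4)) (t, \<xi>) = 0"
      using cyl_n_powr[of "\<mu>/4", where 'n='n] n unfolding cyl_def by auto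
    ultimately show ?thesis unfolding G(2)
      using dt_mult[OF _ Ck_numeralD(1)[OF F]] by simp
  qed
  finally have 1: "deriv (\<lambda>s. G (s, \<xi>)) t = hn \<xi> powr (\<mu> / 4) * dt F (t, \<xi>)" .
  have 2: "L_H \<mu> (\<lambda>\<eta>. G (t, \<eta>)) \<xi> = - (hn \<xi> powr (- \<mu> / 4)) * (Lap F (t, \<xi>) + lam * (hz \<xi> / hn \<xi>) * F (t, \<xi>))"
    unfolding L_H_slice[OF G(1) \<xi>] unfolding G(2) using conjugate_operator[OF F n lam] by simp
  have p: "hn \<xi> powr (\<mu> / 4) * (hn \<xi> powr (- \<mu> / 2) * hn \<xi> powr (\<mu> / 4)) = 1"
    "hn \<xi> powr (\<mu> / 4) * hn \<xi> powr (- \<mu> / 4) = 1"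
    using n by (simp_all flip: powr_add)
  have "koranyi \<xi> powr \<mu> * v * (koranyi \<xi> powr (- 2 * \<mu>) * deriv (\<lambda>s. G (s, \<xi>)) t - L_H \<mu> (\<lambda>\<eta>. G (t, \<eta>)) \<xi>)
    = v * ((hn \<xi> powr (\<mu> / 4) * (hn \<xi> powr (- \<mu> / 2) * hn \<xi> powr (\<mu> / 4))) * dt F (t, \<xi>)
     + (hn \<xi> powr (\<mu> / 4) * hn \<xi> powr (- \<mu> / 4)) * (Lap F (t, \<xi>) + lam * (hz \<xi> / hn \<xi>) * F (t, \<xi>)))"
    unfolding 1 2 by (simp add: koranyi_powr algebra_simps)
  also have "\<dots> = v * hardy_op lam F (t, \<xi>)" unfolding p hardy_op_def by simp
  finally show ?thesis .
qed

lemma lebesgue_to_lborel: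
  fixes X W :: "'a::euclidean_space \<Rightarrow> real"
  assumes "set_integrable lebesgue D X" "W \<in> borel_measurable borel"
    and "AE q in lebesgue. indicator D q *\<^sub>R X q = W q"
  shows "integrable lborel W" "(LINT q:D|lebesgue. X q) = (\<integral>q. W q \<partial>lborel)"
proof -
  have W: "W \<in> borel_measurable lebesgue" "W \<in> borel_measurable lborel"
    using assms(2) by (auto intro: measurable_completion)
  have X: "integrable lebesgue (\<lambda>q. indicator D q *\<^sub>R X q)" using assms(1) by (simp add: set_integrable_def)
  have "integrable lebesgue W"
    using integrable_cong_AE[OF borel_measurable_integrable[OF X] W(1) assms(3)] X by simp
  then show "integrable lborel W" using integrable_completion[OF W(2)] by simp
  have "(LINT q:D|lebesgue. X q) = (\<integral>q. W q \<partial>lebesgue)"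
    unfolding set_lebesgue_integral_def
    by (rule integral_cong_AE[OF borel_measurable_integrable[OF X] W(1) assms(3)])
  then show "(LINT q:D|lebesgue. X q) = (\<integral>q. W q \<partial>lborel)" using integral_completion[OF W(2)] by simp
qed

lemma borel_measurable_nn [measurable]: "(nn::'n::finite st \<Rightarrow> real) \<in> borel_measurable borel"
  by (rule borel_measurable_continuous_onI[OF continuous_nn])

lemma admissible_conjugate:
  fixes F :: "'n::finite st \<Rightarrow> real"
  assumes "admissible T F" "G = (\<lambda>q. nn q powr c * F q)"
  shows "Ck 3 UNIV G" "test_fun T (\<lambda>t \<xi>. G (t, \<xi>))"
proof -
  obtain n0 S R where F: "Ck 3 UNIV F" "\<And>p. 0 \<le> F p" "n0 > 0" "\<And>p. nn p < n0 \<Longrightarrow> F p = 0"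
    "S < T" "\<And>p. 0 \<le> fst p \<Longrightarrow> F p \<noteq> 0 \<Longrightarrow> fst p \<le> S \<and> nn p \<le> R"
    using assms(1) unfolding admissible_def by blast
  have "Ck 3 {p. 0 < nn p} G" unfolding assms(2)
    using cyl_n_powr[of c, where 'n='n] by (intro Ck_mult open_nn_pos Ck_subset[OF F(1)]) (auto simp: cyl_def)
  moreover have "Ck 3 {p. nn p < n0} G"
    by (rule iffD2[OF Ck_cong[OF open_nn_less] Ck_const[of _ _ 0]]) (use F(4) in \<open>auto simp: assms(2)\<close>)
  ultimately have "Ck 3 ({p. 0 < nn p} \<union> {p. nn p < n0}) G"
    by (intro Ck_Un open_nn_pos open_nn_less)
  moreover have "{p::'n st. 0 < nn p} \<union> {p. nn p < n0} = UNIV" using F(3) by force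
  ultimately show G: "Ck 3 UNIV G" by (simp only:)
  show "test_fun T (\<lambda>t \<xi>. G (t, \<xi>))"
    by (rule test_fun_slice[OF G _ F(5) compact_hn_le[of R]]) (use F(2,6) in \<open>auto simp: assms(2)\<close>)
qed

text \<open>The weak formulation tested with \<open>\<rho>^\<mu> F\<close>. Passing to a Borel representative \<open>U\<close>, extended by zero outside
\<open>(0, T)\<close>, replaces integrals over a time interval against the completed measure by integrals over all
of space-time, for which Fubini and translation invariance are available.\<close>

lemma weak_solution_borel:
  fixes u0 f :: "'n::finite heis \<Rightarrow> real"
  assumes ws: "weak_solution lam \<alpha> p u0 f T u" and lam: "0 < lam" "lam < ((hdim TYPE('n) - 2) / 2)\<^sup>2"
  obtains U :: "'n st \<Rightarrow> real" where "U \<in> borel_measurable borel"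
    "\<And>q. fst q \<notin> {0<..<T} \<Longrightarrow> U q = 0"
    "AE q in lebesgue. fst q \<in> {0<..<T} \<longrightarrow> u (fst q) (snd q) = U q"
    "\<And>F. admissible T F \<Longrightarrow> integrable lborel (\<lambda>q. U q * hardy_op lam F q)"
    "\<And>F. admissible T F \<Longrightarrow> integrable lborel (\<lambda>q. \<bar>U q\<bar> powr p * F q)"
    "\<And>F. admissible T F \<Longrightarrow> - (\<integral>q. U q * hardy_op lam F q \<partial>lborel) = (\<integral>q. \<bar>U q\<bar> powr p * F q \<partial>lborel)
       + (LINT \<xi>|lebesgue. u0 \<xi> * F (0, \<xi>))
       + (LINT (t, \<xi>):{0<..<T} \<times> UNIV|lebesgue. t powr \<alpha> * f \<xi> * F (t, \<xi>))"
proof -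
  define \<mu> where "\<mu> = hardy_mu (hdim TYPE('n)) lam"
  note mu = hardy_mu_eq[OF lam, folded \<mu>_def]
  define D where "D = {0<..<T} \<times> (UNIV :: 'n heis set)"
  have "open D" unfolding D_def by (intro open_Times) auto
  then have Db: "D \<in> sets borel" and Dm: "D \<in> sets lebesgue" by (auto intro: sets_completionI_sets)
  define v where "v q = koranyi (snd q) powr \<mu> * u (fst q) (snd q)" for q :: "'n st"
  have "(\<lambda>(t, \<xi>). koranyi \<xi> powr \<mu> * u t \<xi>) \<in> borel_measurable (lebesgue_on D)"
    using ws unfolding weak_solution_def Let_def Lq_loc_time_def \<mu>_def[symmetric] D_def[symmetric]
    by blast
  then have "v \<in> borel_measurable (lebesgue_on D)"
    by (rule back_subst[of "\<lambda>g. g \<in> borel_measurable (lebesgue_on D)"])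
      (rule ext, simp add: v_def split_beta)
  then have "(\<lambda>q. if q \<in> D then v q else 0) \<in> borel_measurable lebesgue"
    by (simp add: borel_measurable_if Dm)
  then obtain vb where vb: "vb \<in> borel_measurable lborel"
    and "AE q in lborel. (if q \<in> D then v q else 0) = vb q"
    by (rule bexE[OF completion_ex_borel_measurable_real])
  then have vb_AE: "AE q in lebesgue. (if q \<in> D then v q else 0) = vb q" by (auto intro: AE_completion)
  have vb': "vb \<in> borel_measurable borel" using vb by simp
  define U where "U q = indicator D q * (nn q powr (- \<mu> / 4) * vb q)" for q :: "'n st"
  have U: "U \<in> borel_measurable borel"
    unfolding U_def[abs_def] using vb' Db by measurable
  have U_AE: "AE q in lebesgue. (q \<in> D \<longrightarrow> u (fst q) (snd q) = U q) \<and> snd q \<noteq> 0"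
    using vb_AE AE_spatial_nonzero
  proof eventually_elim
    case (elim q)
    show ?case
    proof (intro conjI impI)
      assume q: "q \<in> D"
      have "0 < nn q" using elim(2) by (simp add: hn_pos_iff)
      then have "nn q powr (- \<mu> / 4) * nn q powr (\<mu> / 4) = 1" by (simp flip: powr_add)
      then show "u (fst q) (snd q) = U q"
        using elim(1) q by (simp add: U_def v_def koranyi_powr flip: elim(1))
    qed fact
  qed
  show thesis
  proof
    show "U \<in> borel_measurable borel" by (rule U)
    show "U q = 0" if "fst q \<notin> {0<..<T}" for q
      using that by (cases q) (auto simp: U_def D_def)
    show "AE q in lebesgue. fst q \<in> {0<..<T} \<longrightarrow> u (fst q) (snd q) = U q"
      using U_AE by eventually_elim (auto simp: D_def mem_Times_iff)
    fix F :: "'n st \<Rightarrow> real" assume admissible: "admissible T F"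
    obtain n0 where F: "Ck 3 UNIV F" "n0 > 0" "\<And>p. nn p < n0 \<Longrightarrow> F p = 0" "\<And>p. 0 \<le> F p"
      using admissible unfolding admissible_def by blast
    have PLm: "hardy_op lam F \<in> borel_measurable borel"
      by (rule borel_measurable_continuous_onI[OF continuous_hardy_op[OF F(1,2,3)]])
    have Fm: "F \<in> borel_measurable borel"
      by (rule borel_measurable_continuous_onI[OF Ck_imp_continuous_on[OF F(1)]])
    define G where "G = (\<lambda>q. nn q powr (\<mu> / 4) * F q)"
    note G = admissible_conjugate[OF admissible G_def]
    have U0: "U q = 0" if "q \<notin> D" for q using that by (simp add: U_def)
    have F0: "F (t, 0) = 0" for t using F(2,3) by (simp add: hn_def hz_def hw_def zero_prod_def)
    let ?X1 = "\<lambda>(t, \<xi>). koranyi \<xi> powr \<mu> * u t \<xi> * (koranyi \<xi> powr (- 2 * \<mu>) * deriv (\<lambda>s. G (s, \<xi>)) t - L_H \<mu> (\<lambda>\<eta>. G (t, \<eta>)) \<xi>)"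
    let ?X2 = "\<lambda>(t, \<xi>). koranyi \<xi> powr (- (p + 1) * \<mu>) * \<bar>koranyi \<xi> powr \<mu> * u t \<xi>\<bar> powr p * G (t, \<xi>)"
    have ws': "?X1 absolutely_integrable_on D \<and> ?X2 absolutely_integrable_on D \<and>
      - (LINT q:D|lebesgue. ?X1 q) = (LINT q:D|lebesgue. ?X2 q)
      + (LINT \<xi>|lebesgue. koranyi \<xi> powr (- 2 * \<mu>) * (koranyi \<xi> powr \<mu> * u0 \<xi>) * G (0, \<xi>))
      + (LINT (t, \<xi>):D|lebesgue. koranyi \<xi> powr (- \<mu>) * t powr \<alpha> * f \<xi> * G (t, \<xi>))"
      using ws G(2) unfolding weak_solution_def Let_def \<mu>_def[symmetric] D_def[symmetric] by blast
    have A1: "AE q in lebesgue. indicator D q *\<^sub>R ?X1 q = U q * hardy_op lam F q"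
      using U_AE
    proof eventually_elim
      case (elim q)
      show ?case
        using elim test_function_identity[OF F(1) _ mu(1) G(1) G_def, of "snd q" "u (fst q) (snd q)" "fst q"] U0
        by (cases "q \<in> D") (simp_all add: split_beta)
    qed
    have n2: "hn \<xi> powr (- (p + 1) * \<mu> / 4) * \<bar>hn \<xi> powr (\<mu> / 4) * r\<bar> powr p * hn \<xi> powr (\<mu> / 4) = \<bar>r\<bar> powr p"
      if "\<xi> \<noteq> 0" for r and \<xi> :: "'n heis"
    proof -
      have pos: "0 < hn \<xi>" using that by (simp add: hn_pos_iff)
      have "\<bar>hn \<xi> powr (\<mu> / 4) * r\<bar> powr p = hn \<xi> powr (\<mu> / 4 * p) * \<bar>r\<bar> powr p"
        by (simp add: abs_mult powr_mult powr_powr)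
      moreover have "hn \<xi> powr (- (p + 1) * \<mu> / 4) * hn \<xi> powr (\<mu> / 4 * p) * hn \<xi> powr (\<mu> / 4) = 1"
        using pos by (simp flip: powr_add) (simp add: field_simps)
      ultimately show ?thesis by (simp add: mult_ac)
    qed
    have A2: "AE q in lebesgue. indicator D q *\<^sub>R ?X2 q = \<bar>U q\<bar> powr p * F q"
      using U_AE
    proof eventually_elim
      case (elim q)
      show ?case
        using elim n2[of "snd q" "U q"] U0
        by (cases "q \<in> D") (simp_all add: split_beta koranyi_powr G_def mult.assoc[symmetric])
    qed
    have n3: "hn \<xi> powr (- 2 * \<mu> / 4) * (hn \<xi> powr (\<mu> / 4) * r) * (hn \<xi> powr (\<mu> / 4) * F (t, \<xi>)) = r * F (t, \<xi>)"
      "hn \<xi> powr (- \<mu> / 4) * r * (hn \<xi> powr (\<mu> / 4) * F (t, \<xi>)) = r * F (t, \<xi>)"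
      for \<xi> :: "'n heis" and r t
    proof -
      have "hn \<xi> powr (- 2 * \<mu> / 4) * (hn \<xi> powr (\<mu> / 4) * r) * (hn \<xi> powr (\<mu> / 4) * F (t, \<xi>)) = r * F (t, \<xi>) \<and>
        hn \<xi> powr (- \<mu> / 4) * r * (hn \<xi> powr (\<mu> / 4) * F (t, \<xi>)) = r * F (t, \<xi>)"
      proof (cases "\<xi> = 0")
        case False
        then have "0 < hn \<xi>" by (simp add: hn_pos_iff)
        then have "hn \<xi> powr (- 2 * \<mu> / 4) * hn \<xi> powr (\<mu> / 4) * hn \<xi> powr (\<mu> / 4) = 1"
          "hn \<xi> powr (- \<mu> / 4) * hn \<xi> powr (\<mu> / 4) = 1" by (simp_all flip: powr_add)
        moreover have "a * (b * r) * (b * z) = (a * b * b) * (r * z)" "c * r * (b * z) = (c * b) * (r * z)"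
          for a b c z :: real by simp_all
        ultimately show ?thesis by (simp only: mult_1)
      qed (simp add: F0)
      then show "hn \<xi> powr (- 2 * \<mu> / 4) * (hn \<xi> powr (\<mu> / 4) * r) * (hn \<xi> powr (\<mu> / 4) * F (t, \<xi>)) = r * F (t, \<xi>)"
      "hn \<xi> powr (- \<mu> / 4) * r * (hn \<xi> powr (\<mu> / 4) * F (t, \<xi>)) = r * F (t, \<xi>)" by auto
    qed
    have U1: "(\<lambda>q. U q * hardy_op lam F q) \<in> borel_measurable borel" using U PLm by measurable
    have U2: "(\<lambda>q. \<bar>U q\<bar> powr p * F q) \<in> borel_measurable borel" using U Fm by measurable
    show "integrable lborel (\<lambda>q. U q * hardy_op lam F q)"
      by (rule lebesgue_to_lborel(1)[OF _ U1 A1]) (use ws' in auto)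
    show "integrable lborel (\<lambda>q. \<bar>U q\<bar> powr p * F q)"
      by (rule lebesgue_to_lborel(1)[OF _ U2 A2]) (use ws' in auto)
    have e1: "(LINT q:D|lebesgue. ?X1 q) = (\<integral>q. U q * hardy_op lam F q \<partial>lborel)"
      by (rule lebesgue_to_lborel(2)[OF _ U1 A1]) (use ws' in auto)
    have e2: "(LINT q:D|lebesgue. ?X2 q) = (\<integral>q. \<bar>U q\<bar> powr p * F q \<partial>lborel)"
      by (rule lebesgue_to_lborel(2)[OF _ U2 A2]) (use ws' in auto)
    have e3: "koranyi \<xi> powr (- 2 * \<mu>) * (koranyi \<xi> powr \<mu> * u0 \<xi>) * G (0, \<xi>) = u0 \<xi> * F (0, \<xi>)" for \<xi>
      using n3(1) by (simp add: koranyi_powr G_def)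
    have e4: "koranyi \<xi> powr (- \<mu>) * t powr \<alpha> * f \<xi> * G (t, \<xi>) = t powr \<alpha> * f \<xi> * F (t, \<xi>)" for \<xi> t
      using n3(2)[of \<xi> "t powr \<alpha> * f \<xi>" t] by (simp add: koranyi_powr G_def mult.assoc)
    show "- (\<integral>q. U q * hardy_op lam F q \<partial>lborel) = (\<integral>q. \<bar>U q\<bar> powr p * F q \<partial>lborel)
       + (LINT \<xi>|lebesgue. u0 \<xi> * F (0, \<xi>))
       + (LINT (t, \<xi>):{0<..<T} \<times> UNIV|lebesgue. t powr \<alpha> * f \<xi> * F (t, \<xi>))"
      using ws'[unfolded e1 e2 e3 e4] unfolding D_def by blast
  qed
qed

section \<open>Group translations and a smooth kernel\<close>

text \<open>\<open>group_diff (t, \<xi>) (s, \<eta>) = (t - s, \<xi> \<circ> \<eta>^(-1))\<close>. With this order of the factors, moving the first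
argument along a horizontal field is the same as moving the second one backwards
(\<open>group_diff_hv\<close>), so that derivatives of a convolution fall on the kernel.\<close>

definition group_diff :: "'n::finite st \<Rightarrow> 'n st \<Rightarrow> 'n st" where
  "group_diff = (\<lambda>(t, x, y, w) (s, x', y', w'). (t - s, x - x', y - y', w - w' - 2 * (y \<bullet> x') + 2 * (x \<bullet> y')))"

lemma group_diff_hv: "group_diff (p + h *\<^sub>R hv j p) q = group_diff p (q - h *\<^sub>R hv j q)"
  by (cases p; cases q; cases j) (simp_all add: group_diff_def inner_axis inner_axis' algebra_simps)

lemma group_diff_time: "group_diff (p - (h, 0)) q = group_diff p (q + (h, 0))"
  by (cases p; cases q) (simp_all add: group_diff_def algebra_simps)

lemma nn_integral_lborel_affine:
  fixes g :: "'a::euclidean_space \<Rightarrow> ennreal"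
  assumes "g \<in> borel_measurable borel" "\<sigma> = 1 \<or> \<sigma> = -1"
  shows "(\<integral>\<^sup>+x. g (c + \<sigma> *\<^sub>R x) \<partial>lborel) = (\<integral>\<^sup>+x. g x \<partial>lborel)"
proof -
  have "(\<integral>\<^sup>+x. g x \<partial>lborel) = (\<integral>\<^sup>+x. g x \<partial>(density (distr lborel borel (\<lambda>x. c + \<sigma> *\<^sub>R x)) (\<lambda>_. (\<bar>\<sigma>\<bar> ^ DIM('a)))))"
    by (subst lborel_affine[of \<sigma> c]) (use assms in auto)
  also have "\<dots> = (\<integral>\<^sup>+x. g x \<partial>distr lborel borel (\<lambda>x. c + \<sigma> *\<^sub>R x))"
    using assms(2) by (auto simp: density_1)
  also have "\<dots> = (\<integral>\<^sup>+x. g (c + \<sigma> *\<^sub>R x) \<partial>lborel)"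
    by (subst nn_integral_distr) (use assms in auto)
  finally show ?thesis by simp
qed

lemma nn_integral_st:
  fixes g :: "'n::finite st \<Rightarrow> ennreal"
  assumes [measurable]: "g \<in> borel_measurable borel"
  shows "(\<integral>\<^sup>+q. g q \<partial>lborel) = (\<integral>\<^sup>+t. \<integral>\<^sup>+x. \<integral>\<^sup>+y. \<integral>\<^sup>+w. g (t, x, y, w) \<partial>lborel \<partial>lborel \<partial>lborel \<partial>lborel)"
proof -
  have "(\<integral>\<^sup>+q. g q \<partial>lborel) = (\<integral>\<^sup>+t. \<integral>\<^sup>+z. g (t, z) \<partial>lborel \<partial>lborel)"
    by (subst lborel_prod[symmetric], subst lborel.nn_integral_fst[symmetric]) (auto simp: lborel_prod)
  also have "\<dots> = (\<integral>\<^sup>+t. \<integral>\<^sup>+x. \<integral>\<^sup>+z. g (t, x, z) \<partial>lborel \<partial>lborel \<partial>lborel)"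
    by (subst lborel_prod[symmetric], subst lborel.nn_integral_fst[symmetric]) (auto simp: lborel_prod)
  also have "\<dots> = (\<integral>\<^sup>+t. \<integral>\<^sup>+x. \<integral>\<^sup>+y. \<integral>\<^sup>+w. g (t, x, y, w) \<partial>lborel \<partial>lborel \<partial>lborel \<partial>lborel)"
    by (subst lborel_prod[symmetric], subst lborel.nn_integral_fst[symmetric]) (auto simp: lborel_prod)
  finally show ?thesis .
qed

lemma nn_integral_shear:
  fixes g :: "'n::finite st \<Rightarrow> ennreal"
  assumes [measurable]: "g \<in> borel_measurable borel" and s: "\<sigma> = 1 \<or> \<sigma> = -1"
    and [measurable]: "(\<lambda>(x, y). l x y) \<in> borel_measurable borel"
  shows "(\<integral>\<^sup>+q. (case q of (t, x, y, w) \<Rightarrow> g (t0 + \<sigma> *\<^sub>R t, x0 + \<sigma> *\<^sub>R x, y0 + \<sigma> *\<^sub>R y, l x y + \<sigma> *\<^sub>R w)) \<partial>lborel)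
     = (\<integral>\<^sup>+q. g q \<partial>lborel)"
proof -
  have lm: "(\<lambda>z. l (fst z) (snd z)) \<in> borel_measurable borel"
    using assms(3) by (simp add: case_prod_beta')
  have [measurable]: "(\<lambda>q::'n st. l (fst (snd q)) (fst (snd (snd q)))) \<in> borel_measurable borel"
  proof -
    have "(\<lambda>q::'n st. (fst (snd q), fst (snd (snd q)))) \<in> borel_measurable borel"
      by (intro borel_measurable_continuous_onI continuous_intros)
    from measurable_compose[OF this lm] show ?thesis by simp
  qed
  have "(\<lambda>q::'n st. g (t0 + \<sigma> *\<^sub>R fst q, x0 + \<sigma> *\<^sub>R fst (snd q), y0 + \<sigma> *\<^sub>R fst (snd (snd q)),
      l (fst (snd q)) (fst (snd (snd q))) + \<sigma> *\<^sub>R snd (snd (snd q)))) \<in> borel_measurable borel"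
  proof (rule measurable_compose[OF _ assms(1)], intro borel_measurable_Pair)
    show "(\<lambda>q::'n st. l (fst (snd q)) (fst (snd (snd q))) + \<sigma> *\<^sub>R snd (snd (snd q))) \<in> borel_measurable borel"
      by (intro borel_measurable_add borel_measurable_continuous_onI[of "\<lambda>q. \<sigma> *\<^sub>R snd (snd (snd q))"]) (measurable, intro continuous_intros)
  qed (intro borel_measurable_continuous_onI continuous_intros)+
  then have m: "(\<lambda>q. case q of (t, x, y, w) \<Rightarrow> g (t0 + \<sigma> *\<^sub>R t, x0 + \<sigma> *\<^sub>R x, y0 + \<sigma> *\<^sub>R y, l x y + \<sigma> *\<^sub>R w)) \<in> borel_measurable borel"
    by (simp add: split_beta)
  have "(\<integral>\<^sup>+w. g (t, x, y, l x' y' + \<sigma> *\<^sub>R w) \<partial>lborel) = (\<integral>\<^sup>+w. g (t, x, y, w) \<partial>lborel)" for t x y x' y'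
    by (rule nn_integral_lborel_affine[OF _ s]) measurable
  then have "(\<integral>\<^sup>+q. (case q of (t, x, y, w) \<Rightarrow> g (t0 + \<sigma> *\<^sub>R t, x0 + \<sigma> *\<^sub>R x, y0 + \<sigma> *\<^sub>R y, l x y + \<sigma> *\<^sub>R w)) \<partial>lborel)
    = (\<integral>\<^sup>+t. \<integral>\<^sup>+x. \<integral>\<^sup>+y. \<integral>\<^sup>+w. g (t0 + \<sigma> *\<^sub>R t, x0 + \<sigma> *\<^sub>R x, y0 + \<sigma> *\<^sub>R y, w) \<partial>lborel \<partial>lborel \<partial>lborel \<partial>lborel)"
    by (subst nn_integral_st[OF m]) simp
  also have "\<dots> = (\<integral>\<^sup>+t. \<integral>\<^sup>+x. \<integral>\<^sup>+y. \<integral>\<^sup>+w. g (t0 + \<sigma> *\<^sub>R t, x0 + \<sigma> *\<^sub>R x, y, w) \<partial>lborel \<partial>lborel \<partial>lborel \<partial>lborel)"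
    by (subst nn_integral_lborel_affine[OF _ s, where c=y0]) measurable
  also have "\<dots> = (\<integral>\<^sup>+t. \<integral>\<^sup>+x. \<integral>\<^sup>+y. \<integral>\<^sup>+w. g (t0 + \<sigma> *\<^sub>R t, x, y, w) \<partial>lborel \<partial>lborel \<partial>lborel \<partial>lborel)"
    by (subst nn_integral_lborel_affine[OF _ s, where c=x0]) measurable
  also have "\<dots> = (\<integral>\<^sup>+t. \<integral>\<^sup>+x. \<integral>\<^sup>+y. \<integral>\<^sup>+w. g (t, x, y, w) \<partial>lborel \<partial>lborel \<partial>lborel \<partial>lborel)"
    by (subst nn_integral_lborel_affine[OF _ s, where c=t0]) measurable
  also have "\<dots> = (\<integral>\<^sup>+q. g q \<partial>lborel)" by (subst nn_integral_st) auto
  finally show ?thesis .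
qed

lemma continuous_group_diff: "continuous_on UNIV (\<lambda>p. group_diff p q)" "continuous_on UNIV (\<lambda>q. group_diff p q)"
   "continuous_on UNIV (\<lambda>z::'n::finite st \<times> 'n st. group_diff (fst z) (snd z))"
  unfolding group_diff_def split_beta by (intro continuous_intros)+

lemma measurable_group_diff [measurable]: "(\<lambda>p. group_diff p q) \<in> borel_measurable borel" "(\<lambda>q. group_diff p q) \<in> borel_measurable borel"
  by (rule borel_measurable_continuous_onI[OF continuous_group_diff(1)]) (rule borel_measurable_continuous_onI[OF continuous_group_diff(2)])

text \<open>In either argument the group difference is a reflection or translation followed by a shear in \<open>w\<close>,
hence preserves Lebesgue measure.\<close>

lemma nn_integral_group_diff:
  fixes g :: "'n::finite st \<Rightarrow> ennreal"
  assumes g: "g \<in> borel_measurable borel"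
  shows "(\<integral>\<^sup>+p. g (group_diff p q) \<partial>lborel) = (\<integral>\<^sup>+q. g q \<partial>lborel)"
    and "(\<integral>\<^sup>+q. g (group_diff p q) \<partial>lborel) = (\<integral>\<^sup>+q. g q \<partial>lborel)"
proof -
  obtain s x' y' w' where q: "q = (s, x', y', w')" by (metis prod_cases4)
  have "(\<lambda>(x, y). - w' - 2 * (y \<bullet> x') + 2 * (x \<bullet> y')) \<in> borel_measurable borel"
    by (intro borel_measurable_continuous_onI) (auto simp: split_beta intro!: continuous_intros)
  from nn_integral_shear[OF g _ this, of 1 "-s" "-x'" "-y'"]
  show "(\<integral>\<^sup>+p. g (group_diff p q) \<partial>lborel) = (\<integral>\<^sup>+q. g q \<partial>lborel)"
    unfolding q group_diff_def by (simp add: split_beta algebra_simps)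
next
  obtain t x y w where p: "p = (t, x, y, w)" by (metis prod_cases4)
  have "(\<lambda>(x', y'). w - 2 * (y \<bullet> x') + 2 * (x \<bullet> y')) \<in> borel_measurable borel"
    by (intro borel_measurable_continuous_onI) (auto simp: split_beta intro!: continuous_intros)
  from nn_integral_shear[OF g _ this, of "-1" t x y]
  show "(\<integral>\<^sup>+q. g (group_diff p q) \<partial>lborel) = (\<integral>\<^sup>+q. g q \<partial>lborel)"
    unfolding p group_diff_def by (simp add: split_beta algebra_simps)
qed

lemma integral_group_diff:
  fixes g :: "'n::finite st \<Rightarrow> real"
  assumes g: "g \<in> borel_measurable borel"
  shows "(\<integral>p. g (group_diff p q) \<partial>lborel) = (\<integral>q. g q \<partial>lborel)" "(\<integral>q. g (group_diff p q) \<partial>lborel) = (\<integral>q. g q \<partial>lborel)"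
    "integrable lborel g \<Longrightarrow> integrable lborel (\<lambda>p. g (group_diff p q))" "integrable lborel g \<Longrightarrow> integrable lborel (\<lambda>q. g (group_diff p q))"
proof -
  have eq: "distr lborel borel T = (lborel :: 'n st measure)"
    if T: "T \<in> borel_measurable borel" and i: "\<And>g::'n st \<Rightarrow> ennreal. g \<in> borel_measurable borel \<Longrightarrow> (\<integral>\<^sup>+p. g (T p) \<partial>lborel) = (\<integral>\<^sup>+q. g q \<partial>lborel)" for T
  proof (rule measure_eqI)
    fix A assume A: "A \<in> sets (distr lborel borel T)"
    have "emeasure (distr lborel borel T) A = (\<integral>\<^sup>+p. indicator A p \<partial>distr lborel borel T)"
      using A by simp
    also have "\<dots> = (\<integral>\<^sup>+p. indicator A (T p) \<partial>lborel)"
      using A T by (intro nn_integral_distr) auto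
    also have "\<dots> = emeasure lborel A" using A by (subst i) auto
    finally show "emeasure (distr lborel borel T) A = emeasure lborel A" .
  qed auto
  have T: "(\<lambda>p. group_diff p q) \<in> lborel \<rightarrow>\<^sub>M borel" "(\<lambda>q. group_diff p q) \<in> lborel \<rightarrow>\<^sub>M borel" by measurable
  have 1: "distr lborel borel (\<lambda>p. group_diff p q) = lborel" by (rule eq) (auto simp: nn_integral_group_diff)
  have 2: "distr lborel borel (\<lambda>q. group_diff p q) = lborel" by (rule eq) (auto simp: nn_integral_group_diff)
  show "(\<integral>p. g (group_diff p q) \<partial>lborel) = (\<integral>q. g q \<partial>lborel)" using integral_distr[OF T(1) g] 1 by simp
  show "(\<integral>q. g (group_diff p q) \<partial>lborel) = (\<integral>q. g q \<partial>lborel)" using integral_distr[OF T(2) g] 2 by simp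
  show "integrable lborel g \<Longrightarrow> integrable lborel (\<lambda>p. g (group_diff p q))" using integrable_distr_eq[OF T(1) g] 1 by simp
  show "integrable lborel g \<Longrightarrow> integrable lborel (\<lambda>q. g (group_diff p q))" using integrable_distr_eq[OF T(2) g] 2 by simp
qed

lemma group_diff_close:
  fixes p q :: "'n::finite st"
  assumes "norm (group_diff p q) < e"
  shows "\<bar>fst p - fst q\<bar> < e" "norm (snd q - snd p) \<le> (3 + 4 * norm (snd p)) * e"
proof -
  obtain t x y w where p: "p = (t, x, y, w)" by (metis prod_cases4)
  obtain s x' y' w' where q: "q = (s, x', y', w')" by (metis prod_cases4)
  define om where "om = w - w' - 2 * (y \<bullet> x') + 2 * (x \<bullet> y')"
  have g: "group_diff p q = (t - s, x - x', y - y', om)" by (simp add: p q group_diff_def om_def)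
  have 1: "norm (t - s) \<le> norm (group_diff p q)" "norm (x - x', y - y', om) \<le> norm (group_diff p q)"
    unfolding g using norm_fst_le[of "t - s" "(x - x', y - y', om)"] norm_snd_le[of "(x - x', y - y', om)" "t - s"] by auto
  have 2: "norm (x - x') \<le> norm (group_diff p q)" "norm (y - y', om) \<le> norm (group_diff p q)"
    using 1(2) norm_fst_le[of "x - x'" "(y - y', om)"] norm_snd_le[of "(y - y', om)" "x - x'"] by auto
  have 3: "norm (y - y') \<le> norm (group_diff p q)" "\<bar>om\<bar> \<le> norm (group_diff p q)"
    using 2(2) norm_fst_le[of "y - y'" om] norm_snd_le[of om "y - y'"] by auto
  show "\<bar>fst p - fst q\<bar> < e" using 1 assms by (simp add: p q)
  have nx: "norm x \<le> norm (snd p)" "norm y \<le> norm (snd p)"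
    using norm_fst_le[of x "(y, w)"] norm_snd_le[of "(y, w)" x] norm_fst_le[of y w] by (auto simp: p)
  have e: "w - w' = om - 2 * (y \<bullet> (x - x')) + 2 * (x \<bullet> (y - y'))"
    by (simp add: om_def inner_diff_right inner_commute)
  have "\<bar>y \<bullet> (x - x')\<bar> \<le> norm (snd p) * e" 
    using Cauchy_Schwarz_ineq2[of y "x - x'"] mult_mono[OF nx(2), of "norm (x - x')" e] 2 assms by simp
  moreover have "\<bar>x \<bullet> (y - y')\<bar> \<le> norm (snd p) * e" 
    using Cauchy_Schwarz_ineq2[of x "y - y'"] mult_mono[OF nx(1), of "norm (y - y')" e] 3 assms by simp
  ultimately have "\<bar>w - w'\<bar> \<le> e + 4 * (norm (snd p) * e)"
    using e 3 assms by linarith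
  moreover have "norm (snd q - snd p) \<le> norm (x' - x) + (norm (y' - y) + norm (w' - w))"
    using norm_Pair_le[of "x' - x" "(y' - y, w' - w)"] norm_Pair_le[of "y' - y" "w' - w"] by (simp add: p q)
  ultimately show "norm (snd q - snd p) \<le> (3 + 4 * norm (snd p)) * e"
    using 2 3 assms by (simp add: norm_minus_commute algebra_simps)
qed

text \<open>On a region bounded away from the origin the potential \<open>a / n\<close> is uniformly continuous, so it varies
little over the support of a concentrated kernel.\<close>

lemma group_diff_close_uniform:
  assumes n: "0 < n0" and om: "0 < om"
  obtains e0 where "0 < e0"
    "\<And>p q::'n::finite st. n0 \<le> nn p \<Longrightarrow> nn p \<le> n1 \<Longrightarrow> norm (group_diff p q) < e0 \<Longrightarrow>
        n0 / 2 \<le> nn q \<and> nn q \<le> n1 + 1 \<and> \<bar>aa q / nn q - aa p / nn p\<bar> \<le> om"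
proof -
  have "bounded {\<xi>::'n heis. hn \<xi> \<le> n1}" using compact_hn_le compact_imp_bounded by blast
  then obtain R where R: "R > 0" "\<And>\<xi>::'n heis. hn \<xi> \<le> n1 \<Longrightarrow> norm \<xi> \<le> R" 
    by (metis bounded_pos mem_Collect_eq)
  let ?C = "cball (0::'n heis) (R + 1)"
  have "uniformly_continuous_on ?C hn"
    by (intro compact_uniformly_continuous continuous_hn) auto
  moreover have "0 < min 1 (n0 / 2)" using n by auto
  ultimately obtain d1 where d1: "d1 > 0" "\<And>\<xi> \<eta>. \<xi> \<in> ?C \<Longrightarrow> \<eta> \<in> ?C \<Longrightarrow> dist \<eta> \<xi> < d1 \<Longrightarrow> dist (hn \<eta>) (hn \<xi>) < min 1 (n0 / 2)"
    unfolding uniformly_continuous_on_def by meson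
  let ?D = "?C \<inter> {\<xi>. n0 / 2 \<le> hn \<xi>}"
  have "compact ?D" by (intro compact_Int_closed closed_Collect_le continuous_hn continuous_on_const) auto
  then have "uniformly_continuous_on ?D (\<lambda>\<xi>. hz \<xi> / hn \<xi>)"
    using n by (intro compact_uniformly_continuous continuous_intros continuous_hn continuous_hz) auto
  then obtain d2 where d2: "d2 > 0" "\<And>\<xi> \<eta>. \<xi> \<in> ?D \<Longrightarrow> \<eta> \<in> ?D \<Longrightarrow> dist \<eta> \<xi> < d2 \<Longrightarrow> dist (hz \<eta> / hn \<eta>) (hz \<xi> / hn \<xi>) < om"
    using om unfolding uniformly_continuous_on_def by meson
  define e0 where "e0 = min 1 (min d1 d2) / (2 * (3 + 4 * R))"
  show thesis
  proof
    show "0 < e0" using d1 d2 R by (simp add: e0_def)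
    fix p q :: "'n st"
    assume p: "n0 \<le> nn p" "nn p \<le> n1" and g: "norm (group_diff p q) < e0"
    have Rp: "norm (snd p) \<le> R" using R p by auto
    have "norm (snd q - snd p) \<le> (3 + 4 * norm (snd p)) * e0" by (rule group_diff_close(2)[OF g])
    also have "\<dots> \<le> (3 + 4 * R) * e0" using Rp \<open>0 < e0\<close> by (intro mult_right_mono) auto
    also have "\<dots> = min 1 (min d1 d2) / 2" using R by (simp add: e0_def field_simps)
    finally have "norm (snd q - snd p) \<le> min 1 (min d1 d2) / 2" .
    moreover have "min 1 (min d1 d2) / 2 < min 1 (min d1 d2)" using d1 d2 by auto
    ultimately have dq: "norm (snd q - snd p) < 1" "dist (snd q) (snd p) < d1" "dist (snd q) (snd p) < d2"
      by (auto simp: dist_norm)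
    have C: "snd p \<in> ?C" "snd q \<in> ?C"
      using Rp dq(1) norm_triangle_sub[of "snd q" "snd p"] by auto
    have "dist (nn q) (nn p) < min 1 (n0 / 2)" by (rule d1(2)[OF C dq(2)])
    then have "\<bar>nn q - nn p\<bar> < 1" "\<bar>nn q - nn p\<bar> < n0 / 2" by (auto simp: dist_real_def)
    then have nq: "n0 / 2 \<le> nn q" "nn q \<le> n1 + 1" using p by linarith+
    moreover have "dist (aa q / nn q) (aa p / nn p) < om"
      by (rule d2(2)[OF _ _ dq(3)]) (use C p nq n in auto)
    ultimately show "n0 / 2 \<le> nn q \<and> nn q \<le> n1 + 1 \<and> \<bar>aa q / nn q - aa p / nn p\<bar> \<le> om"
      by (simp add: dist_real_def)
  qed
qed

definition bump :: "real \<Rightarrow> 'n::finite st \<Rightarrow> real" where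
  "bump e z = max 0 (e\<^sup>2 - (norm z)\<^sup>2) ^ 4"

definition mollifier :: "real \<Rightarrow> 'n::finite st \<Rightarrow> real" where
  "mollifier e z = bump e z / (\<integral>z. bump e (z::'n st) \<partial>lborel)"

lemma continuous_bump: "continuous_on S (bump e)"
  unfolding bump_def by (intro continuous_intros)

lemma bump_support: fixes z :: "'n::finite st" shows "0 < e \<Longrightarrow> bump e z \<noteq> 0 \<Longrightarrow> norm z < e"
  by (auto simp: bump_def max_def split: if_splits intro: power2_less_imp_less)

lemma bump_integral: 
  assumes "0 < e"
  shows "integrable lborel (bump e :: 'n::finite st \<Rightarrow> real)" "0 < (\<integral>z. bump e (z::'n st) \<partial>lborel)"
proof -
  have "integrable lborel (\<lambda>z::'n st. indicator (cball 0 e) z *\<^sub>R bump e z)"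
    by (rule borel_integrable_compact) (auto intro: continuous_bump)
  moreover have "(\<lambda>z::'n st. indicator (cball 0 e) z *\<^sub>R bump e z) = bump e"
    using bump_support[OF assms] by (force simp: indicator_def)
  ultimately show i: "integrable lborel (bump e :: 'n st \<Rightarrow> real)" by simp
  have "(\<integral>z. bump e (z::'n st) \<partial>lborel) \<noteq> 0"
  proof
    assume "(\<integral>z. bump e (z::'n st) \<partial>lborel) = 0"
    then have "AE z::'n st in lborel. bump e z = 0"
      using integral_nonneg_eq_0_iff_AE[OF i AE_I2[of lborel "\<lambda>z. 0 \<le> bump e z"]] by (simp add: bump_def[abs_def])
    then have "AE z::'n st in lborel. z \<notin> ball 0 e"
    proof eventually_elim
      case (elim z)
      show ?case
      proof
        assume "z \<in> ball 0 e"
        then have "(norm z)\<^sup>2 < e\<^sup>2" by (intro power_strict_mono) auto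
        then show False using elim by (simp add: bump_def)
      qed
    qed
    then have "ball (0::'n st) e \<in> null_sets lborel"
      by (rule iffD2[OF AE_iff_null_sets, rotated]) simp
    then have "measure lborel (ball (0::'n st) e) = 0" by (rule measure_eq_0_null_sets)
    moreover have "0 < measure lborel (ball (0::'n st) e)"
      using content_ball_pos[OF assms] by blast
    ultimately show False by simp
  qed
  moreover have "0 \<le> (\<integral>z. bump e (z::'n st) \<partial>lborel)" by (rule integral_nonneg_AE) (auto simp: bump_def)
  ultimately show "0 < (\<integral>z. bump e (z::'n st) \<partial>lborel)" by simp
qed

lemma mollifier:
  assumes "0 < e"
  shows "0 \<le> mollifier e (z::'n::finite st)" "mollifier e (z::'n st) \<noteq> 0 \<Longrightarrow> norm z < e" "continuous_on S (mollifier e :: 'n st \<Rightarrow> real)"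
    "integrable lborel (mollifier e :: 'n st \<Rightarrow> real)" "(\<integral>z. mollifier e (z::'n st) \<partial>lborel) = 1"
    "(mollifier e :: 'n st \<Rightarrow> real) \<in> borel_measurable borel"
proof -
  show "0 \<le> mollifier e z" using bump_integral(2)[OF assms, where 'n='n] unfolding mollifier_def by (simp add: bump_def)
  show "mollifier e z \<noteq> 0 \<Longrightarrow> norm z < e" using bump_support[OF assms, of z] by (auto simp: mollifier_def)
  have c: "continuous_on S (mollifier e :: 'n st \<Rightarrow> real)" for S :: "'n st set" using bump_integral(2)[OF assms, where 'n='n]
    unfolding mollifier_def by (intro continuous_intros continuous_bump) auto
  then show "continuous_on S (mollifier e :: 'n st \<Rightarrow> real)" .
  show "integrable lborel (mollifier e :: 'n st \<Rightarrow> real)" unfolding mollifier_def using bump_integral(1)[OF assms, where 'n='n] by simp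
  show "(\<integral>z. mollifier e (z::'n st) \<partial>lborel) = 1" unfolding mollifier_def using bump_integral[OF assms, where 'n='n] by simp
  show "(mollifier e :: 'n st \<Rightarrow> real) \<in> borel_measurable borel" by (rule borel_measurable_continuous_onI[OF c])
qed

lemma Ck_mollifier: "Ck 3 UNIV (\<lambda>q. mollifier e (group_diff (p::'n::finite st) q))"
proof -
  obtain t x y w where p: "p = (t, x, y, w)" by (metis prod_cases4)
  have n: "(norm (group_diff p q))\<^sup>2 = (t - fst q)\<^sup>2 + (\<Sum>i\<in>UNIV. (x $ i - fst (snd q) $ i)\<^sup>2) + (\<Sum>i\<in>UNIV. (y $ i - fst (snd (snd q)) $ i)\<^sup>2)
     + (w - snd (snd (snd q)) - 2 * (\<Sum>i\<in>UNIV. y $ i * fst (snd q) $ i) + 2 * (\<Sum>i\<in>UNIV. x $ i * fst (snd (snd q)) $ i))\<^sup>2" for q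
    by (simp add: p group_diff_def split_beta norm_prod_def norm_vec_def L2_set_def sum_nonneg inner_vec_def)
  have "Ck 3 UNIV (\<lambda>q. (norm (group_diff p q))\<^sup>2)"
    unfolding n by (intro Ck_add Ck_diff Ck_mult Ck_sum Ck_power Ck_const Ck_coord_x Ck_coord_y Ck_coord_w Ck_coord_t open_UNIV)
  then have "Ck 3 UNIV (\<lambda>q. e\<^sup>2 - (norm (group_diff p q))\<^sup>2)"
    by (rule Ck_diff[OF open_UNIV Ck_const])
  then have "Ck 3 UNIV (\<lambda>q. max 0 (e\<^sup>2 - (norm (group_diff p q))\<^sup>2) ^ 4)"
    by (rule Ck_comp[OF open_UNIV _ open_UNIV Ck_pospart_power[of 3 4]]) auto
  then show ?thesis unfolding mollifier_def bump_def
    using Ck_cmult[of UNIV 3 _ "inverse (\<integral>z. max 0 (e\<^sup>2 - (norm (z::'n st))\<^sup>2) ^ 4 \<partial>lborel)"]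
    by (simp add: divide_inverse mult.commute)
qed

definition region :: "real \<Rightarrow> real \<Rightarrow> real \<Rightarrow> 'n::finite st set" where
  "region S n0 n1 = {q. fst q \<le> S \<and> n0 \<le> nn q \<and> nn q \<le> n1}"

lemma closed_region: "closed (region S n0 n1 :: 'n::finite st set)"
  unfolding region_def by (intro closed_Collect_conj closed_Collect_le continuous_nn continuous_on_const continuous_on_fst continuous_on_id)

lemma region_sets [measurable]: "region S n0 n1 \<in> sets (borel :: 'n::finite st measure)"
  using closed_region by (rule borel_closed)

lemma compact_slab: "compact ({a..b::real} \<times> {\<xi>::'n::finite heis. hn \<xi> \<le> R})"
  by (intro compact_Times compact_hn_le compact_Icc)

text \<open>Integrability against admissible functions yields integrability over regions that avoid the origin.\<close>

lemma region_cutoff: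
  assumes "0 < n0" "n0 < n1" "S < T"
  obtains F :: "'n::finite st \<Rightarrow> real" where "admissible T F" "\<And>q. q \<in> region S n0 n1 \<Longrightarrow> 1 \<le> F q"
proof -
  define S' where "S' = (S + T) / 2"
  have S': "S < S'" "S' < T" using assms by (auto simp: S'_def)
  let ?q = "\<lambda>x::real. max 0 x ^ 4"
  define c where "c = 1 / (?q (S' - S) * (?q (n0 / 2) * ?q n1))"
  have c: "c > 0" using assms S' by (simp add: c_def)
  define F :: "'n st \<Rightarrow> real" where "F q = c * (?q (S' - fst q) * (?q (nn q - n0 / 2) * ?q (2 * n1 - nn q)))" for q
  have Cn: "Ck 3 UNIV (nn :: 'n st \<Rightarrow> real)" using cyl_n[where 'n='n] by (simp add: cyl_def)
  have P: "Ck 3 UNIV (\<lambda>q. ?q (f q))" if "Ck 3 UNIV f" for f :: "'n st \<Rightarrow> real"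
    by (rule Ck_comp[OF open_UNIV that open_UNIV Ck_pospart_power[of 3 4]]) auto
  have "Ck 3 UNIV (\<lambda>q::'n st. S' - fst q)" by (rule Ck_diff[OF open_UNIV Ck_const Ck_coord_t])
  moreover have "Ck 3 UNIV (\<lambda>q::'n st. nn q - n0 / 2)" by (rule Ck_diff[OF open_UNIV Cn Ck_const])
  moreover have "Ck 3 UNIV (\<lambda>q::'n st. 2 * n1 - nn q)" by (rule Ck_diff[OF open_UNIV Ck_const Cn])
  ultimately have CF: "Ck 3 UNIV F"
    unfolding F_def[abs_def] by (intro Ck_cmult open_UNIV Ck_mult[OF open_UNIV P Ck_mult[OF open_UNIV P P]])
  have "admissible T F" unfolding admissible_def
  proof (intro conjI)
    show "\<exists>n0>0. \<forall>p. nn p < n0 \<longrightarrow> F p = 0"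
      using assms by (intro exI[of _ "n0 / 2"]) (auto simp: F_def max_def)
    show "\<exists>S<T. \<exists>R. \<forall>p. 0 \<le> fst p \<longrightarrow> F p \<noteq> 0 \<longrightarrow> fst p \<le> S \<and> nn p \<le> R"
      using S' by (intro exI[of _ S'] conjI exI[of _ "2 * n1"]) (auto simp: F_def max_def split: if_splits)
  qed (use CF c in \<open>auto simp: F_def\<close>)
  moreover have "1 \<le> F q" if q: "q \<in> region S n0 n1" for q
  proof -
    have "?q (S' - S) * (?q (n0 / 2) * ?q n1) \<le> ?q (S' - fst q) * (?q (nn q - n0 / 2) * ?q (2 * n1 - nn q))"
      using q by (intro mult_mono power_mono) (use assms in \<open>auto simp: region_def max_def\<close>)
    moreover have "?q (S' - S) * (?q (n0 / 2) * ?q n1) > 0" using assms S' by simp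
    ultimately show ?thesis by (simp add: F_def c_def)
  qed
  ultimately show thesis using that by blast
qed

text \<open>The horizontal fields are constant along their own straight lines, so derivatives along them are
one-dimensional derivatives.\<close>

lemma hv_shift: "hv j (q + s *\<^sub>R hv j q) = hv j q"
  by (cases q; cases j) auto

lemma line_derivative:
  assumes "F differentiable (at (q + s *\<^sub>R hv j q))"
  shows "((\<lambda>s. F (q + s *\<^sub>R hv j q)) has_real_derivative VF j F (q + s *\<^sub>R hv j q)) (at s)"
proof -
  have "(F \<circ> (\<lambda>s. q + s *\<^sub>R hv j q) has_derivative (\<lambda>h. partial h F (q + s *\<^sub>R hv j q)) \<circ> (\<lambda>h. h *\<^sub>R hv j q)) (at s)"
    by (intro diff_chain_at partial_works assms) (auto intro!: derivative_eq_intros)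
  moreover have "partial (h *\<^sub>R hv j q) F (q + s *\<^sub>R hv j q) = VF j F (q + s *\<^sub>R hv j q) * h" for h
    using linear_cmul[OF linear_frechet_derivative[OF assms], of h "hv j q"]
    by (simp add: partial_def VF_def hv_shift)
  ultimately show ?thesis by (simp add: o_def has_field_derivative_def)
qed

lemma second_difference:
  fixes f :: "real \<Rightarrow> real"
  assumes "0 < h" "\<And>s. \<bar>s\<bar> \<le> h \<Longrightarrow> (f has_real_derivative f' s) (at s)"
    "\<And>s. \<bar>s\<bar> \<le> h \<Longrightarrow> (f' has_real_derivative f'' s) (at s)"
  shows "\<exists>a b. \<bar>a\<bar> \<le> h \<and> \<bar>b\<bar> \<le> h \<and> (f h + f (- h) - 2 * f 0) / h\<^sup>2 = (f'' a + f'' b) / 2"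
proof -
  let ?D = "\<lambda>m::nat. if m = 0 then f else if m = 1 then f' else f''"
  have D: "\<forall>m t. m < 2 \<and> - h \<le> t \<and> t \<le> h \<longrightarrow> ((?D m) has_real_derivative ?D (Suc m) t) (at t)"
    using assms(2,3) by (auto simp: less_2_cases_iff abs_le_iff)
  obtain a where a: "0 < a" "a < h" "f h = (\<Sum>m<2. ?D m 0 / fact m * (h - 0) ^ m) + ?D 2 a / fact 2 * (h - 0)\<^sup>2"
    using Taylor[of 2 ?D f "-h" h 0 h] D assms(1) by auto
  obtain b where b: "- h < b" "b < 0" "f (- h) = (\<Sum>m<2. ?D m 0 / fact m * (- h - 0) ^ m) + ?D 2 b / fact 2 * (- h - 0)\<^sup>2"
    using Taylor[of 2 ?D f "-h" h 0 "-h"] D assms(1) by auto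
  have "f h + f (- h) - 2 * f 0 = (f'' a + f'' b) / 2 * h\<^sup>2"
    using a(3) b(3) by (simp add: numeral_2_eq_2 algebra_simps)
  then show ?thesis using a b assms(1) by (intro exI[of _ a] exI[of _ b]) (auto simp: field_simps)
qed

lemma first_difference:
  fixes f :: "real \<Rightarrow> real"
  assumes "0 < h" "\<And>s. \<bar>s\<bar> \<le> h \<Longrightarrow> (f has_real_derivative f' s) (at s)"
  shows "\<exists>a. \<bar>a\<bar> \<le> h \<and> (f 0 - f (- h)) / h = f' a" "\<exists>a. \<bar>a\<bar> \<le> h \<and> (f 0 - f h) / h = - f' a"
proof -
  have c: "continuous_on {- h..h} f"
    by (rule DERIV_continuous_on[of _ f f', OF has_field_derivative_at_within[OF assms(2)]]) auto
  have d: "x > - h \<Longrightarrow> x < h \<Longrightarrow> f differentiable (at x)" for x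
    using assms(2)[of x] real_differentiable_def by (auto simp: abs_le_iff)
  obtain l z where z: "- h < z" "z < 0" "(f has_real_derivative l) (at z)" "f 0 - f (- h) = (0 - - h) * l"
    using MVT[of "-h" 0 f] assms(1) d continuous_on_subset[OF c, of "{-h..0}"] by auto
  then have "l = f' z" using assms(2)[of z] DERIV_unique by auto
  then show "\<exists>a. \<bar>a\<bar> \<le> h \<and> (f 0 - f (- h)) / h = f' a" using z assms(1) by (intro exI[of _ z]) auto
  obtain l z where z: "0 < z" "z < h" "(f has_real_derivative l) (at z)" "f h - f 0 = (h - 0) * l"
    using MVT[of 0 h f] assms(1) d continuous_on_subset[OF c, of "{0..h}"] by auto
  then have "l = f' z" using assms(2)[of z] DERIV_unique by auto
  moreover have "f 0 - f h = - (h * l)" using z(4) by simp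
  ultimately show "\<exists>a. \<bar>a\<bar> \<le> h \<and> (f 0 - f h) / h = - f' a" using z assms(1) by (intro exI[of _ z]) auto
qed

lemma time_line_derivative:
  fixes q :: "'n::finite st"
  assumes "F differentiable (at (q + (s, 0)))"
  shows "((\<lambda>s. F (q + (s, 0))) has_real_derivative dt F (q + (s, 0))) (at s)"
proof -
  have "(F \<circ> (\<lambda>s. q + (s, 0)) has_derivative (\<lambda>h. partial h F (q + (s, 0))) \<circ> (\<lambda>h. (h, 0))) (at s)"
    by (intro diff_chain_at partial_works assms) (auto intro!: derivative_eq_intros)
  moreover have "partial (h, 0) F (q + (s, 0)) = dt F (q + (s, 0)) * h" for h
    using linear_cmul[OF linear_frechet_derivative[OF assms], of h "(1, 0)"]
    by (simp add: partial_def dt_def)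
  ultimately show ?thesis by (simp add: o_def has_field_derivative_def)
qed

text \<open>Difference quotients are used instead of derivatives because the mollification of a merely locally
integrable function is compared with a barrier at a single touching point.\<close>

lemma difference_limits:
  fixes q :: "'n::finite st"
  assumes U: "open V" "q \<in> V" and F: "Ck 2 V F" and h: "h \<longlonglongrightarrow> 0" "\<And>k. 0 < h k"
  shows "(\<lambda>k. (F (q + h k *\<^sub>R hv j q) + F (q - h k *\<^sub>R hv j q) - 2 * F q) / (h k)\<^sup>2) \<longlonglongrightarrow> VF j (VF j F) q"
    and "(\<lambda>k. (F q - F (q - (h k, 0))) / h k) \<longlonglongrightarrow> dt F q"
    and "(\<lambda>k. (F q - F (q + (h k, 0))) / h k) \<longlonglongrightarrow> - dt F q"
proof -
  note d = Ck2D[OF U(1) F]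
  have line: "\<exists>\<delta>>0. \<forall>s. \<bar>s\<bar> \<le> \<delta> \<longrightarrow> q + s *\<^sub>R v \<in> V" for v
  proof -
    have "open ((\<lambda>s. q + s *\<^sub>R v) -` V)" by (intro open_vimage U continuous_intros)
    moreover have "0 \<in> (\<lambda>s. q + s *\<^sub>R v) -` V" using U by simp
    ultimately obtain e where e: "e > 0" "cball 0 e \<subseteq> (\<lambda>s. q + s *\<^sub>R v) -` V"
      unfolding open_contains_cball by blast
    have "q + s *\<^sub>R v \<in> V" if "\<bar>s\<bar> \<le> e" for s
      using subsetD[OF e(2), of s] that by simp
    then show ?thesis using e(1) by blast
  qed
  have small: "\<forall>\<^sub>F k in sequentially. h k < \<delta>" if "0 < \<delta>" for \<delta>
    using order_tendstoD(2)[OF h(1) that] .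
  have sq: "\<bar>a k\<bar> \<le> h k \<Longrightarrow> \<bar>- a k\<bar> \<le> h k" for a k by simp
  have squeeze: "a \<longlonglongrightarrow> 0" if "\<forall>\<^sub>F k in sequentially. \<bar>a k\<bar> \<le> h k" for a :: "nat \<Rightarrow> real"
    by (rule Lim_null_comparison[OF _ h(1)]) (use that in simp)
  show "(\<lambda>k. (F (q + h k *\<^sub>R hv j q) + F (q - h k *\<^sub>R hv j q) - 2 * F q) / (h k)\<^sup>2) \<longlonglongrightarrow> VF j (VF j F) q"
  proof -
    define f2 where "f2 s = VF j (VF j F) (q + s *\<^sub>R hv j q)" for s
    obtain \<delta> where \<delta>: "\<delta> > 0" "\<And>s. \<bar>s\<bar> \<le> \<delta> \<Longrightarrow> q + s *\<^sub>R hv j q \<in> V" using line by blast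
    have "\<exists>a b. \<bar>a\<bar> \<le> h k \<and> \<bar>b\<bar> \<le> h k \<and> (F (q + h k *\<^sub>R hv j q) + F (q - h k *\<^sub>R hv j q) - 2 * F q) / (h k)\<^sup>2 = (f2 a + f2 b) / 2"
      if "h k < \<delta>" for k
      using second_difference[OF h(2), of k "\<lambda>s. F (q + s *\<^sub>R hv j q)" "\<lambda>s. VF j F (q + s *\<^sub>R hv j q)" f2]
        line_derivative[OF d(1)] line_derivative[OF d(2)] \<delta>(2) that unfolding f2_def by auto
    then obtain a b where ab: "\<And>k. h k < \<delta> \<Longrightarrow> \<bar>a k\<bar> \<le> h k \<and> \<bar>b k\<bar> \<le> h k \<and> (F (q + h k *\<^sub>R hv j q) + F (q - h k *\<^sub>R hv j q) - 2 * F q) / (h k)\<^sup>2 = (f2 (a k) + f2 (b k)) / 2"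
      by metis
    have "Ck 0 V (VF j (VF j F))" using F by (intro Ck_VF U) (simp add: numeral_2_eq_2)
    then have "continuous_on V (VF j (VF j F))" by (rule Ck_imp_continuous_on)
    then have "isCont (VF j (VF j F)) q" using U continuous_on_eq_continuous_at by blast
    then have "isCont (VF j (VF j F)) (q + 0 *\<^sub>R hv j q)" by simp
    moreover have "isCont (\<lambda>s. q + s *\<^sub>R hv j q) 0" by (intro continuous_intros)
    ultimately have "isCont f2 0" unfolding f2_def by (rule isCont_o2[rotated])
    moreover have "a \<longlonglongrightarrow> 0" "b \<longlonglongrightarrow> 0"
      by (rule squeeze, use small[OF \<delta>(1)] ab in \<open>auto elim!: eventually_mono\<close>)+
    ultimately have "(\<lambda>k. f2 (a k)) \<longlonglongrightarrow> f2 0" "(\<lambda>k. f2 (b k)) \<longlonglongrightarrow> f2 0"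
      by (blast intro: isCont_tendsto_compose)+
    then have "(\<lambda>k. (f2 (a k) + f2 (b k)) / 2) \<longlonglongrightarrow> (f2 0 + f2 0) / 2" by (intro tendsto_intros) auto
    then have "(\<lambda>k. (f2 (a k) + f2 (b k)) / 2) \<longlonglongrightarrow> VF j (VF j F) q" by (simp add: f2_def)
    then show ?thesis
      by (rule Lim_transform_eventually) (use small[OF \<delta>(1)] ab in \<open>auto elim!: eventually_mono\<close>)
  qed
  obtain \<delta> where \<delta>: "\<delta> > 0" "\<And>s. \<bar>s\<bar> \<le> \<delta> \<Longrightarrow> q + (s, 0) \<in> V" using line[of "(1, 0)"] by auto
  define f1 where "f1 s = dt F (q + (s, 0))" for s
  have shift: "q - (x, 0) = q + (- x, 0)" for x :: real by (cases q) simp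
  have e: "(\<exists>a. \<bar>a\<bar> \<le> h k \<and> (F q - F (q - (h k, 0))) / h k = f1 a) \<and> (\<exists>a. \<bar>a\<bar> \<le> h k \<and> (F q - F (q + (h k, 0))) / h k = - f1 a)"
    if "h k < \<delta>" for k
    using first_difference[OF h(2), of k "\<lambda>s. F (q + (s, 0))" f1]
      time_line_derivative[OF d(1)] \<delta>(2) that unfolding f1_def by (auto simp: zero_prod_def[symmetric] shift)
  obtain a where a: "\<And>k. h k < \<delta> \<Longrightarrow> \<bar>a k\<bar> \<le> h k \<and> (F q - F (q - (h k, 0))) / h k = f1 (a k)"
    using e by metis
  obtain b where b: "\<And>k. h k < \<delta> \<Longrightarrow> \<bar>b k\<bar> \<le> h k \<and> (F q - F (q + (h k, 0))) / h k = - f1 (b k)"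
    using e by metis
  have "Ck 1 V (dt F)" using F by (intro Ck_dt Ck_3_Suc)
  then have "continuous_on V (dt F)" by (rule Ck_imp_continuous_on)
  then have "isCont (dt F) (q + (0, 0))" using U continuous_on_eq_continuous_at by (metis add.right_neutral zero_prod_def)
  moreover have "isCont (\<lambda>s. q + (s, 0)) 0" by (intro continuous_intros)
  ultimately have "isCont f1 0" unfolding f1_def by (rule isCont_o2[rotated])
  moreover have "a \<longlonglongrightarrow> 0" "b \<longlonglongrightarrow> 0"
    by (rule squeeze, use small[OF \<delta>(1)] a b in \<open>auto elim!: eventually_mono\<close>)+
  ultimately have "(\<lambda>k. f1 (a k)) \<longlonglongrightarrow> f1 0" "(\<lambda>k. f1 (b k)) \<longlonglongrightarrow> f1 0"
    by (blast intro: isCont_tendsto_compose)+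
  then have f1: "(\<lambda>k. f1 (a k)) \<longlonglongrightarrow> dt F q" "(\<lambda>k. - f1 (b k)) \<longlonglongrightarrow> - dt F q"
    by (auto simp: f1_def zero_prod_def[symmetric] intro: tendsto_minus)
  show "(\<lambda>k. (F q - F (q - (h k, 0))) / h k) \<longlonglongrightarrow> dt F q"
    by (rule Lim_transform_eventually[OF f1(1)]) (use small[OF \<delta>(1)] a in \<open>auto elim!: eventually_mono\<close>)
  show "(\<lambda>k. (F q - F (q + (h k, 0))) / h k) \<longlonglongrightarrow> - dt F q"
    by (rule Lim_transform_eventually[OF f1(2)]) (use small[OF \<delta>(1)] b in \<open>auto elim!: eventually_mono\<close>)
qed

lemma difference_bounds:
  fixes F :: "'n::finite st \<Rightarrow> real"
  assumes F: "Ck 2 UNIV F" and C: "\<And>q. \<bar>dt F q\<bar> \<le> C" "\<And>j q. \<bar>VF j (VF j F) q\<bar> \<le> C" and h: "0 < h"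
  shows "\<bar>(F (q + h *\<^sub>R hv j q) + F (q - h *\<^sub>R hv j q) - 2 * F q) / h\<^sup>2\<bar> \<le> C"
    and "\<bar>(F q - F (q + (h, 0))) / h\<bar> \<le> C"
proof -
  note d = Ck2D[OF open_UNIV F UNIV_I]
  show "\<bar>(F (q + h *\<^sub>R hv j q) + F (q - h *\<^sub>R hv j q) - 2 * F q) / h\<^sup>2\<bar> \<le> C"
  proof -
    obtain a b where e: "(F (q + h *\<^sub>R hv j q) + F (q - h *\<^sub>R hv j q) - 2 * F q) / h\<^sup>2
       = (VF j (VF j F) (q + a *\<^sub>R hv j q) + VF j (VF j F) (q + b *\<^sub>R hv j q)) / 2"
      using second_difference[OF h, of "\<lambda>s. F (q + s *\<^sub>R hv j q)" "\<lambda>s. VF j F (q + s *\<^sub>R hv j q)" "\<lambda>s. VF j (VF j F) (q + s *\<^sub>R hv j q)"]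
        line_derivative[OF d(1)] line_derivative[OF d(2)] by auto
    show ?thesis unfolding e using C(2)[of j "q + a *\<^sub>R hv j q"] C(2)[of j "q + b *\<^sub>R hv j q"]
      by (auto simp: abs_le_iff field_simps)
  qed
  obtain a where e: "(F q - F (q + (h, 0))) / h = - dt F (q + (a, 0))"
    using first_difference(2)[OF h, of "\<lambda>s. F (q + (s, 0))" "\<lambda>s. dt F (q + (s, 0))"] time_line_derivative[OF d(1)]
    by (auto simp: zero_prod_def[symmetric])
  show "\<bar>(F q - F (q + (h, 0))) / h\<bar> \<le> C" unfolding e using C(1)[of "q + (a, 0)"] by simp
qed

lemma compact_support_bounded:
  fixes H :: "'n::finite st \<Rightarrow> real"
  assumes "continuous_on UNIV H" "\<And>q. q \<notin> {a..b} \<times> {\<xi>. hn \<xi> \<le> R} \<Longrightarrow> H q = 0"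
  obtains C where "0 < C" "\<And>q. \<bar>H q\<bar> \<le> C"
proof -
  have "bounded (H ` ({a..b} \<times> {\<xi>. hn \<xi> \<le> R}))"
    by (intro compact_imp_bounded compact_continuous_image compact_slab continuous_on_subset[OF assms(1)]) auto
  then obtain C where C: "0 < C" "\<And>q. q \<in> {a..b} \<times> {\<xi>. hn \<xi> \<le> R} \<Longrightarrow> \<bar>H q\<bar> \<le> C"
    by (auto simp: bounded_pos)
  show thesis
  proof (rule that[OF C(1)])
    show "\<bar>H q\<bar> \<le> C" for q
      using C assms(2)[of q] by (cases "q \<in> {a..b} \<times> {\<xi>. hn \<xi> \<le> R}") auto
  qed
qed

lemma Ck_derivs_bounded:
  fixes F :: "'n::finite st \<Rightarrow> real"
  assumes F: "Ck 2 UNIV F" and s: "\<And>q. q \<notin> {a..b} \<times> {\<xi>. hn \<xi> \<le> R} \<Longrightarrow> F q = 0"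
  obtains C where "0 < C" "\<And>q. \<bar>dt F q\<bar> \<le> C" "\<And>j q. \<bar>VF j (VF j F) q\<bar> \<le> C"
proof -
  let ?A = "{a..b} \<times> {\<xi>::'n heis. hn \<xi> \<le> R}"
  have o: "open (- ?A)" using compact_slab compact_imp_closed by blast
  have 1: "dt F q = 0" "VF j F q = 0" if "q \<notin> ?A" for q j
    using hardy_op_zero(1,2)[OF o, of q F] s that by auto
  have 2: "VF j (VF j F) q = 0" if "q \<notin> ?A" for q j
    using hardy_op_zero(2)[OF o, of q "VF j F"] 1 that by auto
  have c: "continuous_on UNIV (dt F)" "continuous_on UNIV (VF j (VF j F))" for j
  proof -
    have "Ck 1 UNIV (dt F)" using F by (intro Ck_dt Ck_3_Suc)
    then show "continuous_on UNIV (dt F)" by (rule Ck_imp_continuous_on)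
    have "Ck 0 UNIV (VF j (VF j F))" using F by (intro Ck_VF open_UNIV) (simp add: numeral_2_eq_2)
    then show "continuous_on UNIV (VF j (VF j F))" by (rule Ck_imp_continuous_on)
  qed
  obtain C0 where C0: "0 < C0" "\<And>q. \<bar>dt F q\<bar> \<le> C0" using compact_support_bounded[OF c(1) 1(1)] by blast
  have "\<exists>C. \<forall>q. \<bar>VF j (VF j F) q\<bar> \<le> C" for j using compact_support_bounded[OF c(2) 2] by metis
  then obtain D where D: "\<And>j q. \<bar>VF j (VF j F) q\<bar> \<le> D j" by metis
  show thesis
  proof
    show "0 < C0 + (\<Sum>j\<in>UNIV. \<bar>D j\<bar>)" using C0(1) by (intro add_pos_nonneg sum_nonneg) auto
    show "\<bar>dt F q\<bar> \<le> C0 + (\<Sum>j\<in>UNIV. \<bar>D j\<bar>)" for q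
    proof -
      have "0 \<le> (\<Sum>j\<in>UNIV. \<bar>D j\<bar>)" by (intro sum_nonneg) auto
      then show ?thesis using C0(2)[of q] by linarith
    qed
    show "\<bar>VF j (VF j F) q\<bar> \<le> C0 + (\<Sum>j\<in>UNIV. \<bar>D j\<bar>)" for j q
    proof -
      have "\<bar>D j\<bar> \<le> (\<Sum>j\<in>UNIV. \<bar>D j\<bar>)" by (intro member_le_sum) auto
      then show ?thesis using D[of j q] C0(1) by linarith
    qed
  qed
qed

section \<open>Supersolutions and their mollification\<close>

text \<open>The part of the weak identity that survives when the nonnegative data terms are dropped. Here
\<open>2 / (p - 1) < \<mu>\<close> is the hypothesis \<open>p > (\<mu> + 2) / \<mu>\<close>.\<close>

locale heis_super =
  fixes lam \<mu> p T :: real and U :: "'n::finite st \<Rightarrow> real"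
  assumes lam: "lam = \<mu> * (2 * real CARD('n) - \<mu>)" and mu: "0 < \<mu>" "\<mu> < real CARD('n)"
    and p: "1 < p" "2 / (p - 1) < \<mu>" and T: "0 < T"
    and U_meas: "U \<in> borel_measurable borel"
    and U_supp: "\<And>q. fst q \<notin> {0<..<T} \<Longrightarrow> U q = 0"
    and int_hardy_op: "\<And>F. admissible T F \<Longrightarrow> integrable lborel (\<lambda>q. U q * hardy_op lam F q)"
    and int_pow: "\<And>F. admissible T F \<Longrightarrow> integrable lborel (\<lambda>q. \<bar>U q\<bar> powr p * F q)"
    and super: "\<And>F. admissible T F \<Longrightarrow> (\<integral>q. \<bar>U q\<bar> powr p * F q \<partial>lborel) \<le> - (\<integral>q. U q * hardy_op lam F q \<partial>lborel)"
begin

lemma lam_pos: "0 < lam" "lam < (real CARD('n))\<^sup>2"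
proof -
  show "0 < lam" using lam mu by auto
  have "0 < (real CARD('n) - \<mu>)\<^sup>2" using mu by simp
  then show "lam < (real CARD('n))\<^sup>2" unfolding lam by (simp add: power2_eq_square algebra_simps)
qed

lemma pow_integrable:
  assumes "0 < n0" "n0 < n1" "S < T"
  shows "integrable lborel (\<lambda>q. \<bar>U q\<bar> powr p * indicator (region S n0 n1) q)"
proof -
  obtain F :: "'n st \<Rightarrow> real" where F: "admissible T F" "\<And>q. q \<in> region S n0 n1 \<Longrightarrow> 1 \<le> F q" using region_cutoff[OF assms] by blast
  show ?thesis
  proof (rule Bochner_Integration.integrable_bound[OF int_pow[OF F(1)]])
    show "(\<lambda>q. \<bar>U q\<bar> powr p * indicator (region S n0 n1) q) \<in> borel_measurable lborel"
      using U_meas by measurable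
    show "AE q in lborel. norm (\<bar>U q\<bar> powr p * indicator (region S n0 n1) q) \<le> norm (\<bar>U q\<bar> powr p * F q)"
    proof (rule AE_I2)
      fix q
      have "indicator (region S n0 n1) q \<le> F q"
        using F(2)[of q] F(1) by (cases "q \<in> region S n0 n1") (auto simp: admissible_def)
      then have "\<bar>U q\<bar> powr p * indicator (region S n0 n1) q \<le> \<bar>U q\<bar> powr p * F q"
        by (intro mult_left_mono) auto
      then show "norm (\<bar>U q\<bar> powr p * indicator (region S n0 n1) q) \<le> norm (\<bar>U q\<bar> powr p * F q)"
        unfolding real_norm_def using F(1) by (subst (1 2) abs_of_nonneg) (auto simp: admissible_def)
    qed
  qed
qed

lemma le_powr_add_1: "\<bar>x\<bar> \<le> \<bar>x\<bar> powr p + 1" for x :: real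
proof (cases "\<bar>x\<bar> \<le> 1")
  case False
  then have "\<bar>x\<bar> powr 1 \<le> \<bar>x\<bar> powr p" using p by (intro powr_mono) auto
  then show ?thesis using False by simp
next
  case True
  then show ?thesis using powr_ge_zero[of "\<bar>x\<bar>" p] by linarith
qed

lemma finite_slab: "emeasure lborel ({0..S::real} \<times> {\<xi>::'n heis. hn \<xi> \<le> R}) < \<infinity>"
  by (rule emeasure_compact_finite[OF compact_slab])

lemma U_integrable:
  assumes "0 < n0" "n0 < n1" "S < T"
  shows "integrable lborel (\<lambda>q. U q * indicator (region S n0 n1) q)"
proof (rule Bochner_Integration.integrable_bound)
  let ?A = "{0..S} \<times> {\<xi>::'n heis. hn \<xi> \<le> n1}"
  have A: "?A \<in> sets lborel" unfolding sets_lborel by (intro borel_closed compact_imp_closed compact_slab)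
  show "integrable lborel (\<lambda>q. \<bar>U q\<bar> powr p * indicator (region S n0 n1) q + indicator ?A q)"
    using finite_slab A by (intro Bochner_Integration.integrable_add pow_integrable assms integrable_real_indicator) auto
  show "(\<lambda>q. U q * indicator (region S n0 n1) q) \<in> borel_measurable lborel" using U_meas by measurable
  show "AE q in lborel. norm (U q * indicator (region S n0 n1) q) \<le> norm (\<bar>U q\<bar> powr p * indicator (region S n0 n1) q + indicator ?A q)"
  proof (rule AE_I2)
    fix q
    show "norm (U q * indicator (region S n0 n1) q) \<le> norm (\<bar>U q\<bar> powr p * indicator (region S n0 n1) q + indicator ?A q)"
    proof (cases "q \<in> region S n0 n1 \<and> 0 < fst q")
      case True
      then have "q \<in> ?A" by (cases q) (auto simp: region_def)
      then show ?thesis using True le_powr_add_1[of "U q"] by simp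
    next
      case False
      then have "U q * indicator (region S n0 n1) q = 0" using U_supp[of q] by auto
      then have "norm (U q * indicator (region S n0 n1) q) = 0" by (simp only: norm_zero)
      then show ?thesis by (metis norm_ge_zero)
    qed
  qed
qed

lemma U_mult_bound:
  assumes "\<And>q. 0 < fst q \<Longrightarrow> \<bar>G q\<bar> \<le> C * indicator (region S n0 n1) q"
  shows "norm (U q * G q) \<le> C * norm (U q * indicator (region S n0 n1) q)"
proof (cases "0 < fst q")
  case True
  then have "\<bar>U q\<bar> * \<bar>G q\<bar> \<le> \<bar>U q\<bar> * (C * indicator (region S n0 n1) q)"
    by (intro mult_left_mono assms) auto
  then show ?thesis by (simp add: abs_mult mult_ac)
qed (use U_supp[of q] in auto)

lemma U_mult_integrable:
  assumes "0 < n0" "n0 < n1" "S < T" "G \<in> borel_measurable borel"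
    "\<And>q. 0 < fst q \<Longrightarrow> \<bar>G q\<bar> \<le> C * indicator (region S n0 n1) q"
  shows "integrable lborel (\<lambda>q. U q * G q)"
proof (rule Bochner_Integration.integrable_bound)
  show "integrable lborel (\<lambda>q. C * norm (U q * indicator (region S n0 n1) q))"
    by (intro integrable_mult_right integrable_norm U_integrable assms)
  show "(\<lambda>q. U q * G q) \<in> borel_measurable lborel" using U_meas assms(4) by measurable
  show "AE q in lborel. norm (U q * G q) \<le> norm (C * norm (U q * indicator (region S n0 n1) q))"
    using U_mult_bound[OF assms(5)] by (intro AE_I2) (metis abs_ge_self order_trans real_norm_def)
qed

lemma U_dominated:
  assumes "0 < n0" "n0 < n1" "S < T" "\<And>k. G k \<in> borel_measurable borel" "H \<in> borel_measurable borel"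
    "\<forall>\<^sub>F k in sequentially. \<forall>q. 0 < fst q \<longrightarrow> \<bar>G k q\<bar> \<le> C * indicator (region S n0 n1) q"
    "\<And>q. 0 < fst q \<Longrightarrow> (\<lambda>k. G k q) \<longlonglongrightarrow> H q"
  shows "(\<lambda>k. \<integral>q. U q * G k q \<partial>lborel) \<longlonglongrightarrow> (\<integral>q. U q * H q \<partial>lborel)"
proof -
  obtain k0 where k0: "\<And>k q. k \<ge> k0 \<Longrightarrow> 0 < fst q \<Longrightarrow> \<bar>G k q\<bar> \<le> C * indicator (region S n0 n1) q"
    using assms(6) by (auto simp: eventually_sequentially)
  have "(\<lambda>k. \<integral>q. U q * G (k + k0) q \<partial>lborel) \<longlonglongrightarrow> (\<integral>q. U q * H q \<partial>lborel)"
  proof (rule integral_dominated_convergence)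
    show "integrable lborel (\<lambda>q. C * norm (U q * indicator (region S n0 n1) q))"
      by (intro integrable_mult_right integrable_norm U_integrable assms)
    show "(\<lambda>q. U q * H q) \<in> borel_measurable lborel" using U_meas assms(5) by measurable
    show "(\<lambda>q. U q * G (k + k0) q) \<in> borel_measurable lborel" for k using U_meas assms(4) by measurable
    show "AE q in lborel. norm (U q * G (k + k0) q) \<le> C * norm (U q * indicator (region S n0 n1) q)" for k
      by (intro AE_I2 U_mult_bound k0) auto
    show "AE q in lborel. (\<lambda>k. U q * G (k + k0) q) \<longlonglongrightarrow> U q * H q"
    proof (rule AE_I2)
      fix q
      show "(\<lambda>k. U q * G (k + k0) q) \<longlonglongrightarrow> U q * H q"
      proof (cases "0 < fst q")
        case True
        then show ?thesis by (intro tendsto_mult tendsto_const LIMSEQ_ignore_initial_segment assms(7))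
      qed (use U_supp[of q] in auto)
    qed
  qed
  then show ?thesis by (rule LIMSEQ_offset)
qed

definition mollified :: "real \<Rightarrow> 'n st \<Rightarrow> real" where
  "mollified e q = (\<integral>z. U z * mollifier e (group_diff q z) \<partial>lborel)"

text \<open>The kernel width \<open>e\<close> is small enough for the kernel centred at any point of \<open>region S n0 n1\<close> to be an
admissible test function.\<close>

definition mollifiable :: "real \<Rightarrow> real \<Rightarrow> real \<Rightarrow> real \<Rightarrow> bool" where
  "mollifiable e S n0 n1 \<longleftrightarrow> 0 < e \<and> S + e < T \<and> 0 < n0 \<and> n0 < n1 \<and>
     (\<forall>q z::'n st. n0 \<le> nn q \<longrightarrow> nn q \<le> n1 \<longrightarrow> norm (group_diff q z) < e \<longrightarrow> n0 / 2 \<le> nn z \<and> nn z \<le> n1 + 1)"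

lemma mollifier_region:
  fixes q z :: "'n st"
  assumes "mollifiable e S n0 n1" "q \<in> region S n0 n1" "mollifier e (group_diff q z) \<noteq> 0"
  shows "z \<in> region (S + e) (n0 / 2) (n1 + 1)" "\<bar>fst q - fst z\<bar> < e"
proof -
  have e: "0 < e" using assms(1) by (simp add: mollifiable_def)
  have n: "norm (group_diff q z) < e" by (rule mollifier(2)[OF e assms(3)])
  then show f: "\<bar>fst q - fst z\<bar> < e" by (rule group_diff_close(1))
  have "n0 / 2 \<le> nn z \<and> nn z \<le> n1 + 1" using assms(1,2) n unfolding mollifiable_def region_def by blast
  then show "z \<in> region (S + e) (n0 / 2) (n1 + 1)" using f assms(2) by (auto simp: region_def)
qed

lemma mollifier_bounded:
  assumes "0 < e"
  obtains C where "0 < C" "\<And>z::'n st. mollifier e z \<le> C"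
proof -
  have "bounded (mollifier e ` cball (0::'n st) e)"
    by (intro compact_imp_bounded compact_continuous_image mollifier(3)[OF assms] compact_cball)
  then obtain C where C: "0 < C" "\<And>z::'n st. z \<in> cball 0 e \<Longrightarrow> \<bar>mollifier e z\<bar> \<le> C"
    by (auto simp: bounded_pos)
  show thesis
  proof (rule that[OF C(1)])
    fix z :: "'n st"
    show "mollifier e z \<le> C"
      using C mollifier(2)[OF assms, of z] by (cases "mollifier e z = 0") (auto simp: less_imp_le abs_le_iff)
  qed
qed

lemma mollifier_indicator_bound:
  assumes "mollifiable e S n0 n1"
  obtains C where "0 < C" "\<And>q z::'n st. q \<in> region S n0 n1 \<Longrightarrow> \<bar>mollifier e (group_diff q z)\<bar> \<le> C * indicator (region (S + e) (n0 / 2) (n1 + 1)) z"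
proof -
  have e: "0 < e" using assms(1) by (simp add: mollifiable_def)
  obtain C where C: "0 < C" "\<And>z::'n st. mollifier e z \<le> C" using mollifier_bounded[OF e] by blast
  show thesis
  proof (rule that[OF C(1)])
    fix q z :: "'n st" assume q: "q \<in> region S n0 n1"
    show "\<bar>mollifier e (group_diff q z)\<bar> \<le> C * indicator (region (S + e) (n0 / 2) (n1 + 1)) z"
      using mollifier_region(1)[OF assms q, of z] C(2)[of "group_diff q z"] mollifier(1)[OF e, of "group_diff q z"] C(1)
      by (cases "mollifier e (group_diff q z) = 0") auto
  qed
qed

lemma mollifiable_region:
  assumes "mollifiable e S n0 n1" shows "0 < n0 / 2" "n0 / 2 < n1 + 1" "S + e < T" "0 < e"
  using assms by (auto simp: mollifiable_def)

lemma continuous_mollifier: "0 < e \<Longrightarrow> continuous_on UNIV (\<lambda>z::'n st \<times> 'n st. mollifier e (group_diff (fst z) (snd z)))"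
  by (rule continuous_on_compose2[OF mollifier(3)[of e UNIV] continuous_group_diff(3)]) auto

lemma measurable_mollifier: "0 < e \<Longrightarrow> (\<lambda>z. mollifier e (group_diff (q::'n st) z)) \<in> borel_measurable borel"
  using measurable_compose[OF measurable_group_diff(2) mollifier(6)] .

lemma mollified_integrable:
  assumes "mollifiable e S n0 n1" "q \<in> region S n0 n1"
  shows "integrable lborel (\<lambda>z. U z * mollifier e (group_diff q z))"
proof -
  obtain C where C: "0 < C" "\<And>q z::'n st. q \<in> region S n0 n1 \<Longrightarrow> \<bar>mollifier e (group_diff q z)\<bar> \<le> C * indicator (region (S + e) (n0 / 2) (n1 + 1)) z"
    using mollifier_indicator_bound[OF assms(1)] by blast
  show ?thesis
    by (rule U_mult_integrable[OF mollifiable_region(1-3)[OF assms(1)] measurable_mollifier[OF mollifiable_region(4)[OF assms(1)]] C(2)[OF assms(2)]])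
qed

lemma mollified_continuous:
  assumes "mollifiable e S n0 n1"
  shows "continuous_on (region S n0 n1) (mollified e)"
proof (rule continuous_on_sequentiallyI)
  fix u :: "nat \<Rightarrow> 'n st" and a assume u: "\<forall>k. u k \<in> region S n0 n1" "a \<in> region S n0 n1" "u \<longlonglongrightarrow> a"
  obtain C where C: "0 < C" "\<And>q z::'n st. q \<in> region S n0 n1 \<Longrightarrow> \<bar>mollifier e (group_diff q z)\<bar> \<le> C * indicator (region (S + e) (n0 / 2) (n1 + 1)) z"
    using mollifier_indicator_bound[OF assms] by blast
  note e = mollifiable_region(4)[OF assms]
  show "(\<lambda>k. mollified e (u k)) \<longlonglongrightarrow> mollified e a" unfolding mollified_def
  proof (rule U_dominated[OF mollifiable_region(1-3)[OF assms]])
    show "(\<lambda>z. mollifier e (group_diff (u k) z)) \<in> borel_measurable borel" "(\<lambda>z. mollifier e (group_diff a z)) \<in> borel_measurable borel" for k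
      by (rule measurable_mollifier[OF e])+
    show "\<forall>\<^sub>F k in sequentially. \<forall>z. 0 < fst z \<longrightarrow> \<bar>mollifier e (group_diff (u k) z)\<bar> \<le> C * indicator (region (S + e) (n0 / 2) (n1 + 1)) z"
      using C(2) u(1) by (intro always_eventually) blast
    fix z :: "'n st"
    have "(\<lambda>k. (\<lambda>z. mollifier e (group_diff (fst z) (snd z))) (u k, z)) \<longlonglongrightarrow> (\<lambda>z. mollifier e (group_diff (fst z) (snd z))) (a, z)"
      by (rule continuous_on_tendsto_compose[OF continuous_mollifier[OF e]]) (use u(3) in \<open>auto intro!: tendsto_intros\<close>)
    then show "(\<lambda>k. mollifier e (group_diff (u k) z)) \<longlonglongrightarrow> mollifier e (group_diff a z)" by simp
  qed
qed

lemma admissible_mollifier: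
  assumes "mollifiable e S n0 n1" "q \<in> region S n0 n1"
  shows "admissible T (\<lambda>z. mollifier e (group_diff (q::'n st) z))"
  unfolding admissible_def
proof (intro conjI)
  show "Ck 3 UNIV (\<lambda>z. mollifier e (group_diff q z))" by (rule Ck_mollifier)
  show "\<exists>n0>0. \<forall>z. nn z < n0 \<longrightarrow> mollifier e (group_diff q z) = 0"
  proof (intro exI[of _ "n0 / 2"] conjI allI impI)
    show "mollifier e (group_diff q z) = 0" if "nn z < n0 / 2" for z
    proof (rule ccontr)
      assume "mollifier e (group_diff q z) \<noteq> 0"
      from mollifier_region(1)[OF assms this] show False using that by (simp add: region_def)
    qed
  qed (rule mollifiable_region(1)[OF assms(1)])
  show "\<exists>S<T. \<exists>R. \<forall>z. 0 \<le> fst z \<longrightarrow> mollifier e (group_diff q z) \<noteq> 0 \<longrightarrow> fst z \<le> S \<and> nn z \<le> R"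
  proof (rule exI[of _ "S + e"], rule conjI[rotated], rule exI[of _ "n1 + 1"], intro allI impI conjI)
    fix z assume "mollifier e (group_diff q z) \<noteq> 0"
    from mollifier_region(1)[OF assms this] show "fst z \<le> S + e" "nn z \<le> n1 + 1" by (auto simp: region_def)
  qed (rule mollifiable_region(3)[OF assms(1)])
qed (auto intro!: mollifier(1) mollifiable_region(4)[OF assms(1)])

text \<open>The parabolic maximum principle at a point \<open>q\<close> where \<open>- \<theta> B\<close> touches the mollified function from below: the
first and second order conditions hold for difference quotients, which are then shifted onto the
kernel. Only earlier times enter, as befits a parabolic comparison.\<close>

lemma touching_inequality:
  assumes g: "mollifiable e S n0 n1" and q: "fst q \<le> S" "n0 < nn q" "nn q < n1"
    and B: "open V" "q \<in> V" "Ck 2 V B" and V: "\<And>z. z \<in> V \<Longrightarrow> fst z \<le> fst q \<Longrightarrow> 0 \<le> mollified e z + \<theta> * B z"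
    and touch: "mollified e q + \<theta> * B q = 0"
  shows "- (\<integral>z. U z * (dt (\<lambda>z. mollifier e (group_diff q z)) z + Lap (\<lambda>z. mollifier e (group_diff q z)) z) \<partial>lborel)
    \<le> \<theta> * (Lap B q - dt B q)"
proof -
  define K where "K = (\<lambda>z. mollifier e (group_diff q z))"
  note e = mollifiable_region(4)[OF g]
  have qr: "q \<in> region S n0 n1" using q by (auto simp: region_def)
  let ?R = "region (S + e) (n0 / 2) (n1 + 1)"
  have K: "Ck 2 UNIV K" unfolding K_def by (rule Ck32[OF Ck_mollifier])
  have Ks: "K z = 0" if "z \<notin> {fst q - e..fst q + e} \<times> {\<xi>. hn \<xi> \<le> n1 + 1}" for z
  proof (rule ccontr)
    assume "K z \<noteq> 0"
    then have "mollifier e (group_diff q z) \<noteq> 0" by (simp add: K_def)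
    from mollifier_region[OF g qr this] show False using that by (cases z) (auto simp: region_def abs_less_iff)
  qed
  obtain C where C: "0 < C" "\<And>z. \<bar>dt K z\<bar> \<le> C" "\<And>j z. \<bar>VF j (VF j K) z\<bar> \<le> C"
    using Ck_derivs_bounded[OF K Ks] by blast
  define h where "h k = inverse (real (Suc k))" for k
  have h: "h \<longlonglongrightarrow> 0" "\<And>k. 0 < h k" unfolding h_def by (rule LIMSEQ_inverse_real_of_nat) simp
  have Km: "(\<lambda>z. K (z + c z)) \<in> borel_measurable borel" if "continuous_on UNIV c" for c
    by (intro borel_measurable_continuous_onI continuous_on_compose2[OF Ck_imp_continuous_on[OF K]] continuous_intros that) auto
  have hvc: "continuous_on UNIV (hv j :: 'n st \<Rightarrow> 'n st)" for j
    by (cases j) (auto intro!: continuous_intros)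
  have dtc: "dt K \<in> borel_measurable borel" "VF j (VF j K) \<in> borel_measurable borel" for j
  proof -
    have "Ck 1 UNIV (dt K)" using K by (intro Ck_dt Ck_3_Suc)
    then show "dt K \<in> borel_measurable borel" by (intro borel_measurable_continuous_onI Ck_imp_continuous_on)
    have "Ck 0 UNIV (VF j (VF j K))" using K by (intro Ck_VF open_UNIV) (simp add: numeral_2_eq_2)
    then show "VF j (VF j K) \<in> borel_measurable borel" by (intro borel_measurable_continuous_onI Ck_imp_continuous_on)
  qed
  have K0m: "K \<in> borel_measurable borel" using Km[of "\<lambda>_. 0"] by simp
  have Tlim: "(\<lambda>k. (mollified e q - mollified e (q - (h k, 0))) / h k) \<longlonglongrightarrow> (\<integral>z. U z * - dt K z \<partial>lborel)"
  proof -
    have r: "q - (h k, 0) \<in> region S n0 n1" for k using qr h(2)[of k] by (cases q) (auto simp: region_def)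
    have sh: "mollifier e (group_diff (q - (h k, 0)) z) = K (z + (h k, 0))" for k z by (simp add: K_def group_diff_time)
    have eq: "(mollified e q - mollified e (q - (h k, 0))) / h k = (\<integral>z. U z * ((K z - K (z + (h k, 0))) / h k) \<partial>lborel)" for k
    proof -
      have "mollified e q - mollified e (q - (h k, 0)) = (\<integral>z. U z * K z - U z * K (z + (h k, 0)) \<partial>lborel)"
        using Bochner_Integration.integral_diff[OF mollified_integrable[OF g qr] mollified_integrable[OF g r[of k]]]
        unfolding mollified_def sh by (simp add: K_def)
      then show ?thesis by (simp add: algebra_simps diff_divide_distrib flip: integral_divide_zero)
    qed
    have b: "\<bar>(K z - K (z + (h k, 0))) / h k\<bar> \<le> C * indicator ?R z" for k z
    proof (cases "z \<in> ?R")
      case True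
      then show ?thesis using difference_bounds(2)[OF K C(2,3) h(2)] by simp
    next
      case False
      then have "K z = 0" "K (z + (h k, 0)) = 0"
        using mollifier_region(1)[OF g qr, of z] mollifier_region(1)[OF g r, of k z] sh[of k z] by (auto simp: K_def)
      then show ?thesis using False by simp
    qed
    show ?thesis unfolding eq
    proof (rule U_dominated[OF mollifiable_region(1-3)[OF g], where C=C])
      show "(\<lambda>z. (K z - K (z + (h k, 0))) / h k) \<in> borel_measurable borel" for k
        using K0m Km[of "\<lambda>_. (h k, 0)"] by measurable
      show "(\<lambda>z. - dt K z) \<in> borel_measurable borel" using dtc(1) by measurable
      show "(\<lambda>k. (K z - K (z + (h k, 0))) / h k) \<longlonglongrightarrow> - dt K z" for z
        by (rule difference_limits(3)[OF open_UNIV UNIV_I K h])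
    qed (use b in auto)
  qed
  have Slim: "(\<lambda>k. (mollified e (q + h k *\<^sub>R hv j q) + mollified e (q - h k *\<^sub>R hv j q) - 2 * mollified e q) / (h k)\<^sup>2)
      \<longlonglongrightarrow> (\<integral>z. U z * VF j (VF j K) z \<partial>lborel)"
    and near: "\<forall>\<^sub>F k in sequentially. q + h k *\<^sub>R hv j q \<in> V \<and> q - h k *\<^sub>R hv j q \<in> V" for j
  proof -
    have lim: "(\<lambda>k. q + h k *\<^sub>R hv j q) \<longlonglongrightarrow> q + 0 *\<^sub>R hv j q" "(\<lambda>k. q - h k *\<^sub>R hv j q) \<longlonglongrightarrow> q - 0 *\<^sub>R hv j q"
      by (intro tendsto_intros h)+
    have ev: "\<forall>\<^sub>F k in sequentially. q + h k *\<^sub>R hv j q \<in> W \<and> q - h k *\<^sub>R hv j q \<in> W" if "open W" "q \<in> W" for W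
      using topological_tendstoD[OF lim(1) that(1)] topological_tendstoD[OF lim(2) that(1)] that(2)
      by (auto intro: eventually_conj)
    show "\<forall>\<^sub>F k in sequentially. q + h k *\<^sub>R hv j q \<in> V \<and> q - h k *\<^sub>R hv j q \<in> V" by (rule ev[OF B(1,2)])
    let ?W = "{z::'n st. n0 < nn z} \<inter> {z. nn z < n1}"
    have ft: "fst (hv j q) = 0" by (cases j) simp_all
    have r: "\<forall>\<^sub>F k in sequentially. q + h k *\<^sub>R hv j q \<in> region S n0 n1 \<and> q - h k *\<^sub>R hv j q \<in> region S n0 n1"
      using ev[of ?W] q ft by (auto simp: region_def open_Int open_nn_greater open_nn_less elim!: eventually_mono)
    have sh: "mollifier e (group_diff (q + h k *\<^sub>R hv j q) z) = K (z - h k *\<^sub>R hv j z)" "mollifier e (group_diff (q - h k *\<^sub>R hv j q) z) = K (z + h k *\<^sub>R hv j z)" for k z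
      using group_diff_hv[of q "h k" j z] group_diff_hv[of q "- h k" j z] by (auto simp: K_def)
    have eq: "\<forall>\<^sub>F k in sequentially. (\<integral>z. U z * ((K (z + h k *\<^sub>R hv j z) + K (z - h k *\<^sub>R hv j z) - 2 * K z) / (h k)\<^sup>2) \<partial>lborel)
      = (mollified e (q + h k *\<^sub>R hv j q) + mollified e (q - h k *\<^sub>R hv j q) - 2 * mollified e q) / (h k)\<^sup>2"
      using r
    proof eventually_elim
      case (elim k)
      note I = mollified_integrable[OF g conjunct1[OF elim], unfolded sh] mollified_integrable[OF g conjunct2[OF elim], unfolded sh]
      have iK: "integrable lborel (\<lambda>z. U z * K z)" using mollified_integrable[OF g qr] by (simp add: K_def)
      have u: "mollified e (q + h k *\<^sub>R hv j q) = (\<integral>z. U z * K (z - h k *\<^sub>R hv j z) \<partial>lborel)"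
        "mollified e (q - h k *\<^sub>R hv j q) = (\<integral>z. U z * K (z + h k *\<^sub>R hv j z) \<partial>lborel)"
        "mollified e q = (\<integral>z. U z * K z \<partial>lborel)"
        unfolding mollified_def sh by (simp_all add: K_def)
      have "(\<integral>z. U z * ((K (z + h k *\<^sub>R hv j z) + K (z - h k *\<^sub>R hv j z) - 2 * K z) / (h k)\<^sup>2) \<partial>lborel)
        = (\<integral>z. (U z * K (z + h k *\<^sub>R hv j z) + U z * K (z - h k *\<^sub>R hv j z) - 2 * (U z * K z)) / (h k)\<^sup>2 \<partial>lborel)"
        by (intro Bochner_Integration.integral_cong) (auto simp: algebra_simps)
      also have "\<dots> = (\<integral>z. (U z * K (z + h k *\<^sub>R hv j z) + U z * K (z - h k *\<^sub>R hv j z) - 2 * (U z * K z)) \<partial>lborel) / (h k)\<^sup>2"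
        by simp
      also have "\<dots> = (mollified e (q + h k *\<^sub>R hv j q) + mollified e (q - h k *\<^sub>R hv j q) - 2 * mollified e q) / (h k)\<^sup>2"
        using I iK by (simp add: u)
      finally show ?case .
    qed
    have b: "\<forall>\<^sub>F k in sequentially. \<forall>z. 0 < fst z \<longrightarrow> \<bar>(K (z + h k *\<^sub>R hv j z) + K (z - h k *\<^sub>R hv j z) - 2 * K z) / (h k)\<^sup>2\<bar> \<le> C * indicator ?R z"
      using r
    proof eventually_elim
      case (elim k)
      show ?case
      proof (intro allI impI)
        fix z
        show "\<bar>(K (z + h k *\<^sub>R hv j z) + K (z - h k *\<^sub>R hv j z) - 2 * K z) / (h k)\<^sup>2\<bar> \<le> C * indicator ?R z"
        proof (cases "z \<in> ?R")
          case True
          then show ?thesis using difference_bounds(1)[OF K C(2,3) h(2)] by simp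
        next
          case False
          then have "K z = 0" "K (z + h k *\<^sub>R hv j z) = 0" "K (z - h k *\<^sub>R hv j z) = 0"
            using mollifier_region(1)[OF g qr, of z] mollifier_region(1)[OF g conjunct1[OF elim], of z]
              mollifier_region(1)[OF g conjunct2[OF elim], of z] sh[of k z] by (auto simp: K_def)
          then show ?thesis using False by simp
        qed
      qed
    qed
    have "(\<lambda>k. \<integral>z. U z * ((K (z + h k *\<^sub>R hv j z) + K (z - h k *\<^sub>R hv j z) - 2 * K z) / (h k)\<^sup>2) \<partial>lborel)
      \<longlonglongrightarrow> (\<integral>z. U z * VF j (VF j K) z \<partial>lborel)"
    proof (rule U_dominated[OF mollifiable_region(1-3)[OF g] _ _ b])
      show "(\<lambda>z. (K (z + h k *\<^sub>R hv j z) + K (z - h k *\<^sub>R hv j z) - 2 * K z) / (h k)\<^sup>2) \<in> borel_measurable borel" for k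
      proof -
        have "(\<lambda>z. K (z + h k *\<^sub>R hv j z)) \<in> borel_measurable borel" "(\<lambda>z. K (z - h k *\<^sub>R hv j z)) \<in> borel_measurable borel"
          using Km[OF continuous_on_scaleR[OF continuous_on_const hvc], of "h k" j]
            Km[OF continuous_on_scaleR[OF continuous_on_const hvc], of "- h k" j] by simp_all
        then show ?thesis using K0m by measurable
      qed
      show "(\<lambda>k. (K (z + h k *\<^sub>R hv j z) + K (z - h k *\<^sub>R hv j z) - 2 * K z) / (h k)\<^sup>2) \<longlonglongrightarrow> VF j (VF j K) z" for z
        by (rule difference_limits(1)[OF open_UNIV UNIV_I K h])
    qed (rule dtc)
    then show "(\<lambda>k. (mollified e (q + h k *\<^sub>R hv j q) + mollified e (q - h k *\<^sub>R hv j q) - 2 * mollified e q) / (h k)\<^sup>2)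
      \<longlonglongrightarrow> (\<integral>z. U z * VF j (VF j K) z \<partial>lborel)"
      by (rule Lim_transform_eventually[OF _ eq])
  qed
  have iT: "integrable lborel (\<lambda>z. U z * dt K z)" and iS: "integrable lborel (\<lambda>z. U z * VF j (VF j K) z)" for j
  proof -
    have z: "dt K z = 0 \<and> VF j (VF j K) z = 0" if "z \<notin> ?R" for j z
    proof -
      have o: "open (- ?R)" using closed_region by blast
      have K0: "\<And>z. z \<in> - ?R \<Longrightarrow> K z = 0" using mollifier_region(1)[OF g qr] by (auto simp: K_def)
      have "\<And>z. z \<in> - ?R \<Longrightarrow> VF j K z = 0" using hardy_op_zero(2)[OF o, of _ K] K0 by blast
      then show ?thesis using hardy_op_zero(1)[OF o, of z K] K0 hardy_op_zero(2)[OF o, of z "VF j K"] that by blast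
    qed
    show "integrable lborel (\<lambda>z. U z * dt K z)"
      by (rule U_mult_integrable[OF mollifiable_region(1-3)[OF g] dtc(1), where C=C]) (use z C in \<open>auto simp: indicator_def\<close>)
    show "integrable lborel (\<lambda>z. U z * VF j (VF j K) z)"
      by (rule U_mult_integrable[OF mollifiable_region(1-3)[OF g] dtc(2), where C=C]) (use z C in \<open>auto simp: indicator_def\<close>)
  qed
  have t1: "(\<integral>z. U z * - dt K z \<partial>lborel) \<le> - \<theta> * dt B q"
  proof (rule LIMSEQ_le[OF Tlim])
    show "(\<lambda>k. - \<theta> * ((B q - B (q - (h k, 0))) / h k)) \<longlonglongrightarrow> - \<theta> * dt B q"
      by (intro tendsto_intros difference_limits(2)[OF B h])
    have "(\<lambda>k. q - (h k, 0)) \<longlonglongrightarrow> q - (0, 0)" by (intro tendsto_intros h)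
    then have "\<forall>\<^sub>F k in sequentially. q - (h k, 0) \<in> V"
      using topological_tendstoD[OF _ B(1)] B(2) by (simp add: zero_prod_def[symmetric])
    then have "\<forall>\<^sub>F k in sequentially. (mollified e q - mollified e (q - (h k, 0))) / h k \<le> - \<theta> * ((B q - B (q - (h k, 0))) / h k)"
    proof eventually_elim
      case (elim k)
      have "0 \<le> mollified e (q - (h k, 0)) + \<theta> * B (q - (h k, 0))" by (rule V[OF elim]) (use h(2)[of k] in simp)
      then have "mollified e q - mollified e (q - (h k, 0)) \<le> - \<theta> * (B q - B (q - (h k, 0)))"
        using touch by (simp add: algebra_simps)
      then show ?case using h(2)[of k] divide_right_mono[of _ _ "h k"] by fastforce
    qed
    then show "\<exists>N. \<forall>n\<ge>N. (mollified e q - mollified e (q - (h n, 0))) / h n \<le> - \<theta> * ((B q - B (q - (h n, 0))) / h n)"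
      by (simp add: eventually_sequentially)
  qed
  have s1: "- \<theta> * VF j (VF j B) q \<le> (\<integral>z. U z * VF j (VF j K) z \<partial>lborel)" for j
  proof (rule LIMSEQ_le[OF _ Slim])
    show "(\<lambda>k. - \<theta> * ((B (q + h k *\<^sub>R hv j q) + B (q - h k *\<^sub>R hv j q) - 2 * B q) / (h k)\<^sup>2)) \<longlonglongrightarrow> - \<theta> * VF j (VF j B) q"
      by (intro tendsto_intros difference_limits(1)[OF B h])
    have ft: "fst (hv j q) = 0" by (cases j) simp_all
    have "\<forall>\<^sub>F k in sequentially. - \<theta> * ((B (q + h k *\<^sub>R hv j q) + B (q - h k *\<^sub>R hv j q) - 2 * B q) / (h k)\<^sup>2)
       \<le> (mollified e (q + h k *\<^sub>R hv j q) + mollified e (q - h k *\<^sub>R hv j q) - 2 * mollified e q) / (h k)\<^sup>2"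
      using near[of j]
    proof eventually_elim
      case (elim k)
      have "0 \<le> mollified e (q + h k *\<^sub>R hv j q) + \<theta> * B (q + h k *\<^sub>R hv j q)" "0 \<le> mollified e (q - h k *\<^sub>R hv j q) + \<theta> * B (q - h k *\<^sub>R hv j q)"
        using V elim ft by auto
      then have "- \<theta> * (B (q + h k *\<^sub>R hv j q) + B (q - h k *\<^sub>R hv j q) - 2 * B q)
         \<le> mollified e (q + h k *\<^sub>R hv j q) + mollified e (q - h k *\<^sub>R hv j q) - 2 * mollified e q"
        using touch by (simp add: algebra_simps)
      then show ?case using divide_right_mono[of _ _ "(h k)\<^sup>2"] by fastforce
    qed
    then show "\<exists>N. \<forall>k\<ge>N. - \<theta> * ((B (q + h k *\<^sub>R hv j q) + B (q - h k *\<^sub>R hv j q) - 2 * B q) / (h k)\<^sup>2)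
       \<le> (mollified e (q + h k *\<^sub>R hv j q) + mollified e (q - h k *\<^sub>R hv j q) - 2 * mollified e q) / (h k)\<^sup>2"
      by (simp add: eventually_sequentially)
  qed
  have "(\<integral>z. U z * (dt K z + Lap K z) \<partial>lborel) = (\<integral>z. U z * dt K z + (\<Sum>j\<in>UNIV. U z * VF j (VF j K) z) \<partial>lborel)"
    by (simp add: Lap_def sum_distrib_left distrib_left)
  also have "\<dots> = (\<integral>z. U z * dt K z \<partial>lborel) + (\<Sum>j\<in>UNIV. \<integral>z. U z * VF j (VF j K) z \<partial>lborel)"
    using iT iS by simp
  finally have "- (\<integral>z. U z * (dt K z + Lap K z) \<partial>lborel)
     = (\<integral>z. U z * - dt K z \<partial>lborel) - (\<Sum>j\<in>UNIV. \<integral>z. U z * VF j (VF j K) z \<partial>lborel)"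
    using iT by simp
  also have "\<dots> \<le> - \<theta> * dt B q - (\<Sum>j\<in>UNIV. - \<theta> * VF j (VF j B) q)"
    by (intro diff_mono t1 sum_mono s1)
  also have "\<dots> = \<theta> * (Lap B q - dt B q)"
    by (simp add: Lap_def sum_distrib_left sum_negf algebra_simps)
  finally show ?thesis unfolding K_def .
qed

end

section \<open>Comparison of the mollified function with a large solution\<close>

lemma powr_tangent:
  fixes x m p :: real
  assumes "1 < p" "0 \<le> x" "0 < m"
  shows "m powr p + p * m powr (p - 1) * (x - m) \<le> x powr p"
proof -
  have m: "m powr p = m powr (p - 1) * m" using assms by (simp add: powr_mult_base mult.commute)
  show ?thesis
  proof (cases "x = 0")
    case True
    have "m powr (p - 1) * m * (1 - p) \<le> 0"
      using assms by (intro mult_nonneg_nonpos) auto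
    then show ?thesis using True m by (simp add: algebra_simps)
  next
    case False
    then have y: "0 < x / m" using assms by simp
    have "((x / m) powr p) powr (1 / p) * 1 powr (1 - 1 / p) \<le> (1 / p) * (x / m) powr p + (1 - 1 / p) * 1"
      using Youngs_inequality_0[of "1 / p" "1 - 1 / p" "(x / m) powr p" 1] assms y False by simp
    then have "x / m \<le> (1 / p) * (x / m) powr p + (1 - 1 / p)"
      using assms y by (simp add: powr_powr)
    then have "p * (x / m) \<le> (x / m) powr p + (p - 1)"
    proof -
      have "p * (x / m) \<le> p * ((1 / p) * (x / m) powr p + (1 - 1 / p))"
        using \<open>x / m \<le> _\<close> assms(1) by (intro mult_left_mono) auto
      also have "\<dots> = (x / m) powr p + (p - 1)"
        using assms(1) by (simp add: distrib_left right_diff_distrib)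
      finally show ?thesis .
    qed
    moreover have "(x / m) powr p = x powr p / m powr p" using assms by (simp add: powr_divide)
    ultimately have "m powr p * (p * (x / m)) \<le> m powr p * (x powr p / m powr p + (p - 1))"
      by (intro mult_left_mono) auto
    moreover have "m powr p * (p * (x / m)) = m powr (p - 1) * (p * x)" using m assms by simp
    moreover have "m powr p * (x powr p / m powr p + (p - 1)) = x powr p + m powr p * (p - 1)"
      using assms by (simp add: distrib_left)
    ultimately have "m powr (p - 1) * (p * x) \<le> x powr p + m powr p * (p - 1)" by (simp only:)
    then show ?thesis using m by (simp add: algebra_simps)
  qed
qed

context heis_super
begin

text \<open>Jensen's inequality for the probability density given by the kernel, proved by integrating the tangent
line of the convex power at the mean.\<close>

lemma jensen_mollifier:
  assumes "mollifiable e S n0 n1" "q \<in> region S n0 n1" "0 < (\<integral>z. \<bar>U z\<bar> * mollifier e (group_diff q z) \<partial>lborel)"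
  shows "(\<integral>z. \<bar>U z\<bar> * mollifier e (group_diff q z) \<partial>lborel) powr p \<le> (\<integral>z. \<bar>U z\<bar> powr p * mollifier e (group_diff q z) \<partial>lborel)"
proof -
  define m where "m = (\<integral>z. \<bar>U z\<bar> * mollifier e (group_diff q z) \<partial>lborel)"
  note e = mollifiable_region(4)[OF assms(1)]
  let ?K = "\<lambda>z. mollifier e (group_diff q z)"
  have K: "integrable lborel ?K" "(\<integral>z. ?K z \<partial>lborel) = 1"
    using integral_group_diff(4)[OF mollifier(6)[OF e] mollifier(4)[OF e], of q] integral_group_diff(2)[OF mollifier(6)[OF e], of q] mollifier(5)[OF e, where 'n='n] by auto
  have K0: "0 \<le> ?K z" for z by (rule mollifier(1)[OF e])
  have iU: "integrable lborel (\<lambda>z. \<bar>U z\<bar> * ?K z)"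
    using integrable_norm[OF mollified_integrable[OF assms(1,2)]] K0 by (simp add: abs_mult)
  have ip: "integrable lborel (\<lambda>z. \<bar>U z\<bar> powr p * ?K z)" by (rule int_pow[OF admissible_mollifier[OF assms(1,2)]])
  have "(\<integral>z. (m powr p - p * m powr (p - 1) * m) * ?K z + p * m powr (p - 1) * (\<bar>U z\<bar> * ?K z) \<partial>lborel)
     \<le> (\<integral>z. \<bar>U z\<bar> powr p * ?K z \<partial>lborel)"
  proof (rule integral_mono)
    fix z
    have "(m powr p + p * m powr (p - 1) * (\<bar>U z\<bar> - m)) * ?K z \<le> \<bar>U z\<bar> powr p * ?K z"
      using p assms(3) K0[of z] by (intro mult_right_mono powr_tangent) (auto simp: m_def)
    then show "(m powr p - p * m powr (p - 1) * m) * ?K z + p * m powr (p - 1) * (\<bar>U z\<bar> * ?K z) \<le> \<bar>U z\<bar> powr p * ?K z"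
      by (simp add: algebra_simps)
  qed (use K iU ip in auto)
  moreover have "(\<integral>z. (m powr p - p * m powr (p - 1) * m) * ?K z + p * m powr (p - 1) * (\<bar>U z\<bar> * ?K z) \<partial>lborel) = m powr p"
    using K iU by (simp add: m_def[symmetric])
  ultimately show ?thesis by (simp add: m_def)
qed

text \<open>The function is zero for negative times, which serves as the initial condition of the comparison. This
is why barriers are considered from time \<open>-1\<close> on.\<close>

lemma mollified_early: 
  assumes "0 < e" "fst q \<le> - e"
  shows "mollified e q = 0"
proof -
  have "U z * mollifier e (group_diff q z) = 0" for z
  proof (cases "mollifier e (group_diff q z) = 0")
    case False
    then have "\<bar>fst q - fst z\<bar> < e" using group_diff_close(1) mollifier(2)[OF assms(1)] by blast
    then have "fst z \<le> 0" using assms by linarith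
    then show ?thesis using U_supp[of z] by auto
  qed simp
  then show ?thesis unfolding mollified_def by (simp only: Bochner_Integration.integral_zero)
qed

text \<open>Suppose the mollified function \<open>V\<close> falls below \<open>- B\<close>. As \<open>B\<close> blows up at the lateral boundary, \<open>V / B\<close> has a
minimum \<open>- \<theta> < - 1\<close>. With \<open>m\<close> the mean of \<open>|U|\<close> over the kernel at the minimum point, \<open>m \<ge> \<theta> B\<close>, and
the touching inequality, the supersolution property of \<open>U\<close> and Jensen give
\<open>m^p \<le> \<theta> B^p / 4 + lam om m\<close>, where \<open>om\<close> bounds the oscillation of the potential over the kernel.
Since \<open>\<theta> B^p \<le> m^p\<close> and \<open>om\<close> was chosen with \<open>lam om = b0^(p - 1) / 2\<close>, this is impossible.\<close>

lemma mollified_lower_bound: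
  fixes B :: "'n st \<Rightarrow> real" and m0 m1 :: real
  defines "\<Omega> \<equiv> {z::'n st. m0 < nn z} \<inter> {z. nn z < m1}"
  assumes S: "S < T" and m: "0 < m0" "m0 < m1" and CB: "Ck 2 \<Omega> B"
    and pos: "0 < b0" "\<And>z. z \<in> \<Omega> \<Longrightarrow> -1 \<le> fst z \<Longrightarrow> b0 \<le> B z"
    and superB: "\<And>z. z \<in> \<Omega> \<Longrightarrow> -1 \<le> fst z \<Longrightarrow> Lap B z - dt B z + lam * (aa z / nn z) * B z \<le> B z powr p / 4"
    and blow: "\<And>M. \<exists>a b. m0 < a \<and> b < m1 \<and> (\<forall>z\<in>\<Omega>. -1 \<le> fst z \<longrightarrow> nn z < a \<or> b < nn z \<longrightarrow> M \<le> B z)"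
  obtains e0 where "0 < e0" "\<And>e z. 0 < e \<Longrightarrow> e < e0 \<Longrightarrow> z \<in> \<Omega> \<Longrightarrow> -1 \<le> fst z \<Longrightarrow> fst z \<le> S \<Longrightarrow> - B z \<le> mollified e z"
proof -
  \<comment> \<open>the oscillation of the potential that half of \<open>m^p\<close> can absorb, as \<open>m \<ge> b0\<close> below\<close>
  define om where "om = b0 powr (p - 1) / (2 * lam)"
  have om: "0 < om" using pos(1) lam_pos by (simp add: om_def)
  obtain e1 where e1: "0 < e1" "\<And>q z::'n st. m0 \<le> nn q \<Longrightarrow> nn q \<le> m1 \<Longrightarrow> norm (group_diff q z) < e1 \<Longrightarrow>
        m0 / 2 \<le> nn z \<and> nn z \<le> m1 + 1 \<and> \<bar>aa z / nn z - aa q / nn q\<bar> \<le> om"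
    using group_diff_close_uniform[OF m(1) om, of m1] by blast
  define e0 where "e0 = min e1 (min (T - S) 1)"
  have o\<Omega>: "open \<Omega>" unfolding \<Omega>_def by (intro open_Int open_nn_greater open_nn_less)
  show thesis
  proof (rule that)
    show "0 < e0" using e1 S by (simp add: e0_def)
    fix e and z1 :: "'n st"
    assume e: "0 < e" "e < e0" and z1: "z1 \<in> \<Omega>" "-1 \<le> fst z1" "fst z1 \<le> S"
    have g: "mollifiable e S m0 m1"
      using e e1 m by (auto simp: mollifiable_def e0_def)
    show "- B z1 \<le> mollified e z1"
    proof (rule ccontr)
      assume "\<not> - B z1 \<le> mollified e z1"
      then have bad: "mollified e z1 < - B z1" by simp
      let ?A = "{-1..S} \<times> {\<xi>::'n heis. hn \<xi> \<le> m1} \<inter> region S m0 m1"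
      have cU: "continuous_on (region S m0 m1) (mollified e)" by (rule mollified_continuous[OF g])
      have "compact ?A" by (intro compact_Int_closed compact_slab closed_region)
      then have "bounded (mollified e ` ?A)"
        by (intro compact_imp_bounded compact_continuous_image continuous_on_subset[OF cU]) auto
      then obtain M where M: "\<And>z. z \<in> ?A \<Longrightarrow> \<bar>mollified e z\<bar> \<le> M" by (auto simp: bounded_iff)
      have M\<Omega>: "\<bar>mollified e z\<bar> \<le> M" if "z \<in> \<Omega>" "-1 \<le> fst z" "fst z \<le> S" for z
        by (rule M) (use that in \<open>cases z; auto simp: \<Omega>_def region_def\<close>)
      obtain a b where ab: "m0 < a" "b < m1" "\<And>z. z \<in> \<Omega> \<Longrightarrow> -1 \<le> fst z \<Longrightarrow> nn z < a \<or> b < nn z \<Longrightarrow> M + 1 \<le> B z"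
        using blow[of "M + 1"] by blast
      let ?C = "{-1..S} \<times> {\<xi>::'n heis. hn \<xi> \<le> b} \<inter> region S a b"
      have C\<Omega>: "z \<in> \<Omega> \<and> -1 \<le> fst z \<and> fst z \<le> S" if "z \<in> ?C" for z
        using that ab by (cases z) (auto simp: region_def \<Omega>_def)
      have z1C: "z1 \<in> ?C"
      proof (rule ccontr)
        assume "z1 \<notin> ?C"
        then have "nn z1 < a \<or> b < nn z1" using z1 by (cases z1) (auto simp: region_def)
        from ab(3)[OF z1(1,2) this] M\<Omega>[OF z1] bad show False by linarith
      qed
      have Bpos: "0 < B z" if "z \<in> \<Omega>" "-1 \<le> fst z" for z by (rule order.strict_trans2[OF pos(1) pos(2)[OF that]])
      have cf: "continuous_on ?C (\<lambda>z. mollified e z / B z)"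
      proof (intro continuous_on_divide)
        show "continuous_on ?C (mollified e)"
          by (rule continuous_on_subset[OF cU]) (use ab in \<open>auto simp: region_def\<close>)
        show "continuous_on ?C B"
          by (rule continuous_on_subset[OF Ck_imp_continuous_on[OF CB]]) (use C\<Omega> in blast)
        show "\<forall>z\<in>?C. B z \<noteq> 0" using C\<Omega> Bpos by (metis less_irrefl)
      qed
      have "compact ?C" by (intro compact_Int_closed compact_slab closed_region)
      then obtain q where q: "q \<in> ?C" "\<And>z. z \<in> ?C \<Longrightarrow> mollified e q / B q \<le> mollified e z / B z"
        using continuous_attains_inf[OF _ _ cf] z1C by blast
      define \<theta> where "\<theta> = - (mollified e q / B q)"
      note q\<Omega> = C\<Omega>[OF q(1)]
      have Bq: "0 < B q" "b0 \<le> B q" using Bpos pos q\<Omega> by auto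
      have \<theta>: "1 < \<theta>"
      proof -
        have "mollified e z1 / B z1 < -1" using bad Bpos[OF z1(1,2)] by (simp add: field_simps)
        then show ?thesis using q(2)[OF z1C] by (simp add: \<theta>_def)
      qed
      have touch: "mollified e q + \<theta> * B q = 0" using Bq by (simp add: \<theta>_def)
      have above: "0 \<le> mollified e z + \<theta> * B z" if z: "z \<in> \<Omega>" "-1 \<le> fst z" "fst z \<le> S" for z
      proof (cases "z \<in> ?C")
        case True
        have "- \<theta> \<le> mollified e z / B z" using q(2)[OF True] by (simp add: \<theta>_def)
        then show ?thesis using Bpos[OF z(1,2)] by (simp add: field_simps)
      next
        case False
        then have "nn z < a \<or> b < nn z" using z by (cases z) (auto simp: region_def)
        from ab(3)[OF z(1,2) this] M\<Omega>[OF z] have "\<bar>mollified e z\<bar> \<le> B z" by linarith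
        moreover have "B z \<le> \<theta> * B z" using \<theta> Bpos[OF z(1,2)] by simp
        ultimately show ?thesis by linarith
      qed
      have tq: "-1 < fst q"
      proof (rule ccontr)
        assume "\<not> -1 < fst q"
        then have "mollified e q = 0" using e by (intro mollified_early) (auto simp: e0_def)
        then show False using touch \<theta> Bq by auto
      qed
      have qr: "q \<in> region S m0 m1" "m0 < nn q" "nn q < m1" "fst q \<le> S"
        using q\<Omega> by (auto simp: \<Omega>_def region_def)
      let ?K = "\<lambda>z. mollifier e (group_diff q z)"
      let ?V = "\<Omega> \<inter> {z. -1 < fst z}"
      have key: "- (\<integral>z. U z * (dt ?K z + Lap ?K z) \<partial>lborel) \<le> \<theta> * (Lap B q - dt B q)"
      proof (rule touching_inequality[OF g qr(4,2,3)])
        show "open ?V" by (intro open_Int o\<Omega> open_Collect_less continuous_intros)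
        show "q \<in> ?V" using q\<Omega> tq by simp
        show "Ck 2 ?V B" by (rule Ck_subset[OF CB]) auto
        show "0 \<le> mollified e z + \<theta> * B z" if "z \<in> ?V" "fst z \<le> fst q" for z
          by (rule above) (use that qr in auto)
      qed (rule touch)
      have kp: "0 \<le> ?K z" for z by (rule mollifier(1)[OF e(1)])
      define m where "m = (\<integral>z. \<bar>U z\<bar> * ?K z \<partial>lborel)"
      have iUK: "integrable lborel (\<lambda>z. U z * ?K z)" by (rule mollified_integrable[OF g qr(1)])
      have iaK: "integrable lborel (\<lambda>z. \<bar>U z\<bar> * ?K z)"
        using integrable_norm[OF iUK] kp by (simp add: abs_mult)
      have mU: "\<bar>mollified e q\<bar> \<le> m"
        using integral_norm_bound[of lborel "\<lambda>z. U z * ?K z"] kp by (simp add: mollified_def m_def abs_mult)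
      have mB: "\<theta> * B q \<le> m" using mU touch by linarith
      have mb0: "b0 \<le> m" 
      proof -
        have "1 * B q \<le> \<theta> * B q" using \<theta> Bq by (intro mult_right_mono) auto
        then show ?thesis using Bq mB by linarith
      qed
      have mpos: "0 < m" using mb0 pos(1) by linarith
      define Vq where "Vq = aa q / nn q"
      have clo: "\<bar>aa z / nn z - Vq\<bar> \<le> om" if "?K z \<noteq> 0" for z
        using e1(2)[of q z] mollifier(2)[OF e(1) that] qr e by (auto simp: Vq_def e0_def)
      have Vm: "(\<lambda>z::'n st. aa z / nn z) \<in> borel_measurable borel"
        using borel_measurable_continuous_onI[OF continuous_aa] borel_measurable_continuous_onI[OF continuous_nn]
        by (intro borel_measurable_divide)
      have bnd: "norm (U z * ?K z * (aa z / nn z - Vq)) \<le> om * (\<bar>U z\<bar> * ?K z)" for z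
      proof (cases "?K z = 0")
        case False
        have "\<bar>U z * ?K z\<bar> * \<bar>aa z / nn z - Vq\<bar> \<le> \<bar>U z * ?K z\<bar> * om"
          by (intro mult_left_mono clo False) auto
        then show ?thesis using kp by (simp add: abs_mult mult_ac)
      qed simp
      have iD: "integrable lborel (\<lambda>z. U z * ?K z * (aa z / nn z - Vq))"
      proof (rule Bochner_Integration.integrable_bound[OF integrable_mult_right[OF iaK, of om]])
        show "(\<lambda>z. U z * ?K z * (aa z / nn z - Vq)) \<in> borel_measurable lborel"
          using U_meas measurable_mollifier[OF e(1)] Vm by measurable
        show "AE z in lborel. norm (U z * ?K z * (aa z / nn z - Vq)) \<le> norm (om * (\<bar>U z\<bar> * ?K z))"
          using bnd by (intro AE_I2) (metis abs_ge_self order_trans real_norm_def)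
      qed
      have Dle: "\<bar>\<integral>z. U z * ?K z * (aa z / nn z - Vq) \<partial>lborel\<bar> \<le> om * m"
      proof -
        have "\<bar>\<integral>z. U z * ?K z * (aa z / nn z - Vq) \<partial>lborel\<bar> \<le> (\<integral>z. om * (\<bar>U z\<bar> * ?K z) \<partial>lborel)"
          by (rule order_trans[OF integral_norm_bound[of lborel "\<lambda>z. U z * ?K z * (aa z / nn z - Vq)", unfolded real_norm_def]
             integral_mono[OF integrable_norm[OF iD, unfolded real_norm_def] integrable_mult_right[OF iaK, of om] bnd[unfolded real_norm_def]]])
        then show ?thesis by (simp add: m_def)
      qed
      have iPL: "integrable lborel (\<lambda>z. U z * hardy_op lam ?K z)" by (rule int_hardy_op[OF admissible_mollifier[OF g qr(1)]])
      have split: "U z * hardy_op lam ?K z = U z * (dt ?K z + Lap ?K z) + lam * (U z * ?K z * (aa z / nn z - Vq)) + lam * Vq * (U z * ?K z)" for z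
        by (simp add: hardy_op_def algebra_simps)
      have iDL: "integrable lborel (\<lambda>z. U z * (dt ?K z + Lap ?K z))"
      proof -
        have "(\<lambda>z. U z * (dt ?K z + Lap ?K z)) = (\<lambda>z. U z * hardy_op lam ?K z - lam * (U z * ?K z * (aa z / nn z - Vq)) - lam * Vq * (U z * ?K z))"
          by (rule ext) (simp add: split)
        then show ?thesis using iPL iD iUK by simp
      qed
      have "m powr p \<le> (\<integral>z. \<bar>U z\<bar> powr p * ?K z \<partial>lborel)"
        unfolding m_def by (rule jensen_mollifier[OF g qr(1)]) (use mpos in \<open>simp add: m_def\<close>)
      also have "\<dots> \<le> - (\<integral>z. U z * hardy_op lam ?K z \<partial>lborel)" by (rule super[OF admissible_mollifier[OF g qr(1)]])
      also have "\<dots> = - (\<integral>z. U z * (dt ?K z + Lap ?K z) \<partial>lborel)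
         - lam * (\<integral>z. U z * ?K z * (aa z / nn z - Vq) \<partial>lborel) - lam * Vq * mollified e q"
        unfolding split mollified_def using iDL iD iUK by simp
      also have "\<dots> \<le> \<theta> * (Lap B q - dt B q) + lam * (om * m) + lam * Vq * (\<theta> * B q)"
      proof -
        have "- lam * (\<integral>z. U z * ?K z * (aa z / nn z - Vq) \<partial>lborel) \<le> lam * (om * m)"
          using Dle lam_pos mult_left_mono[of "- (\<integral>z. U z * ?K z * (aa z / nn z - Vq) \<partial>lborel)" "om * m" lam] by (simp add: abs_le_iff)
        moreover have "lam * Vq * mollified e q = - (lam * Vq * (\<theta> * B q))" using touch by (simp add: eq_neg_iff_add_eq_0 flip: distrib_left)
        ultimately show ?thesis using key by linarith
      qed
      also have "\<dots> = \<theta> * (Lap B q - dt B q + lam * (aa q / nn q) * B q) + lam * (om * m)"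
        by (simp add: Vq_def algebra_simps)
      also have "\<dots> \<le> \<theta> * (B q powr p / 4) + lam * (om * m)"
        using superB[of q] q\<Omega> \<theta> by (intro add_right_mono mult_left_mono) auto
      also have "\<theta> * (B q powr p / 4) \<le> m powr p / 4"
      proof -
        have "\<theta> powr 1 \<le> \<theta> powr p" using \<theta> p by (intro powr_mono) auto
        then have "\<theta> * B q powr p \<le> \<theta> powr p * B q powr p" using \<theta> by (intro mult_right_mono) auto
        also have "\<dots> = (\<theta> * B q) powr p" using \<theta> Bq by (simp add: powr_mult)
        also have "\<dots> \<le> m powr p" using mB \<theta> Bq p by (intro powr_mono2) auto
        finally show ?thesis by simp
      qed
      also have "lam * (om * m) \<le> m powr p / 2"
      proof -
        have "b0 powr (p - 1) \<le> m powr (p - 1)" using mb0 pos p by (intro powr_mono2) auto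
        then have "b0 powr (p - 1) * m \<le> m powr (p - 1) * m" using mpos by (intro mult_right_mono) auto
        also have "\<dots> = m powr p" using mpos by (simp add: powr_mult_base mult.commute)
        finally show ?thesis using lam_pos by (simp add: om_def)
      qed
      finally have "m powr p \<le> 0" by simp
      then show False using mpos by simp
    qed
  qed
qed

end

section \<open>Explicit barriers\<close>

lemma barrier_exponent_bound:
  fixes d m k :: real
  assumes "0 < d" "0 < m" "0 \<le> k"
  obtains C where "0 < C"
    "\<And>y. 0 < y \<Longrightarrow> y < 1 \<Longrightarrow> 16 * (m * y * (1 - y) + m * (m + 1) * y\<^sup>2) - d * (1 - y)\<^sup>2 \<le> C * y powr k"
proof -
  define A where "A = 16 * m * (m + 2)"
  have A: "0 < A" using assms by (simp add: A_def)
  define y0 where "y0 = min (1 / 2) (d / (4 * A))"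
  have y0: "0 < y0" "y0 \<le> 1 / 2" "y0 \<le> d / (4 * A)" using A assms by (auto simp: y0_def)
  show thesis
  proof (rule that)
    show "0 < A * y0 powr (- k)" using A y0 by simp
    fix y :: real assume y: "0 < y" "y < 1"
    have "y * (1 - y) \<le> y" "y\<^sup>2 \<le> y" using y by (auto simp: power2_eq_square mult_le_cancel_left1)
    then have "m * (y * (1 - y)) + m * (m + 1) * y\<^sup>2 \<le> m * y + m * (m + 1) * y"
      using assms by (intro add_mono mult_left_mono) auto
    then have E: "16 * (m * y * (1 - y) + m * (m + 1) * y\<^sup>2) \<le> A * y"
      unfolding A_def by (simp add: algebra_simps)
    show "16 * (m * y * (1 - y) + m * (m + 1) * y\<^sup>2) - d * (1 - y)\<^sup>2 \<le> A * y0 powr (- k) * y powr k"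
    proof (cases "y \<le> y0")
      case True
      have "A * y \<le> A * (d / (4 * A))" using True y0 A by (intro mult_left_mono) auto
      also have "\<dots> = d * (1 / 2)\<^sup>2" using A by (simp add: power2_eq_square)
      also have "\<dots> \<le> d * (1 - y)\<^sup>2" using True y0 assms by (intro mult_left_mono power_mono) auto
      finally have "16 * (m * y * (1 - y) + m * (m + 1) * y\<^sup>2) - d * (1 - y)\<^sup>2 \<le> 0" using E by linarith
      also have "0 \<le> A * y0 powr (- k) * y powr k" using A by simp
      finally show ?thesis .
    next
      case False
      have "y0 powr k \<le> y powr k" using False y0 assms by (intro powr_mono2) auto
      then have "y0 powr (- k) * y0 powr k \<le> y0 powr (- k) * y powr k" by (intro mult_left_mono) auto
      then have "1 \<le> y0 powr (- k) * y powr k" using y0 by (simp flip: powr_add)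
      then have "A * 1 \<le> A * (y0 powr (- k) * y powr k)" using A by (intro mult_left_mono) auto
      moreover have "A * y \<le> A" using A y by simp
      moreover have "0 \<le> d * (1 - y)\<^sup>2" using assms by simp
      ultimately show ?thesis using E by (simp add: mult.assoc)
    qed
  qed
qed

context heis_super
begin

lemma V_le: "0 < nn z \<Longrightarrow> 0 \<le> aa z / nn z" "0 < nn z \<Longrightarrow> aa z / nn z \<le> nn z powr (- (1 / 2))" for z :: "'n st"
proof -
  assume n: "0 < nn z"
  show "0 \<le> aa z / nn z" by (rule divide_nonneg_pos[OF hz_nonneg n])
  have "aa z \<le> sqrt (nn z)" using hz_le_hn[of "snd z"] by (simp add: real_le_rsqrt)
  then have "aa z / nn z \<le> sqrt (nn z) / nn z" using n by (intro divide_right_mono) auto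
  also have "\<dots> = nn z powr (1 / 2) / nn z powr 1" using n by (simp add: powr_half_sqrt)
  also have "\<dots> = nn z powr (- (1 / 2))" by (simp only: powr_diff[symmetric]) simp
  finally show "aa z / nn z \<le> nn z powr (- (1 / 2))" .
qed

lemma barrier_profile:
  fixes Y :: "'n st \<Rightarrow> real" and s m :: real and \<Omega> :: "'n st set"
  assumes s: "s = 1 \<or> s = -1" and o: "open \<Omega>" and \<Omega>: "\<And>z. z \<in> \<Omega> \<Longrightarrow> 0 < nn z \<and> Y z < 1"
    and Y: "\<And>z. z \<in> \<Omega> \<Longrightarrow> Y z = c0 * nn z powr s"
    and F: "F = (\<lambda>z. nn z powr (- (real CARD('n)) / 4) * (1 - Y z) powr (- m))"
  obtains Fa Fw where "cyl \<Omega> F (\<lambda>z. 0) Fa Fw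
     (\<lambda>z. F z * (aa z / nn z) * (16 * (m * Y z * (1 - Y z) + m * (m + 1) * (Y z)\<^sup>2) - (real CARD('n))\<^sup>2 * (1 - Y z)\<^sup>2) / (1 - Y z)\<^sup>2)"
proof -
  have sub: "\<Omega> \<subseteq> {z. 0 < nn z}" using \<Omega> by auto
  let ?n = "\<lambda>c z::'n st. nn z powr c"
  have cY: "cyl \<Omega> Y (\<lambda>z. 0) (\<lambda>z. c0 * (s * ?n (s - 1) z * (2 * aa z))) (\<lambda>z. c0 * (s * ?n (s - 1) z * (2 * ww z)))
     (\<lambda>z. c0 * (8 * s * aa z * ?n (s - 1) z * ((real CARD('n)) + 2 * s)))"
    by (rule cyl_eq[OF cyl_mult[OF cyl_const[OF o] cyl_subset[OF cyl_n_powr o sub]]]) (auto simp: Y)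
  have cg: "cyl \<Omega> (\<lambda>z. (1 - Y z) powr (- m)) (\<lambda>z. m * (1 - Y z) powr (- m - 1) * 0)
     (\<lambda>z. m * (1 - Y z) powr (- m - 1) * (c0 * (s * ?n (s - 1) z * (2 * aa z))))
     (\<lambda>z. m * (1 - Y z) powr (- m - 1) * (c0 * (s * ?n (s - 1) z * (2 * ww z))))
     (\<lambda>z. m * (1 - Y z) powr (- m - 1) * (c0 * (8 * s * aa z * ?n (s - 1) z * ((real CARD('n)) + 2 * s)))
       + m * (m + 1) * (1 - Y z) powr (- m - 2) * (4 * aa z * ((c0 * (s * ?n (s - 1) z * (2 * aa z)))\<^sup>2 + (c0 * (s * ?n (s - 1) z * (2 * ww z)))\<^sup>2)))"
  proof (rule cyl_comp[OF cY, where V="{..<1}" and g="\<lambda>y. (1 - y) powr (- m)"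
      and g'="\<lambda>y. m * (1 - y) powr (- m - 1)" and g''="\<lambda>y. m * (m + 1) * (1 - y) powr (- m - 2)"])
    show "Ck 3 {..<1} (\<lambda>y::real. (1 - y) powr (- m))"
      by (rule Ck_comp[where g="\<lambda>x. x powr (- m)", OF _ Ck_diff[OF _ Ck_const Ck_id] _ Ck_powr]) auto
    show "((\<lambda>y. (1 - y) powr (- m)) has_real_derivative m * (1 - y) powr (- m - 1)) (at y)" if "y \<in> {..<1}" for y
      using that by (auto intro!: derivative_eq_intros)
    show "((\<lambda>y. m * (1 - y) powr (- m - 1)) has_real_derivative m * (m + 1) * (1 - y) powr (- m - 2)) (at y)" if "y \<in> {..<1}" for y
      using that by (auto intro!: derivative_eq_intros simp: algebra_simps)
  qed (use \<Omega> in auto)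
  have cn: "cyl \<Omega> (?n (- (real CARD('n)) / 4)) (\<lambda>z. 0) (\<lambda>z. - (real CARD('n)) / 4 * ?n (- (real CARD('n)) / 4 - 1) z * (2 * aa z)) (\<lambda>z. - (real CARD('n)) / 4 * ?n (- (real CARD('n)) / 4 - 1) z * (2 * ww z))
    (\<lambda>z. 8 * (- (real CARD('n)) / 4) * aa z * ?n (- (real CARD('n)) / 4 - 1) z * ((real CARD('n)) + 2 * (- (real CARD('n)) / 4)))"
    by (rule cyl_subset[OF cyl_n_powr o sub])
  show thesis
  proof (rule that, rule cyl_eq[OF cyl_mult[OF cn cg]])
    show "F z = ?n (- (real CARD('n)) / 4) z * (1 - Y z) powr (- m)" for z by (simp add: F)
    fix z assume z: "z \<in> \<Omega>"
    have n: "0 < nn z" and y: "0 < 1 - Y z" using \<Omega>[OF z] by auto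
    define V where "V = aa z / nn z"
    define P where "P = ?n (- (real CARD('n)) / 4) z"
    define g where "g = (1 - Y z) powr (- m - 2)"
    have a: "aa z = V * nn z" using n by (simp add: V_def)
    have g1: "(1 - Y z) powr (- m - 1) = g * (1 - Y z)" "(1 - Y z) powr (- m) = g * (1 - Y z)\<^sup>2"
    proof -
      have e: "- m - 1 = (- m - 2) + 1" "- m = (- m - 2) + 2" by simp_all
      show "(1 - Y z) powr (- m - 1) = g * (1 - Y z)"
        unfolding g_def e(1) powr_add using y by simp
      show "(1 - Y z) powr (- m) = g * (1 - Y z)\<^sup>2"
        unfolding g_def by (subst e(2), subst powr_add) (use y in simp)
    qed
    have P1: "?n (- (real CARD('n)) / 4 - 1) z = P / nn z" using n by (simp add: P_def powr_diff)
    have Y1: "c0 * ?n (s - 1) z = Y z / nn z" using n Y[OF z] by (simp add: powr_diff)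
    have nw: "(aa z)\<^sup>2 + (ww z)\<^sup>2 = nn z" by (simp add: hn_def)
    have s2: "s * s = 1" using s by auto
    have t1: "c0 * (8 * s * aa z * ?n (s - 1) z * ((real CARD('n)) + 2 * s)) = 8 * V * Y z * (s * (real CARD('n)) + 2)"
    proof -
      have "c0 * (8 * s * aa z * ?n (s - 1) z * ((real CARD('n)) + 2 * s)) = 8 * aa z * (c0 * ?n (s - 1) z) * (s * (real CARD('n)) + 2 * (s * s))"
        by (simp add: algebra_simps)
      then show ?thesis unfolding Y1 s2 a using n by simp
    qed
    have t2: "4 * aa z * ((c0 * (s * ?n (s - 1) z * (2 * aa z)))\<^sup>2 + (c0 * (s * ?n (s - 1) z * (2 * ww z)))\<^sup>2) = 16 * V * (Y z)\<^sup>2"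
    proof -
      have "4 * aa z * ((c0 * (s * ?n (s - 1) z * (2 * aa z)))\<^sup>2 + (c0 * (s * ?n (s - 1) z * (2 * ww z)))\<^sup>2)
        = 16 * aa z * (c0 * ?n (s - 1) z)\<^sup>2 * (s * s) * ((aa z)\<^sup>2 + (ww z)\<^sup>2)"
        by (simp add: algebra_simps power2_eq_square)
      also have "\<dots> = 16 * V * (Y z)\<^sup>2" unfolding Y1 s2 nw unfolding a using n by (simp add: power2_eq_square)
      finally show ?thesis .
    qed
    have t3: "8 * aa z * (- (real CARD('n)) / 4 * ?n (- (real CARD('n)) / 4 - 1) z * (2 * aa z) * (m * (g * (1 - Y z)) * (c0 * (s * ?n (s - 1) z * (2 * aa z))))
         + - (real CARD('n)) / 4 * ?n (- (real CARD('n)) / 4 - 1) z * (2 * ww z) * (m * (g * (1 - Y z)) * (c0 * (s * ?n (s - 1) z * (2 * ww z)))))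
      = - 8 * (real CARD('n)) * s * P * V * Y z * m * g * (1 - Y z)"
    proof -
      have "8 * aa z * (- (real CARD('n)) / 4 * ?n (- (real CARD('n)) / 4 - 1) z * (2 * aa z) * (m * (g * (1 - Y z)) * (c0 * (s * ?n (s - 1) z * (2 * aa z))))
         + - (real CARD('n)) / 4 * ?n (- (real CARD('n)) / 4 - 1) z * (2 * ww z) * (m * (g * (1 - Y z)) * (c0 * (s * ?n (s - 1) z * (2 * ww z)))))
        = - 8 * (real CARD('n)) * s * aa z * ?n (- (real CARD('n)) / 4 - 1) z * m * g * (1 - Y z) * (c0 * ?n (s - 1) z) * ((aa z)\<^sup>2 + (ww z)\<^sup>2)"
        by (simp add: algebra_simps power2_eq_square)
      also have "\<dots> = - 8 * (real CARD('n)) * s * P * V * Y z * m * g * (1 - Y z)" unfolding Y1 P1 nw unfolding a using n by simp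
      finally show ?thesis .
    qed
    have t4: "8 * (- (real CARD('n)) / 4) * aa z * ?n (- (real CARD('n)) / 4 - 1) z * ((real CARD('n)) + 2 * (- (real CARD('n)) / 4)) = - (real CARD('n))\<^sup>2 * P * V"
      unfolding P1 a using n by (simp add: power2_eq_square)
    have Fz: "F z = P * (g * (1 - Y z)\<^sup>2)" by (simp add: F P_def g1)
    show "F z * (aa z / nn z) * (16 * (m * Y z * (1 - Y z) + m * (m + 1) * (Y z)\<^sup>2) - (real CARD('n))\<^sup>2 * (1 - Y z)\<^sup>2) / (1 - Y z)\<^sup>2
      = ?n (- (real CARD('n)) / 4) z * (m * (1 - Y z) powr (- m - 1) * (c0 * (8 * s * aa z * ?n (s - 1) z * ((real CARD('n)) + 2 * s)))
       + m * (m + 1) * (1 - Y z) powr (- m - 2) * (4 * aa z * ((c0 * (s * ?n (s - 1) z * (2 * aa z)))\<^sup>2 + (c0 * (s * ?n (s - 1) z * (2 * ww z)))\<^sup>2)))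
       + 8 * (- (real CARD('n)) / 4) * aa z * ?n (- (real CARD('n)) / 4 - 1) z * ((real CARD('n)) + 2 * (- (real CARD('n)) / 4)) * (1 - Y z) powr (- m)
       + 8 * aa z * (- (real CARD('n)) / 4 * ?n (- (real CARD('n)) / 4 - 1) z * (2 * aa z) * (m * (1 - Y z) powr (- m - 1) * (c0 * (s * ?n (s - 1) z * (2 * aa z))))
         + - (real CARD('n)) / 4 * ?n (- (real CARD('n)) / 4 - 1) z * (2 * ww z) * (m * (1 - Y z) powr (- m - 1) * (c0 * (s * ?n (s - 1) z * (2 * ww z)))))"
    proof -
      have D: "P * (g * (1 - Y z)\<^sup>2) * V * x / (1 - Y z)\<^sup>2 = P * g * V * x" for x using y by simp
      show ?thesis
        unfolding g1 t1 t2 t3 t4 Fz g_def[symmetric] P_def[symmetric] V_def[symmetric] D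
        by (simp add: algebra_simps power2_eq_square)
    qed
  qed auto
qed


text \<open>Both barriers are \<open>\<rho>^(-N)\<close>, the critical Hardy profile, times a power that blows up on a Koranyi sphere:
\<open>n = m0\<close> for the inner and \<open>n = m1\<close> for the outer one. The powers of \<open>m0\<close> and \<open>m1\<close> in front make the constants in
\<open>barrier_inequalities\<close> independent of the spheres.\<close>

definition inner_barrier :: "real \<Rightarrow> real \<Rightarrow> real \<Rightarrow> 'n st \<Rightarrow> real" where
  "inner_barrier C m m0 = (\<lambda>z. C * m0 powr ((real CARD('n) - 2 / (p - 1)) / 4) *
     (nn z powr (- real CARD('n) / 4) * (1 - m0 / nn z) powr (- m)))"

definition outer_barrier :: "real \<Rightarrow> real \<Rightarrow> real \<Rightarrow> 'n st \<Rightarrow> real" where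
  "outer_barrier C m m1 = (\<lambda>z. C * m1 powr ((real CARD('n) - m) / 4) *
     (nn z powr (- real CARD('n) / 4) * (1 - nn z / m1) powr (- m)))"

text \<open>The factor by which \<open>\<Delta> + lam a / n\<close> acts on a barrier, up to \<open>a / (n (1 - y)^2)\<close>. It is negative for
small \<open>y\<close>, thanks to \<open>lam < N^2\<close>, and the blow-up absorbs it for \<open>y\<close> near \<open>1\<close>.\<close>

definition barrier_excess :: "real \<Rightarrow> real \<Rightarrow> real \<Rightarrow> real" where
  "barrier_excess N m y = 16 * (m * y * (1 - y) + m * (m + 1) * y\<^sup>2) - (N\<^sup>2 - lam) * (1 - y)\<^sup>2"

lemma inner_barrier_cyl:
  fixes m m0 C :: real
  assumes "0 < m0" and o: "open \<Omega>" and \<Omega>: "\<And>z. z \<in> \<Omega> \<Longrightarrow> m0 < nn z"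
  obtains Fa Fw where "cyl \<Omega> (inner_barrier C m m0) (\<lambda>z. 0) Fa Fw
     (\<lambda>z. inner_barrier C m m0 z * (aa z / nn z) * barrier_excess (real CARD('n)) m (m0 / nn z) / (1 - m0 / nn z)\<^sup>2 - lam * (aa z / nn z) * inner_barrier C m m0 z)"
proof -
  have \<Omega>': "0 < nn z \<and> m0 / nn z < 1" if "z \<in> \<Omega>" for z using \<Omega>[OF that] assms(1) by simp
  have Y: "m0 / nn z = m0 * nn z powr - 1" if "z \<in> \<Omega>" for z :: "'n st"
    using \<Omega>'[OF that] by (simp add: powr_minus_divide)
  obtain Fa Fw where c: "cyl \<Omega> (\<lambda>z. nn z powr (- real CARD('n) / 4) * (1 - m0 / nn z) powr (- m)) (\<lambda>z. 0) Fa Fw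
     (\<lambda>z. nn z powr (- real CARD('n) / 4) * (1 - m0 / nn z) powr (- m) * (aa z / nn z) * (16 * (m * (m0 / nn z) * (1 - m0 / nn z) + m * (m + 1) * (m0 / nn z)\<^sup>2) - (real CARD('n))\<^sup>2 * (1 - m0 / nn z)\<^sup>2) / (1 - m0 / nn z)\<^sup>2)"
    using barrier_profile[of "-1", OF _ o \<Omega>' Y refl, where m=m] by auto
  show thesis
  proof (rule that, rule cyl_eq[OF cyl_mult[OF cyl_const[OF o, of "C * m0 powr ((real CARD('n) - 2 / (p - 1)) / 4)"] c]])
    fix z assume "z \<in> \<Omega>"
    from \<Omega>'[OF this] have "1 - m0 / nn z \<noteq> 0" by linarith
    then have "(1 - m0 / nn z)\<^sup>2 \<noteq> 0" by (rule power_not_zero)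
    then show "inner_barrier C m m0 z * (aa z / nn z) * barrier_excess (real CARD('n)) m (m0 / nn z) / (1 - m0 / nn z)\<^sup>2 - lam * (aa z / nn z) * inner_barrier C m m0 z
      = C * m0 powr ((real CARD('n) - 2 / (p - 1)) / 4) * (nn z powr (- real CARD('n) / 4) * (1 - m0 / nn z) powr (- m) * (aa z / nn z) * (16 * (m * (m0 / nn z) * (1 - m0 / nn z) + m * (m + 1) * (m0 / nn z)\<^sup>2) - (real CARD('n))\<^sup>2 * (1 - m0 / nn z)\<^sup>2) / (1 - m0 / nn z)\<^sup>2)
       + 0 * (nn z powr (- real CARD('n) / 4) * (1 - m0 / nn z) powr (- m)) + 8 * aa z * (0 * Fa z + 0 * Fw z)"
      unfolding barrier_excess_def inner_barrier_def by (simp add: diff_divide_distrib left_diff_distrib right_diff_distrib)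
  qed (auto simp: inner_barrier_def)
qed

lemma outer_barrier_cyl:
  fixes m m1 C :: real
  assumes "0 < m1" and o: "open \<Omega>" and \<Omega>: "\<And>z. z \<in> \<Omega> \<Longrightarrow> 0 < nn z \<and> nn z < m1"
  obtains Fa Fw where "cyl \<Omega> (outer_barrier C m m1) (\<lambda>z. 0) Fa Fw
     (\<lambda>z. outer_barrier C m m1 z * (aa z / nn z) * barrier_excess (real CARD('n)) m (nn z / m1) / (1 - nn z / m1)\<^sup>2 - lam * (aa z / nn z) * outer_barrier C m m1 z)"
proof -
  have \<Omega>': "0 < nn z \<and> nn z / m1 < 1" if "z \<in> \<Omega>" for z using \<Omega>[OF that] assms(1) by simp
  have Y: "nn z / m1 = (1 / m1) * nn z powr 1" if "z \<in> \<Omega>" for z :: "'n st"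
    using \<Omega>'[OF that] by simp
  obtain Fa Fw where c: "cyl \<Omega> (\<lambda>z. nn z powr (- real CARD('n) / 4) * (1 - nn z / m1) powr (- m)) (\<lambda>z. 0) Fa Fw
     (\<lambda>z. nn z powr (- real CARD('n) / 4) * (1 - nn z / m1) powr (- m) * (aa z / nn z) * (16 * (m * (nn z / m1) * (1 - nn z / m1) + m * (m + 1) * (nn z / m1)\<^sup>2) - (real CARD('n))\<^sup>2 * (1 - nn z / m1)\<^sup>2) / (1 - nn z / m1)\<^sup>2)"
    using barrier_profile[of "1", OF _ o \<Omega>' Y refl, where m=m] by auto
  show thesis
  proof (rule that, rule cyl_eq[OF cyl_mult[OF cyl_const[OF o, of "C * m1 powr ((real CARD('n) - m) / 4)"] c]])
    fix z assume "z \<in> \<Omega>"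
    from \<Omega>'[OF this] have "1 - nn z / m1 \<noteq> 0" by linarith
    then have "(1 - nn z / m1)\<^sup>2 \<noteq> 0" by (rule power_not_zero)
    then show "outer_barrier C m m1 z * (aa z / nn z) * barrier_excess (real CARD('n)) m (nn z / m1) / (1 - nn z / m1)\<^sup>2 - lam * (aa z / nn z) * outer_barrier C m m1 z
      = C * m1 powr ((real CARD('n) - m) / 4) * (nn z powr (- real CARD('n) / 4) * (1 - nn z / m1) powr (- m) * (aa z / nn z) * (16 * (m * (nn z / m1) * (1 - nn z / m1) + m * (m + 1) * (nn z / m1)\<^sup>2) - (real CARD('n))\<^sup>2 * (1 - nn z / m1)\<^sup>2) / (1 - nn z / m1)\<^sup>2)
       + 0 * (nn z powr (- real CARD('n) / 4) * (1 - nn z / m1) powr (- m)) + 8 * aa z * (0 * Fa z + 0 * Fw z)"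
      unfolding barrier_excess_def outer_barrier_def by (simp add: diff_divide_distrib left_diff_distrib right_diff_distrib)
  qed (auto simp: outer_barrier_def)
qed

text \<open>The exponent \<open>m\<close> exceeds \<open>N\<close>, so that the outer barrier fades as its sphere expands, and satisfies
\<open>m (p - 1) \<ge> 2\<close>, so that near the sphere the \<open>p\<close>-th power of a barrier dominates the factor \<open>(1 - y)^(-2)\<close>
gained by the operator.\<close>

lemma barrier_inequalities:
  defines "m \<equiv> real CARD('n) + 1 + 2 / (p - 1)"
  obtains C K where "0 < C" "0 < K"
    "\<And>m0 z. 0 < m0 \<Longrightarrow> m0 < nn z \<Longrightarrow>
       inner_barrier C m m0 z * (aa z / nn z) * barrier_excess (real CARD('n)) m (m0 / nn z) / (1 - m0 / nn z)\<^sup>2 \<le> inner_barrier C m m0 z powr p / 4"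
    "\<And>m1 z. 0 < nn z \<Longrightarrow> nn z < m1 \<Longrightarrow>
       outer_barrier C m m1 z * (aa z / nn z) * barrier_excess (real CARD('n)) m (nn z / m1) / (1 - nn z / m1)\<^sup>2
         \<le> K * outer_barrier C m m1 z + outer_barrier C m m1 z powr p / 4"
proof -
  define N where "N = real CARD('n)"
  define d where "d = N\<^sup>2 - lam"
  define k where "k = N * (p - 1) / 4"
  have d: "0 < d" using lam_pos by (simp add: d_def N_def)
  have p1: "0 < p - 1" using p by simp
  have m: "0 < m" "N < m" "2 \<le> m * (p - 1)"
  proof -
    have e: "2 / (p - 1) * (p - 1) = 2"
      by (subst times_divide_eq_left, rule nonzero_mult_div_cancel_right) (use p1 in simp)
    have "m * (p - 1) = (N + 1) * (p - 1) + 2"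
      unfolding m_def N_def distrib_right[of "real CARD('n) + 1" "2 / (p - 1)"] e ..
    then show "2 \<le> m * (p - 1)" using p1 by (simp add: N_def)
    show "0 < m" "N < m" using p1 by (auto simp: m_def N_def add_nonneg_pos)
  qed
  have k: "0 \<le> k" using p1 by (simp add: k_def N_def)
  obtain C1 where C1: "0 < C1" "\<And>y. 0 < y \<Longrightarrow> y < 1 \<Longrightarrow> barrier_excess (real CARD('n)) m y \<le> C1 * y powr k"
    using barrier_exponent_bound[OF d m(1) k] unfolding barrier_excess_def d_def N_def by blast
  obtain C2 where C2: "0 < C2" "\<And>y. 0 < y \<Longrightarrow> y < 1 \<Longrightarrow> barrier_excess (real CARD('n)) m y \<le> C2 * y powr (1/2)"
    using barrier_exponent_bound[OF d m(1), of "1/2"] unfolding barrier_excess_def d_def N_def by auto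
  define C where "C = (4 * (C1 + C2)) powr (1 / (p - 1))"
  have C: "0 < C" "C powr (p - 1) = 4 * (C1 + C2)" using C1 C2 p1 by (auto simp: C_def powr_powr)
  have pw: "b * x \<le> b powr p / 4" if "0 < b" "x \<le> b powr (p - 1) / 4" for b x :: real
  proof -
    have "b * x \<le> b * (b powr (p - 1) / 4)" using that by (intro mult_left_mono) auto
    then show ?thesis using that by (simp add: powr_mult_base)
  qed
  show thesis
  proof (rule that[OF C(1) C2(1)])
    fix m0 :: real and z :: "'n st" assume z: "0 < m0" "m0 < nn z"
    define n where "n = nn z"
    define y where "y = m0 / n"
    have n: "0 < n" and y: "0 < y" "y < 1" and m0: "m0 = y * n" using z by (auto simp: n_def y_def)
    have b: "inner_barrier C m m0 z = C * m0 powr ((N - 2 / (p - 1)) / 4) * (n powr (- N / 4) * (1 - y) powr (- m))"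
      by (simp add: inner_barrier_def N_def n_def y_def)
    have bpos: "0 < inner_barrier C m m0 z" unfolding b using C y n z by simp
    have "inner_barrier C m m0 z powr (p - 1) = C powr (p - 1) * (m0 powr ((N - 2 / (p - 1)) / 4 * (p - 1)) * (n powr (- N / 4 * (p - 1)) * (1 - y) powr (- m * (p - 1))))"
      unfolding b using C y n z by (simp add: powr_mult powr_powr)
    also have "(N - 2 / (p - 1)) / 4 * (p - 1) = k - 1 / 2" using p1 by (simp add: k_def field_simps)
    also have "m0 powr (k - 1 / 2) = y powr (k - 1 / 2) * n powr (k - 1 / 2)" unfolding m0 using y n by (simp add: powr_mult)
    also have "- N / 4 * (p - 1) = - k" by (simp add: k_def)
    also have "y powr (k - 1 / 2) * n powr (k - 1 / 2) * (n powr (- k) * (1 - y) powr (- m * (p - 1)))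
       = y powr (k - 1 / 2) * ((n powr (k - 1 / 2) * n powr (- k)) * (1 - y) powr (- m * (p - 1)))" by simp
    also have "n powr (k - 1 / 2) * n powr (- k) = n powr (- (1 / 2))" by (simp flip: powr_add)
    finally have e: "inner_barrier C m m0 z powr (p - 1) = 4 * (C1 + C2) * (y powr (k - 1 / 2) * (n powr (- (1 / 2)) * (1 - y) powr (- m * (p - 1))))"
      by (simp add: C)
    have "(aa z / nn z) * barrier_excess (real CARD('n)) m y / (1 - y)\<^sup>2 \<le> (aa z / nn z) * (C1 * y powr k) / (1 - y)\<^sup>2"
      using V_le(1)[of z] n C1(2)[OF y] unfolding n_def by (intro divide_right_mono mult_left_mono) auto
    also have "\<dots> \<le> n powr (- (1 / 2)) * (C1 * y powr k) / (1 - y)\<^sup>2"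
      using V_le(2)[of z] n C1(1) unfolding n_def by (intro divide_right_mono mult_right_mono) auto
    also have "\<dots> = C1 * (y powr k * (n powr (- (1 / 2)) * (1 - y) powr (- 2)))"
      using y by (simp add: powr_minus_divide)
    also have "\<dots> \<le> (C1 + C2) * (y powr (k - 1 / 2) * (n powr (- (1 / 2)) * (1 - y) powr (- m * (p - 1))))"
    proof -
      have "y powr k \<le> y powr (k - 1 / 2)" using y by (intro powr_mono') auto
      moreover have "(1 - y) powr (- 2) \<le> (1 - y) powr (- m * (p - 1))" using y m by (intro powr_mono') auto
      ultimately show ?thesis using C1 C2 by (intro mult_mono mult_left_mono) auto
    qed
    finally have "(aa z / nn z) * barrier_excess (real CARD('n)) m y / (1 - y)\<^sup>2
      \<le> (C1 + C2) * (y powr (k - 1 / 2) * (n powr (- (1 / 2)) * (1 - y) powr (- m * (p - 1))))" .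
    then have "(aa z / nn z) * barrier_excess (real CARD('n)) m y / (1 - y)\<^sup>2 \<le> inner_barrier C m m0 z powr (p - 1) / 4"
      unfolding e by linarith
    from pw[OF bpos this]
    show "inner_barrier C m m0 z * (aa z / nn z) * barrier_excess (real CARD('n)) m (m0 / nn z) / (1 - m0 / nn z)\<^sup>2 \<le> inner_barrier C m m0 z powr p / 4"
      by (simp add: y_def n_def mult.assoc)
  next
    fix m1 :: real and z :: "'n st" assume z: "0 < nn z" "nn z < m1"
    define n where "n = nn z"
    define y where "y = n / m1"
    have n: "0 < n" "n < m1" "0 < m1" and y: "0 < y" "y < 1" using z by (auto simp: n_def y_def)
    define X where "X = m1 powr (- (1 / 4)) / (1 - y)"
    have X: "0 < X" using y n by (simp add: X_def)
    have b: "outer_barrier C m m1 z = C * m1 powr ((N - m) / 4) * (n powr (- N / 4) * (1 - y) powr (- m))"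
      by (simp add: outer_barrier_def N_def n_def y_def)
    have bpos: "0 < outer_barrier C m m1 z" unfolding b using C y n by simp
    have "C * X powr m \<le> outer_barrier C m m1 z"
    proof -
      have "X powr m = m1 powr (- m / 4) * (1 - y) powr (- m)"
        using y n by (simp add: X_def powr_divide powr_powr powr_minus_divide powr_mult)
      also have "m1 powr (- m / 4) = m1 powr ((N - m) / 4) * m1 powr (- N / 4)"
        by (simp flip: powr_add add: field_simps)
      finally have "C * X powr m = C * m1 powr ((N - m) / 4) * (m1 powr (- N / 4) * (1 - y) powr (- m))" by simp
      also have "\<dots> \<le> C * m1 powr ((N - m) / 4) * (n powr (- N / 4) * (1 - y) powr (- m))"
        using C n by (intro mult_left_mono mult_right_mono powr_mono2') (auto simp: N_def)
      finally show ?thesis unfolding b .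
    qed
    then have "(C * X powr m) powr (p - 1) \<le> outer_barrier C m m1 z powr (p - 1)"
      using C X p1 by (intro powr_mono2) auto
    moreover have "(C * X powr m) powr (p - 1) = 4 * (C1 + C2) * X powr (m * (p - 1))"
      using C X by (simp add: powr_mult powr_powr)
    ultimately have bX: "(C1 + C2) * X powr (m * (p - 1)) \<le> outer_barrier C m m1 z powr (p - 1) / 4" by linarith
    have "(aa z / nn z) * barrier_excess (real CARD('n)) m y / (1 - y)\<^sup>2 \<le> (aa z / nn z) * (C2 * y powr (1/2)) / (1 - y)\<^sup>2"
      using V_le(1)[of z] n C2(2)[OF y] unfolding n_def by (intro divide_right_mono mult_left_mono) auto
    also have "\<dots> \<le> n powr (- (1 / 2)) * (C2 * y powr (1/2)) / (1 - y)\<^sup>2"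
      using V_le(2)[of z] n C2(1) unfolding n_def by (intro divide_right_mono mult_right_mono) auto
    also have "\<dots> = C2 * X\<^sup>2"
    proof -
      have "n powr (- (1 / 2)) * y powr (1 / 2) = (n powr (- (1 / 2)) * n powr (1 / 2)) / m1 powr (1 / 2)"
        using n by (simp add: y_def powr_divide)
      also have "\<dots> = m1 powr (- (1 / 2))" using n by (simp add: powr_minus_divide)
      also have "\<dots> = (m1 powr (- (1 / 4)))\<^sup>2" using n by (simp add: power2_eq_square flip: powr_add)
      finally show ?thesis by (simp add: X_def power_divide)
    qed
    also have "\<dots> \<le> C2 + outer_barrier C m m1 z powr (p - 1) / 4"
    proof (cases "X \<le> 1")
      case True
      then have "C2 * X\<^sup>2 \<le> C2 * 1" using C2 X by (intro mult_left_mono power_le_one) auto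
      then show ?thesis using powr_ge_zero[of "outer_barrier C m m1 z" "p - 1"] by linarith
    next
      case False
      have "X\<^sup>2 = X powr 2" using X by simp
      also have "\<dots> \<le> X powr (m * (p - 1))" using False m by (intro powr_mono) auto
      finally have "C2 * X\<^sup>2 \<le> (C1 + C2) * X powr (m * (p - 1))" using C1 C2 by (intro mult_mono) auto
      then show ?thesis using bX C2 by linarith
    qed
    finally have "(aa z / nn z) * barrier_excess (real CARD('n)) m y / (1 - y)\<^sup>2 - C2 \<le> outer_barrier C m m1 z powr (p - 1) / 4" by linarith
    then have "outer_barrier C m m1 z * ((aa z / nn z) * barrier_excess (real CARD('n)) m y / (1 - y)\<^sup>2)
         \<le> C2 * outer_barrier C m m1 z + outer_barrier C m m1 z powr p / 4"
    proof -
      have "b * x \<le> c * b + w" if "b * (x - c) \<le> w" for b x c w :: real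
        using that by (simp add: algebra_simps)
      from this[OF pw[OF bpos \<open>_ - C2 \<le> _\<close>]] show ?thesis .
    qed
    then show "outer_barrier C m m1 z * (aa z / nn z) * barrier_excess (real CARD('n)) m (nn z / m1) / (1 - nn z / m1)\<^sup>2
         \<le> C2 * outer_barrier C m m1 z + outer_barrier C m m1 z powr p / 4"
      by (simp add: y_def n_def mult.assoc)
  qed
qed


lemma inner_barrier_pos: "0 < C \<Longrightarrow> 0 < m0 \<Longrightarrow> m0 < nn z \<Longrightarrow> 0 < inner_barrier C m m0 z"
  by (auto simp: inner_barrier_def)

lemma outer_barrier_pos: "0 < C \<Longrightarrow> 0 < nn z \<Longrightarrow> nn z < m1 \<Longrightarrow> 0 < outer_barrier C m m1 z"
  by (auto simp: outer_barrier_def)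

lemma powr_blow_up:
  fixes D m M :: real
  assumes "0 < D" "0 < m"
  obtains \<delta> where "0 < \<delta>" "\<delta> < 1" "\<And>x. 0 < x \<Longrightarrow> x < \<delta> \<Longrightarrow> M \<le> D * x powr (- m)"
proof -
  define r where "r = \<bar>M\<bar> / D + 1"
  have r: "0 < r" "M \<le> D * r" using assms by (auto simp: r_def distrib_left add_nonneg_pos)
  define \<delta> where "\<delta> = min (1/2) (r powr (- 1 / m))"
  show thesis
  proof (rule that)
    show "0 < \<delta>" "\<delta> < 1" using r by (auto simp: \<delta>_def)
    fix x assume x: "0 < x" "x < \<delta>"
    have "r = (r powr (- 1 / m)) powr (- m)" using r assms by (simp add: powr_powr)
    also have "\<dots> \<le> x powr (- m)" using x assms by (intro powr_mono2') (auto simp: \<delta>_def)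
    finally have "D * r \<le> D * x powr (- m)" using assms by (intro mult_left_mono) auto
    then show "M \<le> D * x powr (- m)" using r by linarith
  qed
qed

text \<open>At a fixed distance from the origin the inner barrier is of order \<open>m0^((N - q) / 4)\<close> and the outer one
of order \<open>m1^((N - m) / 4)\<close>. Both tend to zero as \<open>m0\<close> shrinks and \<open>m1\<close> grows, because
\<open>q < \<mu> < N < m\<close>.\<close>

lemma mollified_lower_limit:
  assumes S: "S < T" and n: "0 < n0" "n0 < n1" and tau: "0 < \<tau>"
  obtains e0 where "0 < e0" "\<And>e z. 0 < e \<Longrightarrow> e < e0 \<Longrightarrow> n0 \<le> nn z \<Longrightarrow> nn z \<le> n1 \<Longrightarrow> -1 \<le> fst z \<Longrightarrow> fst z \<le> S \<Longrightarrow> - \<tau> \<le> mollified e z"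
proof -
  define N where "N = real CARD('n)"
  define m where "m = real CARD('n) + 1 + 2 / (p - 1)"
  have p1: "0 < p - 1" using p by simp
  have m: "0 < m" "N < m" using p1 by (auto simp: m_def N_def add_nonneg_pos)
  have Nq: "0 < N - 2 / (p - 1)" using p mu by (simp add: N_def)
  obtain C K where CK: "0 < C" "0 < K"
    "\<And>m0 z. 0 < m0 \<Longrightarrow> m0 < nn z \<Longrightarrow>
       inner_barrier C m m0 z * (aa z / nn z) * barrier_excess (real CARD('n)) m (m0 / nn z) / (1 - m0 / nn z)\<^sup>2 \<le> inner_barrier C m m0 z powr p / 4"
    "\<And>m1 z. 0 < nn z \<Longrightarrow> nn z < m1 \<Longrightarrow>
       outer_barrier C m m1 z * (aa z / nn z) * barrier_excess (real CARD('n)) m (nn z / m1) / (1 - nn z / m1)\<^sup>2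
         \<le> K * outer_barrier C m m1 z + outer_barrier C m m1 z powr p / 4"
    using barrier_inequalities unfolding m_def by blast
  define L where "L = exp (K * (S + 1)) * (C * (n0 powr (- N / 4) * (1 / 2) powr (- m)))"
  have L: "0 < L" using CK n by (simp add: L_def)
  define \<eta> where "\<eta> = \<tau> / (2 * L)"
  have eta: "0 < \<eta>" "L * \<eta> = \<tau> / 2" using tau L by (auto simp: \<eta>_def)
  define s0 where "s0 = (N - 2 / (p - 1)) / 4"
  define s1 where "s1 = (m - N) / 4"
  have s: "0 < s0" "0 < s1" using Nq m by (auto simp: s0_def s1_def)
  define m0 where "m0 = min (n0 / 2) (\<eta> powr (1 / s0))"
  define m1 where "m1 = max (2 * n1) (\<eta> powr (- 1 / s1))"
  have m0: "0 < m0" "m0 \<le> n0 / 2" and m1: "0 < m1" "2 * n1 \<le> m1" and m01: "m0 < m1"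
    using n eta by (auto simp: m0_def m1_def)
  have m0s: "m0 powr s0 \<le> \<eta>"
  proof -
    have "m0 powr s0 \<le> (\<eta> powr (1 / s0)) powr s0" using m0 s by (intro powr_mono2) (auto simp: m0_def)
    then show ?thesis using s eta by (simp add: powr_powr)
  qed
  have m1s: "m1 powr (- s1) \<le> \<eta>"
  proof -
    have "m1 powr (- s1) \<le> (\<eta> powr (- 1 / s1)) powr (- s1)" using eta s by (intro powr_mono2') (auto simp: m1_def)
    then show ?thesis using s eta by (simp add: powr_powr)
  qed
  define \<Omega> where "\<Omega> = {z::'n st. m0 < nn z} \<inter> {z. nn z < m1}"
  have o: "open \<Omega>" unfolding \<Omega>_def by (intro open_Int open_nn_greater open_nn_less)
  have \<Omega>0: "\<And>z. z \<in> \<Omega> \<Longrightarrow> m0 < nn z" and \<Omega>1: "\<And>z. z \<in> \<Omega> \<Longrightarrow> 0 < nn z \<and> nn z < m1"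
    using m0 by (auto simp: \<Omega>_def)
  define b where "b z = inner_barrier C m m0 z + outer_barrier C m m1 z" for z
  define B where "B = (\<lambda>z. exp (K * (fst z + 1)) * b z)"
  obtain ia iw where ci: "cyl \<Omega> (inner_barrier C m m0) (\<lambda>z. 0) ia iw
     (\<lambda>z. inner_barrier C m m0 z * (aa z / nn z) * barrier_excess (real CARD('n)) m (m0 / nn z) / (1 - m0 / nn z)\<^sup>2 - lam * (aa z / nn z) * inner_barrier C m m0 z)"
    using inner_barrier_cyl[OF m0(1) o \<Omega>0] by blast
  obtain oa ow where co: "cyl \<Omega> (outer_barrier C m m1) (\<lambda>z. 0) oa ow
     (\<lambda>z. outer_barrier C m m1 z * (aa z / nn z) * barrier_excess (real CARD('n)) m (nn z / m1) / (1 - nn z / m1)\<^sup>2 - lam * (aa z / nn z) * outer_barrier C m m1 z)"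
    using outer_barrier_cyl[OF m1(1) o \<Omega>1] by blast
  have ct: "cyl \<Omega> (\<lambda>z. exp (K * (fst z + 1))) (\<lambda>z. K * exp (K * (fst z + 1)) * 1) (\<lambda>z. K * exp (K * (fst z + 1)) * 0) (\<lambda>z. K * exp (K * (fst z + 1)) * 0)
     (\<lambda>z. K * exp (K * (fst z + 1)) * 0 + K\<^sup>2 * exp (K * (fst z + 1)) * (4 * aa z * (0\<^sup>2 + 0\<^sup>2)))"
  proof (rule cyl_comp[OF cyl_t[OF o], where V=UNIV and g="\<lambda>t. exp (K * (t + 1))" and g'="\<lambda>t. K * exp (K * (t + 1))" and g''="\<lambda>t. K\<^sup>2 * exp (K * (t + 1))"])
    show "Ck 3 UNIV (\<lambda>t::real. exp (K * (t + 1)))"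
      by (rule Ck_comp[where g=exp, OF open_UNIV Ck_cmult[OF open_UNIV Ck_add[OF open_UNIV Ck_id Ck_const]] open_UNIV Ck_exp]) auto
    show "((\<lambda>t. exp (K * (t + 1))) has_real_derivative K * exp (K * (x + 1))) (at x)" for x
      by (auto intro!: derivative_eq_intros)
    show "((\<lambda>t. K * exp (K * (t + 1))) has_real_derivative K\<^sup>2 * exp (K * (x + 1))) (at x)" for x
      by (auto intro!: derivative_eq_intros simp: power2_eq_square)
  qed auto
  note cB = cyl_mult[OF ct cyl_add[OF ci co]]
  have dB: "dt B z = K * B z" and CB: "Ck 3 \<Omega> B"
    and LB: "Lap B z + lam * (aa z / nn z) * B z = exp (K * (fst z + 1)) *
      (inner_barrier C m m0 z * (aa z / nn z) * barrier_excess (real CARD('n)) m (m0 / nn z) / (1 - m0 / nn z)\<^sup>2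
      + outer_barrier C m m1 z * (aa z / nn z) * barrier_excess (real CARD('n)) m (nn z / m1) / (1 - nn z / m1)\<^sup>2)" if "z \<in> \<Omega>" for z
    using cB that unfolding cyl_def B_def b_def by (auto simp: algebra_simps)
  have CB: "Ck 2 \<Omega> B" using cB unfolding cyl_def B_def b_def by (blast intro: Ck32)
  have bp: "0 < inner_barrier C m m0 z" "0 < outer_barrier C m m1 z" if "z \<in> \<Omega>" for z
    using inner_barrier_pos[OF CK(1) m0(1) \<Omega>0[OF that]] outer_barrier_pos[OF CK(1)] \<Omega>1[OF that] by auto
  have Eb: "b z \<le> B z" if "z \<in> \<Omega>" "-1 \<le> fst z" for z
  proof -
    have "1 * b z \<le> exp (K * (fst z + 1)) * b z"
      using bp[OF that(1)] CK(2) that(2) by (intro mult_right_mono) (auto simp: b_def)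
    then show ?thesis by (simp add: B_def)
  qed
  have low: "D * m1 powr (- N / 4) \<le> D * nn z powr (- N / 4)" if "z \<in> \<Omega>" "0 \<le> D" for z D
    using \<Omega>1[OF that(1)] that(2) by (intro mult_left_mono powr_mono2') (auto simp: N_def)
  have one_le: "1 \<le> x powr (- m)" if "0 < x" "x \<le> 1" for x :: real
    using powr_mono2'[of "- m" x 1] that m by simp
  define b0 where "b0 = C * m1 powr ((N - m) / 4) * m1 powr (- N / 4)"
  obtain e0 where e0: "0 < e0" "\<And>e z. 0 < e \<Longrightarrow> e < e0 \<Longrightarrow> z \<in> \<Omega> \<Longrightarrow> -1 \<le> fst z \<Longrightarrow> fst z \<le> S \<Longrightarrow> - B z \<le> mollified e z"
  proof (rule mollified_lower_bound[OF S m0(1) m01, of B b0, folded \<Omega>_def])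
    show "Ck 2 \<Omega> B" by (rule CB)
    show "0 < b0" using CK m1 by (simp add: b0_def)
    show "b0 \<le> B z" if "z \<in> \<Omega>" "-1 \<le> fst z" for z
    proof -
      have "b0 \<le> C * m1 powr ((N - m) / 4) * nn z powr (- N / 4) * 1"
        unfolding b0_def using low[OF that(1), of "C * m1 powr ((N - m) / 4)"] CK by simp
      also have "\<dots> \<le> C * m1 powr ((N - m) / 4) * nn z powr (- N / 4) * (1 - nn z / m1) powr (- m)"
        using \<Omega>1[OF that(1)] CK m1 by (intro mult_left_mono one_le) auto
      also have "\<dots> = outer_barrier C m m1 z" by (simp add: outer_barrier_def N_def)
      also have "\<dots> \<le> b z" using bp[OF that(1)] by (simp add: b_def)
      also have "\<dots> \<le> B z" by (rule Eb[OF that])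
      finally show ?thesis .
    qed
    show "Lap B z - dt B z + lam * (aa z / nn z) * B z \<le> B z powr p / 4" if z: "z \<in> \<Omega>" "-1 \<le> fst z" for z
    proof -
      define e where "e = exp (K * (fst z + 1))"
      have e: "1 \<le> e" using CK(2) z(2) by (simp add: e_def)
      have "Lap B z - dt B z + lam * (aa z / nn z) * B z
        \<le> e * (inner_barrier C m m0 z powr p / 4 + (K * outer_barrier C m m1 z + outer_barrier C m m1 z powr p / 4)) - K * B z"
        using LB[OF z(1)] dB[OF z(1)] CK(3)[OF m0(1) \<Omega>0[OF z(1)]] CK(4)[of z m1] \<Omega>1[OF z(1)] e
          mult_left_mono[OF add_mono[OF CK(3)[OF m0(1) \<Omega>0[OF z(1)]] CK(4)[of z m1]], of e]
        unfolding e_def by (simp add: algebra_simps)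
      also have "\<dots> = e * (inner_barrier C m m0 z powr p + outer_barrier C m m1 z powr p) / 4 - e * K * inner_barrier C m m0 z"
        by (simp add: B_def b_def e_def algebra_simps)
      also have "\<dots> \<le> e * (inner_barrier C m m0 z powr p + outer_barrier C m m1 z powr p) / 4"
        using bp[OF z(1)] CK(2) e by simp
      also have "\<dots> \<le> e powr p * (b z powr p) / 4"
      proof -
        have "x powr p \<le> x * b z powr (p - 1)" if "0 < x" "x \<le> b z" for x
        proof -
          have "x powr p = x * x powr (p - 1)" using that by (simp add: powr_mult_base)
          also have "\<dots> \<le> x * b z powr (p - 1)" using that p1 by (intro mult_left_mono powr_mono2) auto
          finally show ?thesis .
        qed
        then have "inner_barrier C m m0 z powr p + outer_barrier C m m1 z powr p \<le> inner_barrier C m m0 z * b z powr (p - 1) + outer_barrier C m m1 z * b z powr (p - 1)"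
          using bp[OF z(1)] by (intro add_mono) (auto simp: b_def)
        also have "\<dots> = b z powr p"
          using bp[OF z(1)] by (simp add: b_def powr_mult_base flip: distrib_right)
        finally have "inner_barrier C m m0 z powr p + outer_barrier C m m1 z powr p \<le> b z powr p" .
        moreover have "e powr 1 \<le> e powr p" using e p by (intro powr_mono) auto
        ultimately show ?thesis using e by (intro divide_right_mono mult_mono) auto
      qed
      also have "e powr p * b z powr p = B z powr p" using bp[OF z(1)] by (simp add: B_def e_def b_def powr_mult)
      finally show ?thesis .
    qed
    fix M
    define D0 where "D0 = C * m0 powr s0 * m1 powr (- N / 4)"
    define D1 where "D1 = C * m1 powr ((N - m) / 4) * m1 powr (- N / 4)"
    have D: "0 < D0" "0 < D1" using CK m0 m1 by (auto simp: D0_def D1_def)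
    obtain \<delta>0 where d0: "0 < \<delta>0" "\<delta>0 < 1" "\<And>x. 0 < x \<Longrightarrow> x < \<delta>0 \<Longrightarrow> M \<le> D0 * x powr (- m)"
      using powr_blow_up[OF D(1) m(1)] by blast
    obtain \<delta>1 where d1: "0 < \<delta>1" "\<delta>1 < 1" "\<And>x. 0 < x \<Longrightarrow> x < \<delta>1 \<Longrightarrow> M \<le> D1 * x powr (- m)"
      using powr_blow_up[OF D(2) m(1)] by blast
    show "\<exists>a b. m0 < a \<and> b < m1 \<and> (\<forall>z\<in>\<Omega>. -1 \<le> fst z \<longrightarrow> nn z < a \<or> b < nn z \<longrightarrow> M \<le> B z)"
    proof (rule exI[of _ "m0 / (1 - \<delta>0)"], rule exI[of _ "m1 * (1 - \<delta>1)"], intro conjI ballI impI)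
      show "m0 < m0 / (1 - \<delta>0)" using d0 m0 by (simp add: field_simps)
      show "m1 * (1 - \<delta>1) < m1" using d1 m1 by simp
      fix z assume z: "z \<in> \<Omega>" "-1 \<le> fst z" and c: "nn z < m0 / (1 - \<delta>0) \<or> m1 * (1 - \<delta>1) < nn z"
      from c have "M \<le> b z"
      proof
        assume "nn z < m0 / (1 - \<delta>0)"
        then have "1 - m0 / nn z < \<delta>0" "0 < 1 - m0 / nn z" using d0 \<Omega>0[OF z(1)] \<Omega>1[OF z(1)] by (auto simp: field_simps)
        then have "M \<le> D0 * (1 - m0 / nn z) powr (- m)" by (intro d0(3))
        also have "\<dots> \<le> (C * m0 powr s0 * nn z powr (- N / 4)) * (1 - m0 / nn z) powr (- m)"
          unfolding D0_def using CK by (intro mult_right_mono low[OF z(1)]) auto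
        also have "\<dots> = inner_barrier C m m0 z" by (simp add: inner_barrier_def N_def s0_def)
        also have "\<dots> \<le> b z" using bp[OF z(1)] by (simp add: b_def)
        finally show ?thesis .
      next
        assume "m1 * (1 - \<delta>1) < nn z"
        then have "1 - nn z / m1 < \<delta>1" "0 < 1 - nn z / m1" using d1 m1 \<Omega>1[OF z(1)] by (auto simp: field_simps)
        then have "M \<le> D1 * (1 - nn z / m1) powr (- m)" by (intro d1(3))
        also have "\<dots> \<le> (C * m1 powr ((N - m) / 4) * nn z powr (- N / 4)) * (1 - nn z / m1) powr (- m)"
          unfolding D1_def using CK by (intro mult_right_mono low[OF z(1)]) auto
        also have "\<dots> = outer_barrier C m m1 z" by (simp add: outer_barrier_def N_def)
        also have "\<dots> \<le> b z" using bp[OF z(1)] by (simp add: b_def)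
        finally show ?thesis .
      qed
      also have "\<dots> \<le> B z" by (rule Eb[OF z])
      finally show "M \<le> B z" .
    qed
  qed blast
  show thesis
  proof (rule that[OF e0(1)])
    fix e and z :: "'n st" assume e: "0 < e" "e < e0" and z: "n0 \<le> nn z" "nn z \<le> n1" "-1 \<le> fst z" "fst z \<le> S"
    have z\<Omega>: "z \<in> \<Omega>" using z m0 m1 n by (auto simp: \<Omega>_def)
    have half: "(1 - x) powr (- m) \<le> (1 / 2) powr (- m)" if "x \<le> 1 / 2" for x :: real
      using that m by (intro powr_mono2') auto
    have np: "nn z powr (- N / 4) \<le> n0 powr (- N / 4)" using z n by (intro powr_mono2') (auto simp: N_def)
    have x: "m0 / nn z \<le> 1 / 2" "nn z / m1 \<le> 1 / 2" using m0 m1 z n by (auto simp: field_simps)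
    let ?c = "n0 powr (- N / 4) * (1 / 2) powr (- m)"
    have "inner_barrier C m m0 z \<le> C * \<eta> * ?c"
      unfolding inner_barrier_def N_def[symmetric] s0_def[symmetric]
      using m0s np half[OF x(1)] CK eta by (intro mult_mono) auto
    moreover have "outer_barrier C m m1 z \<le> C * \<eta> * ?c"
    proof -
      have "(N - m) / 4 = - s1" unfolding s1_def minus_divide_left by simp
      then show ?thesis unfolding outer_barrier_def N_def[symmetric]
        using m1s np half[OF x(2)] CK eta by (intro mult_mono) auto
    qed
    ultimately have "b z \<le> 2 * (C * \<eta> * ?c)" by (simp add: b_def)
    moreover have "exp (K * (fst z + 1)) \<le> exp (K * (S + 1))" using z CK by simp
    ultimately have "B z \<le> exp (K * (S + 1)) * (2 * (C * \<eta> * ?c))"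
      unfolding B_def using bp[OF z\<Omega>] by (intro mult_mono) (auto simp: b_def)
    also have "\<dots> = 2 * (L * \<eta>)" by (simp add: L_def)
    also have "\<dots> = \<tau>" using eta by simp
    finally have "B z \<le> \<tau>" .
    then show "- \<tau> \<le> mollified e z" using e0(2)[OF e z\<Omega> z(3,4)] by linarith
  qed
qed


section \<open>Nonnegativity\<close>

lemma group_diff_close_back:
  fixes y z :: "'n st"
  assumes "norm (group_diff z y) < e" "e \<le> 1 / 8"
  shows "norm (z - y) \<le> (1 + 4 * (4 + 4 * norm (snd y))) * e"
proof -
  have e: "0 < e" using assms(1) norm_ge_zero[of "group_diff z y"] by linarith
  note c = group_diff_close[OF assms(1)]
  have "norm (snd z) \<le> norm (snd y) + norm (snd y - snd z)"
    using norm_triangle_sub[of "snd z" "snd y"] by (simp add: norm_minus_commute)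
  moreover have "(3 + 4 * norm (snd z)) * e \<le> (3 + 4 * norm (snd z)) * (1 / 8)"
    using assms(2) by (intro mult_left_mono) auto
  ultimately have "norm (snd z) \<le> norm (snd y) + (3 + 4 * norm (snd z)) * (1 / 8)" using c(2) by linarith
  then have "norm (snd z) \<le> 2 * norm (snd y) + 1" by (simp add: field_simps)
  then have "(3 + 4 * norm (snd z)) * e \<le> (3 + 4 * (2 * norm (snd y) + 1)) * e"
    using e by (intro mult_right_mono) auto
  moreover have "norm (z - y) \<le> norm (fst (z - y)) + norm (snd (z - y))"
    using norm_Pair_le[of "fst (z - y)" "snd (z - y)"] unfolding prod.collapse .
  ultimately have "norm (z - y) \<le> e + (3 + 4 * (2 * norm (snd y) + 1)) * e"
    using c by (simp add: norm_minus_commute)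
  also have "\<dots> \<le> (1 + 4 * (4 + 4 * norm (snd y))) * e"
  proof -
    have "e + (3 + 4 * (2 * norm (snd y) + 1)) * e = (8 + 8 * norm (snd y)) * e" by (simp add: algebra_simps)
    also have "\<dots> \<le> (1 + 4 * (4 + 4 * norm (snd y))) * e" using e by (intro mult_right_mono) auto
    finally show ?thesis .
  qed
  finally show ?thesis .
qed

text \<open>Fubini moves the kernel from the solution to the test function: the mollified solution is
asymptotically nonnegative, and the mollified test functions converge boundedly.\<close>

lemma nonneg_distributional_compact:
  fixes G :: "'n st \<Rightarrow> real"
  assumes S: "S < T" and n: "0 < n0" "n0 < n1" and G: "continuous_on UNIV G" "\<And>z. 0 \<le> G z"
    and supp: "\<And>z. G z \<noteq> 0 \<Longrightarrow> 0 \<le> fst z \<and> z \<in> region S n0 n1"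
  shows "0 \<le> (\<integral>z. U z * G z \<partial>lborel)"
proof -
  have "compact ({0..S} \<times> {\<xi>::'n heis. hn \<xi> \<le> n1})" by (rule compact_slab)
  obtain CG where CG: "0 < CG" "\<And>z. \<bar>G z\<bar> \<le> CG"
  proof (rule compact_support_bounded[OF G(1)])
    show "G z = 0" if "z \<notin> {0..S} \<times> {\<xi>. hn \<xi> \<le> n1}" for z
      using supp[of z] that by (cases z) (auto simp: region_def)
  qed blast
  have Gm: "G \<in> borel_measurable borel" by (rule borel_measurable_continuous_onI[OF G(1)])
  have Gi: "integrable lborel G"
  proof -
    have "integrable lborel (\<lambda>z. indicator ({0..S} \<times> {\<xi>::'n heis. hn \<xi> \<le> n1}) z *\<^sub>R G z)"
      by (rule borel_integrable_compact[OF compact_slab]) (rule continuous_on_subset[OF G(1)], simp)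
    moreover have "indicator ({0..S} \<times> {\<xi>::'n heis. hn \<xi> \<le> n1}) z *\<^sub>R G z = G z" for z
      using supp[of z] by (cases z) (auto simp: region_def indicator_def)
    ultimately show ?thesis by (simp only:)
  qed
  obtain eg where eg: "0 < eg" "\<And>q z::'n st. n0 \<le> nn q \<Longrightarrow> nn q \<le> n1 \<Longrightarrow> norm (group_diff q z) < eg \<Longrightarrow>
        n0 / 2 \<le> nn z \<and> nn z \<le> n1 + 1 \<and> \<bar>aa z / nn z - aa q / nn q\<bar> \<le> 1"
    using group_diff_close_uniform[OF n(1) zero_less_one, of n1] by blast
  define e1 where "e1 = min eg ((T - S) / 2)"
  have e1: "0 < e1" using eg S by (simp add: e1_def)
  have mollifiable: "mollifiable e S n0 n1" if "0 < e" "e < e1" for e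
    using that eg n S by (auto simp: mollifiable_def e1_def)
  define Ge where "Ge e y = (\<integral>z. mollifier e (group_diff z y) * G z \<partial>lborel)" for e y
  let ?S' = "(S + T) / 2"
  have S': "?S' < T" using S by simp
  have n': "0 < n0 / 2" "n0 / 2 < n1 + 1" using n by auto
  have kG: "integrable lborel (\<lambda>z. mollifier e (group_diff z y) * G z)" if "0 < e" for e y
  proof (rule Bochner_Integration.integrable_bound)
    show "integrable lborel (\<lambda>z. mollifier e (group_diff z y) * CG)"
      by (intro integrable_mult_left integral_group_diff(3)[OF mollifier(6)[OF that] mollifier(4)[OF that]])
    show "(\<lambda>z. mollifier e (group_diff z y) * G z) \<in> borel_measurable lborel"
      using Gm measurable_compose[OF measurable_group_diff(1) mollifier(6)[OF that]] by measurable
    show "AE z in lborel. norm (mollifier e (group_diff z y) * G z) \<le> norm (mollifier e (group_diff z y) * CG)"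
      using CG by (intro AE_I2) (auto simp: abs_mult intro!: mult_left_mono)
  qed
  have Ge0: "0 \<le> Ge e y" if "0 < e" for e y
    unfolding Ge_def by (intro integral_nonneg_AE AE_I2 mult_nonneg_nonneg mollifier(1)[OF that] G(2))
  have Geb: "\<bar>Ge e y\<bar> \<le> CG * indicator (region ?S' (n0 / 2) (n1 + 1)) y" if e: "0 < e" "e < e1" for e y
  proof (cases "y \<in> region ?S' (n0 / 2) (n1 + 1)")
    case True
    have "Ge e y \<le> (\<integral>z. mollifier e (group_diff z y) * CG \<partial>lborel)"
      unfolding Ge_def
    proof (rule integral_mono[OF kG[OF e(1)]])
      show "integrable lborel (\<lambda>z. mollifier e (group_diff z y) * CG)"
        by (rule integrable_mult_left[OF integral_group_diff(3)[OF mollifier(6)[OF e(1)] mollifier(4)[OF e(1)]]])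
      show "mollifier e (group_diff z y) * G z \<le> mollifier e (group_diff z y) * CG" for z
        using CG(2)[of z] G(2)[of z] by (intro mult_left_mono mollifier(1)[OF e(1)]) auto
    qed
    also have "\<dots> = CG" using integral_group_diff(1)[OF mollifier(6)[OF e(1)], of y] mollifier(5)[OF e(1), where 'n='n] by simp
    finally show ?thesis using True Ge0[OF e(1), of y] by simp
  next
    case False
    have "mollifier e (group_diff z y) * G z = 0" for z
    proof (rule ccontr)
      assume "mollifier e (group_diff z y) * G z \<noteq> 0"
      then have "mollifier e (group_diff z y) \<noteq> 0" "z \<in> region S n0 n1" using supp[of z] by auto
      from mollifier_region(1)[OF mollifiable[OF e] this(2,1)] have "y \<in> region (S + e) (n0 / 2) (n1 + 1)" .
      then show False using False e by (auto simp: region_def e1_def)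
    qed
    then have "Ge e y = 0" unfolding Ge_def by (simp only: Bochner_Integration.integral_zero)
    then show ?thesis using False by simp
  qed
  have pm: "(\<lambda>(y, z). mollifier e (group_diff z y) * G z) \<in> borel_measurable (lborel \<Otimes>\<^sub>M lborel)" if "0 < e" for e
  proof -
    have "continuous_on UNIV (\<lambda>w::'n st \<times> 'n st. mollifier e (group_diff (snd w) (fst w)) * G (snd w))"
      by (intro continuous_intros continuous_on_compose2[OF G(1)] continuous_on_compose2[OF continuous_mollifier[OF that], of _ "\<lambda>w. (snd w, fst w)", simplified]) auto
    then have "(\<lambda>(y, z). mollifier e (group_diff z y) * G z) \<in> borel_measurable (borel :: ('n st \<times> 'n st) measure)"
      by (simp add: borel_measurable_continuous_onI case_prod_beta')
    then show ?thesis by (simp add: lborel_prod)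
  qed
  have Gem: "Ge e \<in> borel_measurable borel" if "0 < e" for e
    using lborel.borel_measurable_lebesgue_integral[OF pm[OF that]] by (simp add: Ge_def[abs_def])
  have fubini: "(\<integral>z. mollified e z * G z \<partial>lborel) = (\<integral>y. U y * Ge e y \<partial>lborel)" if e: "0 < e" "e < e1" for e
  proof -
    let ?f = "\<lambda>y z. U y * (mollifier e (group_diff z y) * G z)"
    have "(\<lambda>w::'n st \<times> 'n st. U (fst w)) \<in> borel_measurable (lborel \<Otimes>\<^sub>M lborel)"
      using U_meas by measurable
    then have fm: "case_prod ?f \<in> borel_measurable (lborel \<Otimes>\<^sub>M lborel)"
      using pm[OF e(1)] by (simp add: case_prod_beta')
    have "integrable (lborel \<Otimes>\<^sub>M lborel) (case_prod ?f)"
    proof (rule lborel_pair.Fubini_integrable[OF fm])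
      have "(\<integral>z. norm (case (y, z) of (y, z) \<Rightarrow> ?f y z) \<partial>lborel) = norm (U y * Ge e y)" for y
      proof -
        have "norm (?f y z) = \<bar>U y\<bar> * (mollifier e (group_diff z y) * G z)" for z
          using G(2)[of z] mollifier(1)[OF e(1), of "group_diff z y"] by (simp add: abs_mult)
        then have "(\<lambda>z. norm (case (y, z) of (y, z) \<Rightarrow> ?f y z)) = (\<lambda>z. \<bar>U y\<bar> * (mollifier e (group_diff z y) * G z))"
          unfolding prod.case by (rule ext)
        moreover have "norm (U y * Ge e y) = \<bar>U y\<bar> * Ge e y" using Ge0[OF e(1), of y] by (simp add: abs_mult)
        ultimately show ?thesis by (simp only:) (simp add: Ge_def)
      qed
      moreover have "integrable lborel (\<lambda>y. U y * Ge e y)"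
        by (rule U_mult_integrable[OF n' S' Gem[OF e(1)] Geb[OF e]])
      ultimately show "integrable lborel (\<lambda>y. \<integral>z. norm (case (y, z) of (y, z) \<Rightarrow> ?f y z) \<partial>lborel)"
        by (simp only: integrable_norm)
      show "AE y in lborel. integrable lborel (\<lambda>z. case (y, z) of (y, z) \<Rightarrow> ?f y z)"
        using kG[OF e(1)] by auto
    qed
    from lborel_pair.Fubini_integral[OF this]
    have "(\<integral>z. (\<integral>y. ?f y z \<partial>lborel) \<partial>lborel) = (\<integral>y. (\<integral>z. ?f y z \<partial>lborel) \<partial>lborel)" .
    moreover have "(\<integral>y. ?f y z \<partial>lborel) = mollified e z * G z" for z
      by (simp add: mollified_def mult.assoc[symmetric])
    ultimately show ?thesis by (simp add: Ge_def)
  qed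
  define ek where "ek k = e1 / 2 * inverse (real (Suc k))" for k
  have ek: "0 < ek k" "ek k < e1" for k
  proof -
    have "e1 / 2 * inverse (real (Suc k)) \<le> e1 / 2 * 1" using e1 by (intro mult_left_mono) (auto simp: field_simps)
    then show "0 < ek k" "ek k < e1" using e1 by (auto simp: ek_def)
  qed
  have ek0: "ek \<longlonglongrightarrow> 0"
    using tendsto_mult[OF tendsto_const LIMSEQ_inverse_real_of_nat, of "e1 / 2"] by (simp add: ek_def[abs_def])
  have Glim: "(\<lambda>k. Ge (ek k) y) \<longlonglongrightarrow> G y" for y
  proof (rule LIMSEQ_I)
    fix r :: real assume r: "0 < r"
    have "isCont G y" using G(1) by (simp add: continuous_on_eq_continuous_at)
    then obtain d where d: "0 < d" "\<And>z. norm (z - y) < d \<Longrightarrow> norm (G z - G y) < r / 2"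
      using r unfolding continuous_at_eps_delta dist_norm by (metis half_gt_zero)
    define A where "A = 1 + 4 * (4 + 4 * norm (snd y))"
    have A: "0 < A" by (simp add: A_def add_pos_nonneg)
    have "0 < min (1 / 8) (d / A)" using d A by simp
    from order_tendstoD(2)[OF ek0 this] obtain k0 where k0: "\<And>k. k \<ge> k0 \<Longrightarrow> ek k < min (1 / 8) (d / A)"
      by (auto simp: eventually_sequentially)
    have "norm (Ge (ek k) y - G y) < r" if "k \<ge> k0" for k
    proof -
      note e = ek(1)[of k]
      have eA: "A * ek k < d" "ek k \<le> 1 / 8" using k0[OF that] A by (auto simp: field_simps)
      have K: "integrable lborel (\<lambda>z. mollifier (ek k) (group_diff z y))" "(\<integral>z. mollifier (ek k) (group_diff z y) \<partial>lborel) = 1"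
        using integral_group_diff(3)[OF mollifier(6)[OF e] mollifier(4)[OF e], of y] integral_group_diff(1)[OF mollifier(6)[OF e], of y] mollifier(5)[OF e, where 'n='n] by auto
      have b0: "Ge (ek k) y - G y = (\<integral>z. mollifier (ek k) (group_diff z y) * G z - mollifier (ek k) (group_diff z y) * G y \<partial>lborel)"
        using K kG[OF e, of y] by (simp add: Ge_def)
      have b1: "norm (\<integral>z. mollifier (ek k) (group_diff z y) * G z - mollifier (ek k) (group_diff z y) * G y \<partial>lborel)
         \<le> (\<integral>z. norm (mollifier (ek k) (group_diff z y) * G z - mollifier (ek k) (group_diff z y) * G y) \<partial>lborel)"
        by (rule integral_norm_bound)
      have b2: "(\<integral>z. norm (mollifier (ek k) (group_diff z y) * G z - mollifier (ek k) (group_diff z y) * G y) \<partial>lborel) \<le> (\<integral>z. mollifier (ek k) (group_diff z y) * (r / 2) \<partial>lborel)"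
      proof (rule integral_mono)
        show "integrable lborel (\<lambda>z. norm (mollifier (ek k) (group_diff z y) * G z - mollifier (ek k) (group_diff z y) * G y))"
          using K kG[OF e, of y] by (intro integrable_norm) auto
        show "integrable lborel (\<lambda>z. mollifier (ek k) (group_diff z y) * (r / 2))" using K by simp
        fix z
        show "norm (mollifier (ek k) (group_diff z y) * G z - mollifier (ek k) (group_diff z y) * G y) \<le> mollifier (ek k) (group_diff z y) * (r / 2)"
        proof (cases "mollifier (ek k) (group_diff z y) = 0")
          case False
          then have "norm (group_diff z y) < ek k" by (rule mollifier(2)[OF e])
          from group_diff_close_back[OF this eA(2)] have "norm (z - y) < d" using eA(1) by (simp add: A_def)
          then have "\<bar>G z - G y\<bar> \<le> r / 2" using d(2) by fastforce
          then have "mollifier (ek k) (group_diff z y) * \<bar>G z - G y\<bar> \<le> mollifier (ek k) (group_diff z y) * (r / 2)"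
            by (intro mult_left_mono mollifier(1)[OF e])
          then show ?thesis using mollifier(1)[OF e, of "group_diff z y"] by (simp add: abs_mult flip: right_diff_distrib)
        qed simp
      qed
      have b3: "(\<integral>z. mollifier (ek k) (group_diff z y) * (r / 2) \<partial>lborel) = r / 2" using K by simp
      have "norm (Ge (ek k) y - G y) \<le> r / 2"
        unfolding b0 by (rule order_trans[OF b1 order_trans[OF b2 eq_refl[OF b3]]])
      then show ?thesis using r by linarith
    qed
    then show "\<exists>k0. \<forall>k\<ge>k0. norm (Ge (ek k) y - G y) < r" by blast
  qed
  have lim: "(\<lambda>k. \<integral>y. U y * Ge (ek k) y \<partial>lborel) \<longlonglongrightarrow> (\<integral>y. U y * G y \<partial>lborel)"
  proof (rule U_dominated[OF n' S', where C=CG])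
    show "\<forall>\<^sub>F k in sequentially. \<forall>q. 0 < fst q \<longrightarrow> \<bar>Ge (ek k) q\<bar> \<le> CG * indicator (region ?S' (n0 / 2) (n1 + 1)) q"
      using Geb[OF ek] by (intro always_eventually allI impI)
  qed (use Gem ek Gm Glim in auto)
  have "- \<tau> * (\<integral>z. G z \<partial>lborel) \<le> (\<integral>y. U y * G y \<partial>lborel)" if tau: "0 < \<tau>" for \<tau>
  proof (rule LIMSEQ_le_const[OF lim])
    obtain e0 where e0: "0 < e0" "\<And>e z. 0 < e \<Longrightarrow> e < e0 \<Longrightarrow> n0 \<le> nn z \<Longrightarrow> nn z \<le> n1 \<Longrightarrow> -1 \<le> fst z \<Longrightarrow> fst z \<le> S \<Longrightarrow> - \<tau> \<le> mollified e z"
      using mollified_lower_limit[OF S n tau] by blast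
    from order_tendstoD(2)[OF ek0 e0(1)] obtain k0 where k0: "\<And>k. k \<ge> k0 \<Longrightarrow> ek k < e0"
      by (auto simp: eventually_sequentially)
    have "- \<tau> * (\<integral>z. G z \<partial>lborel) \<le> (\<integral>y. U y * Ge (ek k) y \<partial>lborel)" if "k \<ge> k0" for k
    proof -
      have cU: "continuous_on (region S n0 n1) (mollified (ek k))" by (rule mollified_continuous[OF mollifiable[OF ek]])
      let ?A = "{0..S} \<times> {\<xi>::'n heis. hn \<xi> \<le> n1} \<inter> region S n0 n1"
      have A: "compact ?A" by (intro compact_Int_closed compact_slab closed_region)
      have "integrable lborel (\<lambda>z. indicator ?A z *\<^sub>R (mollified (ek k) z * G z))"
        by (rule borel_integrable_compact[OF A])
          (intro continuous_on_mult continuous_on_subset[OF cU] continuous_on_subset[OF G(1)]; auto)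
      moreover have "indicator ?A z *\<^sub>R (mollified (ek k) z * G z) = mollified (ek k) z * G z" for z
        using supp[of z] by (cases z) (auto simp: region_def indicator_def)
      ultimately have iUG: "integrable lborel (\<lambda>z. mollified (ek k) z * G z)" by (simp only:)
      have "(\<integral>z. - \<tau> * G z \<partial>lborel) \<le> (\<integral>z. mollified (ek k) z * G z \<partial>lborel)"
      proof (rule integral_mono[OF _ iUG])
        show "integrable lborel (\<lambda>z. - \<tau> * G z)" using Gi by simp
        show "- \<tau> * G z \<le> mollified (ek k) z * G z" for z
        proof (cases "G z = 0")
          case False
          from supp[OF this] have "- \<tau> \<le> mollified (ek k) z"
            by (intro e0(2)[OF ek(1) k0[OF that]]) (auto simp: region_def)
          then show ?thesis by (intro mult_right_mono G(2))
        qed simp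
      qed
      then show ?thesis using fubini[OF ek] by simp
    qed
    then show "\<exists>k0. \<forall>k\<ge>k0. - \<tau> * (\<integral>z. G z \<partial>lborel) \<le> (\<integral>y. U y * Ge (ek k) y \<partial>lborel)" by blast
  qed
  note fin = this
  show ?thesis
  proof (rule field_le_epsilon)
    fix r :: real assume r: "0 < r"
    define I where "I = (\<integral>z. G z \<partial>lborel)"
    have I: "0 \<le> I" unfolding I_def by (intro integral_nonneg_AE AE_I2 G(2))
    have "r / (I + 1) * I \<le> r"
    proof -
      have "r * I \<le> r * (I + 1)" using r by simp
      then show ?thesis using I by (simp add: field_simps)
    qed
    moreover have "- (r / (I + 1)) * I \<le> (\<integral>y. U y * G y \<partial>lborel)"
      unfolding I_def by (rule fin) (use r I in \<open>simp add: I_def\<close>)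
    ultimately show "0 \<le> (\<integral>y. U y * G y \<partial>lborel) + r" by simp
  qed
qed

lemma nonneg_distributional:
  fixes G :: "'n st \<Rightarrow> real"
  assumes S: "S < T" and n: "0 < n0" "n0 < n1" and G: "continuous_on UNIV G" "\<And>z. 0 \<le> G z"
    and supp: "\<And>z. 0 < fst z \<Longrightarrow> G z \<noteq> 0 \<Longrightarrow> z \<in> region S n0 n1"
  shows "0 \<le> (\<integral>z. U z * G z \<partial>lborel)"
proof -
  define ch where "ch k z = max 0 (min 1 (real k * fst z))" for k and z :: "'n st"
  have ch01: "0 \<le> ch k z" "ch k z \<le> 1" for k z by (auto simp: ch_def)
  have c: "continuous_on UNIV (\<lambda>z. G z * ch k z)" for k
    unfolding ch_def by (intro continuous_intros G(1))
  obtain CG where CG: "0 < CG" "\<And>z. z \<in> {0..S} \<times> {\<xi>. hn \<xi> \<le> n1} \<Longrightarrow> \<bar>G z\<bar> \<le> CG"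
  proof -
    have "bounded (G ` ({0..S} \<times> {\<xi>. hn \<xi> \<le> n1}))"
      by (intro compact_imp_bounded compact_continuous_image compact_slab continuous_on_subset[OF G(1)]) auto
    then show thesis using that by (auto simp: bounded_pos)
  qed
  have "(\<lambda>k. \<integral>z. U z * (G z * ch k z) \<partial>lborel) \<longlonglongrightarrow> (\<integral>z. U z * G z \<partial>lborel)"
  proof (rule U_dominated[OF n S, where C=CG])
    show "(\<lambda>z. G z * ch k z) \<in> borel_measurable borel" for k by (rule borel_measurable_continuous_onI[OF c])
    show "G \<in> borel_measurable borel" by (rule borel_measurable_continuous_onI[OF G(1)])
    have "\<bar>G z * ch k z\<bar> \<le> CG * indicator (region S n0 n1) z" if "0 < fst z" for k z
    proof (cases "G z = 0")
      case False
      then have r: "z \<in> region S n0 n1" using supp that by simp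
      then have "\<bar>G z\<bar> \<le> CG" using that by (intro CG(2)) (cases z, auto simp: region_def)
      then have "\<bar>G z\<bar> * \<bar>ch k z\<bar> \<le> CG * 1" using ch01[of k z] CG(1) by (intro mult_mono) auto
      then show ?thesis using r by (simp add: abs_mult)
    qed (use CG in simp)
    then show "\<forall>\<^sub>F k in sequentially. \<forall>z. 0 < fst z \<longrightarrow> \<bar>G z * ch k z\<bar> \<le> CG * indicator (region S n0 n1) z"
      by (intro always_eventually) blast
    fix z :: "'n st" assume z: "0 < fst z"
    obtain k0 where "1 / fst z < real k0" using reals_Archimedean2 by blast
    then have "1 \<le> real k * fst z" if "k \<ge> k0" for k
    proof -
      have "1 \<le> real k0 * fst z" using \<open>1 / fst z < real k0\<close> z by (simp add: field_simps)
      also have "\<dots> \<le> real k * fst z" using that z by (intro mult_right_mono) auto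
      finally show ?thesis .
    qed
    then have "\<forall>\<^sub>F k in sequentially. G z * ch k z = G z"
      unfolding eventually_sequentially by (intro exI[of _ k0]) (auto simp: ch_def)
    then show "(\<lambda>k. G z * ch k z) \<longlonglongrightarrow> G z" by (rule tendsto_eventually)
  qed
  moreover have "0 \<le> (\<integral>z. U z * (G z * ch k z) \<partial>lborel)" for k
  proof (rule nonneg_distributional_compact[OF S n c])
    show "0 \<le> G z * ch k z" for z using G(2) ch01 by simp
    show "0 \<le> fst z \<and> z \<in> region S n0 n1" if "G z * ch k z \<noteq> 0" for z
    proof -
      have "0 < fst z"
      proof (rule ccontr)
        assume "\<not> 0 < fst z"
        then have "real k * fst z \<le> 0" by (simp add: mult_nonneg_nonpos)
        then have "ch k z = 0" by (simp add: ch_def)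
        then show False using that by simp
      qed
      then show ?thesis using supp that by auto
    qed
  qed
  ultimately show ?thesis by (intro LIMSEQ_le_const) auto
qed

text \<open>The solution is nonnegative against the positive part of the operator, and its absolute value
dominates it against the negative part.\<close>

lemma negative_part_inequality:
  assumes F: "admissible T F"
  shows "- (\<integral>z. U z * hardy_op lam F z \<partial>lborel) \<le> (\<integral>z. \<bar>U z\<bar> * max 0 (- hardy_op lam F z) \<partial>lborel)"
    "integrable lborel (\<lambda>z. \<bar>U z\<bar> * max 0 (- hardy_op lam F z))"
proof -
  obtain n0 S R where A: "Ck 3 UNIV F" "\<And>z. 0 \<le> F z" "n0 > 0" "\<And>z. nn z < n0 \<Longrightarrow> F z = 0"
    "S < T" "\<And>z. 0 \<le> fst z \<Longrightarrow> F z \<noteq> 0 \<Longrightarrow> fst z \<le> S \<and> nn z \<le> R"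
    using F unfolding admissible_def by blast
  have c: "continuous_on UNIV (hardy_op lam F)" by (rule continuous_hardy_op[OF A(1,3,4)])
  define n1 where "n1 = max R n0 + 1"
  define S' where "S' = (S + T) / 2"
  have S': "S < S'" "S' < T" using A(5) by (auto simp: S'_def)
  have n: "0 < n0 / 2" "n0 / 2 < n1" using A(3) by (auto simp: n1_def)
  have z: "z \<in> region S' (n0 / 2) n1" if z: "0 < fst z" "hardy_op lam F z \<noteq> 0" for z
  proof (rule ccontr)
    assume "z \<notin> region S' (n0 / 2) n1"
    then consider "S < fst z" | "nn z < n0" | "R < nn z" using S' A(3) by (fastforce simp: region_def n1_def)
    then show False
    proof cases
      case 1
      have "open ({w::'n st. S < fst w} \<inter> {w. 0 < fst w})" by (intro open_Int open_Collect_less continuous_intros)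
      moreover have "F w = 0" if "w \<in> {w::'n st. S < fst w} \<inter> {w. 0 < fst w}" for w
        using A(6)[of w] that by (cases "F w = 0") auto
      ultimately show False using hardy_op_zero(4)[of _ z F lam] 1 z by blast
    next
      case 2
      then show False using hardy_op_zero(4)[OF open_nn_less[of n0], of z F lam] z A(4) by blast
    next
      case 3
      have "open ({w::'n st. R < nn w} \<inter> {w. 0 < fst w})" by (intro open_Int open_nn_greater open_Collect_less continuous_intros)
      moreover have "F w = 0" if "w \<in> {w::'n st. R < nn w} \<inter> {w. 0 < fst w}" for w
        using A(6)[of w] that by (cases "F w = 0") auto
      ultimately show False using hardy_op_zero(4)[of _ z F lam] 3 z by blast
    qed
  qed
  obtain C where C: "0 < C" "\<And>z. z \<in> {0..S'} \<times> {\<xi>. hn \<xi> \<le> n1} \<Longrightarrow> \<bar>hardy_op lam F z\<bar> \<le> C"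
  proof -
    have "bounded (hardy_op lam F ` ({0..S'} \<times> {\<xi>. hn \<xi> \<le> n1}))"
      by (intro compact_imp_bounded compact_continuous_image compact_slab continuous_on_subset[OF c]) auto
    then show thesis using that by (auto simp: bounded_pos)
  qed
  have b: "\<bar>hardy_op lam F z\<bar> \<le> C * indicator (region S' (n0 / 2) n1) z" if "0 < fst z" for z
  proof (cases "hardy_op lam F z = 0")
    case False
    then have "z \<in> region S' (n0 / 2) n1" using z that by blast
    then show ?thesis using that C(2)[of z] by (cases z) (auto simp: region_def)
  qed (use C in simp)
  let ?P = "\<lambda>z. max 0 (hardy_op lam F z)"
  let ?M = "\<lambda>z. max 0 (- hardy_op lam F z)"
  have cP: "continuous_on UNIV ?P" "continuous_on UNIV ?M" by (intro continuous_intros c)+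
  have bP: "\<bar>?P z\<bar> \<le> C * indicator (region S' (n0 / 2) n1) z" "\<bar>?M z\<bar> \<le> C * indicator (region S' (n0 / 2) n1) z" if "0 < fst z" for z
    using b[OF that] by (auto simp: abs_le_iff)
  have iP: "integrable lborel (\<lambda>z. U z * ?P z)" "integrable lborel (\<lambda>z. U z * ?M z)"
    by (rule U_mult_integrable[OF n S'(2) borel_measurable_continuous_onI[OF cP(1)] bP(1)], assumption)
      (rule U_mult_integrable[OF n S'(2) borel_measurable_continuous_onI[OF cP(2)] bP(2)], assumption)
  have iM: "integrable lborel (\<lambda>z. \<bar>U z\<bar> * ?M z)" using integrable_norm[OF iP(2)] by (simp add: abs_mult)
  show "integrable lborel (\<lambda>z. \<bar>U z\<bar> * ?M z)" by (rule iM)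
  have "0 \<le> (\<integral>z. U z * ?P z \<partial>lborel)"
  proof (rule nonneg_distributional[OF S'(2) n(1) _ cP(1)])
    show "n0 / 2 < n1 + 1" using n by simp
    show "z \<in> region S' (n0 / 2) (n1 + 1)" if "0 < fst z" "?P z \<noteq> 0" for z
      using z[OF that(1)] that(2) by (auto simp: region_def max_def split: if_splits)
  qed simp
  have "- (\<integral>z. U z * hardy_op lam F z \<partial>lborel) = - (\<integral>z. U z * ?P z - U z * ?M z \<partial>lborel)"
    by (intro arg_cong[where f=uminus] Bochner_Integration.integral_cong) (auto simp: max_def)
  also have "\<dots> = (\<integral>z. U z * ?M z \<partial>lborel) - (\<integral>z. U z * ?P z \<partial>lborel)" using iP by simp
  also have "\<dots> \<le> (\<integral>z. U z * ?M z \<partial>lborel)" using \<open>0 \<le> (\<integral>z. U z * ?P z \<partial>lborel)\<close> by simp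
  also have "\<dots> \<le> (\<integral>z. \<bar>U z\<bar> * ?M z \<partial>lborel)"
    by (rule integral_mono[OF iP(2) iM]) (auto intro!: mult_right_mono)
  finally show "- (\<integral>z. U z * hardy_op lam F z \<partial>lborel) \<le> (\<integral>z. \<bar>U z\<bar> * ?M z \<partial>lborel)" .
qed

end

section \<open>The a priori bound on shells\<close>

lemma emeasure_lborel_Times:
  fixes A :: "'a::euclidean_space set" and B :: "'b::euclidean_space set"
  assumes "A \<in> sets borel" "B \<in> sets borel"
  shows "emeasure lborel (A \<times> B) = emeasure lborel A * emeasure lborel B"
  unfolding lborel_prod[symmetric] by (rule lborel.emeasure_pair_measure_Times) (use assms in auto)

lemma slab_volume:
  assumes "0 \<le> S" "0 < r"
  shows "measure lborel ({0..S} \<times> {\<xi>::'n::finite heis. hn \<xi> \<le> r ^ 4}) \<le> S * 2 ^ (2 * CARD('n) + 1) * r ^ (2 * CARD('n) + 2)"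
proof -
  let ?v = "(\<chi> i. r) :: real ^ 'n"
  let ?B = "{0..S} \<times> (cbox (- ?v) ?v \<times> (cbox (- ?v) ?v \<times> {- (r\<^sup>2)..r\<^sup>2}))"
  have sub: "{0..S} \<times> {\<xi>::'n heis. hn \<xi> \<le> r ^ 4} \<subseteq> ?B"
  proof
    fix z assume z: "z \<in> {0..S} \<times> {\<xi>::'n heis. hn \<xi> \<le> r ^ 4}"
    obtain t x y w where zz: "z = (t, x, y, w)" by (metis prod_cases4)
    have h: "hn (x, y, w) \<le> (r\<^sup>2)\<^sup>2" and t: "t \<in> {0..S}" using z by (auto simp: zz)
    have "(hz (x, y, w))\<^sup>2 \<le> (r\<^sup>2)\<^sup>2" "w\<^sup>2 \<le> (r\<^sup>2)\<^sup>2"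
      using h zero_le_power2[of w] zero_le_power2[of "hz (x, y, w)"] unfolding hn_def hw_def prod.case by linarith+
    then have hz: "hz (x, y, w) \<le> r\<^sup>2" and w: "\<bar>w\<bar> \<le> r\<^sup>2"
      by (auto intro: power2_le_imp_le simp: abs_le_square_iff[symmetric])
    have "(x $ i)\<^sup>2 + (y $ i)\<^sup>2 \<le> hz (x, y, w)" for i
      unfolding hz_def prod.case by (rule member_le_sum[of i UNIV "\<lambda>i. (x $ i)\<^sup>2 + (y $ i)\<^sup>2"]) auto
    then have "(x $ i)\<^sup>2 \<le> r\<^sup>2" "(y $ i)\<^sup>2 \<le> r\<^sup>2" for i
      using hz zero_le_power2[of "x $ i"] zero_le_power2[of "y $ i"] by (smt (verit))+
    then have "\<bar>x $ i\<bar> \<le> \<bar>r\<bar> \<and> \<bar>y $ i\<bar> \<le> \<bar>r\<bar>" for i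
      unfolding abs_le_square_iff by blast
    then have "\<bar>x $ i\<bar> \<le> r" "\<bar>y $ i\<bar> \<le> r" for i
      using assms(2) by auto
    then show "z \<in> ?B" using t w by (auto simp: zz mem_box_cart abs_le_iff minus_le_iff)
  qed
  have em: "emeasure lborel ?B = ennreal (S * 2 ^ (2 * CARD('n) + 1) * r ^ (2 * CARD('n) + 2))"
  proof -
    have c: "emeasure lborel (cbox (- ?v) ?v) = ennreal ((2 * r) ^ CARD('n))"
    proof -
      have "- ?v \<in> cbox (- ?v) ?v" using assms by (auto simp: mem_box_cart)
      then have "measure lborel (cbox (- ?v) ?v) = (\<Prod>i\<in>UNIV. ?v $ i - (- ?v) $ i)"
        by (intro content_cbox_cart) auto
      also have "\<dots> = (2 * r) ^ CARD('n)" by simp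
      finally have m: "measure lborel (cbox (- ?v) ?v) = (2 * r) ^ CARD('n)" .
      have "emeasure lborel (cbox (- ?v) ?v) \<noteq> top"
        using emeasure_lborel_cbox_finite[of "- ?v" ?v] by (metis infinity_ennreal_def less_irrefl)
      from emeasure_eq_ennreal_measure[OF this] show ?thesis unfolding m .
    qed
    have w: "emeasure lborel {- (r\<^sup>2)..r\<^sup>2} = ennreal (2 * r\<^sup>2)" by simp
    have s: "emeasure lborel {0..S} = ennreal S" using assms by simp
    have "emeasure lborel ?B = emeasure lborel {0..S} * (emeasure lborel (cbox (- ?v) ?v) * (emeasure lborel (cbox (- ?v) ?v) * emeasure lborel {- (r\<^sup>2)..r\<^sup>2}))"
    proof -
      have 1: "emeasure lborel (cbox (- ?v) ?v \<times> {- (r\<^sup>2)..r\<^sup>2}) = emeasure lborel (cbox (- ?v) ?v) * emeasure lborel {- (r\<^sup>2)..r\<^sup>2}"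
        by (rule emeasure_lborel_Times) auto
      have 2: "emeasure lborel (cbox (- ?v) ?v \<times> (cbox (- ?v) ?v \<times> {- (r\<^sup>2)..r\<^sup>2})) = emeasure lborel (cbox (- ?v) ?v) * emeasure lborel (cbox (- ?v) ?v \<times> {- (r\<^sup>2)..r\<^sup>2})"
        by (rule emeasure_lborel_Times) (auto intro!: borel_closed closed_Times)
      have 3: "emeasure lborel ?B = emeasure lborel {0..S} * emeasure lborel (cbox (- ?v) ?v \<times> (cbox (- ?v) ?v \<times> {- (r\<^sup>2)..r\<^sup>2}))"
        by (rule emeasure_lborel_Times) (auto intro!: borel_closed closed_Times)
      show ?thesis unfolding 3 2 1 ..
    qed
    also have "\<dots> = ennreal (S * ((2 * r) ^ CARD('n) * ((2 * r) ^ CARD('n) * (2 * r\<^sup>2))))"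
      unfolding c w s using assms by (simp add: ennreal_mult')
    also have "S * ((2 * r) ^ CARD('n) * ((2 * r) ^ CARD('n) * (2 * r\<^sup>2))) = S * 2 ^ (2 * CARD('n) + 1) * r ^ (2 * CARD('n) + 2)"
    proof -
      have e: "y ^ (2 * n) = y ^ n * y ^ n" for y :: real and n
        unfolding mult.commute[of 2 n] power_mult power2_eq_square ..
      show ?thesis unfolding power_add e power_mult_distrib by simp
    qed
    finally show ?thesis .
  qed
  have Bm: "?B \<in> sets lborel" unfolding sets_lborel by (intro borel_closed closed_Times closed_cbox closed_real_atLeastAtMost)
  have "measure lborel ({0..S} \<times> {\<xi>::'n heis. hn \<xi> \<le> r ^ 4}) \<le> measure lborel ?B"
  proof (rule measure_mono_fmeasurable[OF sub])
    show "{0..S} \<times> {\<xi>::'n heis. hn \<xi> \<le> r ^ 4} \<in> sets lborel"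
      unfolding sets_lborel by (intro borel_closed compact_imp_closed compact_slab)
    show "?B \<in> fmeasurable lborel" by (rule fmeasurableI[OF Bm]) (simp only: em ennreal_less_top infinity_ennreal_def)
  qed
  also have "measure lborel ?B = S * 2 ^ (2 * CARD('n) + 1) * r ^ (2 * CARD('n) + 2)"
    unfolding measure_def em by (rule enn2real_ennreal) (use assms in simp)
  finally show ?thesis .
qed

text \<open>Young's inequality with a crude constant.\<close>

lemma young_split:
  fixes x b p :: real
  assumes "1 < p" "0 \<le> x" "0 \<le> b"
  shows "x * b \<le> x powr p / 2 + (2 * b) powr (p / (p - 1))"
proof (cases "b \<le> x powr (p - 1) / 2")
  case True
  then have "x * b \<le> x * (x powr (p - 1) / 2)" using assms by (intro mult_left_mono) auto
  also have "\<dots> = x powr p / 2" using assms by (cases "x = 0") (auto simp: powr_mult_base)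
  finally show ?thesis using powr_ge_zero[of "2 * b" "p / (p - 1)"] by linarith
next
  case False
  then have b: "x powr (p - 1) < 2 * b" by simp
  then have b0: "0 < 2 * b" using powr_ge_zero[of x "p - 1"] by linarith
  have "x = (x powr (p - 1)) powr (1 / (p - 1))" using assms by (simp add: powr_powr)
  also have "\<dots> \<le> (2 * b) powr (1 / (p - 1))" using b assms by (intro powr_mono2) auto
  finally have "x * b \<le> (2 * b) powr (1 / (p - 1)) * (2 * b)" using assms by (intro mult_mono) auto
  also have "\<dots> = (2 * b) powr (1 / (p - 1) + 1)" using b0 by (simp add: powr_add)
  also have "1 / (p - 1) + 1 = p / (p - 1)" using assms by (simp add: field_simps)
  finally show ?thesis using powr_ge_zero[of x p] by linarith
qed

lemma pospart_shift:
  fixes c s :: real and l :: nat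
  assumes "2 \<le> l"
  shows "((\<lambda>x. max 0 (s * (x - c)) ^ Suc l) has_real_derivative s * (real (Suc l) * max 0 (s * (x - c)) ^ l)) (at x)"
proof -
  have "((\<lambda>x. s * (x - c)) has_real_derivative s) (at x)" by (auto intro!: derivative_eq_intros)
  from DERIV_chain2[OF has_real_derivative_pospart_power this, of l] assms show ?thesis
    by (simp add: mult.commute mult.left_commute)
qed

context heis_super
begin

text \<open>A high power \<open>l\<close> makes the first and second derivatives of the cut-off controlled by a power of the
cut-off itself that is large enough to be absorbed by Young's inequality.\<close>

definition shell_cutoff :: "nat \<Rightarrow> real \<Rightarrow> real" where
  "shell_cutoff l x = max 0 (x - 1 / 32) ^ l * max 0 (2 - x) ^ l"

lemma shell_cutoff_derivs:
  fixes l :: nat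
  assumes l: "4 \<le> l"
  obtains h1 h2 where "\<And>x. (shell_cutoff l has_real_derivative h1 x) (at x)" "\<And>x. (h1 has_real_derivative h2 x) (at x)"
    "Ck 3 UNIV (shell_cutoff l)"
    "\<And>x. \<bar>h1 x\<bar> \<le> 16 * real l * (max 0 (x - 1 / 32) * max 0 (2 - x)) ^ (l - 2)"
    "\<And>x. \<bar>h2 x\<bar> \<le> 16 * (real l)\<^sup>2 * (max 0 (x - 1 / 32) * max 0 (2 - x)) ^ (l - 2)"
proof -
  obtain k where k: "l = Suc (Suc k)" "2 \<le> k"
  proof (rule that)
    show "l = Suc (Suc (l - 2))" "2 \<le> l - 2" using l by auto
  qed
  let ?P = "\<lambda>x::real. max 0 (x - 1 / 32)" and ?R = "\<lambda>x::real. max 0 (2 - x)"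
  have dP: "((\<lambda>x. ?P x ^ Suc j) has_real_derivative real (Suc j) * ?P x ^ j) (at x)" if "2 \<le> j" for j x
    using pospart_shift[OF that, of 1 "1/32" x] by simp
  have dR: "((\<lambda>x. ?R x ^ Suc j) has_real_derivative - (real (Suc j) * ?R x ^ j)) (at x)" if "2 \<le> j" for j x
    using pospart_shift[OF that, of "-1" "2" x] by simp
  define h1 where "h1 x = real l * (?P x ^ Suc k * ?R x ^ l - ?P x ^ l * ?R x ^ Suc k)" for x
  define h2 where "h2 x = real l * (real (Suc k) * ?P x ^ k * ?R x ^ l - 2 * real l * ?P x ^ Suc k * ?R x ^ Suc k + real (Suc k) * ?P x ^ l * ?R x ^ k)" for x
  show thesis
  proof (rule that[of h1 h2])
    show "(shell_cutoff l has_real_derivative h1 x) (at x)" for x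
      unfolding shell_cutoff_def[abs_def] k h1_def
      using DERIV_mult[OF dP[of "Suc k" x] dR[of "Suc k" x]] k(2) by (simp add: algebra_simps)
    show "(h1 has_real_derivative h2 x) (at x)" for x
    proof -
      have e: "((\<lambda>x. ?P x ^ Suc k * ?R x ^ l) has_real_derivative real (Suc k) * ?P x ^ k * ?R x ^ l + - (real l * ?R x ^ Suc k) * ?P x ^ Suc k) (at x)"
        using DERIV_mult[OF dP[of k x] dR[of "Suc k" x]] k by simp
      have f: "((\<lambda>x. ?P x ^ l * ?R x ^ Suc k) has_real_derivative real l * ?P x ^ Suc k * ?R x ^ Suc k + - (real (Suc k) * ?R x ^ k) * ?P x ^ l) (at x)"
        using DERIV_mult[OF dP[of "Suc k" x] dR[of k x]] k by simp
      have "((\<lambda>x. real l * (?P x ^ Suc k * ?R x ^ l - ?P x ^ l * ?R x ^ Suc k)) has_real_derivative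
        real l * ((real (Suc k) * ?P x ^ k * ?R x ^ l + - (real l * ?R x ^ Suc k) * ?P x ^ Suc k)
          - (real l * ?P x ^ Suc k * ?R x ^ Suc k + - (real (Suc k) * ?R x ^ k) * ?P x ^ l))) (at x)"
        by (intro DERIV_cmult DERIV_diff e f)
      then show ?thesis unfolding h1_def[abs_def] h2_def by (simp add: algebra_simps)
    qed
    have aff: "Ck 3 UNIV (\<lambda>x::real. x - 1 / 32)" "Ck 3 UNIV (\<lambda>x::real. 2 - x)"
      by (intro Ck_diff Ck_id Ck_const open_UNIV)+
    show "Ck 3 UNIV (shell_cutoff l)"
      unfolding shell_cutoff_def[abs_def]
      by (intro Ck_mult open_UNIV Ck_comp[OF open_UNIV aff(1) open_UNIV Ck_pospart_power] Ck_comp[OF open_UNIV aff(2) open_UNIV Ck_pospart_power]) (use l in auto)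
    fix x :: real
    define a where "a = ?P x" define b where "b = ?R x"
    have ab: "0 \<le> a" "0 \<le> b" by (auto simp: a_def b_def)
    have "\<bar>h1 x\<bar> \<le> 16 * real l * (a * b) ^ k \<and> \<bar>h2 x\<bar> \<le> 16 * (real l)\<^sup>2 * (a * b) ^ k"
    proof (cases "a = 0 \<or> b = 0")
      case True
      then have "h1 x = 0 \<and> h2 x = 0" using k unfolding h1_def h2_def a_def[symmetric] b_def[symmetric] by auto
      then show ?thesis using ab by auto
    next
      case False
      then have ab2: "a \<le> 2" "b \<le> 2" by (auto simp: a_def b_def max_def split: if_splits)
      have q: "a * b\<^sup>2 \<le> 2 * 4" "a\<^sup>2 * b \<le> 4 * 2" "b\<^sup>2 \<le> 4" "a * b \<le> 4" "a\<^sup>2 \<le> 4"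
        using ab ab2 mult_mono[of a 2 "b\<^sup>2" 4] mult_mono[of "a\<^sup>2" 4 b 2] power_mono[of b 2 2] power_mono[of a 2 2] mult_mono[of a 2 b 2] by auto
      have "h1 x = (a * b) ^ k * (real l * (a * b\<^sup>2 - a\<^sup>2 * b))"
        unfolding h1_def k a_def[symmetric] b_def[symmetric] by (simp add: power_mult_distrib power2_eq_square algebra_simps)
      moreover have "\<bar>real l * (a * b\<^sup>2 - a\<^sup>2 * b)\<bar> \<le> real l * 16"
      proof -
        have "0 \<le> a * b\<^sup>2" "0 \<le> a\<^sup>2 * b" using ab by auto
        then have "\<bar>a * b\<^sup>2 - a\<^sup>2 * b\<bar> \<le> 16" using q unfolding abs_le_iff by linarith
        then show ?thesis unfolding abs_mult by (intro mult_mono) auto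
      qed
      ultimately have 1: "\<bar>h1 x\<bar> \<le> (a * b) ^ k * (real l * 16)"
        using ab by (simp add: abs_mult mult_left_mono)
      have "h2 x = (a * b) ^ k * (real l * (real (Suc k) * b\<^sup>2 - 2 * real l * (a * b) + real (Suc k) * a\<^sup>2))"
        unfolding h2_def k a_def[symmetric] b_def[symmetric] by (simp add: power_mult_distrib power2_eq_square algebra_simps)
      moreover have "\<bar>real l * (real (Suc k) * b\<^sup>2 - 2 * real l * (a * b) + real (Suc k) * a\<^sup>2)\<bar> \<le> real l * (real l * 16)"
      proof -
        have sk: "real (Suc k) \<le> real l" using k by simp
        have "real (Suc k) * b\<^sup>2 \<le> real l * 4" "real l * (a * b) \<le> real l * 4" "real (Suc k) * a\<^sup>2 \<le> real l * 4"
          using mult_mono[OF sk q(3)] mult_mono[OF order_refl q(4), of "real l"] mult_mono[OF sk q(5)] ab by simp_all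
        moreover have "0 \<le> real (Suc k) * b\<^sup>2" "0 \<le> real l * (a * b)" "0 \<le> real (Suc k) * a\<^sup>2" using ab by auto
        ultimately have "\<bar>real (Suc k) * b\<^sup>2 - 2 * real l * (a * b) + real (Suc k) * a\<^sup>2\<bar> \<le> real l * 16"
          unfolding abs_le_iff by linarith
        then show ?thesis unfolding abs_mult by (intro mult_mono) auto
      qed
      ultimately have 2: "\<bar>h2 x\<bar> \<le> (a * b) ^ k * (real l * (real l * 16))"
        using ab by (simp add: abs_mult mult_left_mono)
      show ?thesis using 1 2 by (simp add: power2_eq_square mult_ac)
    qed
    then show "\<bar>h1 x\<bar> \<le> 16 * real l * (?P x * ?R x) ^ (l - 2)" "\<bar>h2 x\<bar> \<le> 16 * (real l)\<^sup>2 * (?P x * ?R x) ^ (l - 2)"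
      by (auto simp: a_def b_def k)
  qed
qed


lemma cyl_scaled_n: "open \<Omega> \<Longrightarrow> cyl \<Omega> (\<lambda>z::'n st. nn z / c) (\<lambda>z. 0) (\<lambda>z. 2 * aa z / c) (\<lambda>z. 2 * ww z / c)
    (\<lambda>z. 8 * (real CARD('n) + 2) * aa z / c)"
  by (rule cyl_eq[OF cyl_mult[OF cyl_const[of _ "1 / c"] cyl_subset[OF cyl_n]]]) auto

lemma cyl_profile_n:
  fixes g g' g'' :: "real \<Rightarrow> real"
  assumes "open \<Omega>" "Ck 3 UNIV g" "\<And>x. (g has_real_derivative g' x) (at x)" "\<And>x. (g' has_real_derivative g'' x) (at x)"
  shows "cyl \<Omega> (\<lambda>z::'n st. g (nn z / c)) (\<lambda>z. 0) (\<lambda>z. g' (nn z / c) * (2 * aa z / c)) (\<lambda>z. g' (nn z / c) * (2 * ww z / c))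
    (\<lambda>z. g' (nn z / c) * (8 * (real CARD('n) + 2) * aa z / c) + g'' (nn z / c) * (16 * aa z * nn z / c\<^sup>2))"
  by (rule cyl_eq[OF cyl_comp[OF cyl_scaled_n[OF assms(1)] open_UNIV _ assms(2,3,4)]])
    (auto simp: hn_def power_divide add_divide_distrib algebra_simps)

lemma cyl_time_pospart:
  assumes "open \<Omega>" "4 \<le> k"
  shows "cyl \<Omega> (\<lambda>z::'n st. max 0 (t2 - fst z) ^ k) (\<lambda>z. - (real k * max 0 (t2 - fst z) ^ (k - 1))) (\<lambda>z. 0) (\<lambda>z. 0) (\<lambda>z. 0)"
proof -
  obtain j where k: "k = Suc (Suc j)" "2 \<le> j"
  proof (rule that)
    show "k = Suc (Suc (k - 2))" "2 \<le> k - 2" using assms(2) by auto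
  qed
  have c: "cyl \<Omega> (\<lambda>z::'n st. t2 - fst z) (\<lambda>z. -1) (\<lambda>z. 0) (\<lambda>z. 0) (\<lambda>z. 0)"
    by (rule cyl_eq[OF cyl_add[OF cyl_const[OF assms(1), of t2] cyl_mult[OF cyl_const[OF assms(1), of "-1"] cyl_t[OF assms(1)]]]]) auto
  show ?thesis
  proof (rule cyl_eq[OF cyl_comp[OF c open_UNIV, where g="\<lambda>x. max 0 x ^ k" and g'="\<lambda>x. real k * max 0 x ^ Suc j" and g''="\<lambda>x. real k * (real (Suc j) * max 0 x ^ j)"]])
    show "Ck 3 UNIV (\<lambda>x::real. max 0 x ^ k)" using assms by (intro Ck_pospart_power) auto
    show "((\<lambda>x::real. max 0 x ^ k) has_real_derivative real k * max 0 x ^ Suc j) (at x)" for x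
      unfolding k by (rule has_real_derivative_pospart_power) simp
    show "((\<lambda>x. real k * max 0 x ^ Suc j) has_real_derivative real k * (real (Suc j) * max 0 x ^ j)) (at x)" for x
      using k by (intro DERIV_cmult has_real_derivative_pospart_power) simp
  qed (auto simp: k)
qed

lemma shell_test_function:
  assumes S: "S < S'" "0 < S'" and l: "4 \<le> l"
  obtains C where "0 < C"
    "\<And>r F. 0 < r \<Longrightarrow> r \<le> 1 \<Longrightarrow> F = (\<lambda>z::'n st. max 0 (S' - fst z) ^ l * shell_cutoff l (nn z / r ^ 4)) \<Longrightarrow>
        Ck 3 UNIV F \<and> (\<forall>z. 0 < fst z \<longrightarrow>
          \<bar>hardy_op lam F z\<bar> \<le> C * r powr (- 2) * (max 0 (S' - fst z) * (max 0 (nn z / r ^ 4 - 1 / 32) * max 0 (2 - nn z / r ^ 4))) ^ (l - 2))"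
proof -
  define N where "N = real CARD('n)"
  obtain h1 h2 where h: "\<And>x. (shell_cutoff l has_real_derivative h1 x) (at x)" "\<And>x. (h1 has_real_derivative h2 x) (at x)"
    "Ck 3 UNIV (shell_cutoff l)"
    "\<And>x. \<bar>h1 x\<bar> \<le> 16 * real l * (max 0 (x - 1 / 32) * max 0 (2 - x)) ^ (l - 2)"
    "\<And>x. \<bar>h2 x\<bar> \<le> 16 * (real l)\<^sup>2 * (max 0 (x - 1 / 32) * max 0 (2 - x)) ^ (l - 2)"
    using shell_cutoff_derivs[OF l] by blast
  define C where "C = real l * S' * 16 + S'\<^sup>2 * (16 * real l * (16 * (N + 2)) + 16 * (real l)\<^sup>2 * 64) + S'\<^sup>2 * (lam * 6 * 16)"
  have Cpos: "0 < C" unfolding C_def using S l lam_pos by (intro add_pos_nonneg) (auto simp: N_def)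
  show thesis
  proof (rule that[OF Cpos])
    fix r :: real and F :: "'n st \<Rightarrow> real"
    assume r: "0 < r" "r \<le> 1" and F: "F = (\<lambda>z. max 0 (S' - fst z) ^ l * shell_cutoff l (nn z / r ^ 4))"
    note cF = cyl_mult[OF cyl_time_pospart[OF open_UNIV l, of S'] cyl_profile_n[OF open_UNIV h(3,1,2), of "r ^ 4"]]
    have CF: "Ck 3 UNIV F" using cF unfolding cyl_def F by blast
    have "\<bar>hardy_op lam F z\<bar> \<le> C * r powr (- 2) * (max 0 (S' - fst z) * (max 0 (nn z / r ^ 4 - 1 / 32) * max 0 (2 - nn z / r ^ 4))) ^ (l - 2)"
      if t: "0 < fst z" for z :: "'n st"
    proof -
      define th where "th = max 0 (S' - fst z)"
      define x where "x = nn z / r ^ 4"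
      define Z where "Z = max 0 (x - 1 / 32) * max 0 (2 - x)"
      have th: "0 \<le> th" "th \<le> S'" using t S by (auto simp: th_def)
      have Z0: "0 \<le> Z" by (simp add: Z_def)
      have nx: "nn z = x * r ^ 4" using r by (simp add: x_def)
      have r2: "r powr (- 2) = 1 / r\<^sup>2" using r by (simp add: powr_minus_divide)
      have PLz: "hardy_op lam F z = - (real l * th ^ (l - 1)) * shell_cutoff l x
          + th ^ l * (h1 x * (8 * (N + 2) * aa z / r ^ 4) + h2 x * (16 * aa z * nn z / (r ^ 4)\<^sup>2))
          + lam * (aa z / nn z) * (th ^ l * shell_cutoff l x)"
        using cF unfolding cyl_def hardy_op_def F th_def x_def N_def by (simp add: UNIV_I)
      have hZ: "shell_cutoff l x = Z ^ l" by (simp add: shell_cutoff_def Z_def power_mult_distrib)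
      show ?thesis
      proof (cases "Z = 0")
        case True
        have z0: "(0::real) ^ (l - 2) = 0" using l unfolding power_0_left by simp
        have "\<bar>h1 x\<bar> \<le> 16 * real l * 0" "\<bar>h2 x\<bar> \<le> 16 * (real l)\<^sup>2 * 0"
          using h(4,5)[of x] unfolding Z_def[symmetric] True z0 .
        then have "h1 x = 0" "h2 x = 0" by simp_all
        then show ?thesis unfolding PLz hZ using True l by (simp add: Z_def[symmetric] x_def[symmetric] th_def[symmetric] power_0_left)
      next
        case False
        then have x: "1 / 32 < x" "x < 2" by (auto simp: Z_def max_def split: if_splits)
        have Z4: "Z \<le> 4" unfolding Z_def using x mult_mono[of "x - 1/32" 2 "2 - x" 2] by auto
        have n: "0 < nn z" using nx x r by simp
        have a: "0 \<le> aa z" "aa z \<le> 2 * r\<^sup>2"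
        proof -
          show "0 \<le> aa z" by (rule hz_nonneg)
          have "(aa z)\<^sup>2 \<le> (2 * r\<^sup>2)\<^sup>2"
          proof -
            have "x * r ^ 4 \<le> 4 * r ^ 4" using x r by (intro mult_right_mono) auto
            moreover have "(2 * r\<^sup>2)\<^sup>2 = 4 * r ^ 4" by (simp add: power_mult_distrib flip: power_mult)
            ultimately show ?thesis using hz_le_hn[of "snd z"] unfolding nx by linarith
          qed
          then show "aa z \<le> 2 * r\<^sup>2" by (rule power2_le_imp_le) simp
        qed
        have V: "0 \<le> aa z / nn z" "aa z / nn z \<le> 6 / r\<^sup>2"
        proof -
          show "0 \<le> aa z / nn z" by (rule V_le(1)[OF n])
          have "(aa z)\<^sup>2 \<le> nn z" by (rule hz_le_hn)
          then have "(aa z / nn z)\<^sup>2 \<le> nn z / (nn z)\<^sup>2" unfolding power_divide by (intro divide_right_mono) auto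
          also have "\<dots> = 1 / nn z" using n by (simp add: power2_eq_square)
          also have "\<dots> \<le> 32 / r ^ 4" using nx x r by (simp add: field_simps)
          also have "\<dots> \<le> (6 / r\<^sup>2)\<^sup>2" using r by (simp add: power_divide divide_right_mono flip: power_mult)
          finally show "aa z / nn z \<le> 6 / r\<^sup>2" by (rule power2_le_imp_le) simp
        qed
        define Y where "Y = th ^ (l - 2) * Z ^ (l - 2)"
        have Y0: "0 \<le> Y" using th Z0 by (simp add: Y_def)
        obtain k where k: "l = Suc (Suc k)" 
        proof (rule that)
          show "l = Suc (Suc (l - 2))" using l by simp
        qed
        have lk: "l - 2 = k" "l - 1 = Suc k" using k by auto
        have e1: "\<bar>- (real l * th ^ (l - 1)) * shell_cutoff l x\<bar> \<le> Y * (real l * S' * 16) / r\<^sup>2"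
        proof -
          have "\<bar>- (real l * th ^ (l - 1)) * shell_cutoff l x\<bar> = Y * (real l * th * Z\<^sup>2)"
          proof -
            have "(real l * th ^ (l - 1)) * shell_cutoff l x = Y * (real l * th * Z\<^sup>2)"
              unfolding hZ Y_def unfolding k by (simp add: power2_eq_square algebra_simps)
            moreover have "0 \<le> Y * (real l * th * Z\<^sup>2)" using th Y0 by simp
            ultimately show ?thesis by (simp only: mult_minus_left abs_minus_cancel abs_of_nonneg)
          qed
          also have "\<dots> \<le> Y * (real l * S' * 16)"
            using th Z0 Z4 Y0 power_mono[OF Z4 Z0, of 2] S by (intro mult_left_mono mult_mono) auto
          also have "\<dots> \<le> Y * (real l * S' * 16) / r\<^sup>2"
          proof -
            have "r\<^sup>2 \<le> 1" using r by (simp add: power_le_one)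
            then show ?thesis using r Y0 S by (simp add: le_divide_eq mult_left_le)
          qed
          finally show ?thesis .
        qed
        have e2: "\<bar>h1 x * (8 * (N + 2) * aa z / r ^ 4)\<bar> \<le> Z ^ (l - 2) * (16 * real l * (16 * (N + 2))) / r\<^sup>2"
        proof -
          have "8 * (N + 2) * aa z / r ^ 4 \<le> 8 * (N + 2) * (2 * r\<^sup>2) / r ^ 4"
            using a by (intro divide_right_mono mult_left_mono) (auto simp: N_def)
          also have "\<dots> = 16 * (N + 2) / r\<^sup>2" using r by (simp add: power2_eq_square power4_eq_xxxx)
          finally have "\<bar>8 * (N + 2) * aa z / r ^ 4\<bar> \<le> 16 * (N + 2) / r\<^sup>2" using a by (simp add: N_def)
          then have "\<bar>h1 x * (8 * (N + 2) * aa z / r ^ 4)\<bar> \<le> (16 * real l * Z ^ (l - 2)) * (16 * (N + 2) / r\<^sup>2)"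
            unfolding abs_mult using h(4)[of x] Z0 by (intro mult_mono) (auto simp: Z_def[symmetric])
          then show ?thesis by (simp only: times_divide_eq_right times_divide_eq_left mult_ac)
        qed
        have e3: "\<bar>h2 x * (16 * aa z * nn z / (r ^ 4)\<^sup>2)\<bar> \<le> Z ^ (l - 2) * (16 * (real l)\<^sup>2 * 64) / r\<^sup>2"
        proof -
          have "16 * aa z * nn z / (r ^ 4)\<^sup>2 \<le> 16 * (2 * r\<^sup>2) * (2 * r ^ 4) / (r ^ 4)\<^sup>2"
            using a n nx x r by (intro divide_right_mono mult_mono) auto
          also have "\<dots> = 64 / r\<^sup>2" using r by (simp add: power2_eq_square power4_eq_xxxx)
          finally have "\<bar>16 * aa z * nn z / (r ^ 4)\<^sup>2\<bar> \<le> 64 / r\<^sup>2" using a n by simp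
          then have "\<bar>h2 x * (16 * aa z * nn z / (r ^ 4)\<^sup>2)\<bar> \<le> (16 * (real l)\<^sup>2 * Z ^ (l - 2)) * (64 / r\<^sup>2)"
            unfolding abs_mult using h(5)[of x] Z0 by (intro mult_mono) (auto simp: Z_def[symmetric])
          then show ?thesis by (simp only: times_divide_eq_right times_divide_eq_left mult_ac)
        qed
        have th2: "th ^ l = th ^ (l - 2) * th\<^sup>2" "th\<^sup>2 \<le> S'\<^sup>2" using th k by (auto simp: power2_eq_square power_mono mult_mono)
        have e23: "\<bar>th ^ l * (h1 x * (8 * (N + 2) * aa z / r ^ 4) + h2 x * (16 * aa z * nn z / (r ^ 4)\<^sup>2))\<bar>
           \<le> Y * (S'\<^sup>2 * (16 * real l * (16 * (N + 2)) + 16 * (real l)\<^sup>2 * 64)) / r\<^sup>2"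
        proof -
          have "\<bar>h1 x * (8 * (N + 2) * aa z / r ^ 4) + h2 x * (16 * aa z * nn z / (r ^ 4)\<^sup>2)\<bar>
             \<le> Z ^ (l - 2) * (16 * real l * (16 * (N + 2))) / r\<^sup>2 + Z ^ (l - 2) * (16 * (real l)\<^sup>2 * 64) / r\<^sup>2"
            using e2 e3 abs_triangle_ineq[of "h1 x * (8 * (N + 2) * aa z / r ^ 4)" "h2 x * (16 * aa z * nn z / (r ^ 4)\<^sup>2)"] by linarith
          also have "\<dots> = Z ^ (l - 2) * (16 * real l * (16 * (N + 2)) + 16 * (real l)\<^sup>2 * 64) / r\<^sup>2"
            by (simp add: distrib_left add_divide_distrib)
          finally have "th ^ l * \<bar>h1 x * (8 * (N + 2) * aa z / r ^ 4) + h2 x * (16 * aa z * nn z / (r ^ 4)\<^sup>2)\<bar>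
            \<le> (th ^ (l - 2) * S'\<^sup>2) * (Z ^ (l - 2) * (16 * real l * (16 * (N + 2)) + 16 * (real l)\<^sup>2 * 64) / r\<^sup>2)"
            unfolding th2(1) using th th2(2) Z0 by (intro mult_mono mult_left_mono) (auto simp: N_def)
          then show ?thesis using th by (simp add: abs_mult Y_def mult_ac)
        qed
        have e4: "\<bar>lam * (aa z / nn z) * (th ^ l * shell_cutoff l x)\<bar> \<le> Y * (S'\<^sup>2 * (lam * 6 * 16)) / r\<^sup>2"
        proof -
          have "\<bar>lam * (aa z / nn z) * (th ^ l * shell_cutoff l x)\<bar> = lam * (aa z / nn z) * (Y * (th\<^sup>2 * Z\<^sup>2))"
          proof -
            have "th ^ l * shell_cutoff l x = Y * (th\<^sup>2 * Z\<^sup>2)"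
              unfolding hZ Y_def unfolding k by (simp add: power2_eq_square algebra_simps)
            moreover have "0 \<le> lam * (aa z / nn z) * (Y * (th\<^sup>2 * Z\<^sup>2))" using V lam_pos Y0 by (intro mult_nonneg_nonneg) auto
            ultimately show ?thesis by (simp only: abs_of_nonneg)
          qed
          also have "\<dots> \<le> lam * (6 / r\<^sup>2) * (Y * (S'\<^sup>2 * 16))"
            using V lam_pos th2(2) power_mono[OF Z4 Z0, of 2] Y0 Z0 th by (intro mult_mono mult_left_mono) auto
          finally show ?thesis by (simp add: mult_ac)
        qed
        have "\<bar>hardy_op lam F z\<bar> \<le> Y * (real l * S' * 16) / r\<^sup>2 + Y * (S'\<^sup>2 * (16 * real l * (16 * (N + 2)) + 16 * (real l)\<^sup>2 * 64)) / r\<^sup>2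
            + Y * (S'\<^sup>2 * (lam * 6 * 16)) / r\<^sup>2"
          unfolding PLz using e1 e23 e4 by linarith
        also have "\<dots> = C * (1 / r\<^sup>2) * Y" unfolding C_def by (simp add: distrib_left add_divide_distrib mult_ac)
        finally show ?thesis unfolding r2 Y_def th_def[symmetric] x_def[symmetric] Z_def[symmetric] power_mult_distrib .
      qed
    qed
    then show "Ck 3 UNIV F \<and> (\<forall>z. 0 < fst z \<longrightarrow>
          \<bar>hardy_op lam F z\<bar> \<le> C * r powr (- 2) * (max 0 (S' - fst z) * (max 0 (nn z / r ^ 4 - 1 / 32) * max 0 (2 - nn z / r ^ 4))) ^ (l - 2))"
      using CF by blast
  qed
qed


text \<open>With the cut-off at scale \<open>r\<close> as test function, Young's inequality absorbs half of \<open>\<integral> |U|^p F\<close> and bounds it by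
\<open>r^(-2 p')\<close> times the volume \<open>r^(2 N + 2)\<close> of the shell, \<open>p' = p / (p - 1)\<close>. A second use of Young turns
this into the bound on \<open>\<integral> |U|\<close>. The bound extends down to \<open>t = 0\<close>, since admissible functions may be
positive there.\<close>

lemma shell_bound:
  assumes S: "0 < S" "S < T"
  obtains C where "0 < C" "\<And>r. 0 < r \<Longrightarrow> r \<le> 1 \<Longrightarrow>
     (\<integral>z. \<bar>U z\<bar> * indicator (region S (r ^ 4 / 16) (r ^ 4)) z \<partial>lborel) \<le> C * r powr (2 * real CARD('n) + 2 - 2 / (p - 1))"
proof -
  define N where "N = real CARD('n)"
  define p' where "p' = p / (p - 1)"
  define q where "q = 2 / (p - 1)"
  have p1: "0 < p - 1" using p by simp
  have pp: "1 < p'" "q * p = 2 * p'" using p1 by (auto simp: p'_def q_def field_simps)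
  define S' where "S' = (S + T) / 2"
  have S': "S < S'" "S' < T" "0 < S'" using S by (auto simp: S'_def)
  define l where "l = max 4 (nat \<lceil>2 * p'\<rceil>)"
  have l: "4 \<le> l" "2 * p' \<le> real l" unfolding l_def by (auto simp: le_max_iff_disj) linarith+
  obtain C1 where C1: "0 < C1" "\<And>r F. 0 < r \<Longrightarrow> r \<le> 1 \<Longrightarrow> F = (\<lambda>z::'n st. max 0 (S' - fst z) ^ l * shell_cutoff l (nn z / r ^ 4)) \<Longrightarrow>
        Ck 3 UNIV F \<and> (\<forall>z. 0 < fst z \<longrightarrow>
          \<bar>hardy_op lam F z\<bar> \<le> C1 * r powr (- 2) * (max 0 (S' - fst z) * (max 0 (nn z / r ^ 4 - 1 / 32) * max 0 (2 - nn z / r ^ 4))) ^ (l - 2))"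
    using shell_test_function[OF S'(1,3) l(1)] by blast
  \<comment> \<open>of \<open>Y^(l - 2)\<close>, the factor \<open>Y^(l / p)\<close> goes with \<open>U\<close> and makes up \<open>|U|^p Y^l\<close>; the rest is bounded\<close>
  define e where "e = real l - 2 - real l / p"
  have e: "0 \<le> e"
  proof -
    have "2 * p' * (1 - 1 / p) \<le> real l * (1 - 1 / p)" using l p by (intro mult_right_mono) auto
    moreover have "p' * (1 - 1 / p) = 1" using p by (simp add: p'_def field_simps)
    ultimately have "2 \<le> real l * (1 - 1 / p)" by (simp only: mult.assoc)
    moreover have "real l * (1 - 1 / p) = real l - real l / p" by (simp add: right_diff_distrib)
    ultimately show ?thesis unfolding e_def by linarith
  qed
  define D where "D = (2 * (C1 * (4 * S') powr e)) powr p'"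
  define c where "c = S' * 2 ^ (2 * CARD('n) + 1) * 2 ^ (2 * CARD('n) + 2)"
  define \<kappa> where "\<kappa> = (S' - S) ^ l * (1 / 32) ^ l"
  have pos: "0 < D" "0 < c" "0 < \<kappa>" using C1 S' by (auto simp: D_def c_def \<kappa>_def)
  show thesis
  proof (rule that)
    show "0 < (2 * D / \<kappa> + 1) * c" using pos by (auto intro!: mult_pos_pos add_pos_pos)
    fix r :: real assume r: "0 < r" "r \<le> 1"
    define F where "F = (\<lambda>z::'n st. max 0 (S' - fst z) ^ l * shell_cutoff l (nn z / r ^ 4))"
    define Y where "Y z = max 0 (S' - fst z) * (max 0 (nn z / r ^ 4 - 1 / 32) * max 0 (2 - nn z / r ^ 4))" for z :: "'n st"
    note CF = C1(2)[OF r F_def]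
    have Y0: "0 \<le> Y z" for z by (simp add: Y_def)
    have FY: "F z = Y z ^ l" for z by (simp add: F_def Y_def shell_cutoff_def power_mult_distrib)
    have Ypos: "fst z < S' \<and> r ^ 4 / 32 < nn z \<and> nn z < 2 * r ^ 4 \<and> (0 < fst z \<longrightarrow> Y z \<le> 4 * S')" if "Y z \<noteq> 0" for z
    proof -
      have f: "fst z < S'" "1 / 32 < nn z / r ^ 4" "nn z / r ^ 4 < 2"
        by (rule ccontr, use that in \<open>simp add: Y_def\<close>)+
      moreover have "Y z \<le> S' * (2 * 2)" if "0 < fst z"
        unfolding Y_def using f that S' r hn_nonneg[of "snd z"] by (intro mult_mono) auto
      ultimately show ?thesis using r by (auto simp: field_simps)
    qed
    have admissible: "admissible T F" unfolding admissible_def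
    proof (intro conjI)
      show "Ck 3 UNIV F" using CF by blast
      show "\<forall>z. 0 \<le> F z" using Y0 by (simp add: FY)
      show "\<exists>n0>0. \<forall>z. nn z < n0 \<longrightarrow> F z = 0"
        using Ypos r l by (intro exI[of _ "r ^ 4 / 32"]) (fastforce simp: FY)
      show "\<exists>S<T. \<exists>R. \<forall>z. 0 \<le> fst z \<longrightarrow> F z \<noteq> 0 \<longrightarrow> fst z \<le> S \<and> nn z \<le> R"
        using Ypos S' l by (intro exI[of _ S'] conjI exI[of _ "2 * r ^ 4"]) (fastforce simp: FY)+
    qed
    let ?A = "{0..S'} \<times> {\<xi>::'n heis. hn \<xi> \<le> (2 * r) ^ 4}"
    have Am: "?A \<in> sets lborel" unfolding sets_lborel by (intro borel_closed compact_imp_closed compact_slab)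
    have iA: "integrable lborel (indicator ?A :: 'n st \<Rightarrow> real)"
      using Am finite_slab by (intro integrable_real_indicator) auto
    have vol: "measure lborel ?A \<le> c * r powr (2 * N + 2)"
    proof -
      have "measure lborel ?A \<le> S' * 2 ^ (2 * CARD('n) + 1) * (2 * r) ^ (2 * CARD('n) + 2)"
        using S' r by (intro slab_volume) auto
      also have "\<dots> = c * r ^ (2 * CARD('n) + 2)" unfolding c_def power_mult_distrib by simp
      also have "r ^ (2 * CARD('n) + 2) = r powr (2 * N + 2)"
        using powr_realpow[OF r(1), of "2 * CARD('n) + 2"] unfolding N_def
          by (metis of_nat_add of_nat_mult of_nat_numeral)
      finally show ?thesis .
    qed
    have inA: "z \<in> ?A" if "0 < fst z" "fst z \<le> S'" "nn z \<le> 2 * r ^ 4" for z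
    proof -
      have "2 * r ^ 4 \<le> (2 * r) ^ 4" using r by (simp add: power_mult_distrib)
      then have "nn z \<le> (2 * r) ^ 4" using that by linarith
      then show ?thesis using that by (cases z) (simp del: split_paired_All)
    qed
    define E where "E = (\<integral>z. \<bar>U z\<bar> powr p * F z \<partial>lborel)"
    have iE: "integrable lborel (\<lambda>z. \<bar>U z\<bar> powr p * F z)" by (rule int_pow[OF admissible])
    have pt: "norm (U z * hardy_op lam F z) \<le> \<bar>U z\<bar> powr p * F z / 2 + D * r powr (- 2 * p') * indicator ?A z" for z
    proof (cases "0 < fst z \<and> Y z \<noteq> 0")
      case False
      have "U z * hardy_op lam F z = 0"
      proof (cases "0 < fst z")
        case True
        then have "Y z = 0" using False by simp
        have z0: "(0::real) ^ (l - 2) = 0" using l unfolding power_0_left by simp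
        have "\<bar>hardy_op lam F z\<bar> \<le> C1 * r powr (- 2) * Y z ^ (l - 2)" using CF True unfolding Y_def by blast
        then have "\<bar>hardy_op lam F z\<bar> \<le> 0" unfolding \<open>Y z = 0\<close> z0 by simp
        then show ?thesis by simp
      qed (use U_supp[of z] in auto)
      moreover have "0 \<le> \<bar>U z\<bar> powr p * F z / 2 + D * r powr (- 2 * p') * indicator ?A z"
        using Y0 pos by (simp add: FY)
      ultimately show ?thesis by (simp only: norm_zero)
    next
      case True
      then have Yp: "0 < Y z" using Y0[of z] by simp
      note Y1 = Ypos[of z] 
      define b where "b = C1 * r powr (- 2) * Y z powr e"
      have b0: "0 \<le> b" using C1 by (simp add: b_def)
      have "norm (U z * hardy_op lam F z) \<le> \<bar>U z\<bar> * (C1 * r powr (- 2) * Y z ^ (l - 2))"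
        unfolding real_norm_def abs_mult Y_def using CF True by (intro mult_left_mono) auto
      also have "Y z ^ (l - 2) = Y z powr (real l / p) * Y z powr e"
      proof -
        have "Y z ^ (l - 2) = Y z powr (real (l - 2))" using Yp by (simp add: powr_realpow)
        also have "real (l - 2) = real l / p + e" using l by (simp add: e_def)
        finally show ?thesis by (simp add: powr_add)
      qed
      also have "\<bar>U z\<bar> * (C1 * r powr (- 2) * (Y z powr (real l / p) * Y z powr e)) = (\<bar>U z\<bar> * Y z powr (real l / p)) * b"
        by (simp add: b_def mult_ac)
      also have "\<dots> \<le> (\<bar>U z\<bar> * Y z powr (real l / p)) powr p / 2 + (2 * b) powr p'"
        unfolding p'_def by (rule young_split) (use p b0 in auto)
      also have "(\<bar>U z\<bar> * Y z powr (real l / p)) powr p = \<bar>U z\<bar> powr p * F z"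
        using Yp p by (simp add: powr_mult powr_powr FY powr_realpow)
      also have "(2 * b) powr p' \<le> D * r powr (- 2 * p')"
      proof -
        have "Y z powr e \<le> (4 * S') powr e" using Y1 True Yp e by (intro powr_mono2) auto
        then have "2 * b \<le> 2 * (C1 * (4 * S') powr e) * r powr (- 2)"
          using C1 mult_left_mono[of "Y z powr e" "(4 * S') powr e" "C1 * r powr (- 2)"] by (simp add: b_def mult_ac)
        then have "(2 * b) powr p' \<le> (2 * (C1 * (4 * S') powr e) * r powr (- 2)) powr p'"
          using b0 pp by (intro powr_mono2) auto
        also have "\<dots> = D * r powr (- 2 * p')" using C1 by (simp add: D_def powr_mult powr_powr)
        finally show ?thesis .
      qed
      finally show ?thesis using inA[of z] True Y1 by simp
    qed
    have Ele: "E \<le> 2 * (D * r powr (- 2 * p') * (c * r powr (2 * N + 2)))"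
    proof -
      have "E \<le> - (\<integral>z. U z * hardy_op lam F z \<partial>lborel)" unfolding E_def by (rule super[OF admissible])
      also have "\<dots> \<le> norm (\<integral>z. U z * hardy_op lam F z \<partial>lborel)" by simp
      also have "\<dots> \<le> (\<integral>z. norm (U z * hardy_op lam F z) \<partial>lborel)" by (rule integral_norm_bound)
      also have "\<dots> \<le> (\<integral>z. \<bar>U z\<bar> powr p * F z / 2 + D * r powr (- 2 * p') * indicator ?A z \<partial>lborel)"
        by (rule integral_mono[OF integrable_norm[OF int_hardy_op[OF admissible]] _ pt]) (use iE iA in auto)
      also have "\<dots> = E / 2 + D * r powr (- 2 * p') * measure lborel ?A"
        using iE iA Am by (simp add: E_def)
      finally have "E \<le> 2 * (D * r powr (- 2 * p') * measure lborel ?A)" by simp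
      also have "\<dots> \<le> 2 * (D * r powr (- 2 * p') * (c * r powr (2 * N + 2)))"
        using vol pos by (intro mult_left_mono) auto
      finally show ?thesis .
    qed
    have low: "\<bar>U z\<bar> * indicator (region S (r ^ 4 / 16) (r ^ 4)) z \<le> r powr (- q) * (r powr (2 * p') * (\<bar>U z\<bar> powr p * F z / \<kappa>) + indicator ?A z)" for z
    proof (cases "z \<in> region S (r ^ 4 / 16) (r ^ 4) \<and> 0 < fst z")
      case False
      then have "\<bar>U z\<bar> * indicator (region S (r ^ 4 / 16) (r ^ 4)) z = 0" using U_supp[of z] by auto
      moreover have "0 \<le> r powr (- q) * (r powr (2 * p') * (\<bar>U z\<bar> powr p * F z / \<kappa>) + indicator ?A z)"
        using Y0 pos by (simp add: FY)
      ultimately show ?thesis by linarith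
    next
      case True
      then have x: "1 / 16 \<le> nn z / r ^ 4" "nn z / r ^ 4 \<le> 1" using r by (auto simp: region_def field_simps)
      have "(S' - S) * (1 / 32 * 1) \<le> Y z"
        unfolding Y_def
      proof (intro mult_mono)
        show "S' - S \<le> max 0 (S' - fst z)" using True by (auto simp: region_def)
        show "1 / 32 \<le> max 0 (nn z / r ^ 4 - 1 / 32)" using x(1) by linarith
        show "1 \<le> max 0 (2 - nn z / r ^ 4)" using x(2) by linarith
      qed auto
      then have "((S' - S) * (1 / 32 * 1)) ^ l \<le> Y z ^ l" using S' by (intro power_mono) auto
      then have F\<kappa>: "\<kappa> \<le> F z" by (simp add: FY \<kappa>_def power_mult_distrib power_divide)
      have "r powr q * \<bar>U z\<bar> \<le> (r powr q * \<bar>U z\<bar>) powr p + 1"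
        using le_powr_add_1[of "r powr q * \<bar>U z\<bar>"] by simp
      also have "(r powr q * \<bar>U z\<bar>) powr p = r powr (2 * p') * (\<bar>U z\<bar> powr p * 1)" by (simp add: powr_mult powr_powr pp)
      also have "\<dots> \<le> r powr (2 * p') * (\<bar>U z\<bar> powr p * (F z / \<kappa>))"
        using F\<kappa> pos by (intro mult_left_mono) auto
      finally have "r powr (- q) * (r powr q * \<bar>U z\<bar>) \<le> r powr (- q) * (r powr (2 * p') * (\<bar>U z\<bar> powr p * (F z / \<kappa>)) + 1)"
        by (intro mult_left_mono) auto
      moreover have "r powr (- q) * (r powr q * \<bar>U z\<bar>) = \<bar>U z\<bar>" using r by (simp add: mult.assoc[symmetric] flip: powr_add)
      moreover have "z \<in> ?A" using True S' r by (intro inA) (auto simp: region_def)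
      ultimately show ?thesis using True by simp
    qed
    have "(\<integral>z. \<bar>U z\<bar> * indicator (region S (r ^ 4 / 16) (r ^ 4)) z \<partial>lborel)
      \<le> (\<integral>z. r powr (- q) * (r powr (2 * p') * (\<bar>U z\<bar> powr p * F z / \<kappa>) + indicator ?A z) \<partial>lborel)"
    proof (rule integral_mono[OF _ _ low])
      have "integrable lborel (\<lambda>z. U z * indicator (region S (r ^ 4 / 16) (r ^ 4)) z)"
        using r S by (intro U_integrable) auto
      from integrable_norm[OF this] show "integrable lborel (\<lambda>z. \<bar>U z\<bar> * indicator (region S (r ^ 4 / 16) (r ^ 4)) z)"
        by (simp add: abs_mult)
    qed (use iE iA in auto)
    also have "\<dots> = r powr (- q) * (r powr (2 * p') * (E / \<kappa>) + measure lborel ?A)"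
      using iE iA Am by (simp add: E_def)
    also have "\<dots> \<le> r powr (- q) * (r powr (2 * p') * (2 * (D * r powr (- 2 * p') * (c * r powr (2 * N + 2))) / \<kappa>) + c * r powr (2 * N + 2))"
      using Ele vol pos by (intro mult_left_mono add_mono divide_right_mono) auto
    also have "\<dots> = (2 * D / \<kappa> + 1) * c * (r powr (- q) * r powr (2 * N + 2))"
    proof -
      have "r powr (2 * p') * (2 * (D * r powr (- 2 * p') * (c * r powr (2 * N + 2))) / \<kappa>) = (r powr (2 * p') * r powr (- 2 * p')) * (2 * D / \<kappa> * c * r powr (2 * N + 2))"
        by simp
      also have "r powr (2 * p') * r powr (- 2 * p') = 1" using r by (simp flip: powr_add)
      finally show ?thesis by (simp add: algebra_simps)
    qed
    also have "r powr (- q) * r powr (2 * N + 2) = r powr (2 * real CARD('n) + 2 - 2 / (p - 1))"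
      by (simp add: N_def q_def flip: powr_add)
    finally show "(\<integral>z. \<bar>U z\<bar> * indicator (region S (r ^ 4 / 16) (r ^ 4)) z \<partial>lborel) \<le> (2 * D / \<kappa> + 1) * c * r powr (2 * real CARD('n) + 2 - 2 / (p - 1))" .
  qed
qed

end

section \<open>Vanishing near the origin\<close>

lemma smooth_step:
  obtains g g' g'' :: "real \<Rightarrow> real" and W where
    "Ck 3 UNIV g" "\<And>x. (g has_real_derivative g' x) (at x)" "\<And>x. (g' has_real_derivative g'' x) (at x)"
    "\<And>x. 0 \<le> g x" "\<And>x. g x \<le> 1" "\<And>x. x \<le> 1 / 16 \<Longrightarrow> g x = 0" "\<And>x. 1 \<le> x \<Longrightarrow> g x = 1"
    "\<And>x. x \<le> 1 / 16 \<or> 1 \<le> x \<Longrightarrow> g' x = 0 \<and> g'' x = 0"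
    "0 < W" "\<And>x. \<bar>g' x\<bar> \<le> W" "\<And>x. \<bar>g'' x\<bar> \<le> W"
proof -
  \<comment> \<open>normalised so that \<open>y 1 = 1\<close>\<close>
  define c where "c = (16 / 15 :: real) ^ 4"
  define y where "y = (\<lambda>x. c * max 0 (x - 1 / 16 :: real) ^ 4)"
  define y1 where "y1 = (\<lambda>x. 4 * c * max 0 (x - 1 / 16 :: real) ^ 3)"
  define y2 where "y2 = (\<lambda>x. 12 * c * max 0 (x - 1 / 16 :: real) ^ 2)"
  have c: "0 < c" "c \<le> 2" by (auto simp: c_def field_simps)
  have dP: "((\<lambda>x. max 0 (x - 1 / 16) ^ Suc j) has_real_derivative real (Suc j) * max 0 (x - 1 / 16) ^ j) (at x)" if "2 \<le> j" for j and x :: real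
    using pospart_shift[OF that, of 1 "1/16" x] by simp
  have dy: "(y has_real_derivative y1 x) (at x)" for x
    unfolding y_def y1_def using DERIV_cmult[OF dP[of 3 x], of c] by (simp add: eval_nat_numeral mult_ac)
  have dy1: "(y1 has_real_derivative y2 x) (at x)" for x
    unfolding y2_def y1_def using DERIV_cmult[OF dP[of 2 x], of "4 * c"] by (simp add: eval_nat_numeral mult_ac)
  have Cy: "Ck 3 UNIV y" unfolding y_def
    by (intro Ck_cmult open_UNIV Ck_comp[OF open_UNIV Ck_diff[OF open_UNIV Ck_id Ck_const] open_UNIV Ck_pospart_power]) auto
  let ?q = "\<lambda>x. max 0 (1 - y x)"
  have dR: "((\<lambda>x. ?q x ^ Suc j) has_real_derivative - (real (Suc j) * ?q x ^ j) * y1 x) (at x)" if "2 \<le> j" for j x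
  proof -
    have "((\<lambda>t. max 0 (1 - t) ^ Suc j) has_real_derivative - (real (Suc j) * max 0 (1 - t) ^ j)) (at t)" for t :: real
      using pospart_shift[OF that, of "-1" 1 t] by simp
    from DERIV_chain2[OF this dy] show ?thesis .
  qed
  define g where "g = (\<lambda>x. 1 - ?q x ^ 4)"
  define g' where "g' = (\<lambda>x. 4 * (?q x ^ 3 * y1 x))"
  define g'' where "g'' = (\<lambda>x. 4 * (- (3 * ?q x ^ 2) * y1 x * y1 x + y2 x * ?q x ^ 3))"
  have y0: "0 \<le> y x" "0 \<le> y1 x" "0 \<le> y2 x" for x using c by (auto simp: y_def y1_def y2_def)
  have q: "0 \<le> ?q x" "?q x \<le> 1" for x using y0 by auto
  have hi: "1 \<le> y x" if "1 \<le> x" for x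
  proof -
    have "15 / 16 \<le> max 0 (x - 1 / 16)" using that by linarith
    from mult_left_mono[OF power_mono[OF this, of 4], of c] c have "c * (15 / 16) ^ 4 \<le> y x" unfolding y_def by linarith
    then show ?thesis by (simp add: c_def field_simps)
  qed
  have zero: "g' x = 0 \<and> g'' x = 0" if "x \<le> 1 / 16 \<or> 1 \<le> x" for x
    using that
  proof
    assume "x \<le> 1 / 16" then show ?thesis by (simp add: g'_def g''_def y1_def y2_def)
  next
    assume "1 \<le> x" then have "?q x = 0" using hi[of x] by auto
    then show ?thesis by (simp add: g'_def g''_def)
  qed
  have bd: "\<bar>g' x\<bar> \<le> 864 \<and> \<bar>g'' x\<bar> \<le> 864" for x
  proof (cases "x \<le> 1 / 16 \<or> 1 \<le> x")
    case False
    then have p: "0 \<le> max 0 (x - 1 / 16)" "max 0 (x - 1 / 16) \<le> 1" by auto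
    have b: "y1 x \<le> 8" "y2 x \<le> 24"
      unfolding y1_def y2_def using mult_mono[OF c(2) power_le_one[OF p, of 3]] mult_mono[OF c(2) power_le_one[OF p, of 2]] by auto
    have qq: "0 \<le> ?q x ^ 3" "?q x ^ 3 \<le> 1" "0 \<le> ?q x ^ 2" "?q x ^ 2 \<le> 1"
      using power_le_one[OF q, of x 3] power_le_one[OF q, of x 2] by auto
    have 1: "0 \<le> ?q x ^ 3 * y1 x" "?q x ^ 3 * y1 x \<le> 1 * 8" using mult_nonneg_nonneg[OF qq(1) y0(2)] mult_mono[OF qq(2) b(1) zero_le_one y0(2)] by auto
    have 2: "0 \<le> y2 x * ?q x ^ 3" "y2 x * ?q x ^ 3 \<le> 24 * 1" using mult_nonneg_nonneg[OF y0(3) qq(1)] mult_mono[OF b(2) qq(2) _ qq(1)] by auto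
    have 3: "0 \<le> ?q x ^ 2 * (y1 x * y1 x)" "?q x ^ 2 * (y1 x * y1 x) \<le> 1 * (8 * 8)" using mult_nonneg_nonneg[OF qq(3) mult_nonneg_nonneg[OF y0(2) y0(2)]]
        mult_mono[OF qq(4) mult_mono[OF b(1) b(1) _ y0(2)] zero_le_one mult_nonneg_nonneg[OF y0(2) y0(2)]] by auto
    have gen: "(4 * A \<le> 864 \<and> - (4 * A) \<le> 864) \<and> 4 * (- 3 * D + B) \<le> 864 \<and> - (4 * (- 3 * D + B)) \<le> 864"
      if "0 \<le> A" "A \<le> 1 * 8" "0 \<le> B" "B \<le> 24 * 1" "0 \<le> D" "D \<le> 1 * (8 * 8)" for A B D :: real
      using that by auto
    have e: "- (3 * ?q x ^ 2) * y1 x * y1 x = - 3 * (?q x ^ 2 * (y1 x * y1 x))" by simp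
    show ?thesis unfolding g'_def g''_def e abs_le_iff
      by (rule gen[OF 1 2 3])
  qed (use zero[of x] in auto)
  show thesis
  proof (rule that[of g g' g'' 864])
    show "Ck 3 UNIV g" unfolding g_def
      by (intro Ck_diff open_UNIV Ck_const Ck_comp[OF open_UNIV Ck_diff[OF open_UNIV Ck_const Cy] open_UNIV Ck_pospart_power]) auto
    show "(g has_real_derivative g' x) (at x)" for x
      unfolding g_def g'_def using DERIV_diff[OF DERIV_const[of 1] dR[of 3 x]] by (simp add: eval_nat_numeral mult_ac)
    show "(g' has_real_derivative g'' x) (at x)" for x
    proof -
      have "((\<lambda>x. ?q x ^ 3) has_real_derivative - (3 * ?q x ^ 2) * y1 x) (at x)"
        using dR[of 2 x] by (simp add: eval_nat_numeral)
      from DERIV_cmult[OF DERIV_mult[OF this dy1], of 4] show ?thesis unfolding g'_def g''_def .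
    qed
    show "0 \<le> g x" "g x \<le> 1" for x using power_le_one[OF q, of x 4] q[of x] by (auto simp: g_def)
    show "g x = 0" if "x \<le> 1 / 16" for x using that by (simp add: g_def y_def)
    show "g x = 1" if "1 \<le> x" for x using hi[OF that] by (simp add: g_def)
  qed (use zero bd in auto)
qed

text \<open>\<open>j(s) = s^4 / (2 + s)^3\<close> for \<open>s > 0\<close>. Convexity makes \<open>j\<close> of a subsolution a subsolution; linear growth
keeps the test function from being more singular than its argument.\<close>

lemma convex_truncation:
  obtains j j' j'' :: "real \<Rightarrow> real" where
    "Ck 3 {-2<..} j" "\<And>s. -2 < s \<Longrightarrow> (j has_real_derivative j' s) (at s)" "\<And>s. -2 < s \<Longrightarrow> (j' has_real_derivative j'' s) (at s)"
    "\<And>s. -2 < s \<Longrightarrow> 0 \<le> j s" "\<And>s. -2 < s \<Longrightarrow> j s \<le> max 0 s"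
    "\<And>s. -2 < s \<Longrightarrow> 0 \<le> j' s" "\<And>s. -2 < s \<Longrightarrow> j' s \<le> 4" "\<And>s. -2 < s \<Longrightarrow> 0 \<le> j'' s"
    "\<And>s. s \<le> 0 \<Longrightarrow> j s = 0 \<and> j' s = 0 \<and> j'' s = 0" "\<And>s. 0 < s \<Longrightarrow> 0 < j s"
proof -
  let ?p = "\<lambda>s::real. max 0 s"
  define u where "u = (\<lambda>s::real. inverse (2 + s))"
  define j where "j = (\<lambda>s. ?p s ^ 4 * u s ^ 3)"
  define j' where "j' = (\<lambda>s. 4 * (?p s ^ 3 * u s ^ 3) - 3 * (?p s ^ 4 * u s ^ 4))"
  define j'' where "j'' = (\<lambda>s. 12 * (?p s ^ 2 * u s ^ 3) - 24 * (?p s ^ 3 * u s ^ 4) + 12 * (?p s ^ 4 * u s ^ 5))"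
  have du: "(u has_real_derivative - (u s)\<^sup>2) (at s)" if "-2 < s" for s
    unfolding u_def using that by (auto intro!: derivative_eq_intros simp: power2_eq_square)
  have dun: "((\<lambda>s. u s ^ Suc n) has_real_derivative - (real (Suc n) * u s ^ Suc (Suc n))) (at s)" if "-2 < s" for s n
    using DERIV_power[OF du[OF that], of "Suc n"] by (simp add: power2_eq_square algebra_simps)
  have dp: "((\<lambda>s. ?p s ^ Suc n) has_real_derivative real (Suc n) * ?p s ^ n) (at s)" if "2 \<le> n" for n s
    using has_real_derivative_pospart_power[of n s] that by simp
  have dpu: "((\<lambda>s. ?p s ^ Suc n * u s ^ Suc m) has_real_derivative real (Suc n) * ?p s ^ n * u s ^ Suc m
       - real (Suc m) * (?p s ^ Suc n * u s ^ Suc (Suc m))) (at s)" if "-2 < s" "2 \<le> n" for n m s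
    using DERIV_mult[OF dp[OF that(2), of s] dun[OF that(1), of m]] by (simp add: algebra_simps)
  have key: "u s = 1 / (2 + s)" for s by (simp add: u_def inverse_eq_divide)
  have up: "0 < u s" if "-2 < s" for s using that by (simp add: u_def)
  have pu: "0 \<le> ?p s * u s" "?p s * u s \<le> 1" if "-2 < s" for s
    using that by (auto simp: u_def max_def field_simps)
  have k2: "u s * 2 = 1 - s * u s" if "-2 < s" for s using that by (simp add: u_def field_simps)
  show thesis
  proof (rule that[of j j' j''])
    have "Ck 3 {-2<..} (\<lambda>s. (2 + s) powr (-3))"
    proof (rule Ck_comp[where g="\<lambda>x. x powr (-3)", OF _ Ck_add[OF _ Ck_const Ck_id] _ Ck_powr])
    qed auto
    then have "Ck 3 {-2<..} (\<lambda>s. ?p s ^ 4 * (2 + s) powr (-3))"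
      by (intro Ck_mult Ck_subset[OF Ck_pospart_power]) auto
    moreover have "?p s ^ 4 * (2 + s) powr (-3) = j s" if "s \<in> {-2<..}" for s
    proof -
      have "(2 + s) powr (-3) = u s ^ 3" using that powr_realpow[of "2 + s" 3] by (simp add: u_def powr_minus power_inverse)
      then show ?thesis by (simp add: j_def)
    qed
    ultimately show "Ck 3 {-2<..} j" using Ck_cong[of "{-2<..}" j "\<lambda>s. ?p s ^ 4 * (2 + s) powr (-3)" 3] by simp
    fix s :: real
    show "s \<le> 0 \<Longrightarrow> j s = 0 \<and> j' s = 0 \<and> j'' s = 0" by (simp add: j_def j'_def j''_def)
    show "0 < s \<Longrightarrow> 0 < j s" by (simp add: j_def u_def)
    assume s: "-2 < s"
    show "(j has_real_derivative j' s) (at s)"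
      unfolding j_def j'_def using dpu[OF s, of 3 2] by (simp add: eval_nat_numeral mult_ac)
    show "(j' has_real_derivative j'' s) (at s)"
      unfolding j''_def j'_def
      using DERIV_diff[OF DERIV_cmult[OF dpu[OF s, of 2 2], of 4] DERIV_cmult[OF dpu[OF s, of 3 3], of 3]]
      by (simp add: eval_nat_numeral algebra_simps)
    let ?x = "?p s * u s"
    have 3: "j s = ?p s * ?x ^ 3" by (simp add: j_def eval_nat_numeral algebra_simps)
    have 4: "j' s = ?x ^ 3 * (4 - 3 * ?x)" by (simp add: j'_def eval_nat_numeral algebra_simps)
    have 5: "j'' s = 12 * ?x ^ 2 * u s * (1 - ?x) ^ 2" by (simp add: j''_def eval_nat_numeral algebra_simps)
    note x = pu[OF s]
    show "0 \<le> j s" unfolding 3 by (intro mult_nonneg_nonneg zero_le_power x(1)) auto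
    show "j s \<le> max 0 s" unfolding 3 using power_le_one[OF x, of 3] mult_left_mono[of "?x ^ 3" 1 "?p s"] by simp
    show "0 \<le> j' s" unfolding 4 using zero_le_power[OF x(1), of 3] x(2) by (intro mult_nonneg_nonneg) linarith+
    show "j' s \<le> 4" unfolding 4 using x power_le_one[OF x, of 3] mult_mono[of "?x ^ 3" 1 "4 - 3 * ?x" 4] by simp
    show "0 \<le> j'' s" unfolding 5 using up[OF s] by (intro mult_nonneg_nonneg zero_le_power2) auto
  qed
qed

lemma AE_nn_pos: "AE z :: 'n::finite st in lborel. 0 < nn z"
proof -
  have "AE z :: 'n st in lebesgue. 0 < nn z"
    using AE_spatial_nonzero by eventually_elim (simp add: hn_pos_iff)
  then show ?thesis by (simp add: AE_completion_iff borel_measurable_nn)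
qed

context heis_super
begin

text \<open>After the ground state transform the potential is gone and a first order term appears, which for a
homogeneous function is a multiple of \<open>(a / n) G\<close>.\<close>

lemma hardy_transform:
  assumes G: "cyl \<Omega> G Gt Ga Gw GL" and sub: "\<Omega> \<subseteq> {z. 0 < nn z}"
  shows "Ck 3 \<Omega> (\<lambda>z::'n st. nn z powr (- \<mu> / 4) * G z)"
    "z \<in> \<Omega> \<Longrightarrow> hardy_op lam (\<lambda>z. nn z powr (- \<mu> / 4) * G z) z
       = nn z powr (- \<mu> / 4) * (Gt z + GL z - 4 * \<mu> * (aa z / nn z) * (aa z * Ga z + ww z * Gw z))"
proof -
  have o: "open \<Omega>" using G by (simp add: cyl_def)
  note c = cyl_mult[OF cyl_subset[OF cyl_n_powr[of "- \<mu> / 4"] o sub] G]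
  show "Ck 3 \<Omega> (\<lambda>z::'n st. nn z powr (- \<mu> / 4) * G z)" using c by (simp add: cyl_def)
  assume z: "z \<in> \<Omega>"
  then have n: "0 < nn z" using sub by auto
  have p: "nn z powr (- \<mu> / 4 - 1) = nn z powr (- \<mu> / 4) / nn z" using n by (simp add: powr_diff)
  have d: "dt (\<lambda>z. nn z powr (- \<mu> / 4) * G z) z = nn z powr (- \<mu> / 4) * Gt z"
    using c z unfolding cyl_def by simp
  have L: "Lap (\<lambda>z. nn z powr (- \<mu> / 4) * G z) z = nn z powr (- \<mu> / 4) * GL z
     + 8 * (- \<mu> / 4) * aa z * nn z powr (- \<mu> / 4 - 1) * (real CARD('n) + 2 * (- \<mu> / 4)) * G z
     + 8 * aa z * ((- \<mu> / 4 * nn z powr (- \<mu> / 4 - 1) * (2 * aa z)) * Ga z + (- \<mu> / 4 * nn z powr (- \<mu> / 4 - 1) * (2 * ww z)) * Gw z)"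
    using c z unfolding cyl_def by blast
  show "hardy_op lam (\<lambda>z. nn z powr (- \<mu> / 4) * G z) z
       = nn z powr (- \<mu> / 4) * (Gt z + GL z - 4 * \<mu> * (aa z / nn z) * (aa z * Ga z + ww z * Gw z))"
    unfolding hardy_op_def d L p lam using n by (simp add: field_simps power2_eq_square)
qed

text \<open>The exponent \<open>- \<beta>\<close> lies beyond the second root \<open>- (2 N - 2 \<mu>)\<close> of the transformed operator, so \<open>n^(- \<beta> / 4)\<close> is
a subsolution, but a degenerate one: the gain carries a factor \<open>a / n\<close> and is lost on the axis \<open>a = 0\<close>. The
correction \<open>\<sigma> a n^(- \<beta> / 4 - 1 / 2)\<close> has sub-Laplacian \<open>4 N \<sigma> n^(- \<beta> / 4 - 1 / 2)\<close> on the axis and restores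
a gain comparable to \<open>n^(- 1 / 2) M\<close> in all directions.\<close>

lemma growing_profile:
  fixes \<beta> \<sigma> h :: real
  assumes \<beta>: "0 < \<beta>" and s: "\<sigma> = \<beta> / 2 * (\<beta> / 2 + \<mu> - real CARD('n))" "0 < \<sigma>"
    and h: "h = 4 * \<sigma> * min (real CARD('n)) \<sigma> / (1 + \<sigma>)"
    and M: "M = (\<lambda>z. nn z powr (- \<beta> / 4) + \<sigma> * aa z * nn z powr (- \<beta> / 4 - 1 / 2))"
  obtains Ma Mw LM where "cyl {z::'n st. 0 < nn z} M (\<lambda>z. 0) Ma Mw LM"
    "\<And>z. 0 < nn z \<Longrightarrow> aa z * Ma z + ww z * Mw z = - \<beta> / 2 * M z"
    "\<And>z. 0 < nn z \<Longrightarrow> h * M z * nn z powr (- 1 / 2) \<le> LM z + 2 * \<mu> * \<beta> * (aa z / nn z) * M z"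
    "\<And>z. 0 < nn z \<Longrightarrow> nn z powr (- \<beta> / 4) \<le> M z" "\<And>z. 0 < nn z \<Longrightarrow> M z \<le> (1 + \<sigma>) * nn z powr (- \<beta> / 4)"
proof -
  define c where "c = - \<beta> / 4"
  define e where "e = c - 1 / 2"
  define N where "N = real CARD('n)"
  let ?\<Omega> = "{z::'n st. 0 < nn z}"
  have ce: "- \<beta> / 4 = c" "- \<beta> / 4 - 1 / 2 = e" by (simp_all add: c_def e_def)
  note c2 = cyl_mult[OF cyl_mult[OF cyl_const[OF open_nn_pos, of \<sigma>] cyl_a[OF open_nn_pos]] cyl_n_powr[of e]]
  define Ma where "Ma = (\<lambda>z::'n st. c * nn z powr (c - 1) * (2 * aa z) + \<sigma> * (nn z powr e + aa z * (e * nn z powr (e - 1) * (2 * aa z))))"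
  define Mw where "Mw = (\<lambda>z::'n st. c * nn z powr (c - 1) * (2 * ww z) + \<sigma> * aa z * (e * nn z powr (e - 1) * (2 * ww z)))"
  define LM where "LM = (\<lambda>z::'n st. 8 * c * aa z * nn z powr (c - 1) * (N + 2 * c) + \<sigma> * (aa z * (8 * e * aa z * nn z powr (e - 1) * (N + 2 * e)) + 4 * N * nn z powr e + 8 * aa z * (e * nn z powr (e - 1) * (2 * aa z))))"
  have M': "M = (\<lambda>z. nn z powr c + \<sigma> * aa z * nn z powr e)" by (simp only: M ce(2)) (simp only: ce(1))
  have cyl: "cyl ?\<Omega> M (\<lambda>z. 0) Ma Mw LM"
    by (rule cyl_eq[OF cyl_add[OF cyl_n_powr[of c] c2]]) (auto simp: M' Ma_def Mw_def LM_def N_def algebra_simps)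
  have y: "0 \<le> aa z" "aa z \<le> nn z powr (1 / 2)" for z :: "'n st"
  proof -
    show "0 \<le> aa z" by (rule hz_nonneg)
    have "aa z \<le> sqrt (nn z)" using hz_le_hn[of "snd z"] by (simp add: real_le_rsqrt)
    then show "aa z \<le> nn z powr (1 / 2)" using hn_nonneg[of "snd z"] by (simp add: powr_half_sqrt)
  qed
  have pw: "nn z powr c = nn z powr e * nn z powr (1 / 2)" "nn z powr (c - 1) = nn z powr e * nn z powr (1 / 2) / nn z"
     "nn z powr (e - 1) = nn z powr e / nn z" "nn z powr (1 / 2) * nn z powr (1 / 2) = nn z" if "0 < nn z" for z :: "'n st"
  proof -
    have e1: "c = e + 1 / 2" by (simp add: e_def)
    show "nn z powr c = nn z powr e * nn z powr (1 / 2)" unfolding e1 powr_add ..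
    then show "nn z powr (c - 1) = nn z powr e * nn z powr (1 / 2) / nn z" using that by (simp add: powr_diff)
    show "nn z powr (e - 1) = nn z powr e / nn z" using that by (simp add: powr_diff)
    show "nn z powr (1 / 2) * nn z powr (1 / 2) = nn z" using that unfolding powr_add[symmetric] by simp
  qed
  show thesis
  proof (rule that[OF cyl])
    fix z :: "'n st" assume n: "0 < nn z"
    define E where "E = nn z powr e"
    define R where "R = nn z powr (1 / 2)"
    have E: "0 < E" and R: "0 < R" using n by (auto simp: E_def R_def)
    have RR: "nn z = R * R" using pw(4)[OF n] by (simp add: R_def)
    define b where "b = aa z / R"
    have b: "0 \<le> b" "b \<le> 1" using y[of z] R by (auto simp: b_def R_def[symmetric])
    have ab: "aa z = b * R" using R by (simp add: b_def)
    have aw: "aa z * aa z + ww z * ww z = R * R" using RR by (simp add: hn_def power2_eq_square)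
    have Mz: "M z = E * R * (1 + \<sigma> * b)" unfolding M' pw(1)[OF n] E_def[symmetric] R_def[symmetric] ab by (simp add: algebra_simps)
    have nc: "nn z powr (- \<beta> / 4) = E * R" unfolding ce(1) pw(1)[OF n] E_def R_def ..
    show "nn z powr (- \<beta> / 4) \<le> M z" unfolding nc Mz using E R b s by simp
    show "M z \<le> (1 + \<sigma>) * nn z powr (- \<beta> / 4)" unfolding nc Mz using E R b s by (simp add: mult_left_le)
    have "aa z * Ma z + ww z * Mw z = (aa z * aa z + ww z * ww z) * (2 * c * (E * R / nn z) + \<sigma> * aa z * 2 * e * (E / nn z)) + \<sigma> * aa z * E"
      unfolding Ma_def Mw_def pw(2,3)[OF n] E_def[symmetric] R_def[symmetric] by (simp add: algebra_simps add_divide_distrib)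
    also have "\<dots> = 2 * c * (E * R) + \<sigma> * aa z * 2 * e * E + \<sigma> * aa z * E" unfolding aw RR using R by (simp add: field_simps)
    also have "\<dots> = - \<beta> / 2 * M z" unfolding Mz ab e_def c_def by (simp add: algebra_simps)
    finally show "aa z * Ma z + ww z * Mw z = - \<beta> / 2 * M z" .
    have s1: "4 * \<sigma> = 8 * c * (N - \<mu> + 2 * c)" unfolding s(1) c_def N_def by (simp add: algebra_simps)
    have "LM z + 2 * \<mu> * \<beta> * (aa z / nn z) * M z = E * (8 * c * b * (N - \<mu> + 2 * c)
        + \<sigma> * (4 * N + b\<^sup>2 * (8 * e * (N + 2 * e) + 16 * e - 8 * \<mu> * c)))"
    proof -
      have "LM z = E * (8 * c * b * (N + 2 * c) + \<sigma> * (b * (8 * e * b * (N + 2 * e)) + 4 * N + 8 * b * (e * (2 * b))))"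
        unfolding LM_def pw(2,3)[OF n] E_def[symmetric] R_def[symmetric] unfolding ab RR using R by (simp add: field_simps)
      moreover have "2 * \<mu> * \<beta> * (aa z / nn z) * M z = - 8 * c * \<mu> * b * E * (1 + \<sigma> * b)"
        unfolding Mz ab RR c_def using R by (simp add: field_simps)
      ultimately show ?thesis by (simp add: algebra_simps power2_eq_square)
    qed
    also have "8 * c * b * (N - \<mu> + 2 * c) + \<sigma> * (4 * N + b\<^sup>2 * (8 * e * (N + 2 * e) + 16 * e - 8 * \<mu> * c))
      = 4 * \<sigma> * (b + N + (\<sigma> - N - 1) * b\<^sup>2)"
    proof -
      have "8 * e * (N + 2 * e) + 16 * e - 8 * \<mu> * c = 8 * c * (N - \<mu> + 2 * c) - 4 * N - 4"
        unfolding e_def by (simp add: algebra_simps)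
      then have f1: "8 * e * (N + 2 * e) + 16 * e - 8 * \<mu> * c = 4 * \<sigma> - 4 * N - 4" using s1 by simp
      have f2: "8 * c * b * (N - \<mu> + 2 * c) = 4 * \<sigma> * b" unfolding s1 by simp
      show ?thesis unfolding f1 f2 by (simp add: algebra_simps)
    qed
    finally have L: "LM z + 2 * \<mu> * \<beta> * (aa z / nn z) * M z = E * (4 * \<sigma> * (b + N + (\<sigma> - N - 1) * b\<^sup>2))" .
    have "min N \<sigma> \<le> N * (1 - b\<^sup>2) + \<sigma> * b\<^sup>2"
    proof -
      have b2: "0 \<le> b\<^sup>2" "b\<^sup>2 \<le> 1" using b by (auto simp: power_le_one)
      have "min N \<sigma> * (1 - b\<^sup>2) + min N \<sigma> * b\<^sup>2 \<le> N * (1 - b\<^sup>2) + \<sigma> * b\<^sup>2"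
        using b2 by (intro add_mono mult_right_mono) auto
      then show ?thesis by (simp add: algebra_simps)
    qed
    moreover have "b\<^sup>2 \<le> b" using b by (simp add: power2_eq_square mult_left_le)
    ultimately have low: "min N \<sigma> \<le> b + N + (\<sigma> - N - 1) * b\<^sup>2" by (simp add: algebra_simps)
    have "h * M z * nn z powr (- 1 / 2) = E * (h * (1 + \<sigma> * b))"
      unfolding Mz using n R by (simp add: R_def powr_minus field_simps)
    also have "\<dots> \<le> E * (h * (1 + \<sigma>))"
      using E b s by (intro mult_left_mono) (auto simp: h mult_left_le)
    also have "h * (1 + \<sigma>) = 4 * \<sigma> * min N \<sigma>" using s unfolding h N_def by simp
    also have "E * (4 * \<sigma> * min N \<sigma>) \<le> E * (4 * \<sigma> * (b + N + (\<sigma> - N - 1) * b\<^sup>2))"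
      using E s(2) by (intro mult_left_mono low) auto
    finally show "h * M z * nn z powr (- 1 / 2) \<le> LM z + 2 * \<mu> * \<beta> * (aa z / nn z) * M z" unfolding L .
  qed
qed


text \<open>The gain \<open>h M n^(- 1 / 2)\<close> of the profile has to pay for the decrease of \<open>\<theta>(t) = (t2 - t)^k / C0\<close>, that is,
\<open>k \<le> h (t2 - t) n^(- 1 / 2)\<close> must hold where \<open>\<theta> M > 1\<close>. There \<open>n^(\<beta> / 4)\<close> is at most a multiple of
\<open>(t2 - t)^k / C0\<close>, so \<open>k \<ge> \<beta> / 2\<close> and a large \<open>C0\<close> suffice. The limit profile is \<open>J\<close>, and \<open>\<Phi> r\<close> is \<open>J\<close> cut
off below the sphere of radius \<open>r\<close>; the error is confined to a shell.\<close>

lemma near_origin_test_function: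
  fixes \<beta> \<sigma> :: real
  assumes t: "0 < t3" "t3 < t2" "t2 < T"
    and \<beta>: "0 < \<beta>" and s: "\<sigma> = \<beta> / 2 * (\<beta> / 2 + \<mu> - real CARD('n))" "0 < \<sigma>"
  obtains \<Phi> :: "real \<Rightarrow> 'n st \<Rightarrow> real" and J :: "'n st \<Rightarrow> real" and C m0 where
    "\<And>r. 0 < r \<Longrightarrow> r \<le> 1 \<Longrightarrow> admissible T (\<Phi> r)" "0 < C"
    "\<And>r z. 0 < r \<Longrightarrow> r \<le> 1 \<Longrightarrow> 0 < fst z \<Longrightarrow>
       max 0 (- hardy_op lam (\<Phi> r) z) \<le> C * r powr (- 2 - \<beta> - \<mu>) * indicator (region t2 (r ^ 4 / 16) (r ^ 4)) z"
    "\<And>r z. 0 < r \<Longrightarrow> r ^ 4 \<le> nn z \<Longrightarrow> \<Phi> r z = J z"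
    "0 < m0" "\<And>z. fst z \<le> t3 \<Longrightarrow> 0 < nn z \<Longrightarrow> nn z \<le> m0 \<Longrightarrow> 0 < J z"
proof -
  let ?\<Omega> = "{z::'n st. 0 < nn z}"
  define N where "N = real CARD('n)"
  define h where "h = 4 * \<sigma> * min (real CARD('n)) \<sigma> / (1 + \<sigma>)"
  have h: "0 < h" using s by (auto simp: h_def)
  define M where "M = (\<lambda>z::'n st. nn z powr (- \<beta> / 4) + \<sigma> * aa z * nn z powr (- \<beta> / 4 - 1 / 2))"
  obtain Ma Mw LM where M: "cyl ?\<Omega> M (\<lambda>z. 0) Ma Mw LM"
    "\<And>z. 0 < nn z \<Longrightarrow> aa z * Ma z + ww z * Mw z = - \<beta> / 2 * M z"
    "\<And>z. 0 < nn z \<Longrightarrow> h * M z * nn z powr (- 1 / 2) \<le> LM z + 2 * \<mu> * \<beta> * (aa z / nn z) * M z"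
    "\<And>z. 0 < nn z \<Longrightarrow> nn z powr (- \<beta> / 4) \<le> M z" "\<And>z. 0 < nn z \<Longrightarrow> M z \<le> (1 + \<sigma>) * nn z powr (- \<beta> / 4)"
    using growing_profile[OF \<beta> s h_def M_def] by blast
  have M0: "0 \<le> M z" for z using s hz_nonneg[of "snd z"] by (simp add: M_def)
  have Mp: "0 < M z" if "0 < nn z" for z
  proof -
    have "0 < nn z powr (- \<beta> / 4)" using that by simp
    then show ?thesis using M(4)[OF that] by linarith
  qed
  \<comment> \<open>the lower bound \<open>4\<close> is for smoothness of the positive part, the other one for the scaling in \<open>S_pos\<close>\<close>
  define k where "k = max 4 (nat \<lceil>\<beta> / 2\<rceil>)"
  have k: "4 \<le> k" "\<beta> / 2 \<le> real k" unfolding k_def by (auto simp: le_max_iff_disj) linarith+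
  define C0 where "C0 = (1 + \<sigma>) * (h / k) powr (- \<beta> / 2) * t2 powr (real k - \<beta> / 2)"
  have C0: "0 < C0" unfolding C0_def using s h k t by (intro mult_pos_pos) auto
  define \<theta> where "\<theta> = (\<lambda>z::'n st. 1 / C0 * max 0 (t2 - fst z) ^ k)"
  define \<theta>' where "\<theta>' = (\<lambda>z::'n st. - (1 / C0 * (real k * max 0 (t2 - fst z) ^ (k - 1))))"
  define S where "S = (\<lambda>z::'n st. \<theta> z * M z - 1)"
  have \<theta>0: "0 \<le> \<theta> z" for z using C0 by (simp add: \<theta>_def)
  have Sgt: "- 2 < S z" for z using mult_nonneg_nonneg[OF \<theta>0 M0, of z z] by (simp add: S_def)
  have c\<theta>: "cyl ?\<Omega> \<theta> \<theta>' (\<lambda>z. 0) (\<lambda>z. 0) (\<lambda>z. 0)"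
    by (rule cyl_eq[OF cyl_mult[OF cyl_const[OF open_nn_pos, of "1 / C0"] cyl_time_pospart[OF open_nn_pos k(1), of t2]]])
      (auto simp: \<theta>_def \<theta>'_def)
  have cS: "cyl ?\<Omega> S (\<lambda>z. \<theta>' z * M z) (\<lambda>z. \<theta> z * Ma z) (\<lambda>z. \<theta> z * Mw z) (\<lambda>z. \<theta> z * LM z)"
    by (rule cyl_eq[OF cyl_add[OF cyl_mult[OF c\<theta> M(1)] cyl_const[OF open_nn_pos, of "-1"]]]) (auto simp: S_def)
  obtain j j' j'' :: "real \<Rightarrow> real" where j:
    "Ck 3 {-2<..} j" "\<And>s. -2 < s \<Longrightarrow> (j has_real_derivative j' s) (at s)" "\<And>s. -2 < s \<Longrightarrow> (j' has_real_derivative j'' s) (at s)"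
    "\<And>s. -2 < s \<Longrightarrow> 0 \<le> j s" "\<And>s. -2 < s \<Longrightarrow> j s \<le> max 0 s"
    "\<And>s. -2 < s \<Longrightarrow> 0 \<le> j' s" "\<And>s. -2 < s \<Longrightarrow> j' s \<le> 4" "\<And>s. -2 < s \<Longrightarrow> 0 \<le> j'' s"
    "\<And>s. s \<le> 0 \<Longrightarrow> j s = 0 \<and> j' s = 0 \<and> j'' s = 0" "\<And>s. 0 < s \<Longrightarrow> 0 < j s"
    using convex_truncation by blast
  have cH: "cyl ?\<Omega> (\<lambda>z. j (S z)) (\<lambda>z. j' (S z) * (\<theta>' z * M z)) (\<lambda>z. j' (S z) * (\<theta> z * Ma z)) (\<lambda>z. j' (S z) * (\<theta> z * Mw z))
      (\<lambda>z. j' (S z) * (\<theta> z * LM z) + j'' (S z) * (4 * aa z * ((\<theta> z * Ma z)\<^sup>2 + (\<theta> z * Mw z)\<^sup>2)))"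
    by (rule cyl_comp[OF cS _ _ j(1)]) (use j(2,3) Sgt in auto)
  obtain g g' g'' :: "real \<Rightarrow> real" and W where g:
    "Ck 3 UNIV g" "\<And>x. (g has_real_derivative g' x) (at x)" "\<And>x. (g' has_real_derivative g'' x) (at x)"
    "\<And>x. 0 \<le> g x" "\<And>x. g x \<le> 1" "\<And>x. x \<le> 1 / 16 \<Longrightarrow> g x = 0" "\<And>x. 1 \<le> x \<Longrightarrow> g x = 1"
    "\<And>x. x \<le> 1 / 16 \<or> 1 \<le> x \<Longrightarrow> g' x = 0 \<and> g'' x = 0"
    "0 < W" "\<And>x. \<bar>g' x\<bar> \<le> W" "\<And>x. \<bar>g'' x\<bar> \<le> W"
    using smooth_step by blast
  define J where "J = (\<lambda>z::'n st. nn z powr (- \<mu> / 4) * j (S z))"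
  define \<Phi> where "\<Phi> r = (\<lambda>z::'n st. nn z powr (- \<mu> / 4) * (g (nn z / r ^ 4) * j (S z)))" for r
  define \<theta>m where "\<theta>m = 1 / C0 * t2 ^ k"
  have \<theta>m: "0 < \<theta>m" "\<theta> z \<le> \<theta>m" if "0 \<le> fst z" for z
    using that t C0 unfolding \<theta>m_def \<theta>_def by (auto intro!: mult_left_mono power_mono divide_right_mono)
  have S_pos: "0 < max 0 (t2 - fst z)" "nn z powr (1 / 2) \<le> h * max 0 (t2 - fst z) / k" if z: "0 < S z" "0 < nn z" "0 \<le> fst z" for z
  proof -
    define \<tau> where "\<tau> = max 0 (t2 - fst z)"
    have tm: "1 < \<theta> z * M z" using z by (simp add: S_def)
    then have "\<theta> z \<noteq> 0" by auto
    then have \<tau>: "0 < \<tau>" using k by (auto simp: \<theta>_def \<tau>_def power_0_left)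
    then show "0 < max 0 (t2 - fst z)" by (simp add: \<tau>_def)
    have \<tau>2: "\<tau> \<le> t2" using z(3) t by (simp add: \<tau>_def)
    show "nn z powr (1 / 2) \<le> h * max 0 (t2 - fst z) / k"
    proof (rule ccontr)
      assume "\<not> ?thesis"
      then have gt: "h / k * \<tau> \<le> nn z powr (1 / 2)" by (simp add: \<tau>_def)
      have hk: "0 < h / k" using h k by simp
      have "nn z powr (- \<beta> / 4) = (nn z powr (1 / 2)) powr (- \<beta> / 2)" by (simp add: powr_powr)
      also have "\<dots> \<le> (h / k * \<tau>) powr (- \<beta> / 2)" using \<beta> mult_pos_pos[OF hk \<tau>] by (intro powr_mono2'[OF _ _ gt]) linarith+
      also have "\<dots> = (h / k) powr (- \<beta> / 2) * \<tau> powr (- \<beta> / 2)" using hk \<tau> by (simp only: powr_mult)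
      finally have n: "nn z powr (- \<beta> / 4) \<le> (h / k) powr (- \<beta> / 2) * \<tau> powr (- \<beta> / 2)" .
      have "\<theta> z * M z \<le> 1 / C0 * \<tau> ^ k * ((1 + \<sigma>) * ((h / k) powr (- \<beta> / 2) * \<tau> powr (- \<beta> / 2)))"
      proof (rule mult_mono)
        show "\<theta> z \<le> 1 / C0 * \<tau> ^ k" by (simp add: \<theta>_def \<tau>_def)
        show "M z \<le> (1 + \<sigma>) * ((h / k) powr (- \<beta> / 2) * \<tau> powr (- \<beta> / 2))"
          using M(5)[OF z(2)] mult_left_mono[OF n, of "1 + \<sigma>"] s by linarith
      qed (use C0 \<tau> M0 in auto)
      also have "\<dots> = 1 / C0 * ((1 + \<sigma>) * (h / k) powr (- \<beta> / 2) * (\<tau> ^ k * \<tau> powr (- \<beta> / 2)))" by (simp add: mult_ac)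
      also have "\<tau> ^ k * \<tau> powr (- \<beta> / 2) = \<tau> powr (real k - \<beta> / 2)" 
      proof -
        have "\<tau> powr (real k - \<beta> / 2) = \<tau> powr (real k + - \<beta> / 2)" by simp
        then show ?thesis unfolding powr_add powr_realpow[OF \<tau>, of k] by simp
      qed
      also have "1 / C0 * ((1 + \<sigma>) * (h / k) powr (- \<beta> / 2) * \<tau> powr (real k - \<beta> / 2)) \<le> 1 / C0 * C0"
        unfolding C0_def using \<tau> \<tau>2 k s C0 by (intro mult_left_mono powr_mono2) (auto simp: C0_def)
      also have "\<dots> = 1" using C0 by simp
      finally show False using tm by linarith
    qed
  qed
  define Pz where "Pz z = j' (S z) * (\<theta>' z * M z + \<theta> z * (LM z + 2 * \<mu> * \<beta> * (aa z / nn z) * M z))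
      + j'' (S z) * (4 * aa z * ((\<theta> z * Ma z)\<^sup>2 + (\<theta> z * Mw z)\<^sup>2))" for z
  define Rz where "Rz r z = aa z / r ^ 4 * ((g' (nn z / r ^ 4) * (8 * (N + 2) - 8 * \<mu>) + 16 * g'' (nn z / r ^ 4) * (nn z / r ^ 4)) * j (S z)
      - 8 * \<beta> * g' (nn z / r ^ 4) * (j' (S z) * (\<theta> z * M z)))" for r z
  have hardy_op: "hardy_op lam (\<Phi> r) z = nn z powr (- \<mu> / 4) * (g (nn z / r ^ 4) * Pz z + Rz r z)" if r: "0 < r" and n: "0 < nn z" for r z
  proof -
    define x where "x = nn z / r ^ 4"
    define q where "q = r ^ 4"
    have q: "0 < q" using r by (simp add: q_def)
    have nx: "nn z = x * q" using q by (simp add: x_def q_def)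
    have x: "0 < x" using n q by (simp add: x_def q_def)
    note c = cyl_mult[OF cyl_profile_n[OF open_nn_pos g(1,2,3), of "r ^ 4"] cH]
    have z: "z \<in> ?\<Omega>" using n by simp
    have aw: "aa z * aa z + ww z * ww z = nn z" by (simp add: hn_def power2_eq_square)
    define G1 where "G1 = j' (S z)"
    define e where "e = aa z * Ma z + ww z * Mw z"
    have e: "e = - \<beta> / 2 * M z" unfolding e_def by (rule M(2)[OF n])
    have 1: "aa z * (g x * (G1 * (\<theta> z * Ma z)) + g' x * (2 * aa z / q) * j (S z)) + ww z * (g x * (G1 * (\<theta> z * Mw z)) + g' x * (2 * ww z / q) * j (S z))
      = g x * G1 * \<theta> z * e + 2 * g' x * x * j (S z)"
    proof -
      have "aa z * (g x * (G1 * (\<theta> z * Ma z)) + g' x * (2 * aa z / q) * j (S z)) + ww z * (g x * (G1 * (\<theta> z * Mw z)) + g' x * (2 * ww z / q) * j (S z))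
        = g x * G1 * \<theta> z * e + 2 * g' x * j (S z) * (aa z * aa z + ww z * ww z) / q"
        unfolding e_def by (simp add: algebra_simps add_divide_distrib)
      then show ?thesis unfolding aw nx using q by simp
    qed
    have 2: "8 * aa z * (g' x * (2 * aa z / q) * (G1 * (\<theta> z * Ma z)) + g' x * (2 * ww z / q) * (G1 * (\<theta> z * Mw z)))
      = 16 * aa z / q * g' x * G1 * \<theta> z * e" unfolding e_def by (simp add: algebra_simps add_divide_distrib)
    have "hardy_op lam (\<Phi> r) z = nn z powr (- \<mu> / 4) * ((g x * (G1 * (\<theta>' z * M z)) + 0 * j (S z))
       + (g x * (G1 * (\<theta> z * LM z) + j'' (S z) * (4 * aa z * ((\<theta> z * Ma z)\<^sup>2 + (\<theta> z * Mw z)\<^sup>2)))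
          + (g' x * (8 * (N + 2) * aa z / q) + g'' x * (16 * aa z * nn z / q\<^sup>2)) * j (S z)
          + 8 * aa z * (g' x * (2 * aa z / q) * (G1 * (\<theta> z * Ma z)) + g' x * (2 * ww z / q) * (G1 * (\<theta> z * Mw z))))
       - 4 * \<mu> * (aa z / nn z) * (aa z * (g x * (G1 * (\<theta> z * Ma z)) + g' x * (2 * aa z / q) * j (S z)) + ww z * (g x * (G1 * (\<theta> z * Mw z)) + g' x * (2 * ww z / q) * j (S z))))"
      using hardy_transform(2)[OF c order_refl z] unfolding \<Phi>_def x_def q_def G1_def N_def .
    also have "\<dots> = nn z powr (- \<mu> / 4) * (g x * Pz z + Rz r z)"
      unfolding 1 2 e unfolding Pz_def Rz_def G1_def[symmetric] q_def[symmetric] unfolding q_def x_def[symmetric] unfolding q_def[symmetric] nx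
      using q x by (simp add: field_simps power2_eq_square)
    finally show ?thesis unfolding x_def .
  qed
  have Pz: "0 \<le> Pz z" if z: "0 < fst z" "0 < nn z" for z
  proof (cases "0 < S z")
    case False
    then show ?thesis using j(9)[of "S z"] by (simp add: Pz_def)
  next
    case True
    define \<tau> where "\<tau> = max 0 (t2 - fst z)"
    have \<tau>: "0 < \<tau>" "nn z powr (1 / 2) \<le> h * \<tau> / k" unfolding \<tau>_def using S_pos[OF True z(2)] z by auto
    obtain k' where k': "k = Suc k'" using k(1) by (cases k) auto
    define E where "E = nn z powr (1 / 2)"
    have E: "0 < E" "nn z powr (- 1 / 2) = 1 / E" using z by (auto simp: E_def powr_minus_divide)
    have "E * k \<le> h * \<tau>" using \<tau>(2) k by (simp add: E_def field_simps)
    then have kk: "real k \<le> \<tau> * (h / E)" using E by (simp add: field_simps)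
    have "0 \<le> 1 / C0 * \<tau> ^ k' * M z * (\<tau> * (h / E) - k)"
      using kk C0 \<tau> Mp[OF z(2)] by (intro mult_nonneg_nonneg) auto
    also have "\<dots> = \<theta>' z * M z + \<theta> z * (h * M z * nn z powr (- 1 / 2))"
      unfolding \<theta>'_def \<theta>_def E(2) \<tau>_def[symmetric] k' using C0 E(1) by (simp add: field_simps)
    also have "\<dots> \<le> \<theta>' z * M z + \<theta> z * (LM z + 2 * \<mu> * \<beta> * (aa z / nn z) * M z)"
      using mult_left_mono[OF M(3)[OF z(2)] \<theta>0[of z]] by linarith
    finally have 1: "0 \<le> \<theta>' z * M z + \<theta> z * (LM z + 2 * \<mu> * \<beta> * (aa z / nn z) * M z)" .
    have 2: "0 \<le> 4 * aa z * ((\<theta> z * Ma z)\<^sup>2 + (\<theta> z * Mw z)\<^sup>2)" using hz_nonneg[of "snd z"] by simp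
    show ?thesis unfolding Pz_def
      using mult_nonneg_nonneg[OF j(6)[OF Sgt[of z]] 1] mult_nonneg_nonneg[OF j(8)[OF Sgt[of z]] 2] by linarith
  qed
  define K where "K = W * (8 * (N + 2) + 8 * \<mu> + 16) + 32 * \<beta> * W"
  have K: "0 < K" unfolding K_def using g(9) \<beta> mu by (intro add_pos_pos mult_pos_pos) (auto simp: N_def intro!: add_pos_pos add_nonneg_pos)
  define C where "C = 16 powr (\<mu> / 4) * (\<theta>m * ((1 + \<sigma>) * 16 powr (\<beta> / 4)) * K)"
  have C: "0 < C" using \<theta>m(1)[of 0] s K by (auto simp: C_def)
  have Rb: "\<bar>Rz r z\<bar> \<le> aa z / r ^ 4 * (\<theta> z * M z * K)" if r: "0 < r" and x: "nn z \<le> r ^ 4" for r z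
  proof -
    define x where "x = nn z / r ^ 4"
    define Y where "Y = \<theta> z * M z"
    have x01: "0 \<le> x" "x \<le> 1" using x r hn_nonneg[of "snd z"] by (auto simp: x_def)
    have Y: "0 \<le> Y" unfolding Y_def by (intro mult_nonneg_nonneg \<theta>0 M0)
    have jS: "0 \<le> j (S z)" "j (S z) \<le> Y" using j(4,5)[OF Sgt, of z] Y by (auto simp: S_def Y_def)
    have j1: "0 \<le> j' (S z)" "j' (S z) \<le> 4" using j(6,7)[OF Sgt] by auto
    have b1: "\<bar>g' x * (8 * (N + 2) - 8 * \<mu>)\<bar> \<le> W * (8 * (N + 2) + 8 * \<mu>)"
      unfolding abs_mult using g(9,10) mu by (intro mult_mono) (auto simp: N_def)
    have b2: "\<bar>16 * g'' x * x\<bar> \<le> 16 * W * 1"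
      unfolding abs_mult using g(9) g(11)[of x] x01 by (intro mult_mono) auto
    have b3: "\<bar>(g' x * (8 * (N + 2) - 8 * \<mu>) + 16 * g'' x * x) * j (S z)\<bar> \<le> (W * (8 * (N + 2) + 8 * \<mu>) + 16 * W * 1) * Y"
      unfolding abs_mult using b1 b2 jS g(9) mu by (intro mult_mono) (auto simp: N_def)
    have b4: "\<bar>8 * \<beta> * g' x * (j' (S z) * Y)\<bar> \<le> 8 * \<beta> * W * (4 * Y)"
      unfolding abs_mult using g(9) g(10)[of x] j1 Y \<beta> by (intro mult_mono) auto
    have "\<bar>(g' x * (8 * (N + 2) - 8 * \<mu>) + 16 * g'' x * x) * j (S z) - 8 * \<beta> * g' x * (j' (S z) * Y)\<bar> \<le> Y * K"
      using abs_triangle_ineq4[of "(g' x * (8 * (N + 2) - 8 * \<mu>) + 16 * g'' x * x) * j (S z)" "8 * \<beta> * g' x * (j' (S z) * Y)"] b3 b4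
      unfolding K_def by (simp add: algebra_simps)
    then show ?thesis
      unfolding Rz_def x_def[symmetric] Y_def[symmetric] abs_mult[of "aa z / r ^ 4"] using r hz_nonneg[of "snd z"]
      by (simp add: mult_left_mono divide_right_mono)
  qed
  show thesis
  proof (rule that[of \<Phi> C J])
    show "0 < C" by (rule C)
    show "\<Phi> r z = J z" if "0 < r" "r ^ 4 \<le> nn z" for r z
      using g(7)[of "nn z / r ^ 4"] that by (simp add: \<Phi>_def J_def)
    fix r :: real assume r: "0 < r" "r \<le> 1"
    show "admissible T (\<Phi> r)" unfolding admissible_def
    proof (intro conjI)
      have z0: "\<Phi> r z = 0" if "nn z < r ^ 4 / 16" for z
        using g(6)[of "nn z / r ^ 4"] that r by (simp add: \<Phi>_def field_simps)
      have "Ck 3 {z. nn z < r ^ 4 / 16} (\<Phi> r)"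
        using Ck_cong[OF open_nn_less, of "r ^ 4 / 16" "\<Phi> r" "\<lambda>z. 0" 3] z0 by simp
      moreover have "Ck 3 ?\<Omega> (\<Phi> r)" unfolding \<Phi>_def
        by (rule hardy_transform(1)[OF cyl_mult[OF cyl_profile_n[OF open_nn_pos g(1,2,3), of "r ^ 4"] cH] order_refl])
      ultimately have "Ck 3 ({z. nn z < r ^ 4 / 16} \<union> ?\<Omega>) (\<Phi> r)" by (intro Ck_Un open_nn_less open_nn_pos)
      moreover have "{z. nn z < r ^ 4 / 16} \<union> ?\<Omega> = UNIV"
      proof -
        have "0 < r ^ 4 / 16" using r by simp
        then have "nn z < r ^ 4 / 16 \<or> 0 < nn z" for z :: "'n st" by linarith
        then show ?thesis by blast
      qed
      ultimately show "Ck 3 UNIV (\<Phi> r)" by (simp only:)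
      show "\<forall>z. 0 \<le> \<Phi> r z" using g(4) j(4)[OF Sgt] by (simp add: \<Phi>_def)
      show "\<exists>n0>0. \<forall>z. nn z < n0 \<longrightarrow> \<Phi> r z = 0" using z0 r by (intro exI[of _ "r ^ 4 / 16"]) auto
      define R where "R = ((1 + \<sigma>) * \<theta>m) powr (4 / \<beta>)"
      have "fst z \<le> t2 \<and> nn z \<le> R" if z: "0 \<le> fst z" "\<Phi> r z \<noteq> 0" for z
      proof -
        have n: "0 < nn z" using z(2) hn_nonneg[of "snd z"] by (cases "nn z = 0") (auto simp: \<Phi>_def)
        have "0 < S z" using z(2) j(9)[of "S z"] by (force simp: \<Phi>_def)
        from S_pos[OF this n z(1)] have "fst z \<le> t2" by (simp add: max_def split: if_splits)
        moreover have "nn z powr (\<beta> / 4) \<le> (1 + \<sigma>) * \<theta>m"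
        proof -
          have "1 < \<theta> z * M z" using \<open>0 < S z\<close> by (simp add: S_def)
          also have "\<dots> \<le> \<theta>m * ((1 + \<sigma>) * nn z powr (- \<beta> / 4))"
            using \<theta>m[OF z(1)] M(5)[OF n] M0 by (intro mult_mono) auto
          finally have "1 * nn z powr (\<beta> / 4) \<le> \<theta>m * ((1 + \<sigma>) * nn z powr (- \<beta> / 4)) * nn z powr (\<beta> / 4)"
            by (intro mult_right_mono) auto
          also have "\<dots> = \<theta>m * (1 + \<sigma>) * (nn z powr (- \<beta> / 4) * nn z powr (\<beta> / 4))" by simp
          also have "nn z powr (- \<beta> / 4) * nn z powr (\<beta> / 4) = 1" using n by (simp flip: powr_add)
          finally show ?thesis by (simp add: mult.commute)
        qed
        then have "(nn z powr (\<beta> / 4)) powr (4 / \<beta>) \<le> R" unfolding R_def using \<beta> by (intro powr_mono2) auto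
        then have "nn z \<le> R" using n \<beta> by (simp add: powr_powr)
        ultimately show ?thesis by blast
      qed
      then show "\<exists>S<T. \<exists>R. \<forall>z. 0 \<le> fst z \<longrightarrow> \<Phi> r z \<noteq> 0 \<longrightarrow> fst z \<le> S \<and> nn z \<le> R" using t by blast
    qed
    fix z :: "'n st" assume tz: "0 < fst z"
    have nonneg: "0 \<le> C * r powr (- 2 - \<beta> - \<mu>) * indicator (region t2 (r ^ 4 / 16) (r ^ 4)) z" using C by simp
    show "max 0 (- hardy_op lam (\<Phi> r) z) \<le> C * r powr (- 2 - \<beta> - \<mu>) * indicator (region t2 (r ^ 4 / 16) (r ^ 4)) z"
    proof (cases "0 < nn z")
      case False
      then have "nn z < r ^ 4 / 16" using r by (smt (verit) divide_pos_pos zero_less_power)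
      moreover have "\<Phi> r q = 0" if "q \<in> {z. nn z < r ^ 4 / 16}" for q
        using g(6)[of "nn q / r ^ 4"] that r by (simp add: \<Phi>_def field_simps)
      ultimately have "hardy_op lam (\<Phi> r) z = 0" using hardy_op_zero(4)[OF open_nn_less, of z "r ^ 4 / 16" "\<Phi> r"] by simp
      then show ?thesis using nonneg by simp
    next
      case n: True
      have low: "- hardy_op lam (\<Phi> r) z \<le> nn z powr (- \<mu> / 4) * \<bar>Rz r z\<bar>"
      proof -
        have "0 \<le> nn z powr (- \<mu> / 4) * (g (nn z / r ^ 4) * Pz z)" using g(4) Pz[OF tz n] by simp
        moreover have "- (nn z powr (- \<mu> / 4) * Rz r z) \<le> nn z powr (- \<mu> / 4) * \<bar>Rz r z\<bar>"
          using mult_left_mono[of "- Rz r z" "\<bar>Rz r z\<bar>" "nn z powr (- \<mu> / 4)"] by simp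
        ultimately show ?thesis unfolding hardy_op[OF r(1) n] distrib_left by linarith
      qed
      show ?thesis
      proof (cases "z \<in> region t2 (r ^ 4 / 16) (r ^ 4)")
        case False
        have "Rz r z = 0"
        proof (cases "t2 < fst z")
          case True
          then have "\<theta> z = 0" using k by (simp add: \<theta>_def power_0_left)
          then have "j (S z) = 0" "\<theta> z = 0" using j(9)[of "S z"] by (auto simp: S_def)
          then show ?thesis by (simp add: Rz_def)
        next
          case False
          then have "nn z / r ^ 4 \<le> 1 / 16 \<or> 1 \<le> nn z / r ^ 4"
            using \<open>z \<notin> region t2 (r ^ 4 / 16) (r ^ 4)\<close> r by (auto simp: region_def field_simps)
          then show ?thesis using g(8) by (simp add: Rz_def)
        qed
        then show ?thesis using low nonneg by simp
      next
        case True
        then have z: "fst z \<le> t2" "r ^ 4 / 16 \<le> nn z" "nn z \<le> r ^ 4" by (auto simp: region_def)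
        have np: "nn z powr (- c / 4) \<le> 16 powr (c / 4) * r powr (- c)" if "0 < c" for c
        proof -
          have "nn z powr (- c / 4) \<le> (r ^ 4 / 16) powr (- c / 4)" using z r that by (intro powr_mono2') auto
          also have "\<dots> = 16 powr (c / 4) * (r ^ 4) powr (- c / 4)"
            using r by (simp add: powr_divide powr_minus_divide)
          also have "(r ^ 4) powr (- c / 4) = r powr (- c)" 
          proof -
            have "r ^ 4 = r powr 4" using powr_realpow[OF r(1), of 4] by simp
            then show ?thesis by (simp only: powr_powr) simp
          qed
          finally show ?thesis .
        qed
        have a: "0 \<le> aa z" "aa z / r ^ 4 \<le> r powr (- 2)"
        proof -
          show "0 \<le> aa z" by (rule hz_nonneg)
          have "(aa z)\<^sup>2 \<le> (r\<^sup>2)\<^sup>2" using hz_le_hn[of "snd z"] z by simp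
          then have "aa z \<le> r\<^sup>2" by (rule power2_le_imp_le) simp
          then have "aa z / r ^ 4 \<le> r\<^sup>2 / r ^ 4" using r by (intro divide_right_mono) auto
          also have "\<dots> = r powr (- 2)" using r by (simp add: powr_minus_divide power2_eq_square power4_eq_xxxx)
          finally show "aa z / r ^ 4 \<le> r powr (- 2)" .
        qed
        have "\<theta> z * M z \<le> \<theta>m * ((1 + \<sigma>) * (16 powr (\<beta> / 4) * r powr (- \<beta>)))"
        proof (rule mult_mono)
          show "\<theta> z \<le> \<theta>m" using \<theta>m tz by simp
          show "M z \<le> (1 + \<sigma>) * (16 powr (\<beta> / 4) * r powr (- \<beta>))"
            using M(5)[OF n] mult_left_mono[OF np[OF \<beta>], of "1 + \<sigma>"] s by linarith
        qed (use \<theta>m[of z] tz M0 in auto)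
        then have "\<theta> z * M z * K \<le> \<theta>m * ((1 + \<sigma>) * (16 powr (\<beta> / 4) * r powr (- \<beta>))) * K" using K by (intro mult_right_mono) auto
        then have "aa z / r ^ 4 * (\<theta> z * M z * K) \<le> r powr (- 2) * (\<theta>m * ((1 + \<sigma>) * (16 powr (\<beta> / 4) * r powr (- \<beta>))) * K)"
          by (rule mult_mono[OF a(2)]) (use \<theta>0 M0 K in auto)
        then have R1: "\<bar>Rz r z\<bar> \<le> r powr (- 2) * (\<theta>m * ((1 + \<sigma>) * (16 powr (\<beta> / 4) * r powr (- \<beta>))) * K)"
          using Rb[OF r(1) z(3)] by linarith
        have "nn z powr (- \<mu> / 4) * \<bar>Rz r z\<bar> \<le> 16 powr (\<mu> / 4) * r powr (- \<mu>) * (r powr (- 2) * (\<theta>m * ((1 + \<sigma>) * (16 powr (\<beta> / 4) * r powr (- \<beta>))) * K))"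
          by (rule mult_mono[OF np[OF mu(1)] R1]) auto
        also have "\<dots> = C * (r powr (- 2) * r powr (- \<beta>) * r powr (- \<mu>))" unfolding C_def by (simp add: mult_ac)
        also have "r powr (- 2) * r powr (- \<beta>) * r powr (- \<mu>) = r powr (- 2 - \<beta> - \<mu>)" using r by (simp flip: powr_add)
        finally have "- hardy_op lam (\<Phi> r) z \<le> C * r powr (- 2 - \<beta> - \<mu>)" using low by linarith
        then show ?thesis using True C by simp
      qed
    qed
  next
    define \<theta>3 where "\<theta>3 = 1 / C0 * (t2 - t3) ^ k"
    have \<theta>3: "0 < \<theta>3" using C0 t by (simp add: \<theta>3_def)
    define m0 where "m0 = (\<theta>3 / 2) powr (4 / \<beta>)"
    show "0 < (\<theta>3 / 2) powr (4 / \<beta>)" using \<theta>3 by simp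
    fix z :: "'n st" assume z: "fst z \<le> t3" "0 < nn z" "nn z \<le> (\<theta>3 / 2) powr (4 / \<beta>)"
    have "nn z powr (\<beta> / 4) \<le> ((\<theta>3 / 2) powr (4 / \<beta>)) powr (\<beta> / 4)" using z \<beta> by (intro powr_mono2) auto
    also have "\<dots> = \<theta>3 / 2" using \<theta>3 \<beta> by (simp add: powr_powr)
    finally have "nn z powr (\<beta> / 4) < \<theta>3" using \<theta>3 by simp
    then have "nn z powr (\<beta> / 4) * nn z powr (- \<beta> / 4) < \<theta>3 * nn z powr (- \<beta> / 4)" using z by (intro mult_strict_right_mono) auto
    moreover have "nn z powr (\<beta> / 4) * nn z powr (- \<beta> / 4) = 1" using z by (simp flip: powr_add)
    moreover have "\<theta>3 * nn z powr (- \<beta> / 4) \<le> \<theta> z * M z"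
    proof (rule mult_mono)
      show "\<theta>3 \<le> \<theta> z" unfolding \<theta>3_def \<theta>_def using C0 z t by (intro mult_left_mono power_mono) auto
    qed (use M(4)[OF z(2)] \<theta>0 in auto)
    ultimately have "0 < S z" by (simp add: S_def)
    then show "0 < J z" using j(10) z by (simp add: J_def)
  qed
qed

text \<open>With \<open>\<kappa> = (\<mu> - q) / 2\<close> and \<open>\<beta> = 2 N - 2 \<mu> + \<kappa>\<close> the cut-off error against the a priori bound is
\<open>O(r^\<kappa>)\<close>, and \<open>\<kappa> > 0\<close> is the hypothesis on \<open>p\<close>.\<close>

lemma zero_near_origin:
  assumes t3: "0 < t3" "t3 < T"
  obtains m0 where "0 < m0" "AE z in lborel. fst z \<le> t3 \<longrightarrow> nn z \<le> m0 \<longrightarrow> U z = 0"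
proof -
  define N where "N = real CARD('n)"
  define q where "q = 2 / (p - 1)"
  define \<kappa> where "\<kappa> = (\<mu> - q) / 2"
  define \<beta> where "\<beta> = 2 * N - 2 * \<mu> + \<kappa>"
  define \<sigma> where "\<sigma> = \<beta> / 2 * (\<beta> / 2 + \<mu> - real CARD('n))"
  have \<kappa>: "0 < \<kappa>" using p by (simp add: \<kappa>_def q_def)
  have \<beta>: "0 < \<beta>" using \<kappa> mu by (simp add: \<beta>_def N_def)
  have \<sigma>: "0 < \<sigma>" 
  proof -
    have "\<beta> / 2 + \<mu> - real CARD('n) = \<kappa> / 2" by (simp add: \<beta>_def N_def field_simps)
    then show ?thesis unfolding \<sigma>_def using \<beta> \<kappa> by simp
  qed
  define t2 where "t2 = (t3 + T) / 2"
  have t2: "t3 < t2" "t2 < T" "0 < t2" using t3 by (auto simp: t2_def)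
  obtain \<Phi> :: "real \<Rightarrow> 'n st \<Rightarrow> real" and J :: "'n st \<Rightarrow> real" and C m0 where \<Phi>:
    "\<And>r. 0 < r \<Longrightarrow> r \<le> 1 \<Longrightarrow> admissible T (\<Phi> r)" "0 < C"
    "\<And>r z. 0 < r \<Longrightarrow> r \<le> 1 \<Longrightarrow> 0 < fst z \<Longrightarrow>
       max 0 (- hardy_op lam (\<Phi> r) z) \<le> C * r powr (- 2 - \<beta> - \<mu>) * indicator (region t2 (r ^ 4 / 16) (r ^ 4)) z"
    "\<And>r z. 0 < r \<Longrightarrow> r ^ 4 \<le> nn z \<Longrightarrow> \<Phi> r z = J z"
    "0 < m0" "\<And>z. fst z \<le> t3 \<Longrightarrow> 0 < nn z \<Longrightarrow> nn z \<le> m0 \<Longrightarrow> 0 < J z"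
  proof (rule near_origin_test_function[OF t3(1) t2(1,2) \<beta> \<sigma>_def \<sigma>], goal_cases)
    case (1 \<Phi> J C m0)
    show thesis by (rule 1(1)[of \<Phi> C J m0]; fact 1)
  qed
  obtain B where B: "0 < B" "\<And>r. 0 < r \<Longrightarrow> r \<le> 1 \<Longrightarrow>
     (\<integral>z. \<bar>U z\<bar> * indicator (region t2 (r ^ 4 / 16) (r ^ 4)) z \<partial>lborel) \<le> B * r powr (2 * real CARD('n) + 2 - 2 / (p - 1))"
    using shell_bound[OF t2(3,2)] by blast
  have bound: "(\<integral>z. \<bar>U z\<bar> powr p * \<Phi> r z \<partial>lborel) \<le> C * B * r powr \<kappa>" if r: "0 < r" "r \<le> 1" for r
  proof -
    note a = \<Phi>(1)[OF r]
    have i: "integrable lborel (\<lambda>z. \<bar>U z\<bar> * indicator (region t2 (r ^ 4 / 16) (r ^ 4)) z)"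
    proof -
      have "integrable lborel (\<lambda>z. U z * indicator (region t2 (r ^ 4 / 16) (r ^ 4)) z)"
        using r t2 by (intro U_integrable) auto
      from integrable_norm[OF this] show ?thesis by (simp add: abs_mult)
    qed
    have "(\<integral>z. \<bar>U z\<bar> powr p * \<Phi> r z \<partial>lborel) \<le> (\<integral>z. \<bar>U z\<bar> * max 0 (- hardy_op lam (\<Phi> r) z) \<partial>lborel)"
      using super[OF a] negative_part_inequality(1)[OF a] by linarith
    also have "\<dots> \<le> (\<integral>z. C * r powr (- 2 - \<beta> - \<mu>) * (\<bar>U z\<bar> * indicator (region t2 (r ^ 4 / 16) (r ^ 4)) z) \<partial>lborel)"
    proof (rule integral_mono[OF negative_part_inequality(2)[OF a]])
      show "integrable lborel (\<lambda>z. C * r powr (- 2 - \<beta> - \<mu>) * (\<bar>U z\<bar> * indicator (region t2 (r ^ 4 / 16) (r ^ 4)) z))"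
        by (intro integrable_mult_right i)
      show "\<bar>U z\<bar> * max 0 (- hardy_op lam (\<Phi> r) z) \<le> C * r powr (- 2 - \<beta> - \<mu>) * (\<bar>U z\<bar> * indicator (region t2 (r ^ 4 / 16) (r ^ 4)) z)" for z
      proof (cases "0 < fst z")
        case True
        from mult_left_mono[OF \<Phi>(3)[OF r True], of "\<bar>U z\<bar>"] show ?thesis by (simp add: mult_ac)
      next
        case False
        then have "U z = 0" using U_supp[of z] by auto
        then show ?thesis by simp
      qed
    qed
    also have "\<dots> = C * r powr (- 2 - \<beta> - \<mu>) * (\<integral>z. \<bar>U z\<bar> * indicator (region t2 (r ^ 4 / 16) (r ^ 4)) z \<partial>lborel)" by simp
    also have "\<dots> \<le> C * r powr (- 2 - \<beta> - \<mu>) * (B * r powr (2 * real CARD('n) + 2 - 2 / (p - 1)))"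
      using B(2)[OF r] \<Phi>(2) by (intro mult_left_mono) auto
    also have "\<dots> = C * B * (r powr (- 2 - \<beta> - \<mu>) * r powr (2 * real CARD('n) + 2 - 2 / (p - 1)))" by simp
    also have "r powr (- 2 - \<beta> - \<mu>) * r powr (2 * real CARD('n) + 2 - 2 / (p - 1)) = r powr \<kappa>"
    proof -
      have "- 2 - \<beta> - \<mu> + (2 * real CARD('n) + 2 - 2 / (p - 1)) = \<kappa>"
        unfolding \<beta>_def \<kappa>_def q_def N_def by (simp add: field_simps)
      then show ?thesis by (simp only: powr_add[symmetric])
    qed
    finally show ?thesis .
  qed
  have zero: "AE z in lborel. r1 ^ 4 \<le> nn z \<longrightarrow> J z \<noteq> 0 \<longrightarrow> U z = 0" if r1: "0 < r1" "r1 \<le> 1" for r1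
  proof -
    let ?f = "\<lambda>z. \<bar>U z\<bar> powr p * \<Phi> r1 z * indicator {z. r1 ^ 4 \<le> nn z} z"
    have m: "{z :: 'n st. r1 ^ 4 \<le> nn z} \<in> sets lborel"
      unfolding sets_lborel by (intro borel_closed closed_Collect_le continuous_on_const continuous_nn)
    have i: "integrable lborel ?f"
      by (rule integrable_real_mult_indicator[OF m int_pow[OF \<Phi>(1)[OF r1]]])
    have nn: "0 \<le> ?f z" for z using \<Phi>(1)[OF r1] by (simp add: admissible_def)
    have "(\<integral>z. ?f z \<partial>lborel) \<le> C * B * r powr \<kappa>" if r: "0 < r" "r \<le> r1" for r
    proof -
      have r': "r \<le> 1" using r r1 by simp
      have "(\<integral>z. ?f z \<partial>lborel) \<le> (\<integral>z. \<bar>U z\<bar> powr p * \<Phi> r z \<partial>lborel)"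
      proof (rule integral_mono[OF i int_pow[OF \<Phi>(1)[OF r(1) r']]])
        fix z :: "'n st"
        have "0 \<le> \<Phi> r z" using \<Phi>(1)[OF r(1) r'] by (simp add: admissible_def)
        moreover have "\<Phi> r1 z = \<Phi> r z" if "r1 ^ 4 \<le> nn z"
        proof -
          have "r ^ 4 \<le> r1 ^ 4" using r by (intro power_mono) auto
          then show ?thesis using \<Phi>(4)[OF r(1), of z] \<Phi>(4)[OF r1(1), of z] that by linarith
        qed
        ultimately show "?f z \<le> \<bar>U z\<bar> powr p * \<Phi> r z" by (auto simp: indicator_def)
      qed
      then show ?thesis using bound[OF r(1) r'] by linarith
    qed
    then have le: "(\<integral>z. ?f z \<partial>lborel) \<le> C * B * r powr \<kappa>" if "0 < r" "r \<le> r1" for r using that by blast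
    have "((\<lambda>r. C * B * r powr \<kappa>) \<longlongrightarrow> C * B * 0 powr \<kappa>) (at_right 0)"
      using \<kappa> by (intro tendsto_intros tendsto_powr2) (auto simp: eventually_at_right_less eventually_at_filter)
    then have lim: "((\<lambda>r. C * B * r powr \<kappa>) \<longlongrightarrow> 0) (at_right 0)" by simp
    have "eventually (\<lambda>r. (\<integral>z. ?f z \<partial>lborel) \<le> C * B * r powr \<kappa>) (at_right (0::real))"
      unfolding eventually_at_right_field using le r1 by (intro exI[of _ r1]) auto
    from tendsto_lowerbound[OF lim this] have "(\<integral>z. ?f z \<partial>lborel) \<le> 0" by simp
    moreover have "0 \<le> (\<integral>z. ?f z \<partial>lborel)" using nn by (intro integral_nonneg_AE) auto
    ultimately have "(\<integral>z. ?f z \<partial>lborel) = 0" by linarith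
    then have "AE z in lborel. ?f z = 0" using integral_nonneg_eq_0_iff_AE[OF i] nn by auto
    then show ?thesis
    proof eventually_elim
      case (elim z)
      show ?case
      proof (intro impI)
        assume z: "r1 ^ 4 \<le> nn z" "J z \<noteq> 0"
        then have "\<bar>U z\<bar> powr p * J z = 0" using elim \<Phi>(4)[OF r1(1) z(1)] by simp
        then show "U z = 0" using z by simp
      qed
    qed
  qed
  have "AE z in lborel. \<forall>i::nat. (1 / Suc i) ^ 4 \<le> nn z \<longrightarrow> J z \<noteq> 0 \<longrightarrow> U z = 0"
    unfolding AE_all_countable by (intro allI zero) auto
  then have "AE z in lborel. fst z \<le> t3 \<longrightarrow> nn z \<le> m0 \<longrightarrow> U z = 0"
    using AE_nn_pos
  proof eventually_elim
    case (elim z)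
    show ?case
    proof (intro impI)
      assume z: "fst z \<le> t3" "nn z \<le> m0"
      obtain i where i: "1 / Suc i < min 1 (nn z)" using nat_approx_posE[of "min 1 (nn z)"] elim(2) by auto
      have "(1 / Suc i) ^ 4 \<le> (1 / Suc i) ^ 1" by (intro power_decreasing) auto
      then have "(1 / Suc i) ^ 4 \<le> nn z" using i by simp
      moreover have "J z \<noteq> 0" using \<Phi>(6)[OF z(1) elim(2) z(2)] by simp
      ultimately show "U z = 0" using elim(1) by blast
    qed
  qed
  then show thesis using that[OF \<Phi>(5)] by blast
qed

end

section \<open>Propagation to all of space-time\<close>

text \<open>The right-hand side is \<open>\<Delta> (e^(- A S)) / (A e^(- A S))\<close> for \<open>S = a + w^2 - L sqrt(a + 1 / A)\<close>, with
\<open>y = sqrt(a + 1 / A)\<close> and \<open>v = w^2\<close>. The horizontal gradient of \<open>S\<close> degenerates on the axis \<open>a = 0\<close>, and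
\<open>\<Delta> (a + w^2) > 0\<close> has the wrong sign there; the conical correction makes \<open>\<Delta> S\<close> very negative there, of order
\<open>- L sqrt A\<close>. Away from the axis the gradient term wins: for \<open>a \<ge> L^2\<close> through the derivative in \<open>a\<close>,
and for smaller \<open>a\<close> through the derivative in \<open>w\<close>, since \<open>n \<ge> m\<close> keeps \<open>w\<close> away from zero.\<close>

lemma exponential_barrier_bound:
  fixes m N c :: real
  assumes m: "0 < m" and N: "1 \<le> N" and c: "0 \<le> c"
  obtains L A where "0 < L" "L \<le> 1" "1 \<le> A"
    "\<And>a v y. 0 \<le> a \<Longrightarrow> 0 \<le> v \<Longrightarrow> m \<le> a\<^sup>2 + v \<Longrightarrow> 0 < y \<Longrightarrow> y\<^sup>2 = a + 1 / A \<Longrightarrow>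
       c \<le> 4 * A * a * ((1 - L / (2 * y))\<^sup>2 + 4 * v) - (4 * N + 8 * a - L * (2 * N / y - a / y ^ 3))"
proof -
  \<comment> \<open>for \<open>a < L^2\<close> this gives \<open>a^2 \<le> m / 2\<close>, hence \<open>v \<ge> m / 2\<close>\<close>
  define L where "L = min 1 (m / 2)"
  have L: "0 < L" "L \<le> 1" "L \<le> m / 2" using m by (auto simp: L_def)
  define D where "D = 4 * N + c"
  have D: "0 < D" using N c by (simp add: D_def)
  \<comment> \<open>for \<open>a < \<eta>\<close> and \<open>1 / A \<le> \<eta>\<close> the conical term \<open>L / y\<close> is at least \<open>D\<close>\<close>
  define \<eta> where "\<eta> = L\<^sup>2 / (2 * D\<^sup>2)"
  have \<eta>: "0 < \<eta>" using L D by (simp add: \<eta>_def)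
  define A where "A = 9 + D / L\<^sup>2 + 1 / \<eta> + (1 + D / (8 * \<eta>)) / m"
  have pos: "0 < D / L\<^sup>2" "0 < 1 / \<eta>" "0 < (1 + D / (8 * \<eta>)) / m" using L D \<eta> m by (auto intro!: divide_pos_pos add_pos_pos)
  have A: "9 \<le> A" "8 + D / L\<^sup>2 \<le> A" "1 / \<eta> \<le> A" "(1 + D / (8 * \<eta>)) / m \<le> A" using pos unfolding A_def by linarith+
  show thesis
  proof (rule that[OF L(1,2)])
    show "1 \<le> A" using A by simp
    fix a v y :: real
    assume a: "0 \<le> a" and v: "0 \<le> v" and mv: "m \<le> a\<^sup>2 + v" and y: "0 < y" and ya: "y\<^sup>2 = a + 1 / A"
    have e: "0 < 1 / A" using A by simp
    have "a / y ^ 3 \<le> 1 / y"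
    proof -
      have "a / y ^ 3 \<le> y\<^sup>2 / y ^ 3" using ya e y by (intro divide_right_mono) auto
      then show ?thesis using y by (simp add: power2_eq_square power3_eq_cube)
    qed
    moreover have "2 / y \<le> 2 * N / y" using N y by (intro divide_right_mono) auto
    ultimately have "1 / y \<le> 2 * N / y - a / y ^ 3" by simp
    then have Ly: "L / y \<le> L * (2 * N / y - a / y ^ 3)" using mult_left_mono[of "1 / y" _ L] L by simp
    have Ly0: "0 < L / y" using L y by simp
    have "D \<le> 4 * A * a * ((1 - L / (2 * y))\<^sup>2 + 4 * v) - 8 * a + L / y"
    proof (cases "L\<^sup>2 \<le> a")
      case True
      then have "L\<^sup>2 \<le> y\<^sup>2" using ya e by linarith
      then have "L \<le> y" by (rule power2_le_imp_le) (use y in simp)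
      then have "L / (2 * y) \<le> 1 / 2" using y by (simp add: field_simps)
      then have "(1 / 2)\<^sup>2 \<le> (1 - L / (2 * y))\<^sup>2" by (intro power_mono) auto
      then have "1 / 4 \<le> (1 - L / (2 * y))\<^sup>2 + 4 * v" using v by (simp add: power2_eq_square)
      then have "4 * A * a * (1 / 4) \<le> 4 * A * a * ((1 - L / (2 * y))\<^sup>2 + 4 * v)" using A a by (intro mult_left_mono) auto
      moreover have "(A - 8) * L\<^sup>2 \<le> (A - 8) * a" using True A by (intro mult_left_mono) auto
      moreover have "D / L\<^sup>2 * L\<^sup>2 \<le> (A - 8) * L\<^sup>2" using A(2) by (intro mult_right_mono) auto
      ultimately show ?thesis using L Ly0 by (simp add: algebra_simps)
    next
      case False
      have "a\<^sup>2 \<le> L"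
      proof -
        have "L\<^sup>2 \<le> L" using L by (simp add: power2_eq_square mult_left_le)
        then have "a \<le> L" "a \<le> 1" using False L by linarith+
        then show ?thesis using a mult_mono[of a L a 1] L by (simp add: power2_eq_square)
      qed
      then have v2: "m / 2 \<le> v" using mv L by linarith
      have "4 * A * a * (2 * m) \<le> 4 * A * a * ((1 - L / (2 * y))\<^sup>2 + 4 * v)"
        using v2 A a by (intro mult_left_mono) (auto intro: add_nonneg_nonneg order_trans[of "2 * m" "4 * v"])
      moreover have Am: "1 + D / (8 * \<eta>) \<le> A * m" using A(4) m by (simp add: field_simps)
      have "8 * a * (D / (8 * \<eta>)) \<le> 8 * a * (A * m - 1)" using Am a by (intro mult_left_mono) auto
      moreover have "D \<le> 8 * a * (D / (8 * \<eta>)) + L / y"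
      proof (cases "\<eta> \<le> a")
        case True
        then have "D * 1 \<le> D * (a / \<eta>)" using D \<eta> by (intro mult_left_mono) auto
        moreover have "8 * a * (D / (8 * \<eta>)) = D * (a / \<eta>)" by simp
        ultimately show ?thesis using Ly0 by linarith
      next
        case False
        have "1 / A \<le> \<eta>" using A \<eta> by (simp add: field_simps)
        then have "y\<^sup>2 \<le> 2 * \<eta>" using ya False by simp
        then have "D\<^sup>2 * y\<^sup>2 \<le> D\<^sup>2 * (2 * \<eta>)" by (intro mult_left_mono) auto
        also have "\<dots> = L\<^sup>2" using D by (simp add: \<eta>_def)
        finally have "(D * y)\<^sup>2 \<le> L\<^sup>2" by (simp add: power_mult_distrib)
        then have "D * y \<le> L" by (rule power2_le_imp_le) (use L in simp)
        then have "D \<le> L / y" using y by (simp add: field_simps)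
        moreover have "0 \<le> 8 * a * (D / (8 * \<eta>))" using a D \<eta> by simp
        ultimately show ?thesis by linarith
      qed
      ultimately show ?thesis by (simp add: algebra_simps)
    qed
    then show "c \<le> 4 * A * a * ((1 - L / (2 * y))\<^sup>2 + 4 * v) - (4 * N + 8 * a - L * (2 * N / y - a / y ^ 3))"
      using Ly unfolding D_def by linarith
  qed
qed

context heis_super
begin

text \<open>The speed \<open>c\<close> is chosen so that the support, where \<open>S < \<Lambda> - c t\<close>, is empty after time \<open>t3\<close>, whereas for
each earlier time it grows to the whole group as \<open>\<Lambda>\<close> tends to infinity.\<close>

lemma propagation_test_function:
  assumes m: "0 < m" and t3: "0 < t3" "t3 < T" and \<Lambda>: "0 \<le> \<Lambda>"
  obtains F :: "'n st \<Rightarrow> real" where "admissible T F"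
    "\<And>z. m \<le> nn z \<or> t3 < fst z \<Longrightarrow> 0 \<le> hardy_op lam F z"
    "\<And>z. 0 \<le> fst z \<Longrightarrow> m \<le> nn z \<Longrightarrow> aa z + (ww z)\<^sup>2 + 2 < \<Lambda> * (1 - fst z / t3) \<Longrightarrow> 0 < F z"
proof -
  define N where "N = real CARD('n)"
  have N: "1 \<le> N" by (simp add: N_def Suc_leI)
  \<comment> \<open>at time \<open>t3\<close> the positivity condition \<open>S < \<Lambda> - c t\<close> reads \<open>S < - 2\<close>, but \<open>S \<ge> - 1\<close> everywhere\<close>
  define c where "c = (\<Lambda> + 2) / t3"
  have c: "0 < c" using \<Lambda> t3 by (simp add: c_def)
  obtain L A where L: "0 < L" "L \<le> 1" and A: "1 \<le> A" and
    bar: "\<And>a v y. 0 \<le> a \<Longrightarrow> 0 \<le> v \<Longrightarrow> m \<le> a\<^sup>2 + v \<Longrightarrow> 0 < y \<Longrightarrow> y\<^sup>2 = a + 1 / A \<Longrightarrow>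
       c \<le> 4 * A * a * ((1 - L / (2 * y))\<^sup>2 + 4 * v) - (4 * N + 8 * a - L * (2 * N / y - a / y ^ 3))"
    using exponential_barrier_bound[OF m N, of c] c by (metis less_imp_le)
  define e where "e = 1 / A"
  have e: "0 < e" "e \<le> 1" using A by (auto simp: e_def)
  define y where "y = (\<lambda>z::'n st. (aa z + e) powr (1 / 2))"
  have ae: "0 < aa z + e" for z :: "'n st" using hz_nonneg[of "snd z"] e by linarith
  have y: "0 < y z" "(y z)\<^sup>2 = aa z + e" for z
  proof -
    show "0 < y z" unfolding y_def using ae[of z] by simp
    have "(y z)\<^sup>2 = y z powr 2" using \<open>0 < y z\<close> powr_realpow[of "y z" 2] by simp
    also have "\<dots> = aa z + e" unfolding y_def using ae[of z] by (simp add: powr_powr)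
    finally show "(y z)\<^sup>2 = aa z + e" .
  qed
  have cAe: "cyl UNIV (\<lambda>z::'n st. aa z + e) (\<lambda>z. 0) (\<lambda>z. 1) (\<lambda>z. 0) (\<lambda>z. 4 * N)"
    by (rule cyl_eq[OF cyl_add[OF cyl_a[OF open_UNIV] cyl_const[OF open_UNIV, of e]]]) (auto simp: N_def)
  have cY: "cyl UNIV y (\<lambda>z. 0) (\<lambda>z. 1 / (2 * y z)) (\<lambda>z. 0) (\<lambda>z. 2 * N / y z - aa z / y z ^ 3)"
  proof (rule cyl_eq[OF cyl_comp[OF cAe, where V="{0<..}" and g="\<lambda>x. x powr (1 / 2)"
        and g'="\<lambda>x. 1 / 2 * x powr (1 / 2 - 1)" and g''="\<lambda>x. 1 / 2 * ((1 / 2 - 1) * x powr (1 / 2 - 1 - 1))"]])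
    show "((\<lambda>x. x powr (1 / 2)) has_real_derivative 1 / 2 * x powr (1 / 2 - 1)) (at x)" if "x \<in> {0<..}" for x :: real
      by (rule has_real_derivative_powr) (use that in simp)
    show "((\<lambda>x. 1 / 2 * x powr (1 / 2 - 1)) has_real_derivative 1 / 2 * ((1 / 2 - 1) * x powr (1 / 2 - 1 - 1))) (at x)" if "x \<in> {0<..}" for x :: real
      by (rule DERIV_cmult[OF has_real_derivative_powr]) (use that in simp)
    fix z :: "'n st"
    have p1: "(aa z + e) powr (1 / 2 - 1) = 1 / y z"
    proof -
      have "(aa z + e) powr (1 / 2 - 1) = y z / (y z)\<^sup>2"
        unfolding y(2) using ae[of z] by (subst powr_diff) (simp add: y_def)
      then show ?thesis by (simp add: power2_eq_square)
    qed
    have p2: "(aa z + e) powr (1 / 2 - 1 - 1) = 1 / y z ^ 3"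
    proof -
      have "(aa z + e) powr (1 / 2 - 1 - 1) = (aa z + e) powr (1 / 2 - 1) / (y z)\<^sup>2"
        unfolding y(2) using ae[of z] by (subst powr_diff) simp
      then show ?thesis unfolding p1 by (simp add: power2_eq_square power3_eq_cube)
    qed
    show "1 / (2 * y z) = 1 / 2 * (aa z + e) powr (1 / 2 - 1) * 1" unfolding p1 by simp
    show "2 * N / y z - aa z / y z ^ 3 = 1 / 2 * (aa z + e) powr (1 / 2 - 1) * (4 * N)
        + 1 / 2 * ((1 / 2 - 1) * (aa z + e) powr (1 / 2 - 1 - 1)) * (4 * aa z * (1\<^sup>2 + 0\<^sup>2))"
      unfolding p1 p2 by simp
  qed (use ae in \<open>auto simp: y_def Ck_powr\<close>)
  define S where "S = (\<lambda>z::'n st. aa z + (ww z)\<^sup>2 - L * y z)"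
  define Sa where "Sa = (\<lambda>z::'n st. 1 - L / (2 * y z))"
  define SL where "SL = (\<lambda>z::'n st. 4 * N + 8 * aa z - L * (2 * N / y z - aa z / y z ^ 3))"
  have cS: "cyl UNIV S (\<lambda>z. 0) Sa (\<lambda>z. 2 * ww z) SL"
    by (rule cyl_eq[OF cyl_add[OF cyl_add[OF cyl_a[OF open_UNIV] cyl_mult[OF cyl_w[OF open_UNIV] cyl_w[OF open_UNIV]]]
          cyl_mult[OF cyl_const[OF open_UNIV, of "- L"] cY]]])
      (auto simp: S_def Sa_def SL_def N_def power2_eq_square)
  define M where "M = (\<lambda>z::'n st. exp (- A * S z))"
  define LM where "LM = (\<lambda>z. A * M z * (4 * A * aa z * ((Sa z)\<^sup>2 + 4 * (ww z)\<^sup>2) - SL z))"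
  define Ma where "Ma = (\<lambda>z. - A * M z * Sa z)"
  define Mw where "Mw = (\<lambda>z. - A * M z * (2 * ww z))"
  have CE: "Ck 3 UNIV (\<lambda>x::real. exp (k * x))" for k
    by (rule Ck_comp[OF open_UNIV Ck_cmult[OF open_UNIV Ck_id] open_UNIV Ck_exp]) auto
  have cM: "cyl UNIV M (\<lambda>z. 0) Ma Mw LM"
  proof (rule cyl_eq[OF cyl_comp[OF cS open_UNIV _ CE[of "- A"], where g'="\<lambda>x. - A * exp (- A * x)" and g''="\<lambda>x. A\<^sup>2 * exp (- A * x)"]])
    show "((\<lambda>x. exp (- A * x)) has_real_derivative - A * exp (- A * x)) (at x)" for x
      by (auto intro!: derivative_eq_intros)
    show "((\<lambda>x. - A * exp (- A * x)) has_real_derivative A\<^sup>2 * exp (- A * x)) (at x)" for x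
      by (auto intro!: derivative_eq_intros simp: power2_eq_square)
  qed (auto simp: M_def LM_def Ma_def Mw_def power2_eq_square algebra_simps)
  define \<tau> where "\<tau> = (\<lambda>z::'n st. exp (A * (c * fst z - \<Lambda>)))"
  have c\<tau>: "cyl UNIV \<tau> (\<lambda>z. A * c * \<tau> z) (\<lambda>z. 0) (\<lambda>z. 0) (\<lambda>z. 0)"
  proof (rule cyl_eq[OF cyl_comp[OF cyl_add[OF cyl_mult[OF cyl_const[OF open_UNIV, of c] cyl_t[OF open_UNIV]] cyl_const[OF open_UNIV, of "- \<Lambda>"]]
          open_UNIV _ CE[of A], where g'="\<lambda>x. A * exp (A * x)" and g''="\<lambda>x. A\<^sup>2 * exp (A * x)"]])
    show "((\<lambda>x. exp (A * x)) has_real_derivative A * exp (A * x)) (at x)" for x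
      by (auto intro!: derivative_eq_intros)
    show "((\<lambda>x. A * exp (A * x)) has_real_derivative A\<^sup>2 * exp (A * x)) (at x)" for x
      by (auto intro!: derivative_eq_intros simp: power2_eq_square)
  qed (auto simp: \<tau>_def algebra_simps)
  define s where "s = (\<lambda>z. M z - \<tau> z)"
  have cs: "cyl UNIV s (\<lambda>z. - (A * c * \<tau> z)) Ma Mw LM"
    by (rule cyl_eq[OF cyl_add[OF cM cyl_mult[OF cyl_const[OF open_UNIV, of "-1"] c\<tau>]]]) (auto simp: s_def)
  have cH: "cyl UNIV (\<lambda>z. max 0 (s z) ^ 4) (\<lambda>z. 4 * max 0 (s z) ^ 3 * - (A * c * \<tau> z)) (\<lambda>z. 4 * max 0 (s z) ^ 3 * Ma z) (\<lambda>z. 4 * max 0 (s z) ^ 3 * Mw z)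
     (\<lambda>z. 4 * max 0 (s z) ^ 3 * LM z + 12 * max 0 (s z) ^ 2 * (4 * aa z * ((Ma z)\<^sup>2 + (Mw z)\<^sup>2)))"
  proof (rule cyl_comp[OF cs open_UNIV _ Ck_pospart_power, where g'="\<lambda>x. 4 * max 0 x ^ 3" and g''="\<lambda>x. 12 * max 0 x ^ 2"])
    show "((\<lambda>x::real. max 0 x ^ 4) has_real_derivative 4 * max 0 x ^ 3) (at x)" for x
      using has_real_derivative_pospart_power[of 3 x] by (simp add: eval_nat_numeral)
    show "((\<lambda>x::real. 4 * max 0 x ^ 3) has_real_derivative 12 * max 0 x ^ 2) (at x)" for x
      using DERIV_cmult[OF has_real_derivative_pospart_power[of 2 x], of 4] by (simp add: eval_nat_numeral mult_ac)
  qed auto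
  obtain g g' g'' :: "real \<Rightarrow> real" and W where g:
    "Ck 3 UNIV g" "\<And>x. (g has_real_derivative g' x) (at x)" "\<And>x. (g' has_real_derivative g'' x) (at x)"
    "\<And>x. 0 \<le> g x" "\<And>x. g x \<le> 1" "\<And>x. x \<le> 1 / 16 \<Longrightarrow> g x = 0" "\<And>x. 1 \<le> x \<Longrightarrow> g x = 1"
    "\<And>x. x \<le> 1 / 16 \<or> 1 \<le> x \<Longrightarrow> g' x = 0 \<and> g'' x = 0"
    "0 < W" "\<And>x. \<bar>g' x\<bar> \<le> W" "\<And>x. \<bar>g'' x\<bar> \<le> W"
    using smooth_step by blast
  define F where "F = (\<lambda>z::'n st. g (nn z / m) * max 0 (s z) ^ 4)"
  note cF = cyl_mult[OF cyl_profile_n[OF open_UNIV g(1,2,3), of m] cH]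
  have yL: "L * y z \<le> (aa z + 2) / 2" for z
  proof -
    have "L * y z \<le> 1 * y z" using L y[of z] by (intro mult_right_mono) auto
    moreover have "0 \<le> (y z - 1)\<^sup>2" by simp
    ultimately show ?thesis using y(2)[of z] e by (simp add: power2_diff)
  qed
  have s_pos: "S z < \<Lambda> - c * fst z" if "0 < s z" for z
  proof -
    have "A * (c * fst z - \<Lambda>) < - A * S z" using that by (simp add: s_def M_def \<tau>_def)
    then have "A * (c * fst z - \<Lambda>) < A * (- S z)" by simp
    then have "c * fst z - \<Lambda> < - S z" by (rule mult_left_less_imp_less) (use A in simp)
    then show ?thesis by linarith
  qed
  have S_low: "(ww z)\<^sup>2 + aa z / 2 - 1 \<le> S z" for z using yL[of z] by (simp add: S_def)
  have late: "s z \<le> 0" if "t3 \<le> fst z" for z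
  proof (rule ccontr)
    assume "\<not> s z \<le> 0"
    then have "S z < \<Lambda> - c * fst z" using s_pos[of z] by simp
    moreover have "c * t3 \<le> c * fst z" using that c by (intro mult_left_mono) auto
    moreover have "c * t3 = \<Lambda> + 2" using t3 by (simp add: c_def)
    moreover have "- 1 \<le> S z" using S_low[of z] hz_nonneg[of "snd z"] zero_le_power2[of "ww z"] by linarith
    ultimately show False by linarith
  qed
  show thesis
  proof (rule that[of F])
    show "admissible T F" unfolding admissible_def
    proof (intro conjI)
      show "Ck 3 UNIV F" using cF unfolding cyl_def F_def by blast
      show "\<forall>z. 0 \<le> F z" using g(4) by (simp add: F_def)
      have "F z = 0" if "nn z < m / 16" for z using that m g(6)[of "nn z / m"] by (simp add: F_def field_simps)
      then show "\<exists>n0>0. \<forall>z. nn z < n0 \<longrightarrow> F z = 0" using m by (intro exI[of _ "m / 16"]) auto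
      have "fst z \<le> t3 \<and> nn z \<le> (2 * \<Lambda> + 2)\<^sup>2 + (\<Lambda> + 1)" if z: "0 \<le> fst z" "F z \<noteq> 0" for z
      proof
        have s: "0 < s z" using z(2) by (auto simp: F_def max_def split: if_splits)
        then show "fst z \<le> t3" using late[of z] by (cases "t3 \<le> fst z") auto
        have "0 \<le> c * fst z" using c z by simp
        then have b: "(ww z)\<^sup>2 + aa z / 2 \<le> \<Lambda> + 1" using s_pos[OF s] S_low[of z] by linarith
        then have "aa z \<le> 2 * \<Lambda> + 2" "(ww z)\<^sup>2 \<le> \<Lambda> + 1" using zero_le_power2[of "ww z"] hz_nonneg[of "snd z"] by linarith+
        then have "(aa z)\<^sup>2 \<le> (2 * \<Lambda> + 2)\<^sup>2" using hz_nonneg[of "snd z"] by (intro power_mono) auto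
        then show "nn z \<le> (2 * \<Lambda> + 2)\<^sup>2 + (\<Lambda> + 1)" unfolding hn_def using \<open>(ww z)\<^sup>2 \<le> \<Lambda> + 1\<close> by (rule add_mono)
      qed
      then show "\<exists>S<T. \<exists>R. \<forall>z. 0 \<le> fst z \<longrightarrow> F z \<noteq> 0 \<longrightarrow> fst z \<le> S \<and> nn z \<le> R" using t3 by blast
    qed
    fix z :: "'n st"
    show "0 \<le> hardy_op lam F z" if "m \<le> nn z \<or> t3 < fst z"
      using that
    proof
      assume z: "m \<le> nn z"
      have x: "1 \<le> nn z / m" using z m by simp
      have n: "0 < nn z" using z m by linarith
      note g1 = g(7)[OF x] g(8)[OF disjI2[OF x]]
      have PLz: "hardy_op lam F z = 4 * max 0 (s z) ^ 3 * (LM z - A * c * \<tau> z) + 12 * max 0 (s z) ^ 2 * (4 * aa z * ((Ma z)\<^sup>2 + (Mw z)\<^sup>2))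
         + lam * (aa z / nn z) * F z"
        using cF g1 unfolding cyl_def hardy_op_def F_def by (simp add: algebra_simps)
      have "0 \<le> max 0 (s z) ^ 3 * (LM z - A * c * \<tau> z)"
      proof (cases "0 < s z")
        case True
        have "c \<le> 4 * A * aa z * ((1 - L / (2 * y z))\<^sup>2 + 4 * (ww z)\<^sup>2) - (4 * N + 8 * aa z - L * (2 * N / y z - aa z / y z ^ 3))"
          by (rule bar) (use y[of z] z hz_nonneg[of "snd z"] in \<open>auto simp: hn_def e_def\<close>)
        then have "A * M z * c \<le> LM z" unfolding LM_def Sa_def SL_def using A by (intro mult_left_mono) (auto simp: M_def)
        moreover have "A * c * \<tau> z \<le> A * c * M z" using True A c by (intro mult_left_mono) (auto simp: s_def)
        ultimately show ?thesis by (intro mult_nonneg_nonneg) (auto simp: mult_ac)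
      qed simp
      moreover have "0 \<le> 12 * max 0 (s z) ^ 2 * (4 * aa z * ((Ma z)\<^sup>2 + (Mw z)\<^sup>2))" using hz_nonneg[of "snd z"] by simp
      moreover have "0 \<le> lam * (aa z / nn z) * F z"
        by (intro mult_nonneg_nonneg V_le(1)[OF n]) (use lam_pos g(4) in \<open>auto simp: F_def\<close>)
      ultimately show ?thesis unfolding PLz by linarith
    next
      assume z: "t3 < fst z"
      have "open {z::'n st. t3 < fst z}" by (intro open_Collect_less continuous_intros)
      moreover have "F q = 0" if "q \<in> {z. t3 < fst z}" for q
        using late[of q] that by (simp add: F_def max_absorb1)
      ultimately have "hardy_op lam F z = 0" using hardy_op_zero(4)[of "{z. t3 < fst z}" z F] z by simp
      then show ?thesis by simp
    qed
    show "0 < F z" if z: "0 \<le> fst z" "m \<le> nn z" "aa z + (ww z)\<^sup>2 + 2 < \<Lambda> * (1 - fst z / t3)"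
    proof -
      have "0 \<le> aa z + (ww z)\<^sup>2 + 2" using hz_nonneg[of "snd z"] by simp
      then have "0 < \<Lambda> * (1 - fst z / t3)" using z by linarith
      then have "fst z / t3 < 1" using \<Lambda> by (simp add: zero_less_mult_iff)
      moreover have "\<Lambda> - c * fst z = \<Lambda> * (1 - fst z / t3) - 2 * (fst z / t3)"
        by (simp add: c_def algebra_simps add_divide_distrib)
      ultimately have "aa z + (ww z)\<^sup>2 < \<Lambda> - c * fst z" using z by linarith
      moreover have "0 \<le> L * y z" using L y[of z] by simp
      ultimately have "A * S z < A * (\<Lambda> - c * fst z)" using A unfolding S_def by (intro mult_strict_left_mono) auto
      then have "A * (c * fst z - \<Lambda>) < - A * S z" by (simp add: algebra_simps)
      then have "0 < s z" by (simp add: s_def M_def \<tau>_def)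
      then show ?thesis using g(7)[of "nn z / m"] z m by (simp add: F_def)
    qed
  qed
qed

text \<open>The cut-off near the origin costs nothing, because it happens where the solution is already known to
vanish.\<close>

lemma nonpositive_test_function:
  assumes m: "0 < m" and t3: "0 < t3" "t3 < T" and \<Lambda>: "0 \<le> \<Lambda>"
  obtains F :: "'n st \<Rightarrow> real" where "admissible T F" "- (\<integral>z. U z * hardy_op lam F z \<partial>lborel) \<le> 0"
    "\<And>z. 0 \<le> fst z \<Longrightarrow> m \<le> nn z \<Longrightarrow> aa z + (ww z)\<^sup>2 + 2 < \<Lambda> * (1 - fst z / t3) \<Longrightarrow> 0 < F z"
proof -
  obtain m0 where m0: "0 < m0" "AE z in lborel. fst z \<le> t3 \<longrightarrow> nn z \<le> m0 \<longrightarrow> U z = 0"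
    using zero_near_origin[OF t3] by blast
  have mm: "0 < min m m0" using m m0 by simp
  obtain F :: "'n st \<Rightarrow> real" where F: "admissible T F"
    "\<And>z. min m m0 \<le> nn z \<or> t3 < fst z \<Longrightarrow> 0 \<le> hardy_op lam F z"
    "\<And>z. 0 \<le> fst z \<Longrightarrow> min m m0 \<le> nn z \<Longrightarrow> aa z + (ww z)\<^sup>2 + 2 < \<Lambda> * (1 - fst z / t3) \<Longrightarrow> 0 < F z"
    using propagation_test_function[OF mm t3 \<Lambda>] by blast
  have "AE z in lborel. \<bar>U z\<bar> * max 0 (- hardy_op lam F z) = 0"
    using m0(2)
  proof eventually_elim
    case (elim z)
    show ?case
    proof (cases "min m m0 \<le> nn z \<or> t3 < fst z")
      case True
      then show ?thesis using F(2)[of z] by simp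
    next
      case False
      then have "U z = 0" using elim by auto
      then show ?thesis by simp
    qed
  qed
  then have "(\<integral>z. \<bar>U z\<bar> * max 0 (- hardy_op lam F z) \<partial>lborel) = 0" by (rule integral_eq_zero_AE)
  then have "- (\<integral>z. U z * hardy_op lam F z \<partial>lborel) \<le> 0" using negative_part_inequality(1)[OF F(1)] by linarith
  then show thesis using F by (intro that[OF F(1)]) auto
qed

end

section \<open>The data terms and the conclusion\<close>

lemma AE_heis_st:
  assumes "AE \<xi>::'n::finite heis in lebesgue. P \<xi>"
  shows "AE z::'n st in lebesgue. P (snd z)"
proof -
  have "AE \<xi> in lborel. P \<xi>" using assms by (simp add: AE_completion_iff)
  then obtain X where "X \<in> null_sets lborel" "{\<xi> \<in> space lborel. \<not> P \<xi>} \<subseteq> X"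
    unfolding eventually_ae_filter by blast
  then have X: "{\<xi>. \<not> P \<xi>} \<subseteq> X" "emeasure lborel X = 0" "X \<in> sets lborel" by auto
  have "emeasure lborel ((UNIV::real set) \<times> X) = emeasure lborel (UNIV::real set) * emeasure lborel X"
    using X(3) by (intro emeasure_lborel_Times) auto
  then have "(UNIV::real set) \<times> X \<in> null_sets lborel"
  proof (intro null_setsI)
    show "UNIV \<times> X \<in> sets lborel" using X(3) unfolding lborel_prod[symmetric] by (intro pair_measureI) auto
  qed (simp add: X(2))
  then have "AE z::'n st in lborel. P (snd z)" using X(1) by (intro AE_I'[of "UNIV \<times> X"]) auto
  then show ?thesis by (simp add: AE_completion_iff)
qed

lemma AE_st_heis:
  assumes "AE z::'n::finite st in lebesgue. fst z \<in> {a<..<b} \<longrightarrow> P (snd z)" "a < b"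
  shows "AE \<xi>::'n heis in lebesgue. P \<xi>"
proof -
  have "AE z::'n st in lborel \<Otimes>\<^sub>M lborel. fst z \<in> {a<..<b} \<longrightarrow> P (snd z)"
    using assms(1) unfolding AE_completion_iff lborel_prod .
  from lborel_pair.AE_pair[OF this]
  have "AE t in lborel. AE \<xi> in (lborel :: 'n heis measure). t \<in> {a<..<b} \<longrightarrow> P \<xi>" by simp
  then have R: "AE t in lborel. t \<in> {a<..<b} \<longrightarrow> (AE \<xi>::'n heis in lborel. P \<xi>)"
    by eventually_elim auto
  have "AE \<xi>::'n heis in lborel. P \<xi>"
  proof (rule ccontr)
    assume "\<not> (AE \<xi>::'n heis in lborel. P \<xi>)"
    with R have "AE t in lborel. t \<notin> {a<..<b}" by simp
    then have "{a<..<b} \<in> null_sets lborel" by (rule iffD2[OF AE_iff_null_sets, rotated]) simp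
    then have "emeasure lborel {a<..<b} = 0" by blast
    then show False using assms(2) by simp
  qed
  then show ?thesis by (simp add: AE_completion_iff)
qed

lemma integrable_product:
  fixes g :: "'a::euclidean_space \<Rightarrow> real" and k :: "'b::euclidean_space \<Rightarrow> real"
  assumes g: "integrable lborel g" and k: "integrable lborel k"
  shows "integrable lborel (\<lambda>z. g (fst z) * k (snd z))"
proof -
  have [measurable]: "g \<in> borel_measurable borel" "k \<in> borel_measurable borel"
    using borel_measurable_integrable[OF g] borel_measurable_integrable[OF k] by simp_all
  have "integrable (lborel \<Otimes>\<^sub>M lborel) (\<lambda>z. g (fst z) * k (snd z))"
  proof (rule lborel_pair.Fubini_integrable)
    show "(\<lambda>z. g (fst z) * k (snd z)) \<in> borel_measurable (lborel \<Otimes>\<^sub>M lborel)" by measurable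
    show "integrable lborel (\<lambda>x. \<integral>y. norm (g (fst (x, y)) * k (snd (x, y))) \<partial>lborel)"
      using g k by (simp add: abs_mult)
    show "AE x in lborel. integrable lborel (\<lambda>y. g (fst (x, y)) * k (snd (x, y)))" using k by simp
  qed
  then show ?thesis by (simp add: lborel_prod)
qed

lemma integrable_powr_interval:
  fixes \<alpha> S :: real
  assumes "- 1 < \<alpha>" "0 \<le> S"
  shows "integrable lborel (\<lambda>t. indicator {0..S} t * t powr \<alpha>)"
proof -
  have "(\<lambda>t. t powr \<alpha>) absolutely_integrable_on {0..S}"
    using assms by (intro nonnegative_absolutely_integrable_1 integrable_on_powr_from_0) auto
  then have "integrable lebesgue (\<lambda>t. indicator {0..S} t * t powr \<alpha>)" by (simp add: set_integrable_def)
  then show ?thesis by (subst (asm) integrable_completion) auto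
qed

lemma heis_slab_integrable: "integrable lborel (indicator {\<xi>::'n::finite heis. hn \<xi> \<le> R} :: 'n heis \<Rightarrow> real)"
proof (rule integrable_real_indicator)
  show "{\<xi>::'n heis. hn \<xi> \<le> R} \<in> sets lborel" unfolding sets_lborel by (intro borel_closed compact_imp_closed compact_hn_le)
  show "emeasure lborel {\<xi>::'n heis. hn \<xi> \<le> R} < \<infinity>" by (intro emeasure_bounded_finite compact_imp_bounded compact_hn_le)
qed

lemma admissible_bound:
  assumes "admissible T (F :: 'n::finite st \<Rightarrow> real)" "0 < T"
  obtains S R B where "0 < S" "S < T" "0 \<le> B" "F \<in> borel_measurable borel"
    "\<And>z. 0 \<le> fst z \<Longrightarrow> \<bar>F z\<bar> \<le> B * (indicator {0..S} (fst z) * indicator {\<xi>. hn \<xi> \<le> R} (snd z))"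
proof -
  obtain S0 R where SR: "S0 < T" "\<And>p. 0 \<le> fst p \<Longrightarrow> F p \<noteq> 0 \<Longrightarrow> fst p \<le> S0 \<and> nn p \<le> R" and C: "Ck 3 UNIV F"
    using assms unfolding admissible_def by blast
  define S where "S = max S0 (T / 2)"
  have S: "0 < S" "S < T" "S0 \<le> S" using SR assms(2) by (auto simp: S_def)
  have cont: "continuous_on UNIV F" by (rule Ck_imp_continuous_on[OF C])
  have "bounded (F ` ({0..S} \<times> {\<xi>. hn \<xi> \<le> R}))"
    by (intro compact_imp_bounded compact_continuous_image compact_slab continuous_on_subset[OF cont]) auto
  then obtain B where B: "0 < B" "\<And>z. z \<in> {0..S} \<times> {\<xi>. hn \<xi> \<le> R} \<Longrightarrow> \<bar>F z\<bar> \<le> B"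
    by (auto simp: bounded_pos)
  show thesis
  proof (rule that[OF S(1,2)])
    show "0 \<le> B" using B by simp
    show "F \<in> borel_measurable borel" by (rule borel_measurable_continuous_onI[OF cont])
    fix z :: "'n st" assume z: "0 \<le> fst z"
    show "\<bar>F z\<bar> \<le> B * (indicator {0..S} (fst z) * indicator {\<xi>. hn \<xi> \<le> R} (snd z))"
    proof (cases "F z = 0")
      case False
      then have "fst z \<le> S" "nn z \<le> R" using SR(2)[OF z] S(3) by auto
      moreover from this have "\<bar>F z\<bar> \<le> B" using z by (intro B(2)) (auto simp: mem_Times_iff)
      ultimately show ?thesis using z by simp
    qed (use B in simp)
  qed
qed

lemma initial_data_integrable:
  fixes u0 :: "'n::finite heis \<Rightarrow> real"
  assumes u0: "Linf u0" and F: "admissible T F" "0 < T"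
  shows "integrable lebesgue (\<lambda>\<xi>. u0 \<xi> * F (0, \<xi>))"
proof -
  obtain S R B where B: "0 < S" "0 \<le> B" "F \<in> borel_measurable borel"
    "\<And>z. 0 \<le> fst z \<Longrightarrow> \<bar>F z\<bar> \<le> B * (indicator {0..S} (fst z) * indicator {\<xi>. hn \<xi> \<le> R} (snd z))"
  proof (rule admissible_bound[OF F], goal_cases)
    case (1 S R B)
    show thesis by (rule 1(1)[of S B R]; fact 1)
  qed
  obtain C where C: "AE \<xi> in lebesgue. \<bar>u0 \<xi>\<bar> \<le> C" and m: "u0 \<in> borel_measurable lebesgue" using u0 by (auto simp: Linf_def)
  have "(\<lambda>\<xi>. F (0, \<xi>)) \<in> borel_measurable lborel" using B(3) by simp
  then have m2: "(\<lambda>\<xi>. F (0, \<xi>)) \<in> borel_measurable lebesgue" by (rule measurable_completion)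
  show ?thesis
  proof (rule Bochner_Integration.integrable_bound)
    have "integrable lebesgue (indicator {\<xi>::'n heis. hn \<xi> \<le> R} :: 'n heis \<Rightarrow> real)"
      using heis_slab_integrable[of R] by (subst integrable_completion) auto
    then show "integrable lebesgue (\<lambda>\<xi>::'n heis. C * B * indicator {\<xi>. hn \<xi> \<le> R} \<xi> :: real)" by (intro integrable_mult_right)
    show "(\<lambda>\<xi>. u0 \<xi> * F (0, \<xi>)) \<in> borel_measurable lebesgue" using m m2 by (rule borel_measurable_times)
    show "AE \<xi> in lebesgue. norm (u0 \<xi> * F (0, \<xi>)) \<le> norm (C * B * indicator {\<xi>. hn \<xi> \<le> R} \<xi>)"
      using C
    proof eventually_elim
      case (elim \<xi>)
      have "\<bar>u0 \<xi>\<bar> * \<bar>F (0, \<xi>)\<bar> \<le> C * (B * indicator {\<xi>. hn \<xi> \<le> R} \<xi>)"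
        using elim B(4)[of "(0, \<xi>)"] B(1,2) by (intro mult_mono) auto
      moreover have "0 \<le> C" using elim by linarith
      ultimately show ?case using B(2) by (simp add: abs_mult)
    qed
  qed
qed

lemma lebesgue_measurable_AE_eq:
  fixes g h :: "'a::euclidean_space \<Rightarrow> real"
  assumes h: "h \<in> borel_measurable lebesgue" and e: "AE x in lebesgue. h x = g x"
  shows "g \<in> borel_measurable lebesgue"
proof (rule measurableI)
  fix A :: "real set" assume A: "A \<in> sets borel"
  have "AE x in lebesgue. x \<in> h -` A \<inter> space lebesgue \<longleftrightarrow> x \<in> g -` A \<inter> space lebesgue"
    using e by eventually_elim auto
  then show "g -` A \<inter> space lebesgue \<in> sets lebesgue"
    by (rule completion.in_sets_AE[OF _ measurable_sets[OF h A]]) simp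
qed simp

text \<open>Integrability at \<open>t = 0\<close> is where \<open>\<alpha> > - 1\<close> enters. It is needed because the integral of a non-integrable
function is zero by convention, so that a vanishing source term would carry no information.\<close>

lemma source_integrable:
  fixes f :: "'n::finite heis \<Rightarrow> real"
  assumes f: "Linf f" and F: "admissible T F" "0 < T" and \<alpha>: "- 1 < \<alpha>"
  shows "integrable lebesgue (\<lambda>z. indicator ({0<..<T} \<times> UNIV) z * (fst z powr \<alpha> * f (snd z) * F z))"
proof -
  obtain S R B where B: "0 < S" "S < T" "0 \<le> B" "F \<in> borel_measurable borel"
    "\<And>z. 0 \<le> fst z \<Longrightarrow> \<bar>F z\<bar> \<le> B * (indicator {0..S} (fst z) * indicator {\<xi>. hn \<xi> \<le> R} (snd z))"
  proof (rule admissible_bound[OF F], goal_cases)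
    case (1 S R B)
    show thesis by (rule 1(1)[of S B R]; fact 1)
  qed
  obtain C where C: "AE \<xi> in lebesgue. \<bar>f \<xi>\<bar> \<le> C" and m: "f \<in> borel_measurable lebesgue" using f by (auto simp: Linf_def)
  obtain fb where fb: "fb \<in> borel_measurable lborel" and fbe: "AE \<xi> in lborel. f \<xi> = fb \<xi>"
    using completion_ex_borel_measurable_real[OF m] by blast
  have [measurable]: "fb \<in> borel_measurable borel" "F \<in> borel_measurable borel" using fb B by simp_all
  have "AE \<xi> in lebesgue. \<bar>f \<xi>\<bar> \<le> C \<and> f \<xi> = fb \<xi>" using C fbe by (simp add: AE_completion_iff)
  from AE_heis_st[OF this] have ae: "AE z::'n st in lebesgue. \<bar>f (snd z)\<bar> \<le> C \<and> f (snd z) = fb (snd z)" .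
  have Dm: "{0<..<T} \<times> (UNIV :: 'n heis set) \<in> sets borel" by (intro borel_open open_Times) auto
  define H where "H z = indicator ({0<..<T} \<times> UNIV) z * (fst z powr \<alpha> * fb (snd z) * F z)" for z :: "'n st"
  have "(\<lambda>z::'n st. fst z powr \<alpha> * fb (snd z) * F z) \<in> borel_measurable borel"
  proof (intro borel_measurable_times)
    have "(snd :: 'n st \<Rightarrow> 'n heis) \<in> borel_measurable borel"
      by (intro borel_measurable_continuous_onI continuous_intros)
    then show "(\<lambda>z::'n st. fb (snd z)) \<in> borel_measurable borel" by (rule measurable_compose) simp
    have "(fst :: 'n st \<Rightarrow> real) \<in> borel_measurable borel"
      by (intro borel_measurable_continuous_onI continuous_intros)
    moreover have "(\<lambda>t::real. t powr \<alpha>) \<in> borel_measurable borel" by measurable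
    ultimately show "(\<lambda>z::'n st. fst z powr \<alpha>) \<in> borel_measurable borel" by (rule measurable_compose)
  qed (use B in simp_all)
  then have "H \<in> borel_measurable lborel" unfolding H_def[abs_def] using Dm by simp
  then have Hm: "H \<in> borel_measurable lebesgue" by (rule measurable_completion)
  have eq: "AE z::'n st in lebesgue. H z = indicator ({0<..<T} \<times> UNIV) z * (fst z powr \<alpha> * f (snd z) * F z)"
    using ae by eventually_elim (simp add: H_def)
  have W: "integrable lebesgue (\<lambda>z::'n st. C * B * ((indicator {0..S} (fst z) * fst z powr \<alpha>) * indicator {\<xi>. hn \<xi> \<le> R} (snd z)) :: real)"
  proof (rule integrable_mult_right)
    have "integrable lborel (\<lambda>z::'n st. (indicator {0..S} (fst z) * fst z powr \<alpha>) * indicator {\<xi>. hn \<xi> \<le> R} (snd z) :: real)"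
      using B \<alpha> by (intro integrable_product integrable_powr_interval heis_slab_integrable) auto
    then show "integrable lebesgue (\<lambda>z::'n st. (indicator {0..S} (fst z) * fst z powr \<alpha>) * indicator {\<xi>. hn \<xi> \<le> R} (snd z) :: real)"
      using borel_measurable_integrable by (subst integrable_completion) auto
  qed
  have "integrable lebesgue H"
  proof (rule Bochner_Integration.integrable_bound[OF W Hm])
    show "AE z in lebesgue. norm (H z) \<le> norm (C * B * ((indicator {0..S} (fst z) * fst z powr \<alpha>) * indicator {\<xi>. hn \<xi> \<le> R} (snd z)))"
      using ae
    proof eventually_elim
      case (elim z)
      have C0: "0 \<le> C" using elim by linarith
      show ?case
      proof (cases "fst z \<in> {0<..<T}")
        case True
        have "\<bar>fb (snd z)\<bar> * \<bar>F z\<bar> \<le> C * (B * (indicator {0..S} (fst z) * indicator {\<xi>. hn \<xi> \<le> R} (snd z)))"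
          using elim B(5)[of z] True C0 by (intro mult_mono) auto
        then have "fst z powr \<alpha> * (\<bar>fb (snd z)\<bar> * \<bar>F z\<bar>) \<le> fst z powr \<alpha> * (C * (B * (indicator {0..S} (fst z) * indicator {\<xi>. hn \<xi> \<le> R} (snd z))))"
          by (intro mult_left_mono) auto
        moreover have "norm (H z) = fst z powr \<alpha> * (\<bar>fb (snd z)\<bar> * \<bar>F z\<bar>)"
          using True by (cases z) (simp add: H_def abs_mult)
        moreover have "0 \<le> C * B * ((indicator {0..S} (fst z) * fst z powr \<alpha>) * indicator {\<xi>. hn \<xi> \<le> R} (snd z))"
          using C0 B by simp
        ultimately show ?thesis by (simp add: mult_ac)
      next
        case False
        then have "H z = 0" by (cases z) (simp add: H_def)
        then show ?thesis by simp
      qed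
    qed
  qed
  then show ?thesis
    using integrable_cong_AE[OF Hm lebesgue_measurable_AE_eq[OF Hm eq] eq] by blast
qed

theorem theorem3p1:
  fixes u0 f :: "'n::finite heis \<Rightarrow> real" and lam \<alpha> p T :: real
  assumes "0 < lam" and "lam < ((hdim TYPE('n) - 2) / 2)\<^sup>2"
    and "- 1 < \<alpha>"
    and "Linf u0" and "AE \<xi> in lebesgue. 0 \<le> u0 \<xi>"
    and "Linf f" and "AE \<xi> in lebesgue. 0 \<le> f \<xi>"
    and "(hardy_mu (hdim TYPE('n)) lam + 2) / hardy_mu (hdim TYPE('n)) lam < p"
    and "0 < T"
  shows "(\<not> ((AE \<xi> in lebesgue. u0 \<xi> = 0) \<and> (AE \<xi> in lebesgue. f \<xi> = 0)) \<longrightarrow>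
            \<not> (\<exists>u. weak_solution lam \<alpha> p u0 f T u)) \<and>
         \<not> (\<exists>u. weak_solution lam \<alpha> p u0 f T u \<and>
              \<not> (AE (t, \<xi>) in lebesgue_on ({0<..<T} \<times> UNIV). u t \<xi> = 0))"
proof -
  define \<mu> where "\<mu> = hardy_mu (hdim TYPE('n)) lam"
  note mu = hardy_mu_eq[OF assms(1,2), folded \<mu>_def]
  have "\<mu> + 2 < p * \<mu>" using assms(8) mu(2) by (simp add: \<mu>_def[symmetric] field_simps)
  then have pm: "2 < \<mu> * (p - 1)" by (simp add: algebra_simps)
  then have p1: "1 < p" using mu(2) by (smt (verit) mult_nonneg_nonpos)
  then have pq: "2 / (p - 1) < \<mu>" using pm by (simp add: field_simps)
  let ?D = "{0<..<T} \<times> (UNIV :: 'n heis set)"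
  have "(AE z::'n st in lebesgue. fst z \<in> {0<..<T} \<longrightarrow> u (fst z) (snd z) = 0)
      \<and> (AE \<xi> in lebesgue. u0 \<xi> = 0) \<and> (AE \<xi> in lebesgue. f \<xi> = 0)"
    if ws: "weak_solution lam \<alpha> p u0 f T u" for u
  proof -
    obtain U :: "'n st \<Rightarrow> real" where U: "U \<in> borel_measurable borel"
      "\<And>q. fst q \<notin> {0<..<T} \<Longrightarrow> U q = 0"
      "AE q in lebesgue. fst q \<in> {0<..<T} \<longrightarrow> u (fst q) (snd q) = U q"
      "\<And>F. admissible T F \<Longrightarrow> integrable lborel (\<lambda>q. U q * hardy_op lam F q)"
      "\<And>F. admissible T F \<Longrightarrow> integrable lborel (\<lambda>q. \<bar>U q\<bar> powr p * F q)"
      and weak: "\<And>F. admissible T F \<Longrightarrow> - (\<integral>q. U q * hardy_op lam F q \<partial>lborel) = (\<integral>q. \<bar>U q\<bar> powr p * F q \<partial>lborel)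
         + (LINT \<xi>|lebesgue. u0 \<xi> * F (0, \<xi>))
         + (LINT (t, \<xi>):{0<..<T} \<times> UNIV|lebesgue. t powr \<alpha> * f \<xi> * F (t, \<xi>))"
      using weak_solution_borel[OF ws assms(1,2)] by blast
    define d1 where "d1 F = (\<integral>\<xi>. u0 \<xi> * F (0, \<xi>) \<partial>lebesgue)" for F :: "'n st \<Rightarrow> real"
    define d2 where "d2 F = (\<integral>z. indicator ?D z * (fst z powr \<alpha> * f (snd z) * F z) \<partial>lebesgue)" for F :: "'n st \<Rightarrow> real"
    have d2_eq: "(LINT (t, \<xi>):?D|lebesgue. t powr \<alpha> * f \<xi> * F (t, \<xi>)) = d2 F" for F
      by (simp add: d2_def set_lebesgue_integral_def split_beta)
    have balance: "- (\<integral>q. U q * hardy_op lam F q \<partial>lborel) = (\<integral>q. \<bar>U q\<bar> powr p * F q \<partial>lborel) + d1 F + d2 F" if "admissible T F" for F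
      unfolding weak[OF that] d2_eq d1_def ..
    have n1: "AE \<xi> in lebesgue. 0 \<le> u0 \<xi> * F (0, \<xi>)" if "admissible T F" for F
      using assms(5) by eventually_elim (use that in \<open>auto simp: admissible_def\<close>)
    have n2: "AE z in lebesgue. 0 \<le> indicator ?D z * (fst z powr \<alpha> * f (snd z) * F z)" if "admissible T F" for F
      using AE_heis_st[OF assms(7)] by eventually_elim (use that in \<open>auto simp: admissible_def\<close>)
    have d_nonneg: "0 \<le> d1 F" "0 \<le> d2 F" if "admissible T F" for F
      unfolding d1_def d2_def using n1[OF that] n2[OF that] by (intro integral_nonneg_AE; simp)+
    interpret heis_super lam \<mu> p T U
    proof (rule heis_super.intro)
      show "lam = \<mu> * (2 * real CARD('n) - \<mu>)" by (rule mu(1))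
      show "(\<integral>q. \<bar>U q\<bar> powr p * F q \<partial>lborel) \<le> - (\<integral>q. U q * hardy_op lam F q \<partial>lborel)" if "admissible T F" for F
        using balance[OF that] d_nonneg[OF that] by linarith
    qed (fact mu p1 pq assms U)+
    define t3 where "t3 i = T * (1 - 1 / (real i + 2))" for i :: nat
    have t3: "0 < t3 i" "t3 i < T" for i
    proof -
      have x: "0 < 1 / (real i + 2)" "1 / (real i + 2) < 1" by auto
      show "0 < t3 i" unfolding t3_def using x assms(9) by (intro mult_pos_pos) auto
      have "T * (1 - 1 / (real i + 2)) < T * 1" using x assms(9) by (intro mult_strict_left_mono) auto
      then show "t3 i < T" by (simp add: t3_def)
    qed
    define R where "R i j z \<longleftrightarrow> 0 \<le> fst z \<and> 1 / (real j + 1) \<le> nn z \<and> aa z + (ww z)\<^sup>2 + 2 < real j * (1 - fst z / t3 i)"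
      for i j :: nat and z :: "'n st"
    have cover: "\<exists>i j. R i j z" if z: "0 \<le> fst z" "fst z < T" "0 < nn z" for z
    proof -
      have "0 < 1 - fst z / T" using z by simp
      then obtain i where i: "1 / Suc i < 1 - fst z / T"
        using nat_approx_posE[of "1 - fst z / T"] by auto
      have "1 / (real i + 2) \<le> 1 / Suc i" by (simp add: field_simps)
      then have "fst z / T < 1 - 1 / (real i + 2)" using i by linarith
      then have "fst z < t3 i" using assms(9) by (simp add: t3_def divide_less_eq mult.commute)
      then have \<theta>: "0 < 1 - fst z / t3 i" using t3(1)[of i] by simp
      obtain j :: nat where j: "max ((aa z + (ww z)\<^sup>2 + 2) / (1 - fst z / t3 i)) (1 / nn z) < real j" using reals_Archimedean2 by blast
      have "aa z + (ww z)\<^sup>2 + 2 < real j * (1 - fst z / t3 i)" using j pos_divide_less_eq[OF \<theta>] by auto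
      moreover have "1 / (real j + 1) \<le> nn z"
      proof -
        have "1 < real j * nn z" using j pos_divide_less_eq[OF z(3)] by auto
        then have "1 \<le> nn z * (real j + 1)" using z(3) by (simp add: algebra_simps)
        then show ?thesis by (simp add: divide_le_eq)
      qed
      ultimately show ?thesis using z unfolding R_def by blast
    qed
    have key: "(AE z in lebesgue. R i j z \<longrightarrow> U z = 0) \<and> (AE \<xi> in lebesgue. R i j (0, \<xi>) \<longrightarrow> u0 \<xi> = 0)
      \<and> (AE z in lebesgue. fst z \<in> {0<..<T} \<longrightarrow> R i j z \<longrightarrow> f (snd z) = 0)" for i j
    proof -
      have mj: "0 < 1 / (real j + 1)" "0 \<le> real j" by simp_all
      obtain F where F: "admissible T F" "- (\<integral>z. U z * hardy_op lam F z \<partial>lborel) \<le> 0" "\<And>z. R i j z \<Longrightarrow> 0 < F z"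
      proof (rule nonpositive_test_function[OF mj(1) t3(1)[of i] t3(2)[of i] mj(2)], goal_cases)
        case (1 F)
        have "0 < F z" if "R i j z" for z
          by (rule 1(4)) (use that in \<open>simp_all add: R_def\<close>)
        then show thesis by (rule 1(1)[OF 1(2,3)])
      qed
      have F0: "0 \<le> \<bar>U z\<bar> powr p * F z" for z using F(1) by (simp add: admissible_def)
      have "0 \<le> (\<integral>q. \<bar>U q\<bar> powr p * F q \<partial>lborel)" using F0 by (intro integral_nonneg_AE) auto
      then have z: "(\<integral>q. \<bar>U q\<bar> powr p * F q \<partial>lborel) = 0" "d1 F = 0" "d2 F = 0"
        using balance[OF F(1)] F(2) d_nonneg[OF F(1)] by linarith+
      have 1: "AE z in lborel. \<bar>U z\<bar> powr p * F z = 0"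
        using z(1) integral_nonneg_eq_0_iff_AE[OF U(5)[OF F(1)]] F0 by auto
      have 2: "AE \<xi> in lebesgue. u0 \<xi> * F (0, \<xi>) = 0"
        using z(2) integral_nonneg_eq_0_iff_AE[OF initial_data_integrable[OF assms(4) F(1) assms(9)] n1[OF F(1)]] unfolding d1_def by blast
      have 3: "AE z in lebesgue. indicator ?D z * (fst z powr \<alpha> * f (snd z) * F z) = 0"
        using z(3) integral_nonneg_eq_0_iff_AE[OF source_integrable[OF assms(6) F(1) assms(9,3)] n2[OF F(1)]] unfolding d2_def by blast
      have "AE z in lebesgue. \<bar>U z\<bar> powr p * F z = 0" using 1 by (simp only: AE_completion_iff)
      then have "AE z in lebesgue. R i j z \<longrightarrow> U z = 0"
        by eventually_elim (use F(3) in force)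
      moreover have "AE \<xi> in lebesgue. R i j (0, \<xi>) \<longrightarrow> u0 \<xi> = 0"
        using 2 by eventually_elim (use F(3) in force)
      moreover have "AE z in lebesgue. fst z \<in> {0<..<T} \<longrightarrow> R i j z \<longrightarrow> f (snd z) = 0"
        using 3
      proof eventually_elim
        case (elim z)
        show ?case
        proof (intro impI)
          assume z: "fst z \<in> {0<..<T}" "R i j z"
          have "indicator ?D z = (1::real)" using z(1) by (cases z) simp
          moreover have "0 < fst z powr \<alpha> * F z" using z F(3)[OF z(2)] by simp
          ultimately show "f (snd z) = 0" using elim by auto
        qed
      qed
      ultimately show ?thesis by blast
    qed
    have np: "AE z::'n st in lebesgue. 0 < nn z" using AE_nn_pos by (simp add: AE_completion_iff)
    have "AE z in lebesgue. \<forall>i j. R i j z \<longrightarrow> U z = 0" unfolding AE_all_countable using key by blast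
    then have "AE z::'n st in lebesgue. fst z \<in> {0<..<T} \<longrightarrow> u (fst z) (snd z) = 0"
      using np U(3)
    proof eventually_elim
      case (elim z)
      then show ?case using cover[of z] by auto
    qed
    moreover have "AE \<xi> in lebesgue. u0 \<xi> = 0"
    proof -
      have "AE \<xi>::'n heis in lebesgue. \<xi> \<noteq> 0" using AE_lborel_singleton[of "0 :: 'n heis"] by (simp only: AE_completion_iff)
      moreover have "AE \<xi> in lebesgue. \<forall>i j. R i j (0, \<xi>) \<longrightarrow> u0 \<xi> = 0" unfolding AE_all_countable using key by blast
      ultimately show ?thesis
      proof eventually_elim
        case (elim \<xi>)
        then have "0 < nn (0::real, \<xi>)" by (simp add: hn_pos_iff)
        then show ?case using cover[of "(0, \<xi>)"] assms(9) elim(2) by auto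
      qed
    qed
    moreover have "AE \<xi> in lebesgue. f \<xi> = 0"
    proof (rule AE_st_heis[OF _ assms(9)])
      have "AE z in lebesgue. \<forall>i j. fst z \<in> {0<..<T} \<longrightarrow> R i j z \<longrightarrow> f (snd z) = 0" unfolding AE_all_countable using key by blast
      then show "AE z::'n st in lebesgue. fst z \<in> {0<..<T} \<longrightarrow> f (snd z) = 0"
        using np
      proof eventually_elim
        case (elim z)
        then show ?case using cover[of z] by auto
      qed
    qed
    ultimately show ?thesis by blast
  qed
  note main = this
  have "AE (t, \<xi>) in lebesgue_on ?D. u t \<xi> = 0" if ws: "weak_solution lam \<alpha> p u0 f T u" for u
  proof -
    have "open ?D" by (intro open_Times) auto
    then have "?D \<inter> space lebesgue \<in> sets lebesgue" by auto
    moreover have "AE z::'n st in lebesgue. z \<in> ?D \<longrightarrow> (case z of (t, \<xi>) \<Rightarrow> u t \<xi> = 0)"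
      using conjunct1[OF main[OF ws]] by eventually_elim auto
    ultimately show ?thesis by (subst AE_restrict_space_iff) auto
  qed
  then show ?thesis using main by blast
qed

end
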